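(* Let $\alpha>0$ and let $A_N^\alpha$ be the random $N\times N$ anti-symmetric tridiagonal matrix of the anti-symmetric Gaussian $\alpha$-ensemble defined in the context. Then, in the limit $N\to\infty$, the mean spectral measure of $A_N^\alpha$ has density $$\rho_{(1),0}^{\text{a-s}}(x;\alpha)=2x\,\rho_{(1),0}^{\text{(a-s)}^2}(x^2;\alpha)\quad (x>0),\qquad \rho_{(1),0}^{\text{(a-s)}^2}(y;\alpha)=\frac{1}{\Gamma(\alpha+1)\Gamma(\alpha)}\,\frac{1}{|W_{-\alpha+1/2,0}(-y)|^2}\quad(y>0),$$ and the mean density of states of $A_N^\alpha$ has density $$\mu_\alpha^{\text{a-s}}(x)=\frac{\partial}{\partial\alpha}\Big(\alpha\,\rho_{(1),0}^{\text{a-s}}(x;\alpha)\Big)\quad(x>0).$$ Consequently, with $\mu_\alpha^{\text{(a-s)}^2}(y)$ the density of states in the squared variable $y=x^2$, $$\mu_\alpha^{\text{(a-s)}^2}(y)=\frac{\partial}{\partial\alpha}\left(\frac{1}{|\Gamma(\alpha)\,W_{-\alpha+1/2,0}(-y)|^2}\right)\quad(y>0).$$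
   Context: $A_N^\alpha$ is the real anti-symmetric tridiagonal matrix with zero diagonal, entries $a_1,\dots,a_{N-1}>0$ directly above the diagonal and $-a_1,\dots,-a_{N-1}$ directly below it, where $a_1,\dots,a_{N-1}$ are i.i.d. and each $a_j^2$ has the gamma distribution $\Gamma[\alpha,1]$, i.e. density $t^{\alpha-1}e^{-t}/\Gamma(\alpha)$ on $t>0$. The matrix $iA_N^\alpha$ is Hermitian with real spectrum symmetric about $0$; let $x_1,\dots,x_N$ be its eigenvalues with orthonormal eigenvectors $v_1,\dots,v_N$, and let $e_1$ be the first standard basis vector. The mean spectral measure is $\mathbb E\sum_j|\langle v_j,e_1\rangle|^2\delta_{|x_j|}$ and the mean density of states is $\mathbb E\,\frac1N\sum_j\delta_{|x_j|}$; both are measures on $[0,\infty)$ (by the symmetry one records the nonnegative values $|x_j|$), and the theorem concerns their limits as $N\to\infty$. $W_{\kappa,\mu}(z)$ is the standard Whittaker function; $W_{\kappa,\mu}(-y)$ for $y>0$ denotes a boundary value on the branch cut along the negative real axis, $-y\pm i0$ (for real parameters the modulus is the same for both choices). *)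

theory Defs
  imports
    "HOL-Probability.Probability"
    "HOL-Complex_Analysis.Complex_Analysis"
    "Jordan_Normal_Form.Conjugate"
    "Jordan_Normal_Form.Matrix"
begin

section \<open>The anti-symmetric Gaussian ensemble\<close>

text \<open>JNF matrices are indexed from 0, the entries \<open>a 1, \<dots>, a (N - 1)\<close> from 1.\<close>

definition antisym_tridiag :: "nat \<Rightarrow> (nat \<Rightarrow> real) \<Rightarrow> real Matrix.mat" where
  "antisym_tridiag N a = Matrix.mat N N
     (\<lambda>(i, k). if k = Suc i then a k else if i = Suc k then - a i else 0)"

definition gamma_density :: "real \<Rightarrow> real \<Rightarrow> real" where
  "gamma_density \<alpha> t = (if 0 < t then t powr (\<alpha> - 1) * exp (- t) / Gamma \<alpha> else 0)"

text \<open>Since the entries are positive, the law of \<open>(a j)\<^sup>2\<close> determines that of \<open>a j\<close>, so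
  the entries are identically distributed.\<close>

definition antisym_gaussian_ensemble ::
  "real \<Rightarrow> nat \<Rightarrow> 'w measure \<Rightarrow> (nat \<Rightarrow> 'w \<Rightarrow> real) \<Rightarrow> bool" where
  "antisym_gaussian_ensemble \<alpha> N M a \<longleftrightarrow>
     prob_space M \<and>
     prob_space.indep_vars M (\<lambda>_. borel) a {1..<N} \<and>
     (\<forall>j\<in>{1..<N}. (\<forall>\<omega>\<in>space M. 0 < a j \<omega>) \<and>
        distributed M lborel (\<lambda>\<omega>. (a j \<omega>)\<^sup>2) (\<lambda>t. ennreal (gamma_density \<alpha> t)))"

section \<open>Spectral measures\<close>

text \<open>\<open>x 0, \<dots>, x (N - 1)\<close> are the eigenvalues, repeated with multiplicity, and
  \<open>v 0, \<dots>, v (N - 1)\<close> corresponding orthonormal eigenvectors of the \<open>N \<times> N\<close> matrix \<open>H\<close>.\<close>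

definition orthonormal_eigensystem ::
  "nat \<Rightarrow> complex Matrix.mat \<Rightarrow> (nat \<Rightarrow> real) \<Rightarrow> (nat \<Rightarrow> complex Matrix.vec) \<Rightarrow> bool" where
  "orthonormal_eigensystem N H x v \<longleftrightarrow>
     (\<forall>j<N. v j \<in> carrier_vec N \<and> H *\<^sub>v v j = complex_of_real (x j) \<cdot>\<^sub>v v j) \<and>
     (\<forall>j<N. \<forall>k<N. v j \<bullet>c v k = (if j = k then 1 else 0))"

text \<open>The sums below depend only on the matrix, not on the choice of its eigensystem, and are
  therefore measurable in \<open>\<omega>\<close> even if the eigensystem is not chosen measurably.\<close>

definition mean_spectral_measure ::
  "nat \<Rightarrow> 'w measure \<Rightarrow> ('w \<Rightarrow> nat \<Rightarrow> real) \<Rightarrow> ('w \<Rightarrow> nat \<Rightarrow> complex Matrix.vec) \<Rightarrow> real measure" where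
  "mean_spectral_measure N M x v = measure_of UNIV (sets borel)
     (\<lambda>B. \<integral>\<^sup>+\<omega>. (\<Sum>j<N. ennreal ((cmod (vec_index (v \<omega> j) 0))\<^sup>2) * indicator B \<bar>x \<omega> j\<bar>) \<partial>M)"

definition mean_density_of_states ::
  "nat \<Rightarrow> 'w measure \<Rightarrow> ('w \<Rightarrow> nat \<Rightarrow> real) \<Rightarrow> real measure" where
  "mean_density_of_states N M x = measure_of UNIV (sets borel)
     (\<lambda>B. \<integral>\<^sup>+\<omega>. ennreal (1 / real N) * (\<Sum>j<N. indicator B \<bar>x \<omega> j\<bar>) \<partial>M)"

text \<open>\<open>\<nu>\<close> is concentrated on the positive half-line with density \<open>\<rho>\<close>; the values of \<open>\<rho>\<close>
  outside the half-line are irrelevant.\<close>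

definition has_density_on_pos :: "real measure \<Rightarrow> (real \<Rightarrow> real) \<Rightarrow> bool" where
  "has_density_on_pos \<nu> \<rho> \<longleftrightarrow>
     set_borel_measurable lborel {0<..} \<rho> \<and>
     (AE x in lborel. 0 < x \<longrightarrow> 0 \<le> \<rho> x) \<and>
     \<nu> = density lborel (\<lambda>x. ennreal (indicator {0<..} x * \<rho> x))"

section \<open>The Whittaker function\<close>

text \<open>\<open>W\<^bsub>\<kappa>,\<mu>\<^esub>\<close> on the plane cut along the non-positive real axis, as the solution of
  Whittaker's equation with \<open>W\<^bsub>\<kappa>,\<mu>\<^esub>(z) \<sim> exp (-z/2) z\<^sup>\<kappa>\<close> at infinity. The asymptotics
  holds in the whole sector \<open>\<bar>arg z\<bar> < 3\<pi>/2\<close>, but imposing it along the positive real axis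
  already singles out one solution: it is the recessive one there, and two solutions with the same
  leading behaviour have vanishing Wronskian. Values of \<open>whittaker_W\<close> on the cut
  are unspecified.\<close>

definition is_whittaker_W :: "complex \<Rightarrow> complex \<Rightarrow> (complex \<Rightarrow> complex) \<Rightarrow> bool" where
  "is_whittaker_W \<kappa> \<mu> w \<longleftrightarrow>
     w holomorphic_on (- \<real>\<^sub>\<le>\<^sub>0) \<and>
     (\<forall>z\<in>- \<real>\<^sub>\<le>\<^sub>0. deriv (deriv w) z + (- 1/4 + \<kappa> / z + (1/4 - \<mu>\<^sup>2) / z\<^sup>2) * w z = 0) \<and>
     ((\<lambda>t::real. w (of_real t) / (exp (- of_real t / 2) * of_real t powr \<kappa>)) \<longlongrightarrow> 1) at_top"

definition whittaker_W :: "complex \<Rightarrow> complex \<Rightarrow> complex \<Rightarrow> complex" where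
  "whittaker_W \<kappa> \<mu> = (SOME w. is_whittaker_W \<kappa> \<mu> w)"

text \<open>\<open>W\<^bsub>\<kappa>,\<mu>\<^esub>(-y + i0)\<close> for \<open>\<sigma> = 1\<close> and \<open>W\<^bsub>\<kappa>,\<mu>\<^esub>(-y - i0)\<close> for \<open>\<sigma> = -1\<close>.\<close>

definition whittaker_W_cut :: "real \<Rightarrow> complex \<Rightarrow> complex \<Rightarrow> real \<Rightarrow> complex" where
  "whittaker_W_cut \<sigma> \<kappa> \<mu> y = Lim (at_right 0) (\<lambda>\<epsilon>. whittaker_W \<kappa> \<mu> (Complex (- y) (\<sigma> * \<epsilon>)))"

section \<open>The spectral densities\<close>

definition rho_as_sq :: "real \<Rightarrow> real \<Rightarrow> real \<Rightarrow> real" where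
  "rho_as_sq \<sigma> \<alpha> y =
     1 / (Gamma (\<alpha> + 1) * Gamma \<alpha>) *
     (1 / (cmod (whittaker_W_cut \<sigma> (complex_of_real (- \<alpha> + 1/2)) 0 y))\<^sup>2)"

definition rho_as :: "real \<Rightarrow> real \<Rightarrow> real \<Rightarrow> real" where
  "rho_as \<sigma> \<alpha> x = 2 * x * rho_as_sq \<sigma> \<alpha> (x\<^sup>2)"

end

theory Submission
  imports
  Defs
  "HOL-Real_Asymp.Real_Asymp"
  "Jordan_Normal_Form.Determinant"
begin

text \<open>
  Put \<open>I(\<beta>, c) = \<integral> t powr (\<beta> - 1) * (1 + t) powr (- \<beta>) * exp (- c * t) dt\<close> over \<open>t > 0\<close>, that is
  \<open>\<Gamma>(\<beta>) U(\<beta>, 1, c)\<close>. The corner resolvent entry of the tridiagonal matrix is a continued fraction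
  with independent coefficients, hence a Markov chain \<open>t \<mapsto> u / (c (1 + t))\<close> with \<open>u\<close> gamma distributed. Its
  law contracts in the logarithmic metric to the stationary law, whose density is proportional to the
  integrand of \<open>I(\<alpha>, c)\<close>. The Stieltjes transform of the limiting spectral measure in the squared variable is
  therefore \<open>- I' / (\<alpha> I)\<close>, and the logarithmic potential of the density of states, a sum of logarithms
  of the pivots, is obtained from \<open>\<partial>\<^sub>\<alpha> I / I\<close>. Frobenius series at the regular singular point \<open>0\<close>
  continue \<open>I\<close> to the cut, where Stieltjes inversion produces the imaginary part of a logarithmic
  derivative; its numerator is a Wronskian, and this leaves \<open>1 / \<bar>W\<bar>\<^sup>2\<close>.
\<close>

section \<open>Stieltjes transforms and densities\<close>

text \<open>The spectral parameter is kept at real c > 0, which places the resolvent of iA on the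
  imaginary axis: there all continued-fraction coefficients are positive and the means are integrals
  of nonnegative functions. The price is that the transforms are known on a half-line only, while
  the density lives on the cut z = -y, where the integral I diverges. The link is the pair of
  Frobenius solutions: entire series and one logarithm, so continuation, the jump across the cut and
  the derivative in \<alpha> are explicit, and I enters through a single connection constant.
  Inversion needs w, the continuation of I, to be free of zeros in the upper half-plane. No estimate
  of I is made for this; it follows from the existence of the spectral limit, whose transform is -
  w' / (\<alpha> w). The density of states borrows it. The \<alpha>-derivative in its formula arises
  because d/dz of w_\<alpha> / w equals d/d\<alpha> of w_z / w. Eigenvectors need not be chosen
  measurably, so measurability is drawn from matrix moments; the Whittaker function is given by a
  choice, so its defining conditions are shown to have a unique solution.\<close>

lemma
  fixes f f' :: "'a::{real_normed_field,banach,second_countable_topology} \<Rightarrow> 'b \<Rightarrow> 'a"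
  assumes r: "0 < r"
    and f0: "integrable M (f x0)"
    and meas: "\<And>x. x \<in> ball x0 r \<Longrightarrow> f x \<in> borel_measurable M"
    and der: "\<And>x t. x \<in> ball x0 r \<Longrightarrow> t \<in> space M \<Longrightarrow>
      ((\<lambda>x. f x t) has_field_derivative f' x t) (at x)"
    and bound: "\<And>x t. x \<in> ball x0 r \<Longrightarrow> t \<in> space M \<Longrightarrow> norm (f' x t) \<le> g t"
    and g: "integrable M g"
  shows integrable_parametric: "x \<in> ball x0 r \<Longrightarrow> integrable M (f x)"
    and integrable_parametric_deriv: "integrable M (f' x0)"
    and has_field_derivative_lebesgue_integral:
      "((\<lambda>x. \<integral>t. f x t \<partial>M) has_field_derivative (\<integral>t. f' x0 t \<partial>M)) (at x0)"
proof -
  have x0: "x0 \<in> ball x0 r" using r by simp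
  have lip: "norm (f x t - f x0 t) \<le> g t * norm (x - x0)"
    if "x \<in> ball x0 r" "t \<in> space M" for x t
    by (rule field_differentiable_bound[where S="ball x0 r" and f'="\<lambda>x. f' x t"])
      (use that x0 der bound in \<open>auto intro: has_field_derivative_at_within\<close>)
  show int: "integrable M (f x)" if x: "x \<in> ball x0 r" for x
  proof (rule Bochner_Integration.integrable_bound[OF _ meas[OF x]])
    show "integrable M (\<lambda>t. norm (f x0 t) + g t * norm (x - x0))"
      using f0 g by auto
    show "AE t in M. norm (f x t) \<le> norm (norm (f x0 t) + g t * norm (x - x0))"
    proof (rule AE_I2)
      fix t assume t: "t \<in> space M"
      have "norm (f x t) \<le> norm (f x0 t) + norm (f x t - f x0 t)"
        using norm_triangle_ineq[of "f x0 t" "f x t - f x0 t"] by simp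
      then show "norm (f x t) \<le> norm (norm (f x0 t) + g t * norm (x - x0))"
        using lip[OF x t] by simp
    qed
  qed
  define h where "h x t = (f x t - f x0 t) / (x - x0)" for x t
  have lim: "(\<lambda>n. h (X n) t) \<longlonglongrightarrow> f' x0 t"
    if "\<And>n. X n \<noteq> x0" "X \<longlonglongrightarrow> x0" "t \<in> space M" for X t
  proof -
    have "((\<lambda>x. h x t) \<longlongrightarrow> f' x0 t) (at x0)"
      using der[OF x0 that(3)] unfolding h_def has_field_derivative_iff .
    then show ?thesis
      using that unfolding tendsto_at_iff_sequentially by (auto simp: comp_def)
  qed
  have hb: "norm (h x t) \<le> g t" if "x \<in> ball x0 r" "x \<noteq> x0" "t \<in> space M" for x t
    using lip[OF that(1,3)] that(2) by (simp add: h_def norm_divide field_simps)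
  have hm: "h x \<in> borel_measurable M" if "x \<in> ball x0 r" for x
    unfolding h_def using meas[OF that] meas[OF x0] by measurable
  \<comment> \<open>Measurability of the derivative is obtained as a limit of difference quotients
    along the points \<open>x0 + r / (n + 2)\<close>, all inside the ball and distinct from its
    centre.\<close>
  have f'm: "f' x0 \<in> borel_measurable M"
  proof -
    define X where "X n = x0 + of_real (r / (real n + 2))" for n :: nat
    have "norm (of_real (r / (real n + 2)) :: 'a) < r" for n
      unfolding norm_of_real using r by (simp add: divide_less_eq)
    then have 1: "X n \<noteq> x0" "X n \<in> ball x0 r" for n
      using r unfolding X_def by (simp_all add: dist_norm del: of_real_add of_real_divide)
    have "(\<lambda>n. r / (real n + 2)) \<longlonglongrightarrow> 0"
      by real_asymp
    then have "(\<lambda>n. x0 + of_real (r / (real n + 2))) \<longlonglongrightarrow> x0 + of_real 0"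
      by (intro tendsto_intros)
    then have 2: "X \<longlonglongrightarrow> x0"
      unfolding X_def by (simp only: of_real_0 add_0_right)
    show ?thesis
      by (rule borel_measurable_LIMSEQ_metric[where f="\<lambda>n. h (X n)"]) (use 1 2 hm lim in auto)
  qed
  show f'i: "integrable M (f' x0)"
    by (rule Bochner_Integration.integrable_bound[OF g f'm])
      (use bound[OF x0] in \<open>auto intro!: AE_I2 order_trans[OF _ abs_ge_self]\<close>)
  show "((\<lambda>x. \<integral>t. f x t \<partial>M) has_field_derivative (\<integral>t. f' x0 t \<partial>M)) (at x0)"
    unfolding has_field_derivative_iff tendsto_at_iff_sequentially
  proof (intro allI impI)
    fix X assume X: "\<forall>i. X i \<in> UNIV - {x0}" "X \<longlonglongrightarrow> x0"
    have "\<forall>\<^sub>F n in sequentially. X n \<in> ball x0 r"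
      using X(2) r by (auto simp: tendsto_iff dist_commute)
    then obtain N where N: "\<And>n. n \<ge> N \<Longrightarrow> X n \<in> ball x0 r"
      by (auto simp: eventually_sequentially)
    define Y where "Y n = X (n + N)" for n
    have Y: "Y n \<in> ball x0 r" "Y n \<noteq> x0" for n
      using X N by (auto simp: Y_def)
    have "Y \<longlonglongrightarrow> x0" unfolding Y_def using X(2) by (rule LIMSEQ_ignore_initial_segment)
    then have "(\<lambda>n. \<integral>t. h (Y n) t \<partial>M) \<longlonglongrightarrow> (\<integral>t. f' x0 t \<partial>M)"
      by (intro integral_dominated_convergence[where w=g] f'm hm g AE_I2 hb lim) (use Y in auto)
    also have "(\<lambda>n. \<integral>t. h (Y n) t \<partial>M) =
      (\<lambda>n. ((\<lambda>y. ((\<integral>t. f y t \<partial>M) - (\<integral>t. f x0 t \<partial>M)) / (y - x0)) \<circ> X) (n + N))"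
    proof
      fix n
      have "(\<integral>t. h (Y n) t \<partial>M) = (\<integral>t. f (Y n) t - f x0 t \<partial>M) / (Y n - x0)"
        unfolding h_def using int[OF Y(1)] f0 Y(2)[of n]
        by (subst integral_divide_zero) auto
      then show "(\<integral>t. h (Y n) t \<partial>M) =
        ((\<lambda>y. ((\<integral>t. f y t \<partial>M) - (\<integral>t. f x0 t \<partial>M)) / (y - x0)) \<circ> X) (n + N)"
        using int[OF Y(1)] f0 by (simp add: Y_def)
    qed
    finally show "((\<lambda>y. ((\<integral>t. f y t \<partial>M) - (\<integral>t. f x0 t \<partial>M)) / (y - x0)) \<circ> X)
        \<longlonglongrightarrow> (\<integral>t. f' x0 t \<partial>M)"
      by (rule LIMSEQ_offset)
  qed
qed

text \<open>The cdf is recovered from its derivative by the fundamental theorem on [0, t]. Right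
  continuity at 0 supplies the lower limit, and \<open>cdf \<nu> 0 = 0\<close> excludes negative
  mass as well as an atom at 0. The candidate density has total mass 1 because the cdf tends to 1,
  so two distributions with equal cdf are compared.\<close>

lemma has_density_on_posI:
  assumes \<nu>: "real_distribution \<nu>"
    and der: "\<And>t. t > 0 \<Longrightarrow> (cdf \<nu> has_real_derivative r t) (at t)"
    and cont: "continuous_on {0<..} r"
    and c0: "cdf \<nu> 0 = 0"
  shows "has_density_on_pos \<nu> r"
proof -
  interpret real_distribution \<nu> by fact
  have r0: "0 \<le> r t" if "t > 0" for t
    by (rule mono_on_imp_deriv_nonneg[where A=UNIV and f="cdf \<nu>"])
      (use der that in \<open>auto simp: mono_on_def cdf_nondecreasing\<close>)
  have isCont: "isCont r t" if "t > 0" for t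
    using cont that by (simp add: continuous_on_eq_continuous_at)
  have m: "set_borel_measurable lborel {0<..} r"
    using borel_measurable_continuous_on_indicator[OF _ cont]
    by (simp add: set_borel_measurable_def)
  define h where "h = (\<lambda>x. ennreal (indicator {0<..} x * r x))"
  have hm[measurable]: "h \<in> borel_measurable borel"
    using m unfolding h_def set_borel_measurable_def by simp
  define D where "D = density lborel h"
  have Dt: "emeasure D {..t} = ennreal (cdf \<nu> t)" for t
  proof (cases "t > 0")
    case False
    have "emeasure D {..t} = (\<integral>\<^sup>+x. h x * indicator {..t} x \<partial>lborel)"
      unfolding D_def by (subst emeasure_density) auto
    also have "\<dots> = (\<integral>\<^sup>+(x::real). 0 \<partial>lborel)"
      by (rule nn_integral_cong) (use False in \<open>auto simp: h_def indicator_def\<close>)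
    finally have "emeasure D {..t} = (\<integral>\<^sup>+(x::real). 0 \<partial>lborel)" .
    moreover have "cdf \<nu> t = 0"
      using cdf_nondecreasing[of t 0] cdf_nonneg[of t] c0 False by simp
    ultimately show ?thesis by simp
  next
    case True
    have A: "((cdf \<nu> \<circ> real_of_ereal) \<longlongrightarrow> 0) (at_right 0)"
      using cdf_is_right_cont[of 0] c0 unfolding zero_ereal_def
      by (simp add: ereal_tendsto_simps continuous_within)
    have B: "((cdf \<nu> \<circ> real_of_ereal) \<longlongrightarrow> cdf \<nu> t) (at_left (ereal t))"
      using DERIV_isCont[OF der[OF True]]
      by (simp add: ereal_tendsto_simps isCont_def filterlim_at_split)
    note FTC = interval_integral_FTC_nonneg[of 0 "ereal t" "cdf \<nu>" r 0 "cdf \<nu> t", OF _ _ _ _ A B]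
    have 1: "set_integrable lborel (einterval 0 t) r"
      and 2: "(LBINT x=0..ereal t. r x) = cdf \<nu> t"
      using FTC der isCont r0 True by (auto intro!: AE_I2)
    have e: "einterval 0 (ereal t) = {0<..<t}"
      by (auto simp: einterval_def)
    have "emeasure D {..t} = (\<integral>\<^sup>+x. h x * indicator {..t} x \<partial>lborel)"
      unfolding D_def by (subst emeasure_density) auto
    also have "\<dots> = (\<integral>\<^sup>+x. ennreal (indicator {0<..<t} x *\<^sub>R r x) \<partial>lborel)"
    proof (rule nn_integral_cong_AE)
      show "AE x in lborel. h x * indicator {..t} x = ennreal (indicator {0<..<t} x *\<^sub>R r x)"
        using AE_lborel_singleton[of t] by eventually_elim (auto simp: h_def indicator_def)
    qed
    also have "\<dots> = ennreal (\<integral>x. indicator {0<..<t} x *\<^sub>R r x \<partial>lborel)"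
      using 1 r0 unfolding e set_integrable_def
      by (intro nn_integral_eq_integral) (auto simp: indicator_def)
    also have "(\<integral>x. indicator {0<..<t} x *\<^sub>R r x \<partial>lborel) = cdf \<nu> t"
      using 2 True unfolding interval_lebesgue_integral_def set_lebesgue_integral_def e
      by simp
    finally show ?thesis .
  qed
  have "emeasure D UNIV = 1"
  proof (rule LIMSEQ_unique)
    have "(\<lambda>n. emeasure D {..real n}) \<longlonglongrightarrow> emeasure D (\<Union>n. {..real n})"
      by (rule Lim_emeasure_incseq) (auto simp: D_def incseq_def)
    also have "(\<Union>n. {..real n}) = UNIV" by (auto intro: real_arch_simple)
    finally show "(\<lambda>n. emeasure D {..real n}) \<longlonglongrightarrow> emeasure D UNIV" .
    show "(\<lambda>n. emeasure D {..real n}) \<longlonglongrightarrow> 1"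
      unfolding Dt ennreal_1[symmetric] by (intro tendsto_intros cdf_lim_infty_prob)
  qed
  then have "real_distribution D"
    by (auto simp: real_distribution_def real_distribution_axioms_def prob_space_def
      prob_space_axioms_def D_def intro!: finite_measureI)
  then have "\<nu> = D"
    by (intro cdf_unique \<nu>) (auto simp: fun_eq_iff cdf_def measure_def Dt[unfolded cdf_def measure_def])
  then show ?thesis
    using m r0 unfolding has_density_on_pos_def D_def h_def by auto
qed

text \<open>Perron-Stieltjes inversion carried out on primitives: arctan is the primitive of the
  Poisson kernel, so the smoothed distribution functions \<open>\<Phi> n\<close> have derivative -
  Im R(-u + i \<epsilon>) and converge pointwise. Continuity of R up to the cut makes these
  derivatives converge locally uniformly, which differentiates the limit without any prior density
  for \<nu>.\<close>

lemma stieltjes_inversion: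
  assumes \<nu>: "real_distribution \<nu>"
    and S: "\<And>z. Im z > 0 \<Longrightarrow> (\<integral>x. 1 / (z + of_real (x\<^sup>2)) \<partial>\<nu>) = R z"
    and cont: "continuous_on {z. 0 \<le> Im z \<and> Re z < 0} R"
    and y: "y > 0"
  shows "((\<lambda>y. measure \<nu> {x. x\<^sup>2 \<le> y}) has_real_derivative - (1 / pi) * Im (R (- of_real y))) (at y)"
proof -
  interpret real_distribution \<nu> by fact
  have [measurable]: "Measurable.pred borel (\<lambda>x::real. x\<^sup>2 \<le> a)" "Measurable.pred borel (\<lambda>x::real. x\<^sup>2 < a)"
    for a by measurable
  have arctan_abs_le: "\<bar>arctan x\<bar> \<le> pi / 2" "\<bar>arctan x\<bar> * 2 \<le> pi" for x
    using arctan_bounded[of x] by linarith+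
  define \<epsilon> where "\<epsilon> n = 1 / (real n + 1)" for n
  have \<epsilon>: "\<epsilon> n > 0" "\<epsilon> n \<le> 1" for n by (auto simp: \<epsilon>_def)
  have \<epsilon>0: "\<epsilon> \<longlonglongrightarrow> 0" unfolding \<epsilon>_def by real_asymp
  define \<Phi> where "\<Phi> n u = (\<integral>x. arctan ((u - x\<^sup>2) / \<epsilon> n) \<partial>\<nu>)" for n u
  define G where "G u = (\<integral>x. pi / 2 * sgn (u - x\<^sup>2) \<partial>\<nu>)" for u
  have d\<Phi>: "(\<Phi> n has_real_derivative - Im (R (Complex (- u) (\<epsilon> n)))) (at u)" for n u
  proof -
    have e: "\<epsilon> n > 0" by (rule \<epsilon>)
    have "(\<Phi> n has_real_derivative (\<integral>x. \<epsilon> n / ((\<epsilon> n)\<^sup>2 + (u - x\<^sup>2)\<^sup>2) \<partial>\<nu>)) (at u)"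
      unfolding \<Phi>_def
    proof (rule has_field_derivative_lebesgue_integral[where r=1 and g="\<lambda>_. 1 / \<epsilon> n" and
          f'="\<lambda>u x. \<epsilon> n / ((\<epsilon> n)\<^sup>2 + (u - x\<^sup>2)\<^sup>2)"])
      show "integrable \<nu> (\<lambda>x. arctan ((u - x\<^sup>2) / \<epsilon> n))"
        by (rule integrable_const_bound[where B="pi/2"])
          (use arctan_abs_le in auto)
      show "((\<lambda>u. arctan ((u - x\<^sup>2) / \<epsilon> n)) has_real_derivative \<epsilon> n / ((\<epsilon> n)\<^sup>2 + (v - x\<^sup>2)\<^sup>2)) (at v)" for v x
        using e by (auto intro!: derivative_eq_intros simp: field_simps power2_eq_square
            add_nonneg_eq_0_iff)
      show "norm (\<epsilon> n / ((\<epsilon> n)\<^sup>2 + (v - x\<^sup>2)\<^sup>2)) \<le> 1 / \<epsilon> n" for v x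
      proof -
        have "\<epsilon> n / ((\<epsilon> n)\<^sup>2 + (v - x\<^sup>2)\<^sup>2) \<le> \<epsilon> n / (\<epsilon> n)\<^sup>2"
          using e by (intro divide_left_mono mult_pos_pos add_pos_nonneg) auto
        then show ?thesis using e by (simp add: power2_eq_square)
      qed
    qed auto
    moreover have "(\<integral>x. \<epsilon> n / ((\<epsilon> n)\<^sup>2 + (u - x\<^sup>2)\<^sup>2) \<partial>\<nu>) = - Im (R (Complex (- u) (\<epsilon> n)))"
    proof -
      let ?z = "Complex (- u) (\<epsilon> n)"
      have int: "integrable \<nu> (\<lambda>x. 1 / (?z + of_real (x\<^sup>2)))"
      proof (rule integrable_const_bound[where B="1 / \<epsilon> n"])
        show "AE x in \<nu>. cmod (1 / (?z + of_real (x\<^sup>2))) \<le> 1 / \<epsilon> n"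
        proof (rule AE_I2)
          fix x
          have "\<epsilon> n \<le> cmod (?z + of_real (x\<^sup>2))"
            using abs_Im_le_cmod[of "?z + of_real (x\<^sup>2)"] e by simp
          then show "cmod (1 / (?z + of_real (x\<^sup>2))) \<le> 1 / \<epsilon> n"
            using e by (simp add: norm_divide frac_le)
        qed
      qed measurable
      have "Im (R ?z) = (\<integral>x. Im (1 / (?z + of_real (x\<^sup>2))) \<partial>\<nu>)"
        using S[of ?z] e integral_Im[OF int] by simp
      also have "(\<lambda>x. Im (1 / (?z + of_real (x\<^sup>2)))) = (\<lambda>x. - (\<epsilon> n / ((\<epsilon> n)\<^sup>2 + (u - x\<^sup>2)\<^sup>2)))"
        by (auto simp: Im_divide power2_eq_square algebra_simps)
      finally show ?thesis by simp
    qed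
    ultimately show ?thesis by simp
  qed
  have lim\<Phi>: "(\<lambda>n. \<Phi> n u) \<longlonglongrightarrow> G u" for u
    unfolding \<Phi>_def G_def
  proof (rule integral_dominated_convergence[where w="\<lambda>_. pi/2"])
    show "AE x in \<nu>. (\<lambda>n. arctan ((u - x\<^sup>2) / \<epsilon> n)) \<longlonglongrightarrow> pi / 2 * sgn (u - x\<^sup>2)"
    proof (rule AE_I2)
      fix x
      consider "u - x\<^sup>2 > 0" | "u - x\<^sup>2 < 0" | "u - x\<^sup>2 = 0" by linarith
      then show "(\<lambda>n. arctan ((u - x\<^sup>2) / \<epsilon> n)) \<longlonglongrightarrow> pi / 2 * sgn (u - x\<^sup>2)"
      proof cases
        case 1
        then have "filterlim (\<lambda>n. (u - x\<^sup>2) / \<epsilon> n) at_top sequentially"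
          unfolding \<epsilon>_def by real_asymp
        then have "(\<lambda>n. arctan ((u - x\<^sup>2) / \<epsilon> n)) \<longlonglongrightarrow> pi / 2"
          by (rule filterlim_compose[OF tendsto_arctan_at_top])
        then show ?thesis using 1 by simp
      next
        case 2
        then have "filterlim (\<lambda>n. (u - x\<^sup>2) / \<epsilon> n) at_bot sequentially"
          unfolding \<epsilon>_def by real_asymp
        then have "(\<lambda>n. arctan ((u - x\<^sup>2) / \<epsilon> n)) \<longlonglongrightarrow> - (pi / 2)"
          by (rule filterlim_compose[OF tendsto_arctan_at_bot])
        then show ?thesis using 2 by simp
      qed simp
    qed
    show "AE x in \<nu>. norm (arctan ((u - x\<^sup>2) / \<epsilon> n)) \<le> pi / 2" for n
      using arctan_abs_le by auto
  qed auto
  have dG: "(G has_real_derivative - Im (R (- of_real u))) (at u)" if u: "u > 0" for u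
  proof -
    \<comment> \<open>A compact neighbourhood of u inside the positive axis, so that the box below
      stays where R is continuous; its height 1 covers every \<open>\<epsilon> n\<close>.\<close>
    define K where "K = {u/2..2*u}"
    let ?B = "cbox (Complex (- (2*u)) 0) (Complex (- (u/2)) 1)"
    have "compact ?B" by (rule compact_cbox)
    moreover have "?B \<subseteq> {z. 0 \<le> Im z \<and> Re z < 0}"
      using u by (auto simp: in_cbox_complex_iff)
    ultimately have uc: "uniformly_continuous_on ?B R"
      by (intro compact_uniformly_continuous continuous_on_subset[OF cont])
    have "\<exists>g. \<forall>v\<in>K. (\<lambda>n. \<Phi> n v) \<longlonglongrightarrow> g v \<and>
      (g has_derivative (\<lambda>h. - Im (R (- of_real v)) * h)) (at v within K)"
    proof (rule has_derivative_sequence[where f'="\<lambda>n v h. - Im (R (Complex (- v) (\<epsilon> n))) * h"])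
      show "convex K" by (simp add: K_def)
      show "(\<Phi> n has_derivative (*) (- Im (R (Complex (- v) (\<epsilon> n))))) (at v within K)" for n v
        using d\<Phi>[of n v] unfolding has_field_derivative_def by (rule has_derivative_at_withinI)
      show "u \<in> K" using u by (simp add: K_def)
      show "(\<lambda>n. \<Phi> n u) \<longlonglongrightarrow> G u" by (rule lim\<Phi>)
      fix e :: real assume e: "e > 0"
      obtain d where d: "d > 0"
        "\<And>z w. z \<in> ?B \<Longrightarrow> w \<in> ?B \<Longrightarrow> dist w z < d \<Longrightarrow> dist (R w) (R z) < e"
        using uc e unfolding uniformly_continuous_on_def by metis
      have "\<forall>\<^sub>F n in sequentially. \<epsilon> n < d" using \<epsilon>0 d(1) by (rule order_tendstoD)
      then show "\<forall>\<^sub>F n in sequentially. \<forall>v\<in>K. \<forall>h.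
        norm (- Im (R (Complex (- v) (\<epsilon> n))) * h - - Im (R (- of_real v)) * h) \<le> e * norm h"
      proof (eventually_elim, intro ballI allI)
        fix n v h assume n: "\<epsilon> n < d" and v: "v \<in> K"
        let ?w = "Complex (- v) (\<epsilon> n)" and ?z = "- complex_of_real v"
        have "dist ?w ?z < d"
        proof -
          have "?w - ?z = Complex 0 (\<epsilon> n)" by (simp add: complex_eq_iff)
          then show ?thesis using n \<epsilon>(1)[of n] by (simp add: dist_norm complex_norm)
        qed
        then have "dist (R ?w) (R ?z) < e"
          using v \<epsilon>[of n] by (intro d) (auto simp: in_cbox_complex_iff K_def less_imp_le)
        then have "\<bar>Im (R ?w) - Im (R ?z)\<bar> \<le> e"
          using abs_Im_le_cmod[of "R ?w - R ?z"] by (simp add: dist_norm)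
        then have "\<bar>Im (R ?w) - Im (R ?z)\<bar> * \<bar>h\<bar> \<le> e * \<bar>h\<bar>"
          by (rule mult_right_mono) simp
        then show "norm (- Im (R ?w) * h - - Im (R ?z) * h) \<le> e * norm h"
          by (simp add: left_diff_distrib[symmetric] abs_mult[symmetric] abs_minus_commute)
      qed
    qed
    then obtain g where g: "\<And>v. v \<in> K \<Longrightarrow> (\<lambda>n. \<Phi> n v) \<longlonglongrightarrow> g v"
      "\<And>v. v \<in> K \<Longrightarrow> (g has_derivative (\<lambda>h. - Im (R (- of_real v)) * h)) (at v within K)"
      by blast
    have gG: "g v = G v" if "v \<in> K" for v
      using LIMSEQ_unique[OF g(1)[OF that] lim\<Phi>] .
    have "u \<in> interior K" using u by (auto simp: K_def)
    then have "(g has_real_derivative - Im (R (- of_real u))) (at u)"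
      using g(2)[of u] at_within_interior[of u K] interior_subset[of K]
      unfolding has_field_derivative_def by (metis subsetD)
    then show ?thesis
      by (rule has_field_derivative_transform_within_open[where S="interior K"])
        (use \<open>u \<in> interior K\<close> gG interior_subset in auto)
  qed
  define Fle where "Fle u = measure \<nu> {x. x\<^sup>2 \<le> u}" for u
  define Flt where "Flt u = measure \<nu> {x. x\<^sup>2 < u}" for u
  \<comment> \<open>Since sgn 0 = 0, the limit averages the two one-sided distribution functions.
    They are identified afterwards: continuity of G leaves no room for a jump at a positive
    point.\<close>
  have Geq: "G u = pi / 2 * (Flt u + Fle u - 1)" for u
  proof -
    have "(\<lambda>x. pi / 2 * sgn (u - x\<^sup>2)) =
       (\<lambda>x. pi / 2 * (indicator {x. x\<^sup>2 < u} x + indicator {x. x\<^sup>2 \<le> u} x - 1))"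
      by (auto simp: fun_eq_iff sgn_if indicator_def)
    then have "G u = pi / 2 * (\<integral>x. indicator {x. x\<^sup>2 < u} x + indicator {x. x\<^sup>2 \<le> u} x - 1 \<partial>\<nu>)"
      unfolding G_def by simp
    also have "(\<integral>x. indicator {x. x\<^sup>2 < u} x + indicator {x. x\<^sup>2 \<le> u} x - (1::real) \<partial>\<nu>) = Flt u + Fle u - 1"
    proof -
      have "integrable \<nu> (indicator {x. x\<^sup>2 < u} :: real \<Rightarrow> real)"
        and "integrable \<nu> (indicator {x. x\<^sup>2 \<le> u} :: real \<Rightarrow> real)"
        by (auto intro!: integrable_real_indicator simp: emeasure_eq_measure)
      moreover have "measure \<nu> UNIV = 1" using prob_space by simp
      ultimately show ?thesis unfolding Flt_def Fle_def by simp
    qed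
    finally show ?thesis .
  qed
  have lt_le: "Flt u \<le> Fle u" for u
    unfolding Flt_def Fle_def by (intro finite_measure_mono) auto
  have le_lt: "Fle u \<le> Flt v" if "u < v" for u v
    unfolding Flt_def Fle_def using that by (intro finite_measure_mono) auto
  have eq: "Fle u = Flt u" if u: "u > 0" for u
  proof -
    have "pi / 2 * (2 * Fle u - 1) \<le> G u"
    proof (rule tendsto_lowerbound)
      show "(G \<longlongrightarrow> G u) (at_right u)"
        using DERIV_isCont[OF dG[OF u]] by (simp add: isCont_def filterlim_at_split)
      show "\<forall>\<^sub>F v in at_right u. pi / 2 * (2 * Fle u - 1) \<le> G v"
        using eventually_at_right_less[of u]
      proof eventually_elim
        case (elim v)
        have "2 * Fle u - 1 \<le> Flt v + Fle v - 1"
          using le_lt[OF elim] lt_le[of v] by linarith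
        then show ?case unfolding Geq by (intro mult_left_mono) auto
      qed
    qed auto
    then have "2 * Fle u - 1 \<le> Flt u + Fle u - 1"
      unfolding Geq by (simp add: mult_le_cancel_left_pos)
    then show ?thesis using lt_le[of u] by linarith
  qed
  have "((\<lambda>u. G u / pi + 1 / 2) has_real_derivative - (1 / pi) * Im (R (- of_real y))) (at y)"
    by (auto intro!: derivative_eq_intros dG y)
  then have "(Fle has_real_derivative - (1 / pi) * Im (R (- of_real y))) (at y)"
    by (rule has_field_derivative_transform_within_open[where S="{0<..}"])
      (use y eq in \<open>auto simp: Geq field_simps\<close>)
  then show ?thesis unfolding Fle_def .
qed

text \<open>Inversion at y > 0 cannot see an atom at 0. It is detected by c / (c + x^2), which is
  bounded by 1 and tends to the indicator of 0.\<close>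

lemma stieltjes_atom_zero:
  assumes "real_distribution \<nu>"
  shows "((\<lambda>c. \<integral>x. c / (c + x\<^sup>2) \<partial>\<nu>) \<longlongrightarrow> measure \<nu> {0}) (at_right 0)"
proof -
  interpret real_distribution \<nu> by fact
  have "measure \<nu> {0} = (\<integral>x. indicator {0} x \<partial>\<nu>)" by simp
  moreover have "((\<lambda>c. \<integral>x. c / (c + x\<^sup>2) \<partial>\<nu>) \<longlongrightarrow> (\<integral>x. indicator {0} x \<partial>\<nu>)) (at_right 0)"
  proof (rule tendsto_at_right_sequentially[where b=1])
    fix s :: "nat \<Rightarrow> real" assume s: "\<And>n. 0 < s n" "s \<longlonglongrightarrow> 0"
    show "(\<lambda>n. \<integral>x. s n / (s n + x\<^sup>2) \<partial>\<nu>) \<longlonglongrightarrow> (\<integral>x. indicator {0} x \<partial>\<nu>)"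
    proof (rule integral_dominated_convergence[where w="\<lambda>_. 1"])
      show "AE x in \<nu>. (\<lambda>n. s n / (s n + x\<^sup>2)) \<longlonglongrightarrow> indicator {0} x"
      proof (rule AE_I2)
        fix x :: real
        show "(\<lambda>n. s n / (s n + x\<^sup>2)) \<longlonglongrightarrow> indicator {0} x"
        proof (cases "x = 0")
          case True
          then show ?thesis using s(1) by (simp add: less_imp_neq[symmetric])
        next
          case False
          then have "(\<lambda>n. s n / (s n + x\<^sup>2)) \<longlonglongrightarrow> 0 / (0 + x\<^sup>2)"
            by (intro tendsto_intros s(2)) auto
          then show ?thesis using False by simp
        qed
      qed
      show "AE x in \<nu>. norm (s n / (s n + x\<^sup>2)) \<le> 1" for n
        using s(1)[of n] by (intro AE_I2) (simp add: divide_le_eq_1 add_pos_nonneg)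
    qed auto
  qed simp
  ultimately show ?thesis by simp
qed

text \<open>Inversion takes place in the squared variable, where F is the distribution function.
  Without negative mass \<open>cdf \<nu> t = F (t\<^sup>2)\<close> for t \<ge> 0, so the chain rule
  gives the first claim and the second is F itself; \<open>zero\<close> removes the atom at
  0.\<close>

lemma stieltjes_density:
  assumes \<nu>: "real_distribution \<nu>"
    and neg: "measure \<nu> {..<0} = 0"
    and S: "\<And>z. Im z > 0 \<Longrightarrow> (\<integral>x. 1 / (z + of_real (x\<^sup>2)) \<partial>\<nu>) = R z"
    and cont: "continuous_on {z. 0 \<le> Im z \<and> Re z < 0} R"
    and zero: "((\<lambda>c. \<integral>x. c / (c + x\<^sup>2) \<partial>\<nu>) \<longlongrightarrow> 0) (at_right 0)"
    and \<rho>: "\<And>y. y > 0 \<Longrightarrow> \<rho> y = - (1 / pi) * Im (R (- of_real y))"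
  shows "has_density_on_pos \<nu> (\<lambda>t. 2 * t * \<rho> (t\<^sup>2))"
    and "has_density_on_pos (distr \<nu> borel (\<lambda>t. t\<^sup>2)) \<rho>"
proof -
  interpret real_distribution \<nu> by fact
  have atom: "measure \<nu> {0} = 0"
    using tendsto_unique[OF _ stieltjes_atom_zero[OF \<nu>] zero] by simp
  define F where "F y = measure \<nu> {x. x\<^sup>2 \<le> y}" for y
  have F: "(F has_real_derivative \<rho> y) (at y)" if "y > 0" for y
    using stieltjes_inversion[OF \<nu> S cont that] \<rho>[OF that] unfolding F_def by simp
  have F0: "F 0 = 0" using atom unfolding F_def by simp
  have "continuous_on {0<..} (\<lambda>y. - (1 / pi) * Im (R (- of_real y)))"
    by (intro continuous_intros continuous_on_compose2[OF cont]) auto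
  then have c\<rho>: "continuous_on {0<..} \<rho>"
    by (rule continuous_on_eq) (simp add: \<rho>)
  have cdf: "cdf \<nu> t = F (t\<^sup>2)" if t: "t \<ge> 0" for t
  proof -
    have "measure \<nu> {..t} = measure \<nu> {x. x\<^sup>2 \<le> t\<^sup>2}"
    proof (rule finite_measure_eq_AE)
      have "{..<0} \<in> null_sets \<nu>" using neg by (intro null_setsI) (auto simp: emeasure_eq_measure)
      then have "AE x in \<nu>. x \<notin> {..<0}" by (rule AE_not_in)
      then show "AE x in \<nu>. (x \<in> {..t}) = (x \<in> {x. x\<^sup>2 \<le> t\<^sup>2})"
        by eventually_elim (use t in \<open>auto simp: abs_le_square_iff[symmetric]\<close>)
    qed auto
    then show ?thesis by (simp add: cdf_def F_def)
  qed
  show "has_density_on_pos \<nu> (\<lambda>t. 2 * t * \<rho> (t\<^sup>2))"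
  proof (rule has_density_on_posI[OF \<nu>])
    fix t :: real assume t: "t > 0"
    have "((\<lambda>t. F (t\<^sup>2)) has_real_derivative \<rho> (t\<^sup>2) * (2 * t)) (at t)"
      by (rule DERIV_chain'[of "\<lambda>t. t\<^sup>2"]) (use t F in \<open>auto intro!: derivative_eq_intros\<close>)
    then have "(cdf \<nu> has_real_derivative \<rho> (t\<^sup>2) * (2 * t)) (at t)"
      by (rule has_field_derivative_transform_within_open[where S="{0<..}"]) (use t cdf in auto)
    then show "(cdf \<nu> has_real_derivative 2 * t * \<rho> (t\<^sup>2)) (at t)" by (simp add: mult_ac)
  next
    show "continuous_on {0<..} (\<lambda>t. 2 * t * \<rho> (t\<^sup>2))"
      by (intro continuous_intros continuous_on_compose2[OF c\<rho>]) auto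
    show "cdf \<nu> 0 = 0" using cdf[of 0] F0 by simp
  qed
  have cdf2: "cdf (distr \<nu> borel (\<lambda>t. t\<^sup>2)) y = F y" for y
    unfolding cdf_def F_def by (subst measure_distr) (auto simp: vimage_def)
  show "has_density_on_pos (distr \<nu> borel (\<lambda>t. t\<^sup>2)) \<rho>"
  proof (rule has_density_on_posI)
    show "real_distribution (distr \<nu> borel (\<lambda>t. t\<^sup>2))"
      by (rule real_distribution_distr) simp
  qed (use F F0 c\<rho> in \<open>auto simp: cdf2[abs_def]\<close>)
qed

section \<open>Tightness and identification of weak limits\<close>

text \<open>The second moment bound gives tightness, so subsequential limits exist; each equals the
  measure with density r, hence they coincide and the whole sequence converges. A subsequence s is
  returned with \<nu> because transform identities are stated along subsequences and may be wanted
  again for this \<nu>.\<close>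

lemma weak_conv_has_density:
  assumes dist: "\<And>n. real_distribution (\<mu> n)"
    and neg: "\<And>n. measure (\<mu> n) {..<0} = 0"
    and moment: "\<And>n. (\<integral>\<^sup>+x. ennreal (x\<^sup>2) \<partial>\<mu> n) \<le> ennreal C"
    and unique: "\<And>s \<nu>. strict_mono s \<Longrightarrow> real_distribution \<nu> \<Longrightarrow> weak_conv_m (\<mu> \<circ> s) \<nu> \<Longrightarrow>
      measure \<nu> {..<0} = 0 \<Longrightarrow> has_density_on_pos \<nu> r"
  shows "\<exists>\<nu> s. strict_mono s \<and> weak_conv_m (\<mu> \<circ> s) \<nu> \<and> measure \<nu> {..<0} = 0 \<and>
    real_distribution \<nu> \<and> weak_conv_m \<mu> \<nu> \<and> has_density_on_pos \<nu> r"
proof -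
  interpret real_distribution "\<mu> n" for n by (rule dist)
  have tight: "tight \<mu>"
    unfolding tight_def
  proof (intro conjI allI impI dist)
    fix e :: real assume e: "e > 0"
    \<comment> \<open>Markov's inequality for x^2 gives mass at most \<bar>C\<bar> / K^2 outside
      (-K, K]. The added 1 makes this strictly less than e and keeps K positive when C = 0.\<close>
    define K where "K = sqrt (\<bar>C\<bar> / e) + 1"
    have K: "K \<ge> 1" using e by (simp add: K_def)
    have "\<bar>C\<bar> / e < K\<^sup>2"
    proof -
      have "\<bar>C\<bar> / e = (sqrt (\<bar>C\<bar> / e))\<^sup>2" using e by simp
      also have "\<dots> < K\<^sup>2" unfolding K_def using e by (intro power_strict_mono) auto
      finally show ?thesis .
    qed
    then have CK: "\<bar>C\<bar> / K\<^sup>2 < e" using e K by (simp add: field_simps)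
    have "measure (\<mu> n) {- K<..K} > 1 - e" for n
    proof -
      have "emeasure (\<mu> n) {x \<in> space (\<mu> n). 1 \<le> ennreal (1 / K\<^sup>2) * ennreal (x\<^sup>2)} \<le>
        ennreal (1 / K\<^sup>2) * (\<integral>\<^sup>+x. ennreal (x\<^sup>2) * indicator (space (\<mu> n)) x \<partial>\<mu> n)"
        by (rule nn_integral_Markov_inequality) auto
      also have "\<dots> \<le> ennreal (1 / K\<^sup>2) * ennreal \<bar>C\<bar>"
        using order_trans[OF moment ennreal_leI[OF abs_ge_self]]
        by (intro mult_left_mono) (simp_all cong: nn_integral_cong)
      also have "\<dots> = ennreal (\<bar>C\<bar> / K\<^sup>2)" by (simp add: ennreal_mult'[symmetric])
      finally have *: "measure (\<mu> n) {x \<in> space (\<mu> n). 1 \<le> ennreal (1 / K\<^sup>2) * ennreal (x\<^sup>2)} \<le> \<bar>C\<bar> / K\<^sup>2"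
        unfolding emeasure_eq_measure by (subst (asm) ennreal_le_iff) auto
      have "1 - measure (\<mu> n) {- K<..K} = measure (\<mu> n) (space (\<mu> n) - {- K<..K})"
        by (subst prob_compl) auto
      also have "\<dots> \<le> measure (\<mu> n) {x \<in> space (\<mu> n). 1 \<le> ennreal (1 / K\<^sup>2) * ennreal (x\<^sup>2)}"
      proof (rule finite_measure_mono)
        have "1 \<le> ennreal (1 / K\<^sup>2) * ennreal (x\<^sup>2)" if "x \<notin> {- K<..K}" for x
        proof -
          have "K\<^sup>2 \<le> x\<^sup>2" using that K by (auto simp: abs_le_square_iff[symmetric])
          then show ?thesis using K by (simp add: ennreal_mult'[symmetric])
        qed
        then show "space (\<mu> n) - {- K<..K} \<subseteq> {x \<in> space (\<mu> n). 1 \<le> ennreal (1 / K\<^sup>2) * ennreal (x\<^sup>2)}"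
          by auto
      qed measurable
      finally show ?thesis using * CK by linarith
    qed
    then show "\<exists>a b. a < b \<and> (\<forall>n. 1 - e < measure (\<mu> n) {a<..b})"
      using K by (intro exI[of _ "- K"] exI[of _ K]) auto
  qed
  have lim_neg: "measure \<nu> {..<0} = 0"
    if s: "strict_mono s" and \<nu>: "real_distribution \<nu>" and w: "weak_conv_m (\<mu> \<circ> s) \<nu>" for s \<nu>
  proof -
    interpret \<nu>: real_distribution \<nu> by fact
    \<comment> \<open>A bounded continuous function that is positive exactly on the negative axis,
      so that weak convergence carries the absence of negative mass to the limit.\<close>
    define \<phi> where "\<phi> x = min 1 (max 0 (- x))" for x :: real
    have ae: "AE x in \<mu> n. x \<notin> {..<0}" for n
      by (intro AE_not_in null_setsI) (use neg[of n] in \<open>auto simp: emeasure_eq_measure\<close>)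
    have "(\<integral>x. \<phi> x \<partial>\<mu> n) = 0" for n
      by (rule integral_eq_zero_AE) (use ae[of n] in \<open>eventually_elim; auto simp: \<phi>_def\<close>)
    moreover have "(\<lambda>n. \<integral>x. \<phi> x \<partial>(\<mu> \<circ> s) n) \<longlonglongrightarrow> (\<integral>x. \<phi> x \<partial>\<nu>)"
      by (rule weak_conv_imp_integral_bdd_continuous_conv[OF _ _ w, where B=1])
        (use dist \<nu> in \<open>auto simp: \<phi>_def intro!: continuous_intros\<close>)
    ultimately have "(\<integral>x. \<phi> x \<partial>\<nu>) = 0"
      using LIMSEQ_unique[OF tendsto_const[of 0]] by (simp add: comp_def)
    moreover have "integrable \<nu> \<phi>"
      unfolding \<phi>_def by (rule \<nu>.integrable_const_bound[where B=1]) auto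
    ultimately have "AE x in \<nu>. \<phi> x = 0"
      by (subst (asm) integral_nonneg_eq_0_iff_AE) (auto simp: \<phi>_def)
    then have "AE x in \<nu>. x \<notin> {..<0}"
      by eventually_elim (auto simp: \<phi>_def min_def max_def split: if_splits)
    then show ?thesis
      using \<nu>.prob_eq_0[of "{..<0}"] by simp
  qed
  obtain s \<nu> where s: "strict_mono s" and \<nu>: "real_distribution \<nu>" and w: "weak_conv_m (\<mu> \<circ> id \<circ> s) \<nu>"
    using tight_imp_convergent_subsubsequence[OF tight, of id] by (auto simp: strict_mono_def)
  then have w: "weak_conv_m (\<mu> \<circ> s) \<nu>" by simp
  have n: "measure \<nu> {..<0} = 0" using lim_neg[OF s \<nu> w] .
  have d: "has_density_on_pos \<nu> r" using unique[OF s \<nu> w n] .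
  have "weak_conv_m \<mu> \<nu>"
  proof (rule tight_subseq_weak_converge[OF dist \<nu> tight])
    fix s' \<nu>' assume *: "strict_mono s'" "real_distribution \<nu>'" "weak_conv_m (\<mu> \<circ> s') \<nu>'"
    have "has_density_on_pos \<nu>' r" using unique[OF * lim_neg[OF *]] .
    then have "\<nu>' = \<nu>" using d unfolding has_density_on_pos_def by simp
    then show "weak_conv_m (\<mu> \<circ> s') \<nu>" using * by simp
  qed
  then show ?thesis using s \<nu> w n d by blast
qed

section \<open>Frobenius series of the Kummer equation\<close>

text \<open>A factorial bound in place of a radius of convergence: it makes the sum entire, is
  closed under sums, \<open>diffs\<close> and multiplication by n, and can be chosen locally
  uniformly in a parameter, as termwise differentiation in \<beta> requires.\<close>

definition exp_bounded :: "(nat \<Rightarrow> real) \<Rightarrow> bool" where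
  "exp_bounded c \<longleftrightarrow> (\<exists>K C. 0 \<le> K \<and> 0 \<le> C \<and> (\<forall>n. \<bar>c n\<bar> \<le> K * C ^ n / fact n))"

text \<open>Real coefficients evaluated in an arbitrary Banach field: each identity is proved once
  and holds on the real line, where the integral lives, and in the plane, where the inversion takes
  place.\<close>

definition eser :: "(nat \<Rightarrow> real) \<Rightarrow> 'a::{real_normed_field,banach} \<Rightarrow> 'a" where
  "eser c z = (\<Sum>n. of_real (c n) * z ^ n)"

lemma exp_boundedI: "0 \<le> K \<Longrightarrow> 0 \<le> C \<Longrightarrow> (\<And>n. \<bar>c n\<bar> \<le> K * C ^ n / fact n) \<Longrightarrow> exp_bounded c"
  unfolding exp_bounded_def by blast

lemma summable_exp_bound: "summable (\<lambda>n. K * C ^ n / fact n * (x::real) ^ n)"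
proof -
  have "summable (\<lambda>n. K * (inverse (fact n) * (C * x) ^ n))"
    by (intro summable_mult summable_exp)
  then show ?thesis by (simp add: field_simps power_mult_distrib)
qed

lemma exp_bounded_summable:
  assumes "exp_bounded c"
  shows "summable (\<lambda>n. of_real (c n) * z ^ n :: 'a::{real_normed_field,banach})"
proof -
  obtain K C where KC: "0 \<le> K" "0 \<le> C" "\<And>n. \<bar>c n\<bar> \<le> K * C ^ n / fact n"
    using assms unfolding exp_bounded_def by blast
  show ?thesis
  proof (rule summable_comparison_test'[where N=0, OF summable_exp_bound[of K C "norm z"]])
    fix n
    have "norm (of_real (c n) * z ^ n) = \<bar>c n\<bar> * norm z ^ n"
      by (simp add: norm_mult norm_power)
    also have "\<dots> \<le> K * C ^ n / fact n * norm z ^ n"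
      by (intro mult_right_mono KC) auto
    finally show "norm (of_real (c n) * z ^ n) \<le> K * C ^ n / fact n * norm z ^ n" .
  qed
qed

lemma exp_bounded_diffs:
  assumes "exp_bounded c"
  shows "exp_bounded (diffs c)"
proof -
  obtain K C where KC: "0 \<le> K" "0 \<le> C" "\<And>n. \<bar>c n\<bar> \<le> K * C ^ n / fact n"
    using assms unfolding exp_bounded_def by blast
  show ?thesis
  proof (rule exp_boundedI[where K="K * C" and C=C])
    fix n
    have "\<bar>diffs c n\<bar> = real (Suc n) * \<bar>c (Suc n)\<bar>"
      by (simp add: diffs_def abs_mult)
    also have "\<dots> \<le> real (Suc n) * (K * C ^ Suc n / fact (Suc n))"
      by (intro mult_left_mono KC) auto
    also have "\<dots> = K * C * C ^ n / fact n"
      by (simp add: field_simps del: of_nat_Suc)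
    finally show "\<bar>diffs c n\<bar> \<le> K * C * C ^ n / fact n" .
  qed (use KC in auto)
qed

lemma exp_bounded_add:
  assumes "exp_bounded c" "exp_bounded d"
  shows "exp_bounded (\<lambda>n. c n + d n)"
proof -
  obtain K C where KC: "0 \<le> K" "0 \<le> C" "\<And>n. \<bar>c n\<bar> \<le> K * C ^ n / fact n"
    using assms unfolding exp_bounded_def by blast
  obtain L D where LD: "0 \<le> L" "0 \<le> D" "\<And>n. \<bar>d n\<bar> \<le> L * D ^ n / fact n"
    using assms unfolding exp_bounded_def by blast
  show ?thesis
  proof (rule exp_boundedI[where K="K + L" and C="max C D"])
    fix n
    have "\<bar>c n + d n\<bar> \<le> K * C ^ n / fact n + L * D ^ n / fact n"
      using KC(3)[of n] LD(3)[of n] by linarith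
    also have "\<dots> \<le> K * max C D ^ n / fact n + L * max C D ^ n / fact n"
      using KC(1,2) LD(1,2) by (intro add_mono divide_right_mono mult_left_mono power_mono) auto
    finally show "\<bar>c n + d n\<bar> \<le> (K + L) * max C D ^ n / fact n"
      by (simp add: field_simps)
  qed (use KC LD in auto)
qed

lemma exp_bounded_cmult:
  assumes "exp_bounded c"
  shows "exp_bounded (\<lambda>n. a * c n)"
proof -
  obtain K C where KC: "0 \<le> K" "0 \<le> C" "\<And>n. \<bar>c n\<bar> \<le> K * C ^ n / fact n"
    using assms unfolding exp_bounded_def by blast
  show ?thesis
  proof (rule exp_boundedI[where K="\<bar>a\<bar> * K" and C=C])
    fix n
    have "\<bar>a * c n\<bar> \<le> \<bar>a\<bar> * (K * C ^ n / fact n)"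
      unfolding abs_mult by (intro mult_left_mono KC) auto
    then show "\<bar>a * c n\<bar> \<le> \<bar>a\<bar> * K * C ^ n / fact n" by simp
  qed (use KC in auto)
qed

text \<open>Since n \<le> 2^n, the factor is absorbed by doubling C. On sums, multiplication by n is
  the Euler operator z d/dz, in which the Kummer equation becomes a two-term recurrence.\<close>

lemma exp_bounded_theta:
  assumes "exp_bounded c"
  shows "exp_bounded (\<lambda>n. real n * c n)"
proof -
  obtain K C where KC: "0 \<le> K" "0 \<le> C" "\<And>n. \<bar>c n\<bar> \<le> K * C ^ n / fact n"
    using assms unfolding exp_bounded_def by blast
  show ?thesis
  proof (rule exp_boundedI[where K=K and C="2 * C"])
    fix n
    have "\<bar>real n * c n\<bar> = real n * \<bar>c n\<bar>" by (simp add: abs_mult)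
    also have "\<dots> \<le> 2 ^ n * (K * C ^ n / fact n)"
      by (intro mult_mono KC) (auto simp: less_imp_le)
    finally show "\<bar>real n * c n\<bar> \<le> K * (2 * C) ^ n / fact n"
      by (simp add: power_mult_distrib mult_ac)
  qed (use KC in auto)
qed

lemma eser_add: "exp_bounded c \<Longrightarrow> exp_bounded d \<Longrightarrow> eser (\<lambda>n. c n + d n) z = eser c z + eser d z"
  unfolding eser_def by (subst suminf_add) (auto intro: exp_bounded_summable simp: distrib_right)

lemma eser_cmult: "exp_bounded c \<Longrightarrow> eser (\<lambda>n. a * c n) z = of_real a * eser c z"
  unfolding eser_def using suminf_mult[OF exp_bounded_summable[of c z], of "of_real a"]
  by (simp add: mult.assoc)

lemma has_field_derivative_eser:
  "exp_bounded c \<Longrightarrow> (eser c has_field_derivative eser (diffs c) z) (at z)"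
  using termdiffs_strong_converges_everywhere[of "\<lambda>n. of_real (c n)" z] exp_bounded_summable[of c]
  unfolding eser_def[abs_def] diffs_of_real by blast

lemma eser_theta:
  assumes "exp_bounded c"
  shows "eser (\<lambda>n. real n * c n) z = z * eser (diffs c) z"
proof -
  let ?f = "\<lambda>n. of_real (real n * c n) * z ^ n"
  have s: "summable ?f" by (rule exp_bounded_summable[OF exp_bounded_theta[OF assms]])
  have "suminf ?f = (\<Sum>n. ?f (Suc n))"
    using suminf_split_head[OF s] by simp
  also have "\<dots> = (\<Sum>n. z * (of_real (diffs c n) * z ^ n))"
    by (simp add: diffs_def mult_ac)
  also have "\<dots> = z * eser (diffs c) z"
    unfolding eser_def by (rule suminf_mult[OF exp_bounded_summable[OF exp_bounded_diffs[OF assms]]])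
  finally show ?thesis unfolding eser_def .
qed

lemma eser_0: "eser c 0 = of_real (c 0)"
  unfolding eser_def by (rule powser_zero)

lemma eser_of_real: "exp_bounded c \<Longrightarrow> eser c (of_real x) = of_real (eser c x)"
  unfolding eser_def by (subst suminf_of_real) (use exp_bounded_summable[of c x] in auto)

lemma eser_cnj: "exp_bounded c \<Longrightarrow> eser c (cnj z) = cnj (eser c z)"
  unfolding eser_def
  using sums_cnj[THEN iffD2, OF summable_sums[OF exp_bounded_summable[of c z]]]
  by (auto intro!: sums_unique[symmetric])

lemma has_real_derivative_eser_param:
  fixes x :: real
  assumes ab: "a < \<beta>" "\<beta> < b" and KC: "0 \<le> K" "0 \<le> C"
    and der: "\<And>n \<gamma>. a < \<gamma> \<Longrightarrow> \<gamma> < b \<Longrightarrow> ((\<lambda>\<beta>. c \<beta> n) has_real_derivative c' \<gamma> n) (at \<gamma>)"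
    and bound: "\<And>n \<gamma>. a < \<gamma> \<Longrightarrow> \<gamma> < b \<Longrightarrow> \<bar>c' \<gamma> n\<bar> \<le> K * C ^ n / fact n"
    and c: "exp_bounded (c \<beta>)"
  shows "((\<lambda>\<beta>. eser (c \<beta>) x) has_real_derivative eser (c' \<beta>) x) (at \<beta>)"
  unfolding eser_def
proof (rule has_field_derivative_series'(2)[where S="{a<..<b}" and ?x0.0=\<beta> and
      f="\<lambda>n \<beta>. of_real (c \<beta> n) * x ^ n" and f'="\<lambda>n \<beta>. of_real (c' \<beta> n) * x ^ n"])
  show "((\<lambda>\<beta>. of_real (c \<beta> n) * x ^ n) has_real_derivative of_real (c' \<gamma> n) * x ^ n)
      (at \<gamma> within {a<..<b})" if "\<gamma> \<in> {a<..<b}" for n \<gamma>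
    unfolding of_real_eq_id id_def
    by (intro DERIV_cmult_right has_field_derivative_at_within[OF der]) (use that in auto)
  show "uniformly_convergent_on {a<..<b} (\<lambda>n \<gamma>. \<Sum>i<n. of_real (c' \<gamma> i) * x ^ i)"
  proof (rule Weierstrass_m_test'[where M="\<lambda>n. K * C ^ n / fact n * \<bar>x\<bar> ^ n"])
    fix n \<gamma> assume "\<gamma> \<in> {a<..<b}"
    then have "\<bar>c' \<gamma> n\<bar> * \<bar>x\<bar> ^ n \<le> K * C ^ n / fact n * \<bar>x\<bar> ^ n"
      by (intro mult_right_mono bound) auto
    then show "norm (of_real (c' \<gamma> n) * x ^ n) \<le> K * C ^ n / fact n * \<bar>x\<bar> ^ n"
      by (simp add: abs_mult power_abs)
  qed (rule summable_exp_bound)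
  show "summable (\<lambda>n. of_real (c \<beta> n) * x ^ n)" by (rule exp_bounded_summable[OF c])
qed (use ab in auto)

section \<open>Coefficients of the two Frobenius solutions\<close>

text \<open>Coefficients of Kummer's function M(\<beta>, 1, z), the solution of z w'' + (1 - z) w' =
  \<beta> w that is regular at 0.\<close>

definition kummer_coeff :: "real \<Rightarrow> nat \<Rightarrow> real" where
  "kummer_coeff \<beta> n = pochhammer \<beta> n / (fact n)\<^sup>2"

text \<open>\<psi>(\<beta> + n) - \<psi>(\<beta>), the logarithmic derivative of the Pochhammer
  symbol in \<beta>.\<close>

definition kummer_psum :: "real \<Rightarrow> nat \<Rightarrow> real" where
  "kummer_psum \<beta> n = (\<Sum>k<n. 1 / (\<beta> + real k))"

text \<open>The indicial equation at 0 has the double root 0, so the second solution is M ln z plus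
  the series Q with these coefficients: they are the derivatives at s = 0 of the coefficients
  (\<beta> + s)_n / ((1 + s)_n)^2 in the Frobenius ansatz with leading power z^s.\<close>

definition kummer_log_coeff :: "real \<Rightarrow> nat \<Rightarrow> real" where
  "kummer_log_coeff \<beta> n = kummer_coeff \<beta> n * (kummer_psum \<beta> n - 2 * harm n)"

lemma kummer_coeff_Suc:
  "(real (Suc n))\<^sup>2 * kummer_coeff \<beta> (Suc n) = (\<beta> + real n) * kummer_coeff \<beta> n"
  by (simp add: kummer_coeff_def pochhammer_Suc power2_eq_square field_simps del: of_nat_Suc)

text \<open>The recurrence of M with two extra terms: inserting M ln z + Q into (z w')' = z w' +
  \<beta> w leaves M - 2 M' as inhomogeneity for Q once the logarithms cancel.\<close>

lemma kummer_log_coeff_Suc: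
  assumes "\<beta> > 0"
  shows "(real (Suc n))\<^sup>2 * kummer_log_coeff \<beta> (Suc n) =
    (\<beta> + real n) * kummer_log_coeff \<beta> n + kummer_coeff \<beta> n - 2 * real (Suc n) * kummer_coeff \<beta> (Suc n)"
proof -
  have n: "real (Suc n) > 0" "\<beta> + real n > 0" using assms by auto
  have aux: "N\<^sup>2 * (k * ((P + d) - 2 * (H + inverse N))) = N\<^sup>2 * k * (P - 2 * H + d) - 2 * N * k"
    if "N > 0" for N k P d H :: real
    using that by (simp add: field_simps power2_eq_square)
  have "(real (Suc n))\<^sup>2 * kummer_log_coeff \<beta> (Suc n) =
    (real (Suc n))\<^sup>2 * kummer_coeff \<beta> (Suc n) * (kummer_psum \<beta> n - 2 * harm n + 1 / (\<beta> + real n))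
     - 2 * real (Suc n) * kummer_coeff \<beta> (Suc n)"
    using aux[OF n(1)] by (simp add: kummer_log_coeff_def kummer_psum_def harm_Suc del: of_nat_Suc)
  also have "\<dots> = (\<beta> + real n) * kummer_log_coeff \<beta> n + kummer_coeff \<beta> n
      - 2 * real (Suc n) * kummer_coeff \<beta> (Suc n)"
    using n unfolding kummer_coeff_Suc by (simp add: kummer_log_coeff_def field_simps)
  finally show ?thesis .
qed

text \<open>Uniform for \<beta> in (0, b]: as b \<ge> 1, \<beta> + n \<le> b (n + 1), so the
  Pochhammer symbol uses up one of the two factorials and the other survives.\<close>

lemma kummer_coeff_bound:
  assumes "0 < \<beta>" "\<beta> \<le> b" "1 \<le> b"
  shows "0 \<le> kummer_coeff \<beta> n" "kummer_coeff \<beta> n \<le> b ^ n / fact n"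
proof -
  show "0 \<le> kummer_coeff \<beta> n"
    using assms by (auto simp: kummer_coeff_def intro!: divide_nonneg_nonneg pochhammer_nonneg)
  have "pochhammer \<beta> n \<le> b ^ n * fact n"
  proof (induction n)
    case (Suc n)
    have "\<beta> + real n \<le> b * real (Suc n)"
      using assms mult_right_mono[of 1 b "real n"] by (simp add: algebra_simps)
    then have "pochhammer \<beta> n * (\<beta> + real n) \<le> (b ^ n * fact n) * (b * real (Suc n))"
      using Suc assms by (intro mult_mono) (auto intro!: pochhammer_nonneg)
    then show ?case by (simp add: pochhammer_Suc mult_ac)
  qed simp
  then show "kummer_coeff \<beta> n \<le> b ^ n / fact n"
    by (simp add: kummer_coeff_def field_simps power2_eq_square)
qed

lemma kummer_psum_bound:
  assumes "0 < a" "a \<le> \<beta>"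
  shows "0 \<le> kummer_psum \<beta> n" "kummer_psum \<beta> n \<le> real n / a"
proof -
  show "0 \<le> kummer_psum \<beta> n"
    using assms by (auto simp: kummer_psum_def intro!: sum_nonneg)
  have "kummer_psum \<beta> n \<le> (\<Sum>k<n. 1 / a)"
    unfolding kummer_psum_def using assms by (intro sum_mono frac_le) auto
  then show "kummer_psum \<beta> n \<le> real n / a" by simp
qed

lemma harm_le: "harm n \<le> (real n :: real)"
proof (induction n)
  case (Suc n)
  have "inverse (real (Suc n)) \<le> 1" by (simp add: inverse_le_1_iff)
  then show ?case using Suc by (simp add: harm_Suc)
qed (simp add: harm_def)

text \<open>The factor h stands for harmonic-type sums and their products, which grow at most like
  n^2; \<open>4 ^ n\<close> dominates both n and n^2, so one shape of majorant serves all
  coefficient families.\<close>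

lemma kummer_coeff_mult_bound:
  assumes "0 < \<beta>" "\<beta> \<le> b" "1 \<le> b" "\<bar>h\<bar> \<le> K * 4 ^ n"
  shows "\<bar>kummer_coeff \<beta> n * h\<bar> \<le> K * (4 * b) ^ n / fact n"
proof -
  have "\<bar>kummer_coeff \<beta> n * h\<bar> \<le> b ^ n / fact n * (K * 4 ^ n)"
    using kummer_coeff_bound[OF assms(1-3), of n] assms(3,4) unfolding abs_mult
    by (intro mult_mono) auto
  then show ?thesis by (simp add: power_mult_distrib mult_ac)
qed

lemma n_le_4: "real n \<le> 4 ^ n" "real n * real n \<le> 4 ^ n"
proof -
  have 2: "real n \<le> 2 ^ n" by (simp add: less_imp_le)
  have "real n * real n \<le> 2 ^ n * 2 ^ n" by (intro mult_mono 2) auto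
  also have "\<dots> = (4::real) ^ n" by (simp add: power_mult_distrib[symmetric])
  finally show "real n * real n \<le> 4 ^ n" .
  show "real n \<le> 4 ^ n" using 2 power_mono[of "2::real" 4 n] by linarith
qed

lemma exp_bounded_kummer_coeff: "\<beta> > 0 \<Longrightarrow> exp_bounded (kummer_coeff \<beta>)"
  by (rule exp_boundedI[where K=1 and C="max 1 \<beta>"])
    (use kummer_coeff_bound[of \<beta> "max 1 \<beta>"] in auto)

lemma kummer_log_factor_bound:
  assumes "0 < a" "a \<le> \<beta>"
  shows "\<bar>kummer_psum \<beta> n - 2 * harm n\<bar> \<le> (1 / a + 2) * real n"
proof -
  have "0 \<le> (harm n :: real)" by (rule harm_nonneg)
  then show ?thesis
    using kummer_psum_bound[OF assms, of n] harm_le[of n] by (simp add: algebra_simps abs_le_iff)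
qed

lemma exp_bounded_kummer_log_coeff:
  assumes "\<beta> > 0"
  shows "exp_bounded (kummer_log_coeff \<beta>)"
proof (rule exp_boundedI[where K="1 / \<beta> + 2" and C="4 * max 1 \<beta>"])
  fix n
  have "(1 / \<beta> + 2) * real n \<le> (1 / \<beta> + 2) * 4 ^ n"
    using assms n_le_4[of n] by (intro mult_left_mono) auto
  then show "\<bar>kummer_log_coeff \<beta> n\<bar> \<le> (1 / \<beta> + 2) * (4 * max 1 \<beta>) ^ n / fact n"
    unfolding kummer_log_coeff_def using kummer_log_factor_bound[of \<beta> \<beta> n] assms
    by (intro kummer_coeff_mult_bound) auto
qed (use assms in auto)

section \<open>Dependence of the series on the parameter\<close>

definition kummer_coeff_deriv :: "real \<Rightarrow> nat \<Rightarrow> real" where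
  "kummer_coeff_deriv \<beta> n = kummer_coeff \<beta> n * kummer_psum \<beta> n"

definition kummer_log_coeff_deriv :: "real \<Rightarrow> nat \<Rightarrow> real" where
  "kummer_log_coeff_deriv \<beta> n = kummer_coeff \<beta> n *
     (kummer_psum \<beta> n * (kummer_psum \<beta> n - 2 * harm n) - (\<Sum>k<n. 1 / (\<beta> + real k)\<^sup>2))"

lemma has_derivative_kummer_coeff:
  assumes "\<beta> > 0"
  shows "((\<lambda>\<beta>. kummer_coeff \<beta> n) has_real_derivative kummer_coeff_deriv \<beta> n) (at \<beta>)"
proof -
  have "((\<lambda>\<beta>. pochhammer \<beta> n) has_real_derivative pochhammer \<beta> n * kummer_psum \<beta> n) (at \<beta>)"
  proof (induction n)
    case 0 then show ?case by (simp add: kummer_psum_def)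
  next
    case (Suc n)
    have "\<beta> + real n > 0" using assms by simp
    then have "pochhammer \<beta> n * kummer_psum \<beta> n * (\<beta> + real n) + pochhammer \<beta> n =
      pochhammer \<beta> (Suc n) * kummer_psum \<beta> (Suc n)"
      by (simp add: pochhammer_Suc kummer_psum_def field_simps)
    then show ?case
      using DERIV_mult[OF Suc DERIV_add[OF DERIV_ident DERIV_const[of "real n"]]]
      by (simp add: pochhammer_Suc mult_ac)
  qed
  then show ?thesis
    unfolding kummer_coeff_def kummer_coeff_deriv_def
    by (rule DERIV_cong[OF DERIV_cdivide]) simp
qed

lemma has_derivative_kummer_log_coeff:
  assumes "\<beta> > 0"
  shows "((\<lambda>\<beta>. kummer_log_coeff \<beta> n) has_real_derivative kummer_log_coeff_deriv \<beta> n) (at \<beta>)"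
proof -
  have "((\<lambda>\<beta>. kummer_psum \<beta> n) has_real_derivative - (\<Sum>k<n. 1 / (\<beta> + real k)\<^sup>2)) (at \<beta>)"
    unfolding kummer_psum_def sum_negf[symmetric] using assms
    by (intro DERIV_sum) (auto intro!: derivative_eq_intros simp: power2_eq_square field_simps)
  then show ?thesis
    unfolding kummer_log_coeff_def kummer_log_coeff_deriv_def
    by (auto intro!: derivative_eq_intros has_derivative_kummer_coeff[OF assms]
      simp: kummer_coeff_deriv_def algebra_simps)
qed

lemma kummer_coeff_deriv_bound:
  assumes "0 < a" "a \<le> \<beta>" "\<beta> \<le> b" "1 \<le> b"
  shows "\<bar>kummer_coeff_deriv \<beta> n\<bar> \<le> 1 / a * (4 * b) ^ n / fact n"
  unfolding kummer_coeff_deriv_def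
proof (rule kummer_coeff_mult_bound)
  have "real n / a \<le> 4 ^ n / a" using assms n_le_4[of n] by (intro divide_right_mono) auto
  then show "\<bar>kummer_psum \<beta> n\<bar> \<le> 1 / a * 4 ^ n"
    using kummer_psum_bound[OF assms(1,2), of n] by simp
qed (use assms in auto)

lemma kummer_log_coeff_deriv_bound:
  assumes "0 < a" "a \<le> \<beta>" "\<beta> \<le> b" "1 \<le> b"
  shows "\<bar>kummer_log_coeff_deriv \<beta> n\<bar> \<le> (1 / a * (1 / a + 2) + 1 / a\<^sup>2) * (4 * b) ^ n / fact n"
  unfolding kummer_log_coeff_deriv_def
proof (rule kummer_coeff_mult_bound)
  have 1: "\<bar>kummer_psum \<beta> n * (kummer_psum \<beta> n - 2 * harm n)\<bar> \<le> real n / a * ((1 / a + 2) * real n)"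
    unfolding abs_mult using kummer_psum_bound[OF assms(1,2), of n] assms
    by (intro mult_mono kummer_log_factor_bound) auto
  have 2: "(\<Sum>k<n. 1 / (\<beta> + real k)\<^sup>2) \<le> (\<Sum>k<n. 1 / a\<^sup>2)"
    using assms by (intro sum_mono divide_left_mono power_mono) auto
  have 3: "0 \<le> (\<Sum>k<n. 1 / (\<beta> + real k)\<^sup>2)" by (intro sum_nonneg) auto
  have "\<bar>kummer_psum \<beta> n * (kummer_psum \<beta> n - 2 * harm n) - (\<Sum>k<n. 1 / (\<beta> + real k)\<^sup>2)\<bar>
      \<le> real n / a * ((1 / a + 2) * real n) + real n * (1 / a\<^sup>2)"
    using 1 2 3 by simp
  also have "\<dots> = (1 / a * (1 / a + 2)) * (real n * real n) + 1 / a\<^sup>2 * real n"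
    by (simp add: algebra_simps)
  also have "\<dots> \<le> (1 / a * (1 / a + 2)) * 4 ^ n + 1 / a\<^sup>2 * 4 ^ n"
    using assms n_le_4[of n] by (intro add_mono mult_left_mono) auto
  finally show "\<bar>kummer_psum \<beta> n * (kummer_psum \<beta> n - 2 * harm n) - (\<Sum>k<n. 1 / (\<beta> + real k)\<^sup>2)\<bar>
      \<le> (1 / a * (1 / a + 2) + 1 / a\<^sup>2) * 4 ^ n"
    by (simp add: algebra_simps)
qed (use assms in auto)

lemma exp_bounded_kummer_coeff_deriv: "\<beta> > 0 \<Longrightarrow> exp_bounded (kummer_coeff_deriv \<beta>)"
  by (rule exp_boundedI[OF _ _ kummer_coeff_deriv_bound[of \<beta> _ "max 1 \<beta>"]]) auto

lemma exp_bounded_kummer_log_coeff_deriv: "\<beta> > 0 \<Longrightarrow> exp_bounded (kummer_log_coeff_deriv \<beta>)"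
  by (rule exp_boundedI[OF _ _ kummer_log_coeff_deriv_bound[of \<beta> _ "max 1 \<beta>"]])
    (auto intro!: add_nonneg_nonneg)

lemmas exp_bounded_kummer = exp_bounded_kummer_coeff exp_bounded_kummer_log_coeff
  exp_bounded_kummer_coeff_deriv exp_bounded_kummer_log_coeff_deriv

lemma diffs_bound:
  fixes c :: "nat \<Rightarrow> real"
  assumes "\<And>n. \<bar>c n\<bar> \<le> K * C ^ n / fact n"
  shows "\<bar>diffs c n\<bar> \<le> K * C * C ^ n / fact n"
proof -
  have "\<bar>diffs c n\<bar> = real (Suc n) * \<bar>c (Suc n)\<bar>"
    by (simp add: diffs_def abs_mult)
  also have "\<dots> \<le> real (Suc n) * (K * C ^ Suc n / fact (Suc n))"
    by (intro mult_left_mono assms) auto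
  also have "\<dots> = K * C * C ^ n / fact n"
    by (simp add: field_simps del: of_nat_Suc)
  finally show ?thesis .
qed

lemma
  fixes x :: real
  assumes \<beta>: "\<beta> > 0"
  shows has_derivative_eser_kummer_coeff:
      "((\<lambda>\<beta>. eser (kummer_coeff \<beta>) x) has_real_derivative eser (kummer_coeff_deriv \<beta>) x) (at \<beta>)"
    and has_derivative_eser_kummer_log_coeff:
      "((\<lambda>\<beta>. eser (kummer_log_coeff \<beta>) x) has_real_derivative eser (kummer_log_coeff_deriv \<beta>) x) (at \<beta>)"
    and has_derivative_eser_diffs_kummer_coeff:
      "((\<lambda>\<beta>. eser (diffs (kummer_coeff \<beta>)) x) has_real_derivative eser (diffs (kummer_coeff_deriv \<beta>)) x) (at \<beta>)"
    and has_derivative_eser_diffs_kummer_log_coeff: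
      "((\<lambda>\<beta>. eser (diffs (kummer_log_coeff \<beta>)) x) has_real_derivative
        eser (diffs (kummer_log_coeff_deriv \<beta>)) x) (at \<beta>)"
proof -
  \<comment> \<open>A window around \<beta> bounded away from 0, since the differentiated
    coefficients are bounded through powers of 1 / a; \<open>b = \<beta> + 1\<close> also meets the
    condition 1 \<le> b of the coefficient bounds.\<close>
  define a where "a = \<beta> / 2"
  define b where "b = \<beta> + 1"
  have ab: "0 < a" "a < \<beta>" "\<beta> < b" "1 \<le> b" using \<beta> by (auto simp: a_def b_def)
  have d1: "\<bar>kummer_coeff_deriv \<gamma> n\<bar> \<le> 1 / a * (4 * b) ^ n / fact n" if "a < \<gamma>" "\<gamma> < b" for \<gamma> n
    using kummer_coeff_deriv_bound[of a \<gamma> b n] ab that by simp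
  have d2: "\<bar>kummer_log_coeff_deriv \<gamma> n\<bar> \<le> (1 / a * (1 / a + 2) + 1 / a\<^sup>2) * (4 * b) ^ n / fact n"
    if "a < \<gamma>" "\<gamma> < b" for \<gamma> n
    using kummer_log_coeff_deriv_bound[of a \<gamma> b n] ab that by simp
  show "((\<lambda>\<beta>. eser (kummer_coeff \<beta>) x) has_real_derivative eser (kummer_coeff_deriv \<beta>) x) (at \<beta>)"
    by (rule has_real_derivative_eser_param[OF ab(2,3) _ _ has_derivative_kummer_coeff d1])
      (use ab \<beta> in \<open>auto simp: exp_bounded_kummer\<close>)
  show "((\<lambda>\<beta>. eser (kummer_log_coeff \<beta>) x) has_real_derivative eser (kummer_log_coeff_deriv \<beta>) x) (at \<beta>)"
    by (rule has_real_derivative_eser_param[OF ab(2,3) _ _ has_derivative_kummer_log_coeff d2])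
      (use ab \<beta> in \<open>auto simp: exp_bounded_kummer intro!: add_nonneg_nonneg\<close>)
  show "((\<lambda>\<beta>. eser (diffs (kummer_coeff \<beta>)) x) has_real_derivative eser (diffs (kummer_coeff_deriv \<beta>)) x) (at \<beta>)"
    by (rule has_real_derivative_eser_param[OF ab(2,3) _ _ _ diffs_bound[OF d1]])
      (use ab \<beta> exp_bounded_diffs[OF exp_bounded_kummer(1)[OF \<beta>]] in \<open>auto simp: diffs_def
        intro!: DERIV_cmult has_derivative_kummer_coeff simp del: of_nat_Suc\<close>)
  show "((\<lambda>\<beta>. eser (diffs (kummer_log_coeff \<beta>)) x) has_real_derivative
        eser (diffs (kummer_log_coeff_deriv \<beta>)) x) (at \<beta>)"
    by (rule has_real_derivative_eser_param[OF ab(2,3) _ _ _ diffs_bound[OF d2]])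
      (use ab \<beta> exp_bounded_diffs[OF exp_bounded_kummer(2)[OF \<beta>]] in \<open>auto simp: diffs_def
        intro!: DERIV_cmult has_derivative_kummer_log_coeff add_nonneg_nonneg simp del: of_nat_Suc\<close>)
qed

section \<open>The half-line integral\<close>

abbreviation halfline :: "real measure" where
  "halfline \<equiv> restrict_space lborel {0<..}"

lemma measurable_halfline[measurable (raw)]:
  "f \<in> borel_measurable borel \<Longrightarrow> f \<in> borel_measurable halfline"
  by (rule measurable_restrict_space1) simp

lemma integrable_halfline_mono:
  fixes f :: "real \<Rightarrow> real"
  assumes "integrable halfline g" "f \<in> borel_measurable borel" "\<And>t. t > 0 \<Longrightarrow> \<bar>f t\<bar> \<le> g t"
  shows "integrable halfline f"
  by (rule Bochner_Integration.integrable_bound[OF assms(1) measurable_halfline[OF assms(2)]])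
    (use assms(3) in \<open>auto intro!: AE_I2 order_trans[OF _ abs_ge_self]\<close>)

lemma integrable_gamma_halfline:
  assumes "a > 0" "c > 0"
  shows "integrable halfline (\<lambda>t. t powr (a - 1) * exp (- c * t))"
proof -
  have "set_integrable lborel {0<..} (\<lambda>t. complex_of_real t powr (of_real a - 1) / of_real (exp (c * t)))"
    using absolutely_integrable_Gamma_integral[of "of_real a" c] assms
    by (simp add: set_integrable_def integrable_completion)
  then have "integrable halfline (\<lambda>t. complex_of_real t powr (of_real a - 1) / of_real (exp (c * t)))"
    by (subst integrable_restrict_space) (auto simp: set_integrable_def)
  then have "integrable halfline (\<lambda>t. norm (complex_of_real t powr (of_real a - 1) / of_real (exp (c * t))))"
    by (rule integrable_norm)
  then show ?thesis
    by (rule Bochner_Integration.integrable_cong[THEN iffD1, rotated 2])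
      (auto simp: norm_divide norm_powr_real_powr exp_minus field_simps)
qed

lemma halfline_FTC:
  fixes f F :: "real \<Rightarrow> real"
  assumes "\<And>t. t > 0 \<Longrightarrow> (F has_real_derivative f t) (at t)" "\<And>t. t > 0 \<Longrightarrow> isCont f t"
    and "integrable halfline f"
    and "(F \<longlongrightarrow> A) (at_right 0)" "(F \<longlongrightarrow> B) at_top"
  shows "(\<integral>t. f t \<partial>halfline) = B - A"
proof -
  have e: "einterval 0 \<infinity> = {0<..}" by (auto simp: einterval_def)
  have "(LBINT t=0..\<infinity>. f t) = B - A"
  proof (rule interval_integral_FTC_integrable)
    show "set_integrable lborel (einterval 0 \<infinity>) f"
      using assms(3) unfolding e set_integrable_def by (subst (asm) integrable_restrict_space) auto
    show "((F \<circ> real_of_ereal) \<longlongrightarrow> A) (at_right 0)"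
      using assms(4) unfolding zero_ereal_def by (simp add: ereal_tendsto_simps)
    show "((F \<circ> real_of_ereal) \<longlongrightarrow> B) (at_left \<infinity>)"
      using assms(5) by (simp add: ereal_tendsto_simps)
  qed (use assms(1,2) in \<open>auto simp: has_real_derivative_iff_has_vector_derivative[symmetric]\<close>)
  then show ?thesis
    unfolding interval_lebesgue_integral_def set_lebesgue_integral_def e
    by (subst integral_restrict_space) auto
qed

text \<open>The integrand written through t / (1 + t), which lies in (0, 1): the weight is then
  decreasing in \<beta>, its \<beta>-derivative is multiplication by ln (t / (1 + t)), and the
  boundary terms of the integrations by parts can be read off.\<close>

definition kummer_w :: "real \<Rightarrow> real \<Rightarrow> real \<Rightarrow> real" where
  "kummer_w \<beta> c t = (t / (1 + t)) powr \<beta> * exp (- c * t) / t"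

definition kummer_int :: "real \<Rightarrow> real \<Rightarrow> real" where
  "kummer_int \<beta> c = (\<integral>t. kummer_w \<beta> c t \<partial>halfline)"

definition kummer_int_deriv :: "real \<Rightarrow> real \<Rightarrow> real" where
  "kummer_int_deriv \<beta> c = (\<integral>t. - t * kummer_w \<beta> c t \<partial>halfline)"

lemma kummer_w_measurable[measurable]: "kummer_w \<beta> c \<in> borel_measurable borel"
  unfolding kummer_w_def[abs_def] by measurable

lemma kummer_w_pos: "t > 0 \<Longrightarrow> kummer_w \<beta> c t > 0"
  unfolding kummer_w_def by (auto intro!: divide_pos_pos mult_pos_pos)

lemma kummer_w_le:
  assumes "\<beta> > 0" "t > 0"
  shows "kummer_w \<beta> c t \<le> t powr (\<beta> - 1) * exp (- c * t)"
proof -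
  have "(t / (1 + t)) powr \<beta> \<le> t powr \<beta>"
    using assms by (intro powr_mono2) (auto simp: field_simps)
  then have "(t / (1 + t)) powr \<beta> * exp (- c * t) / t \<le> t powr \<beta> * exp (- c * t) / t"
    using assms by (intro divide_right_mono mult_right_mono) auto
  then show ?thesis
    using assms by (simp add: kummer_w_def powr_diff)
qed

lemma integrable_kummer_w_power:
  assumes "\<beta> > 0" "c > 0"
  shows "integrable halfline (\<lambda>t. t ^ k * kummer_w \<beta> c t)"
proof (rule integrable_halfline_mono[OF integrable_gamma_halfline[of "\<beta> + real k" c]])
  fix t :: real assume t: "t > 0"
  have "\<bar>t ^ k * kummer_w \<beta> c t\<bar> = t ^ k * kummer_w \<beta> c t"
    using kummer_w_pos[OF t, of \<beta> c] t by (simp add: abs_mult)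
  also have "\<dots> \<le> t ^ k * (t powr (\<beta> - 1) * exp (- c * t))"
    using kummer_w_le[OF assms(1) t] t by (intro mult_left_mono) auto
  also have "\<dots> = t powr (\<beta> + real k - 1) * exp (- c * t)"
    using t by (simp add: powr_realpow[symmetric] powr_add[symmetric] algebra_simps)
  finally show "\<bar>t ^ k * kummer_w \<beta> c t\<bar> \<le> t powr (\<beta> + real k - 1) * exp (- c * t)" .
qed (use assms in auto)

lemma integrable_kummer_w: "\<beta> > 0 \<Longrightarrow> c > 0 \<Longrightarrow> integrable halfline (kummer_w \<beta> c)"
  using integrable_kummer_w_power[of \<beta> c 0] by simp

lemma has_derivative_kummer_moment:
  assumes "\<beta> > 0" "c > 0"
  shows "((\<lambda>c. \<integral>t. t ^ k * kummer_w \<beta> c t \<partial>halfline) has_real_derivative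
    (\<integral>t. - (t ^ Suc k * kummer_w \<beta> c t) \<partial>halfline)) (at c)"
proof (rule has_field_derivative_lebesgue_integral[where r="c / 2" and
      g="\<lambda>t. t ^ Suc k * kummer_w \<beta> (c / 2) t" and f'="\<lambda>c t. - (t ^ Suc k * kummer_w \<beta> c t)"])
  show "((\<lambda>c. t ^ k * kummer_w \<beta> c t) has_real_derivative - (t ^ Suc k * kummer_w \<beta> d t)) (at d)"
    for d t
    unfolding kummer_w_def by (auto intro!: derivative_eq_intros)
  show "norm (- (t ^ Suc k * kummer_w \<beta> d t)) \<le> t ^ Suc k * kummer_w \<beta> (c / 2) t"
    if "d \<in> ball c (c / 2)" "t \<in> space halfline" for d t
  proof -
    have t: "t > 0" using that by simp
    have "\<bar>c - d\<bar> < c / 2" using that by (simp add: dist_real_def)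
    then have d: "c / 2 \<le> d" by linarith
    then have "exp (- d * t) \<le> exp (- (c / 2) * t)" using t by simp
    then have "kummer_w \<beta> d t \<le> kummer_w \<beta> (c / 2) t"
      unfolding kummer_w_def using t by (intro divide_right_mono mult_left_mono) auto
    then show ?thesis
      using t kummer_w_pos[OF t, of \<beta> d] by (simp add: abs_mult mult_left_mono)
  qed
qed (use assms integrable_kummer_w_power[of \<beta> "c/2" "Suc k"] integrable_kummer_w_power[of \<beta> c k] in auto)

lemma has_derivative_kummer_int:
  assumes "\<beta> > 0" "c > 0"
  shows "(kummer_int \<beta> has_real_derivative kummer_int_deriv \<beta> c) (at c)"
  using has_derivative_kummer_moment[OF assms, of 0]
  unfolding kummer_int_def[abs_def] kummer_int_deriv_def by simp

lemma has_derivative_base_powr: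
  assumes "t > (0::real)"
  shows "((\<lambda>t. (t / (1 + t)) powr \<beta>) has_real_derivative \<beta> * (t / (1 + t)) powr \<beta> / (t * (1 + t))) (at t)"
proof -
  have "((\<lambda>t. t / (1 + t)) has_real_derivative 1 / (1 + t)\<^sup>2) (at t)"
    using assms by (auto intro!: derivative_eq_intros simp: power2_eq_square)
  from DERIV_powr[OF this _ DERIV_const, of \<beta>]
  show ?thesis
    by (rule DERIV_cong) (use assms in \<open>simp_all add: divide_simps power2_eq_square\<close>)
qed

lemma kummer_base_lim_0: "\<beta> > 0 \<Longrightarrow> ((\<lambda>t::real. (t / (1 + t)) powr \<beta>) \<longlongrightarrow> 0) (at_right 0)"
  by real_asymp

lemma kummer_base_lim_top: "((\<lambda>t::real. (t / (1 + t)) powr \<beta>) \<longlongrightarrow> 1) at_top"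
proof -
  have "((\<lambda>t::real. t / (1 + t)) \<longlongrightarrow> 1) at_top" by real_asymp
  from tendsto_powr[OF this tendsto_const, of \<beta>] show ?thesis by simp
qed


lemma kummer_base_bounds: "t > 0 \<Longrightarrow> 0 < t / (1 + t) \<and> t / (1 + t) < (1::real)"
  by (auto simp: field_simps)

lemma isCont_kummer_w: "t > 0 \<Longrightarrow> isCont (kummer_w \<beta> c) t"
  unfolding kummer_w_def by (intro continuous_intros) auto

text \<open>Kummer's equation, from the total derivative of (t / (1 + t))^\<beta> (1 + t) exp(-c t),
  whose boundary terms vanish. The form (c I')' = c I' + \<beta> I keeps to the pair (I, c I'), in
  which I is later compared with the Frobenius solutions.\<close>

lemma kummer_int_ode:
  assumes "\<beta> > 0" "c > 0"
  shows "((\<lambda>c. c * kummer_int_deriv \<beta> c) has_real_derivative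
    c * kummer_int_deriv \<beta> c + \<beta> * kummer_int \<beta> c) (at c)"
proof -
  let ?m = "\<lambda>k. \<integral>t. t ^ k * kummer_w \<beta> c t \<partial>halfline"
  have int: "integrable halfline (\<lambda>t. t ^ k * kummer_w \<beta> c t)" for k
    by (rule integrable_kummer_w_power[OF assms])
  have d: "(kummer_int_deriv \<beta> has_real_derivative ?m 2) (at c)"
    using DERIV_minus[OF has_derivative_kummer_moment[OF assms, of 1]]
    unfolding kummer_int_deriv_def[abs_def] by (simp add: numeral_2_eq_2)
  have "(\<integral>t. \<beta> * kummer_w \<beta> c t + t * kummer_w \<beta> c t - c * (t * kummer_w \<beta> c t)
      - c * (t ^ 2 * kummer_w \<beta> c t) \<partial>halfline) = 0 - 0"
  proof (rule halfline_FTC[where F="\<lambda>t. (t / (1 + t)) powr \<beta> * ((1 + t) * exp (- c * t))"])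
    fix t :: real assume t: "t > 0"
    show "((\<lambda>t. (t / (1 + t)) powr \<beta> * ((1 + t) * exp (- c * t))) has_real_derivative
      \<beta> * kummer_w \<beta> c t + t * kummer_w \<beta> c t - c * (t * kummer_w \<beta> c t) - c * (t ^ 2 * kummer_w \<beta> c t)) (at t)"
    proof (rule DERIV_cong[OF DERIV_mult[OF has_derivative_base_powr[OF t]]])
      show "((\<lambda>t. (1 + t) * exp (- c * t)) has_real_derivative (1 - c * (1 + t)) * exp (- c * t)) (at t)"
        by (auto intro!: derivative_eq_intros simp: algebra_simps)
      have *: "\<beta> * p / (t * (1 + t)) * ((1 + t) * e) + (1 - c * (1 + t)) * e * p =
        \<beta> * (p * e / t) + t * (p * e / t) - c * (t * (p * e / t)) - c * (t ^ 2 * (p * e / t))" for p e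
        using t by (simp add: divide_simps power2_eq_square) (simp add: algebra_simps)
      show "\<beta> * (t / (1 + t)) powr \<beta> / (t * (1 + t)) * ((1 + t) * exp (- c * t)) +
        (1 - c * (1 + t)) * exp (- c * t) * (t / (1 + t)) powr \<beta> =
        \<beta> * kummer_w \<beta> c t + t * kummer_w \<beta> c t - c * (t * kummer_w \<beta> c t) - c * (t ^ 2 * kummer_w \<beta> c t)"
        unfolding kummer_w_def by (rule *)
    qed
    show "isCont (\<lambda>t. \<beta> * kummer_w \<beta> c t + t * kummer_w \<beta> c t - c * (t * kummer_w \<beta> c t)
      - c * (t ^ 2 * kummer_w \<beta> c t)) t"
      by (intro continuous_intros isCont_kummer_w t)
  next
    show "integrable halfline (\<lambda>t. \<beta> * kummer_w \<beta> c t + t * kummer_w \<beta> c t - c * (t * kummer_w \<beta> c t)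
      - c * (t ^ 2 * kummer_w \<beta> c t))"
      using int[of 0] int[of 1] int[of 2] by simp
    have "((\<lambda>t::real. (1 + t) * exp (- c * t)) \<longlongrightarrow> 0) at_top" using assms(2) by real_asymp
    from tendsto_mult[OF kummer_base_lim_top this]
    show "((\<lambda>t. (t / (1 + t)) powr \<beta> * ((1 + t) * exp (- c * t))) \<longlongrightarrow> 0) at_top" by simp
    have "((\<lambda>t::real. (1 + t) * exp (- c * t)) \<longlongrightarrow> 1) (at_right 0)" by real_asymp
    from tendsto_mult[OF kummer_base_lim_0[OF assms(1)] this]
    show "((\<lambda>t. (t / (1 + t)) powr \<beta> * ((1 + t) * exp (- c * t))) \<longlongrightarrow> 0) (at_right 0)" by simp
  qed
  also have "(\<integral>t. \<beta> * kummer_w \<beta> c t + t * kummer_w \<beta> c t - c * (t * kummer_w \<beta> c t)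
      - c * (t ^ 2 * kummer_w \<beta> c t) \<partial>halfline) = \<beta> * ?m 0 + ?m 1 - c * ?m 1 - c * ?m 2"
    using int[of 0] int[of 1] int[of 2] by simp
  finally have "\<beta> * kummer_int \<beta> c - kummer_int_deriv \<beta> c + c * kummer_int_deriv \<beta> c - c * ?m 2 = 0"
    by (simp add: kummer_int_def kummer_int_deriv_def)
  then show ?thesis
    by (intro DERIV_cong[OF DERIV_mult[OF DERIV_ident d]]) (simp add: algebra_simps)
qed

text \<open>Divided by \<open>kummer_int\<close>, this is the stationary mean of 1 / (1 + t), that
  is, of the corner resolvent entry.\<close>

definition kummer_int_shift :: "real \<Rightarrow> real \<Rightarrow> real" where
  "kummer_int_shift \<beta> c = (\<integral>t. kummer_w \<beta> c t / (1 + t) \<partial>halfline)"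

lemma integrable_kummer_w_shift:
  assumes "\<beta> > 0" "c > 0"
  shows "integrable halfline (\<lambda>t. kummer_w \<beta> c t / (1 + t))"
proof (rule integrable_halfline_mono[OF integrable_kummer_w[OF assms]])
  show "\<bar>kummer_w \<beta> c t / (1 + t)\<bar> \<le> kummer_w \<beta> c t" if "t > 0" for t
    using kummer_w_pos[OF that, of \<beta> c] that by (simp add: field_simps)
qed measurable

text \<open>The function (t / (1 + t))^\<beta> exp(-c t) vanishes at both ends, so its derivative
  integrates to zero. This turns the mean resolvent into the logarithmic derivative - c I' /
  (\<beta> I).\<close>

lemma kummer_int_shift_eq:
  assumes "\<beta> > 0" "c > 0"
  shows "\<beta> * kummer_int_shift \<beta> c = - c * kummer_int_deriv \<beta> c"
proof -
  have int: "integrable halfline (\<lambda>t. t * kummer_w \<beta> c t)"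
    using integrable_kummer_w_power[OF assms, of 1] by simp
  note int2 = integrable_kummer_w_shift[OF assms]
  have "(\<integral>t. \<beta> * (kummer_w \<beta> c t / (1 + t)) - c * (t * kummer_w \<beta> c t) \<partial>halfline) = 0 - 0"
  proof (rule halfline_FTC[where F="\<lambda>t. (t / (1 + t)) powr \<beta> * exp (- c * t)"])
    fix t :: real assume t: "t > 0"
    show "((\<lambda>t. (t / (1 + t)) powr \<beta> * exp (- c * t)) has_real_derivative
      \<beta> * (kummer_w \<beta> c t / (1 + t)) - c * (t * kummer_w \<beta> c t)) (at t)"
    proof (rule DERIV_cong[OF DERIV_mult[OF has_derivative_base_powr[OF t]]])
      show "((\<lambda>t. exp (- c * t)) has_real_derivative - c * exp (- c * t)) (at t)"
        by (auto intro!: derivative_eq_intros)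
      have *: "\<beta> * p / (t * (1 + t)) * e + - c * e * p =
        \<beta> * (p * e / t / (1 + t)) - c * (t * (p * e / t))" for p e
        using t by (simp add: divide_simps)
      show "\<beta> * (t / (1 + t)) powr \<beta> / (t * (1 + t)) * exp (- c * t) + - c * exp (- c * t) * (t / (1 + t)) powr \<beta> =
        \<beta> * (kummer_w \<beta> c t / (1 + t)) - c * (t * kummer_w \<beta> c t)"
        unfolding kummer_w_def by (rule *)
    qed
    show "isCont (\<lambda>t. \<beta> * (kummer_w \<beta> c t / (1 + t)) - c * (t * kummer_w \<beta> c t)) t"
      using t by (intro continuous_intros isCont_kummer_w t) auto
  next
    show "integrable halfline (\<lambda>t. \<beta> * (kummer_w \<beta> c t / (1 + t)) - c * (t * kummer_w \<beta> c t))"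
      by (intro Bochner_Integration.integrable_diff integrable_mult_right int int2)
    have "((\<lambda>t::real. exp (- c * t)) \<longlongrightarrow> 0) at_top" using assms(2) by real_asymp
    from tendsto_mult[OF kummer_base_lim_top this]
    show "((\<lambda>t. (t / (1 + t)) powr \<beta> * exp (- c * t)) \<longlongrightarrow> 0) at_top" by simp
    have "((\<lambda>t::real. exp (- c * t)) \<longlongrightarrow> 1) (at_right 0)" by real_asymp
    from tendsto_mult[OF kummer_base_lim_0[OF assms(1)] this]
    show "((\<lambda>t. (t / (1 + t)) powr \<beta> * exp (- c * t)) \<longlongrightarrow> 0) (at_right 0)" by simp
  qed
  also have "(\<integral>t. \<beta> * (kummer_w \<beta> c t / (1 + t)) - c * (t * kummer_w \<beta> c t) \<partial>halfline) =
    \<beta> * kummer_int_shift \<beta> c - c * (\<integral>t. t * kummer_w \<beta> c t \<partial>halfline)"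
    unfolding kummer_int_shift_def
    by (simp only: Bochner_Integration.integral_diff[OF integrable_mult_right[OF int2]
      integrable_mult_right[OF int]] integral_mult_right_zero)
  finally show ?thesis by (simp add: kummer_int_deriv_def)
qed

text \<open>By the relation to \<open>kummer_int_shift\<close>, - c I' is the integral of exp(-c t)
  against the derivative of (t / (1 + t))^\<beta>, a function rising from 0 to 1; hence the same
  limit for every \<beta>. This value later fixes the coefficient of the logarithm.\<close>

lemma kummer_int_deriv_lim_0:
  assumes "\<beta> > 0"
  shows "((\<lambda>c. c * kummer_int_deriv \<beta> c) \<longlongrightarrow> - 1) (at_right 0)"
proof -
  define h where "h t = (t / (1 + t)) powr \<beta> / (t * (1 + t))" for t :: real
  have hm[measurable]: "h \<in> borel_measurable borel" unfolding h_def[abs_def] by measurable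
  have h0: "h t \<ge> 0" if "t > 0" for t using that by (simp add: h_def)
  have e: "einterval 0 \<infinity> = {0<..}" by (auto simp: einterval_def)
  have A: "(((\<lambda>t. (t / (1 + t)) powr \<beta>) \<circ> real_of_ereal) \<longlongrightarrow> 0) (at_right 0)"
    using kummer_base_lim_0[OF assms] unfolding zero_ereal_def by (simp add: ereal_tendsto_simps)
  have B: "(((\<lambda>t. (t / (1 + t)) powr \<beta>) \<circ> real_of_ereal) \<longlongrightarrow> 1) (at_left \<infinity>)"
    using kummer_base_lim_top by (simp add: ereal_tendsto_simps)
  note FTC = interval_integral_FTC_nonneg[of 0 \<infinity> "\<lambda>t. (t / (1 + t)) powr \<beta>" "\<lambda>t. \<beta> * h t", OF _ _ _ _ A B]
  have 1: "(\<And>x. (0::ereal) < ereal x \<Longrightarrow> ereal x < \<infinity> \<Longrightarrow>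
      ((\<lambda>t. (t / (1 + t)) powr \<beta>) has_real_derivative \<beta> * h x) (at x))"
    using has_derivative_base_powr[of _ \<beta>] by (simp add: h_def)
  have 2: "(\<And>x. (0::ereal) < ereal x \<Longrightarrow> ereal x < \<infinity> \<Longrightarrow> isCont (\<lambda>t. \<beta> * h t) x)"
    unfolding h_def by (intro continuous_intros) (auto simp: add_pos_pos)
  have 3: "AE x in lborel. (0::ereal) < ereal x \<longrightarrow> ereal x < \<infinity> \<longrightarrow> 0 \<le> \<beta> * h x"
    using h0 assms by auto
  have "set_integrable lborel {0<..} (\<lambda>t. \<beta> * h t)" using FTC(1)[OF _ 1 2 3] unfolding e by simp
  then have i: "integrable halfline (\<lambda>t. \<beta> * h t)"
    by (subst integrable_restrict_space) (auto simp: set_integrable_def)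
  have v: "(\<integral>t. \<beta> * h t \<partial>halfline) = 1"
    using FTC(2)[OF _ 1 2 3] unfolding interval_lebesgue_integral_def set_lebesgue_integral_def e
    by (subst integral_restrict_space) auto
  have "((\<lambda>c. \<integral>t. \<beta> * h t * exp (- c * t) \<partial>halfline) \<longlongrightarrow> 1) (at_right 0)"
  proof (rule tendsto_at_right_sequentially[where b=1])
    fix s :: "nat \<Rightarrow> real" assume s: "\<And>n. 0 < s n" "s \<longlonglongrightarrow> 0"
    have "(\<lambda>n. \<integral>t. \<beta> * h t * exp (- s n * t) \<partial>halfline) \<longlonglongrightarrow> (\<integral>t. \<beta> * h t \<partial>halfline)"
    proof (rule integral_dominated_convergence[where w="\<lambda>t. \<beta> * h t"])
      show "AE t in halfline. (\<lambda>n. \<beta> * h t * exp (- s n * t)) \<longlonglongrightarrow> \<beta> * h t"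
      proof (rule AE_I2)
        fix t
        have "(\<lambda>n. \<beta> * h t * exp (- s n * t)) \<longlonglongrightarrow> \<beta> * h t * exp (- 0 * t)"
          by (intro tendsto_intros s(2))
        then show "(\<lambda>n. \<beta> * h t * exp (- s n * t)) \<longlonglongrightarrow> \<beta> * h t" by simp
      qed
      show "AE t in halfline. norm (\<beta> * h t * exp (- s n * t)) \<le> \<beta> * h t" for n
      proof (rule AE_I2)
        fix t assume "t \<in> space halfline"
        then have t: "t > 0" by simp
        then have "exp (- s n * t) \<le> 1" using s(1)[of n] by simp
        then have "\<beta> * h t * exp (- s n * t) \<le> \<beta> * h t * 1"
          using h0[OF t] assms by (intro mult_left_mono) auto
        then show "norm (\<beta> * h t * exp (- s n * t)) \<le> \<beta> * h t"
          using h0[OF t] assms by (simp add: abs_mult)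
      qed
    qed (use i in measurable)
    then show "(\<lambda>n. \<integral>t. \<beta> * h t * exp (- s n * t) \<partial>halfline) \<longlonglongrightarrow> 1" using v by simp
  qed simp
  then have "((\<lambda>c. - (\<integral>t. \<beta> * h t * exp (- c * t) \<partial>halfline)) \<longlongrightarrow> - 1) (at_right 0)"
    by (rule tendsto_minus)
  moreover have "\<forall>\<^sub>F c in at_right 0. - (\<integral>t. \<beta> * h t * exp (- c * t) \<partial>halfline) = c * kummer_int_deriv \<beta> c"
    using eventually_at_right_less
  proof eventually_elim
    case (elim c)
    have "(\<integral>t. \<beta> * h t * exp (- c * t) \<partial>halfline) = (\<integral>t. \<beta> * (kummer_w \<beta> c t / (1 + t)) \<partial>halfline)"
      by (intro Bochner_Integration.integral_cong) (auto simp: h_def kummer_w_def)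
    also have "\<dots> = \<beta> * kummer_int_shift \<beta> c"
      unfolding kummer_int_shift_def by (rule integral_mult_right_zero)
    finally show ?case
      using kummer_int_shift_eq[OF assms elim] by simp
  qed
  ultimately show ?thesis by (rule Lim_transform_eventually)
qed

lemma kummer_int_pos:
  assumes "\<beta> > 0" "c > 0"
  shows "kummer_int \<beta> c > 0"
proof -
  have "kummer_int \<beta> c \<noteq> 0"
  proof
    assume "kummer_int \<beta> c = 0"
    then have "AE t in halfline. kummer_w \<beta> c t = 0"
      unfolding kummer_int_def
      by (subst (asm) integral_nonneg_eq_0_iff_AE)
        (use integrable_kummer_w[OF assms] kummer_w_pos in \<open>auto intro!: AE_I2 less_imp_le\<close>)
    then have "AE t in lborel. t \<in> {0<..} \<longrightarrow> kummer_w \<beta> c t = 0"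
      by (subst (asm) AE_restrict_space_iff) auto
    then have "AE t in lborel. \<not> (t \<in> {0<..<1::real})"
      by eventually_elim (use kummer_w_pos[of _ \<beta> c] in force)
    then have "emeasure lborel {0<..<1::real} = 0"
      by (subst (asm) AE_iff_measurable[where N="{0<..<1}"]) auto
    then show False by simp
  qed
  moreover have "kummer_int \<beta> c \<ge> 0"
    unfolding kummer_int_def using kummer_w_pos by (intro integral_nonneg_AE AE_I2) (auto intro: less_imp_le)
  ultimately show ?thesis by linarith
qed

text \<open>Half of the exponent pays for the logarithm: with u = t / (1 + t), \<bar>ln u\<bar>
  \<le> (2 / \<beta>) u^(-\<beta>/2).\<close>

lemma ln_kummer_base_bound:
  assumes "\<beta> > 0" "t > 0"
  shows "\<bar>ln (t / (1 + t))\<bar> * kummer_w \<beta> c t \<le> 2 / \<beta> * kummer_w (\<beta> / 2) c t"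
proof -
  let ?u = "t / (1 + t)"
  have u: "0 < ?u" "?u < 1" using kummer_base_bounds[OF assms(2)] by auto
  have "\<bar>ln ?u\<bar> = ln (1 / ?u)" using u by (subst ln_div) auto
  also have "\<dots> \<le> (1 / ?u) powr (\<beta> / 2) / (\<beta> / 2)"
    by (rule ln_powr_bound) (use u assms in auto)
  also have "\<dots> = 2 / \<beta> * ?u powr (- (\<beta> / 2))"
    using u by (simp add: powr_divide powr_minus field_simps)
  finally have "\<bar>ln ?u\<bar> * kummer_w \<beta> c t \<le> 2 / \<beta> * ?u powr (- (\<beta> / 2)) * kummer_w \<beta> c t"
    using kummer_w_pos[OF assms(2), of \<beta> c] by (intro mult_right_mono) auto
  also have "\<dots> = 2 / \<beta> * (?u powr (- (\<beta> / 2)) * ?u powr \<beta>) * exp (- c * t) / t"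
    by (simp add: kummer_w_def)
  also have "?u powr (- (\<beta> / 2)) * ?u powr \<beta> = ?u powr (\<beta> / 2)"
    by (simp only: powr_add[symmetric]) simp
  finally show ?thesis by (simp add: kummer_w_def)
qed

lemma integrable_ln_kummer_w:
  assumes "\<beta> > 0" "c > 0"
  shows "integrable halfline (\<lambda>t. ln (t / (1 + t)) * kummer_w \<beta> c t)"
proof (rule integrable_halfline_mono)
  show "integrable halfline (\<lambda>t. 2 / \<beta> * kummer_w (\<beta> / 2) c t)"
    using integrable_kummer_w[of "\<beta> / 2" c] assms by simp
  show "\<bar>ln (t / (1 + t)) * kummer_w \<beta> c t\<bar> \<le> 2 / \<beta> * kummer_w (\<beta> / 2) c t" if "t > 0" for t
    using ln_kummer_base_bound[OF assms(1) that, of c] kummer_w_pos[OF that, of \<beta> c]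
    by (simp add: abs_mult)
qed measurable

text \<open>On the ball of radius \<beta>/2 the exponent is at least \<beta>/2, and half of that is
  spent on the logarithm; hence the majorant with parameter \<beta>/4.\<close>

lemma has_derivative_kummer_int_param:
  assumes "\<beta> > 0" "c > 0"
  shows "((\<lambda>\<beta>. kummer_int \<beta> c) has_real_derivative
    (\<integral>t. ln (t / (1 + t)) * kummer_w \<beta> c t \<partial>halfline)) (at \<beta>)"
  unfolding kummer_int_def
proof (rule has_field_derivative_lebesgue_integral[where r="\<beta> / 2" and
      g="\<lambda>t. 4 / \<beta> * kummer_w (\<beta> / 4) c t" and f'="\<lambda>\<beta> t. ln (t / (1 + t)) * kummer_w \<beta> c t"])
  show "((\<lambda>\<beta>. kummer_w \<beta> c t) has_real_derivative ln (t / (1 + t)) * kummer_w \<gamma> c t) (at \<gamma>)"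
    if "t \<in> space halfline" for \<gamma> t
    using that kummer_base_bounds[of t] unfolding kummer_w_def
    by (auto intro!: derivative_eq_intros simp: mult_ac)
  show "norm (ln (t / (1 + t)) * kummer_w \<gamma> c t) \<le> 4 / \<beta> * kummer_w (\<beta> / 4) c t"
    if "\<gamma> \<in> ball \<beta> (\<beta> / 2)" "t \<in> space halfline" for \<gamma> t
  proof -
    have t: "t > 0" using that by simp
    have "\<bar>\<beta> - \<gamma>\<bar> < \<beta> / 2" using that by (simp add: dist_real_def)
    then have g: "\<beta> / 2 \<le> \<gamma>" by linarith
    have "(t / (1 + t)) powr \<gamma> \<le> (t / (1 + t)) powr (\<beta> / 2)"
      using kummer_base_bounds[OF t] g by (intro powr_mono') auto
    then have "kummer_w \<gamma> c t \<le> kummer_w (\<beta> / 2) c t"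
      unfolding kummer_w_def using t by (intro divide_right_mono mult_right_mono) auto
    then have "\<bar>ln (t / (1 + t))\<bar> * kummer_w \<gamma> c t \<le> \<bar>ln (t / (1 + t))\<bar> * kummer_w (\<beta> / 2) c t"
      by (intro mult_left_mono) auto
    also have "\<dots> \<le> 4 / \<beta> * kummer_w (\<beta> / 4) c t"
      using ln_kummer_base_bound[of "\<beta> / 2" t c] assms t by simp
    finally show ?thesis using kummer_w_pos[OF t, of \<gamma> c] by (simp add: abs_mult)
  qed
qed (use assms integrable_kummer_w[of "\<beta>/4" c] integrable_kummer_w[of \<beta> c] in auto)

text \<open>The substitution s = c t moves c into the factor (1 + s/c)^(-\<beta>), which tends to 1
  from below, and the Gamma integral remains. The limit supplies the normalisation of the Whittaker
  function at infinity.\<close>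

lemma kummer_int_asymp:
  assumes "\<beta> > 0"
  shows "((\<lambda>c. c powr \<beta> * kummer_int \<beta> c) \<longlongrightarrow> Gamma \<beta>) at_top"
proof -
  have eq: "c powr \<beta> * kummer_int \<beta> c = (\<integral>s. (s / (1 + s / c)) powr \<beta> * exp (- s) / s \<partial>halfline)"
    if c: "c > 0" for c
  proof -
    let ?f = "\<lambda>s. indicator {0<..} s *\<^sub>R ((s / (1 + s / c)) powr \<beta> * exp (- s) / s)"
    have "(\<integral>s. (s / (1 + s / c)) powr \<beta> * exp (- s) / s \<partial>halfline) = (\<integral>s. ?f s \<partial>lborel)"
      by (subst integral_restrict_space) auto
    also have "\<dots> = \<bar>c\<bar> *\<^sub>R (\<integral>t. ?f (0 + c * t) \<partial>lborel)"
      by (rule lborel_integral_real_affine) (use c in simp)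
    also have "\<dots> = (\<integral>t. c powr \<beta> * (indicator {0<..} t *\<^sub>R kummer_w \<beta> c t) \<partial>lborel)"
      unfolding real_scaleR_def integral_mult_right_zero[symmetric]
    proof (rule Bochner_Integration.integral_cong[OF refl])
      fix t :: real
      have "c * t / (1 + t) = c * (t / (1 + t))" by simp
      then have "t > 0 \<Longrightarrow> (c * t / (1 + t)) powr \<beta> = c powr \<beta> * (t / (1 + t)) powr \<beta>"
        using c by (metis powr_mult)
      then show "\<bar>c\<bar> * (indicator {0<..} (0 + c * t) * (((0 + c * t) / (1 + (0 + c * t) / c)) powr \<beta> *
         exp (- (0 + c * t)) / (0 + c * t))) = c powr \<beta> * (indicator {0<..} t * kummer_w \<beta> c t)"
        using c by (auto simp: indicator_def kummer_w_def zero_less_mult_iff)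
    qed
    also have "\<dots> = c powr \<beta> * kummer_int \<beta> c"
      unfolding kummer_int_def by (subst integral_restrict_space) auto
    finally show ?thesis by simp
  qed
  have "((\<lambda>c. \<integral>s. (s / (1 + s / c)) powr \<beta> * exp (- s) / s \<partial>halfline) \<longlongrightarrow>
    (\<integral>s. s powr (\<beta> - 1) * exp (- 1 * s) \<partial>halfline)) at_top"
  proof (rule integral_dominated_convergence_at_top)
    show "integrable halfline (\<lambda>s. s powr (\<beta> - 1) * exp (- 1 * s))"
      by (rule integrable_gamma_halfline) (use assms in auto)
    show "\<forall>\<^sub>F c in at_top. AE s in halfline. norm ((s / (1 + s / c)) powr \<beta> * exp (- s) / s)
      \<le> s powr (\<beta> - 1) * exp (- 1 * s)"
      using eventually_gt_at_top[of 0]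
    proof eventually_elim
      case (elim c)
      show ?case
      proof (rule AE_I2)
        fix s assume "s \<in> space halfline"
        then have s: "s > 0" by simp
        have "s \<le> s * (1 + s / c)" using s elim by (simp add: algebra_simps)
        then have "s / (1 + s / c) \<le> s"
          using s elim by (subst pos_divide_le_eq) (auto intro!: add_pos_pos)
        then have "(s / (1 + s / c)) powr \<beta> \<le> s powr \<beta>"
          using s elim assms by (intro powr_mono2) (auto intro!: divide_nonneg_nonneg add_nonneg_nonneg)
        then have "(s / (1 + s / c)) powr \<beta> * exp (- s) / s \<le> s powr \<beta> * exp (- s) / s"
          using s by (intro divide_right_mono mult_right_mono) auto
        then show "norm ((s / (1 + s / c)) powr \<beta> * exp (- s) / s) \<le> s powr (\<beta> - 1) * exp (- 1 * s)"
          using s by (simp add: powr_diff)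
      qed
    qed
    show "AE s in halfline. ((\<lambda>c. (s / (1 + s / c)) powr \<beta> * exp (- s) / s) \<longlongrightarrow>
      s powr (\<beta> - 1) * exp (- 1 * s)) at_top"
    proof (rule AE_I2)
      fix s assume "s \<in> space halfline"
      then have s: "s > 0" by simp
      have "((\<lambda>c. s / (1 + s / c)) \<longlongrightarrow> s) at_top" using s by real_asymp
      then have "((\<lambda>c. (s / (1 + s / c)) powr \<beta> * exp (- s) / s) \<longlongrightarrow> s powr \<beta> * exp (- s) / s) at_top"
        using s by (intro tendsto_intros) auto
      then show "((\<lambda>c. (s / (1 + s / c)) powr \<beta> * exp (- s) / s) \<longlongrightarrow> s powr (\<beta> - 1) * exp (- 1 * s)) at_top"
        using s by (simp add: powr_diff)
    qed
  qed measurable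
  moreover have "(\<integral>s. s powr (\<beta> - 1) * exp (- 1 * s) \<partial>halfline) = Gamma \<beta>"
  proof -
    have "ennreal (Gamma \<beta>) = (\<integral>\<^sup>+s. ennreal (indicator {0..} s * s powr (\<beta> - 1) / exp s) \<partial>lborel)"
      by (rule Gamma_conv_nn_integral_real[OF assms])
    also have "\<dots> = (\<integral>\<^sup>+s. ennreal (s powr (\<beta> - 1) * exp (- 1 * s)) \<partial>halfline)"
      by (subst nn_integral_restrict_space, simp, rule nn_integral_cong_AE,
          use AE_lborel_singleton[of 0] in eventually_elim)
        (auto simp: indicator_def exp_minus field_simps)
    also have "\<dots> = ennreal (\<integral>s. s powr (\<beta> - 1) * exp (- 1 * s) \<partial>halfline)"
      by (rule nn_integral_eq_integral) (use integrable_gamma_halfline[of \<beta> 1] assms in auto)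
    finally show ?thesis
      using Gamma_real_pos[OF assms] by (subst (asm) ennreal_inj) (auto intro!: integral_nonneg_AE)
  qed
  ultimately have "((\<lambda>c. \<integral>s. (s / (1 + s / c)) powr \<beta> * exp (- s) / s \<partial>halfline) \<longlongrightarrow> Gamma \<beta>) at_top"
    by simp
  then show ?thesis
    by (rule Lim_transform_eventually)
      (use eq in \<open>auto intro!: eventually_mono[OF eventually_gt_at_top[of 0]]\<close>)
qed

section \<open>Connection formula and Wronskian\<close>

lemma eser_kummer_coeff_ode:
  fixes z :: "'a::{real_normed_field,banach}"
  assumes "\<beta> > 0"
  shows "((\<lambda>z. z * eser (diffs (kummer_coeff \<beta>)) z) has_field_derivative
    z * eser (diffs (kummer_coeff \<beta>)) z + of_real \<beta> * eser (kummer_coeff \<beta>) z) (at z)"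
proof -
  let ?m = "kummer_coeff \<beta>"
  note b = exp_bounded_kummer(1)[OF assms]
  have eq: "diffs (\<lambda>n. real n * ?m n) = (\<lambda>n. real n * ?m n + \<beta> * ?m n)"
  proof
    fix n
    have "diffs (\<lambda>n. real n * ?m n) n = (real (Suc n))\<^sup>2 * ?m (Suc n)"
      by (simp add: diffs_def power2_eq_square)
    then show "diffs (\<lambda>n. real n * ?m n) n = real n * ?m n + \<beta> * ?m n"
      unfolding kummer_coeff_Suc by (simp add: algebra_simps)
  qed
  show ?thesis
    using has_field_derivative_eser[OF exp_bounded_theta[OF b], of z]
    unfolding eq eser_add[OF exp_bounded_theta[OF b] exp_bounded_cmult[OF b]]
      eser_theta[OF b] eser_theta[OF b, abs_def] eser_cmult[OF b] .
qed

lemma eser_kummer_log_coeff_ode: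
  fixes z :: "'a::{real_normed_field,banach}"
  assumes "\<beta> > 0"
  shows "((\<lambda>z. z * eser (diffs (kummer_log_coeff \<beta>)) z) has_field_derivative
    z * eser (diffs (kummer_log_coeff \<beta>)) z + of_real \<beta> * eser (kummer_log_coeff \<beta>) z
      + eser (kummer_coeff \<beta>) z - 2 * eser (diffs (kummer_coeff \<beta>)) z) (at z)"
proof -
  let ?m = "kummer_coeff \<beta>" and ?q = "kummer_log_coeff \<beta>"
  note b = exp_bounded_kummer(1)[OF assms] and bq = exp_bounded_kummer(2)[OF assms]
  have eq: "diffs (\<lambda>n. real n * ?q n) = (\<lambda>n. (real n * ?q n + \<beta> * ?q n) + (?m n + (- 2) * diffs ?m n))"
  proof
    fix n
    have "diffs (\<lambda>n. real n * ?q n) n = (real (Suc n))\<^sup>2 * ?q (Suc n)"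
      by (simp add: diffs_def power2_eq_square)
    then show "diffs (\<lambda>n. real n * ?q n) n = (real n * ?q n + \<beta> * ?q n) + (?m n + (- 2) * diffs ?m n)"
      unfolding kummer_log_coeff_Suc[OF assms] diffs_def by (simp add: algebra_simps)
  qed
  have "eser (diffs (\<lambda>n. real n * ?q n)) z =
    z * eser (diffs ?q) z + of_real \<beta> * eser ?q z + eser ?m z - 2 * eser (diffs ?m) z"
    unfolding eq eser_add[OF exp_bounded_add[OF exp_bounded_theta[OF bq] exp_bounded_cmult[OF bq]]
        exp_bounded_add[OF b exp_bounded_cmult[OF exp_bounded_diffs[OF b]]]]
      eser_add[OF exp_bounded_theta[OF bq] exp_bounded_cmult[OF bq]]
      eser_add[OF b exp_bounded_cmult[OF exp_bounded_diffs[OF b]]]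
      eser_theta[OF bq] eser_cmult[OF bq] eser_cmult[OF exp_bounded_diffs[OF b]]
    by simp
  then show ?thesis
    using has_field_derivative_eser[OF exp_bounded_theta[OF bq], of z]
    unfolding eser_theta[OF bq, abs_def] by simp
qed

text \<open>This is z times the Wronskian of M and M ln z + Q. The logarithms cancel in it, so the
  expression is entire; multiplied by exp(-z) it has derivative zero and equals 1 at the origin.
  Being free of logarithms, the identity is available on the cut as well.\<close>

lemma kummer_wronskian:
  fixes z :: "'a::{real_normed_field,banach}"
  assumes "\<beta> > 0"
  shows "(eser (kummer_coeff \<beta>) z)\<^sup>2 + z * (eser (kummer_coeff \<beta>) z * eser (diffs (kummer_log_coeff \<beta>)) z
    - eser (diffs (kummer_coeff \<beta>)) z * eser (kummer_log_coeff \<beta>) z) = exp z"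
proof -
  define M where "M = (eser (kummer_coeff \<beta>) :: 'a \<Rightarrow> 'a)"
  define M1 where "M1 = (eser (diffs (kummer_coeff \<beta>)) :: 'a \<Rightarrow> 'a)"
  define Q where "Q = (eser (kummer_log_coeff \<beta>) :: 'a \<Rightarrow> 'a)"
  define Q1 where "Q1 = (eser (diffs (kummer_log_coeff \<beta>)) :: 'a \<Rightarrow> 'a)"
  have d: "(M has_field_derivative M1 z) (at z)" "(Q has_field_derivative Q1 z) (at z)"
    "((\<lambda>z. z * M1 z) has_field_derivative z * M1 z + of_real \<beta> * M z) (at z)"
    "((\<lambda>z. z * Q1 z) has_field_derivative z * Q1 z + of_real \<beta> * Q z + M z - 2 * M1 z) (at z)" for z
    unfolding M_def M1_def Q_def Q1_def
    using has_field_derivative_eser[OF exp_bounded_kummer(1)[OF assms]]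
      has_field_derivative_eser[OF exp_bounded_kummer(2)[OF assms]]
      eser_kummer_coeff_ode[OF assms] eser_kummer_log_coeff_ode[OF assms] by blast+
  define W where "W z = (M z * M z + (M z * (z * Q1 z) - (z * M1 z) * Q z)) * exp (- z)" for z
  have e: "((\<lambda>z. exp (- z)) has_field_derivative - exp (- z)) (at z)" for z :: 'a
    by (auto intro!: derivative_eq_intros)
  have "(W has_field_derivative 0) (at z within UNIV)" for z
    unfolding W_def
    by (rule DERIV_cong[OF DERIV_mult[OF DERIV_add[OF DERIV_mult[OF d(1) d(1)]
      DERIV_diff[OF DERIV_mult[OF d(1) d(4)] DERIV_mult[OF d(3) d(2)]]] e]])
      (simp add: algebra_simps)
  then obtain k where k: "\<And>z. W z = k"
    using has_field_derivative_zero_constant[of UNIV W] by auto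
  have "W 0 = 1"
    by (simp add: W_def M_def eser_0 kummer_coeff_def)
  then have "W z = 1" using k by metis
  then have "(M z * M z + (M z * (z * Q1 z) - (z * M1 z) * Q z)) = exp z"
    by (simp add: W_def exp_minus field_simps)
  then show ?thesis
    unfolding M_def[symmetric] M1_def[symmetric] Q_def[symmetric] Q1_def[symmetric]
    by (simp add: power2_eq_square algebra_simps)
qed

lemma eser_kummer_coeff_pos:
  assumes "\<beta> > 0" "x \<ge> (0::real)"
  shows "eser (kummer_coeff \<beta>) x > 0"
proof -
  have nn: "0 \<le> kummer_coeff \<beta> n * x ^ n" for n
    using kummer_coeff_bound(1)[of \<beta> "max 1 \<beta>" n] assms by simp
  have "(\<Sum>n<1. kummer_coeff \<beta> n * x ^ n) \<le> eser (kummer_coeff \<beta>) x"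
    unfolding eser_def of_real_eq_id id_def
    by (rule sum_le_suminf)
      (use nn exp_bounded_summable[OF exp_bounded_kummer(1)[OF assms(1)], of x] in auto)
  then show ?thesis by (simp add: kummer_coeff_def)
qed

section \<open>Connection of the integral with the Frobenius solutions\<close>

text \<open>The coefficient A in I = A M - (M ln c + Q), read off at c = 1, where the logarithm
  vanishes. Its closed form is - \<psi>(\<beta>) - 2 \<gamma> with Euler's constant \<gamma>; the
  form chosen here inherits differentiability in \<beta> directly from the integral and the
  series.\<close>

definition kummer_conn :: "real \<Rightarrow> real" where
  "kummer_conn \<beta> = (kummer_int \<beta> 1 + eser (kummer_log_coeff \<beta>) 1) / eser (kummer_coeff \<beta>) 1"

definition kummer_conn_deriv :: "real \<Rightarrow> real" where
  "kummer_conn_deriv \<beta> = (((\<integral>t. ln (t / (1 + t)) * kummer_w \<beta> 1 t \<partial>halfline) + eser (kummer_log_coeff_deriv \<beta>) 1)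
    - kummer_conn \<beta> * eser (kummer_coeff_deriv \<beta>) 1) / eser (kummer_coeff \<beta>) 1"

text \<open>The logarithm is a separate argument l, so that one formula covers the real logarithm,
  the principal branch, the rotated branch and the limit on the cut. Differentiation in z asks of a
  branch only that its derivative be 1/z; in \<beta> the argument l is constant.\<close>

definition kummer_sol :: "real \<Rightarrow> 'a \<Rightarrow> 'a \<Rightarrow> 'a::{real_normed_field,banach}" where
  "kummer_sol \<beta> l z = of_real (kummer_conn \<beta>) * eser (kummer_coeff \<beta>) z - eser (kummer_coeff \<beta>) z * l
    - eser (kummer_log_coeff \<beta>) z"

definition kummer_sol_dz :: "real \<Rightarrow> 'a \<Rightarrow> 'a \<Rightarrow> 'a::{real_normed_field,banach}" where
  "kummer_sol_dz \<beta> l z = of_real (kummer_conn \<beta>) * eser (diffs (kummer_coeff \<beta>)) z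
    - eser (diffs (kummer_coeff \<beta>)) z * l - eser (kummer_coeff \<beta>) z / z - eser (diffs (kummer_log_coeff \<beta>)) z"

definition kummer_sol_da :: "real \<Rightarrow> 'a \<Rightarrow> 'a \<Rightarrow> 'a::{real_normed_field,banach}" where
  "kummer_sol_da \<beta> l z = of_real (kummer_conn_deriv \<beta>) * eser (kummer_coeff \<beta>) z
    + of_real (kummer_conn \<beta>) * eser (kummer_coeff_deriv \<beta>) z - eser (kummer_coeff_deriv \<beta>) z * l
    - eser (kummer_log_coeff_deriv \<beta>) z"

definition kummer_sol_dadz :: "real \<Rightarrow> 'a \<Rightarrow> 'a \<Rightarrow> 'a::{real_normed_field,banach}" where
  "kummer_sol_dadz \<beta> l z = of_real (kummer_conn_deriv \<beta>) * eser (diffs (kummer_coeff \<beta>)) z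
    + of_real (kummer_conn \<beta>) * eser (diffs (kummer_coeff_deriv \<beta>)) z
    - eser (diffs (kummer_coeff_deriv \<beta>)) z * l - eser (kummer_coeff_deriv \<beta>) z / z
    - eser (diffs (kummer_log_coeff_deriv \<beta>)) z"

lemma has_field_derivative_kummer_sol:
  assumes "\<beta> > 0" "(lg has_field_derivative 1 / z) (at z)"
  shows "((\<lambda>z. kummer_sol \<beta> (lg z) z) has_field_derivative kummer_sol_dz \<beta> (lg z) z) (at z)"
  unfolding kummer_sol_def kummer_sol_dz_def
  by (rule DERIV_cong[OF DERIV_diff[OF DERIV_diff[OF DERIV_cmult DERIV_mult]]])
    (rule has_field_derivative_eser exp_bounded_kummer assms refl | simp add: algebra_simps)+

lemma has_field_derivative_kummer_sol_da:
  assumes "\<beta> > 0" "(lg has_field_derivative 1 / z) (at z)"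
  shows "((\<lambda>z. kummer_sol_da \<beta> (lg z) z) has_field_derivative kummer_sol_dadz \<beta> (lg z) z) (at z)"
  unfolding kummer_sol_da_def kummer_sol_dadz_def
  by (rule DERIV_cong[OF DERIV_diff[OF DERIV_diff[OF DERIV_add[OF DERIV_cmult DERIV_cmult] DERIV_mult]]])
    (rule has_field_derivative_eser exp_bounded_kummer assms refl | simp add: algebra_simps)+

lemma kummer_sol_ode:
  assumes "\<beta> > 0" "(lg has_field_derivative 1 / z) (at z)" "z \<noteq> 0"
  shows "((\<lambda>z. z * kummer_sol_dz \<beta> (lg z) z) has_field_derivative
    z * kummer_sol_dz \<beta> (lg z) z + of_real \<beta> * kummer_sol \<beta> (lg z) z) (at z)"
proof -
  let ?M = "eser (kummer_coeff \<beta>)" and ?M1 = "eser (diffs (kummer_coeff \<beta>))"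
  let ?Q = "eser (kummer_log_coeff \<beta>)" and ?Q1 = "eser (diffs (kummer_log_coeff \<beta>))"
  let ?A = "of_real (kummer_conn \<beta>)"
  have "((\<lambda>z. ?A * (z * ?M1 z) - (z * ?M1 z) * lg z - ?M z - z * ?Q1 z) has_field_derivative
    z * kummer_sol_dz \<beta> (lg z) z + of_real \<beta> * kummer_sol \<beta> (lg z) z) (at z)"
  proof (rule DERIV_cong[OF DERIV_diff[OF DERIV_diff[OF DERIV_diff[OF DERIV_cmult DERIV_mult]]]])
    show "?A * (z * ?M1 z + of_real \<beta> * ?M z) - ((z * ?M1 z + of_real \<beta> * ?M z) * lg z + 1 / z * (z * ?M1 z)) - ?M1 z
      - (z * ?Q1 z + of_real \<beta> * ?Q z + ?M z - 2 * ?M1 z) =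
      z * kummer_sol_dz \<beta> (lg z) z + of_real \<beta> * kummer_sol \<beta> (lg z) z"
      using assms(3) unfolding kummer_sol_dz_def kummer_sol_def by (simp add: field_simps)
  qed (rule has_field_derivative_eser exp_bounded_kummer assms eser_kummer_coeff_ode eser_kummer_log_coeff_ode)+
  then show ?thesis
    by (rule has_field_derivative_transform_within_open[where S="- {0}"])
      (use assms(3) in \<open>auto simp: kummer_sol_dz_def field_simps\<close>)
qed

lemma tendsto_eser:
  assumes "exp_bounded c" "(f \<longlongrightarrow> z) F"
  shows "((\<lambda>x. eser c (f x)) \<longlongrightarrow> eser c z) F"
  using isCont_tendsto_compose[OF DERIV_isCont[OF has_field_derivative_eser[OF assms(1)]] assms(2)] .

text \<open>I, M and N = M ln x + Q satisfy the same first-order system for (f, x f'), so by Abel's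
  identity each pairwise Wronskian is a constant times e^x. The one of M and N is nonzero, and
  Cramer's rule gives I = a M + b N; b is found at 0 and a at 1.\<close>

lemma
  assumes \<beta>: "\<beta> > 0" and c: "c > 0"
  shows kummer_int_eq_sol: "kummer_int \<beta> c = kummer_sol \<beta> (ln c) c"
    and kummer_int_deriv_eq_sol: "kummer_int_deriv \<beta> c = kummer_sol_dz \<beta> (ln c) c"
proof -
  define M where "M = (eser (kummer_coeff \<beta>) :: real \<Rightarrow> real)"
  define Q where "Q = (eser (kummer_log_coeff \<beta>) :: real \<Rightarrow> real)"
  define M1 where "M1 = (eser (diffs (kummer_coeff \<beta>)) :: real \<Rightarrow> real)"
  define Q1 where "Q1 = (eser (diffs (kummer_log_coeff \<beta>)) :: real \<Rightarrow> real)"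
  define N where "N x = M x * ln x + Q x" for x
  define xM1 where "xM1 x = x * M1 x" for x
  define xN1 where "xN1 x = xM1 x * ln x + M x + x * Q1 x" for x
  define xI1 where "xI1 x = x * kummer_int_deriv \<beta> x" for x
  let ?I = "kummer_int \<beta>"
  have dM: "(M has_real_derivative xM1 x / x) (at x)" if "x > 0" for x
    using that has_field_derivative_eser[OF exp_bounded_kummer(1)[OF \<beta>], of x]
    unfolding M_def xM1_def M1_def by simp
  have dxM: "(xM1 has_real_derivative xM1 x + \<beta> * M x) (at x)" for x
    using eser_kummer_coeff_ode[OF \<beta>, of x] unfolding M_def xM1_def[abs_def] M1_def by simp
  have dN: "(N has_real_derivative xN1 x / x) (at x)" if "x > 0" for x
  proof -
    have "(Q has_real_derivative Q1 x) (at x)"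
      using has_field_derivative_eser[OF exp_bounded_kummer(2)[OF \<beta>], of x]
      unfolding Q_def Q1_def .
    then show ?thesis unfolding N_def[abs_def]
      by (rule DERIV_cong[OF DERIV_add[OF DERIV_mult[OF dM[OF that] DERIV_ln[OF that]]]])
        (use that in \<open>simp add: xN1_def field_simps\<close>)
  qed
  have dxN: "(xN1 has_real_derivative xN1 x + \<beta> * N x) (at x)" if "x > 0" for x
  proof -
    have "((\<lambda>x. x * Q1 x) has_real_derivative x * Q1 x + \<beta> * Q x + M x - 2 * M1 x) (at x)"
      using eser_kummer_log_coeff_ode[OF \<beta>, of x] unfolding Q_def Q1_def M_def M1_def by simp
    then show ?thesis unfolding xN1_def[abs_def]
      by (rule DERIV_cong[OF DERIV_add[OF DERIV_add[OF DERIV_mult[OF dxM DERIV_ln[OF that]] dM[OF that]]]])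
        (use that in \<open>simp add: N_def xM1_def field_simps\<close>)
  qed
  have dI: "(?I has_real_derivative xI1 x / x) (at x)" if "x > 0" for x
    using has_derivative_kummer_int[OF \<beta> that] that by (simp add: xI1_def)
  have dxI: "(xI1 has_real_derivative xI1 x + \<beta> * ?I x) (at x)" if "x > 0" for x
    using kummer_int_ode[OF \<beta> that] unfolding xI1_def[abs_def] .
  have de: "((\<lambda>x. exp (- x)) has_real_derivative - exp (- x)) (at x)" for x :: real
    by (auto intro!: derivative_eq_intros)
  \<comment> \<open>Abel's identity. Here \<open>f1\<close> and \<open>g1\<close> stand for x f' and
    x g', which is why the first two premises divide by x.\<close>
  have const: "\<exists>k. \<forall>x>0. exp (- x) * (f x * g1 x - f1 x * g x) = k"
    if "\<And>x. x > 0 \<Longrightarrow> (f has_real_derivative f1 x / x) (at x)"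
      "\<And>x. x > 0 \<Longrightarrow> (g has_real_derivative g1 x / x) (at x)"
      "\<And>x. x > 0 \<Longrightarrow> (f1 has_real_derivative f1 x + \<beta> * f x) (at x)"
      "\<And>x. x > 0 \<Longrightarrow> (g1 has_real_derivative g1 x + \<beta> * g x) (at x)" for f f1 g g1
  proof -
    have "\<exists>k. \<forall>x\<in>{0<..}. exp (- x) * (f x * g1 x - f1 x * g x) = k"
    proof (rule has_field_derivative_zero_constant)
      fix x :: real assume "x \<in> {0<..}"
      then have x: "x > 0" by simp
      have "((\<lambda>x. exp (- x) * (f x * g1 x - f1 x * g x)) has_real_derivative 0) (at x)"
        by (rule DERIV_cong[OF DERIV_mult[OF de DERIV_diff[OF DERIV_mult[OF that(1)[OF x] that(4)[OF x]]
          DERIV_mult[OF that(3)[OF x] that(2)[OF x]]]]]) (simp add: algebra_simps)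
      then show "((\<lambda>x. exp (- x) * (f x * g1 x - f1 x * g x)) has_real_derivative 0) (at x within {0<..})"
        by (rule has_field_derivative_at_within)
    qed simp
    then show ?thesis by auto
  qed
  obtain a where a: "\<And>x. x > 0 \<Longrightarrow> exp (- x) * (?I x * xN1 x - xI1 x * N x) = a"
    using const[OF dI dN dxI dxN] by blast
  obtain b where b: "\<And>x. x > 0 \<Longrightarrow> exp (- x) * (M x * xI1 x - xM1 x * ?I x) = b"
    using const[OF dM dI dxM dxI] by blast
  have wr: "M x * xN1 x - xM1 x * N x = exp x" for x
    using kummer_wronskian[OF \<beta>, of x]
    unfolding N_def xN1_def xM1_def M_def Q_def M1_def Q1_def
    by (simp add: power2_eq_square algebra_simps)
  have I: "?I x = a * M x + b * N x" if "x > 0" for x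
  proof -
    have "a * M x + b * N x = exp (- x) * ?I x * (M x * xN1 x - xM1 x * N x)"
      unfolding a[OF that, symmetric] b[OF that, symmetric] by (simp add: algebra_simps)
    then show ?thesis unfolding wr by (simp add: exp_minus)
  qed
  have I1: "xI1 x = a * xM1 x + b * xN1 x" if "x > 0" for x
  proof -
    have "a * xM1 x + b * xN1 x = exp (- x) * xI1 x * (M x * xN1 x - xM1 x * N x)"
      unfolding a[OF that, symmetric] b[OF that, symmetric] by (simp add: algebra_simps)
    then show ?thesis unfolding wr by (simp add: exp_minus)
  qed
  \<comment> \<open>As x tends to 0, the terms x M', x Q' and M' x ln x vanish and M tends to 1, so
    b is the limit of x I'.\<close>
  have "b = - 1"
  proof -
    have x0: "((\<lambda>x::real. x) \<longlongrightarrow> 0) (at_right 0)" by simp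
    note te = tendsto_eser[OF _ x0]
    have M0: "(M \<longlongrightarrow> 1) (at_right 0)" "(M1 \<longlongrightarrow> M1 0) (at_right 0)" "(Q1 \<longlongrightarrow> Q1 0) (at_right 0)"
      using te[OF exp_bounded_kummer(1)[OF \<beta>]] te[OF exp_bounded_diffs[OF exp_bounded_kummer(1)[OF \<beta>]]]
        te[OF exp_bounded_diffs[OF exp_bounded_kummer(2)[OF \<beta>]]]
      unfolding M_def M1_def Q1_def by (simp_all add: eser_0 kummer_coeff_def)
    have xlx: "((\<lambda>x::real. x * ln x) \<longlongrightarrow> 0) (at_right 0)" by real_asymp
    have "((\<lambda>x. a * (x * M1 x) + b * (M1 x * (x * ln x) + M x + x * Q1 x)) \<longlongrightarrow>
      a * (0 * M1 0) + b * (M1 0 * 0 + 1 + 0 * Q1 0)) (at_right 0)"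
      by (intro tendsto_intros M0 xlx)
    then have "((\<lambda>x. a * (x * M1 x) + b * (M1 x * (x * ln x) + M x + x * Q1 x)) \<longlongrightarrow> b) (at_right 0)"
      by simp
    moreover have "\<forall>\<^sub>F x in at_right 0. a * (x * M1 x) + b * (M1 x * (x * ln x) + M x + x * Q1 x) = xI1 x"
      using eventually_at_right_less[of 0]
      by eventually_elim (simp add: I1 xM1_def xN1_def algebra_simps)
    ultimately have "(xI1 \<longlongrightarrow> b) (at_right 0)" by (rule Lim_transform_eventually)
    moreover have "(xI1 \<longlongrightarrow> - 1) (at_right 0)"
      using kummer_int_deriv_lim_0[OF \<beta>] unfolding xI1_def[abs_def] .
    ultimately show ?thesis using tendsto_unique[of "at_right (0::real)"] by simp
  qed
  moreover have "a = kummer_conn \<beta>"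
    using I[of 1] \<open>b = - 1\<close> eser_kummer_coeff_pos[OF \<beta>, of 1]
    unfolding kummer_conn_def N_def M_def Q_def by (simp add: field_simps)
  ultimately show "?I c = kummer_sol \<beta> (ln c) c" and "kummer_int_deriv \<beta> c = kummer_sol_dz \<beta> (ln c) c"
    using I[OF c] I1[OF c] c
    unfolding kummer_sol_def kummer_sol_dz_def N_def xN1_def xM1_def xI1_def M_def Q_def M1_def Q1_def
    by (simp_all add: field_simps)
qed

lemma has_derivative_kummer_conn:
  assumes "\<beta> > 0"
  shows "(kummer_conn has_real_derivative kummer_conn_deriv \<beta>) (at \<beta>)"
proof -
  have p: "eser (kummer_coeff \<beta>) (1::real) \<noteq> 0" using eser_kummer_coeff_pos[OF assms, of 1] by simp
  show ?thesis
    unfolding kummer_conn_def[abs_def]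
    by (rule DERIV_cong[OF DERIV_divide[OF DERIV_add[OF has_derivative_kummer_int_param
      has_derivative_eser_kummer_log_coeff] has_derivative_eser_kummer_coeff p]])
      (use assms p in \<open>simp_all add: kummer_conn_deriv_def kummer_conn_def divide_simps\<close>)
qed

lemma
  fixes l x :: real
  assumes "\<beta> > 0"
  shows has_derivative_kummer_sol_param:
      "((\<lambda>\<beta>. kummer_sol \<beta> l x) has_real_derivative kummer_sol_da \<beta> l x) (at \<beta>)"
    and has_derivative_kummer_sol_dz_param:
      "((\<lambda>\<beta>. kummer_sol_dz \<beta> l x) has_real_derivative kummer_sol_dadz \<beta> l x) (at \<beta>)"
proof -
  note d = has_derivative_kummer_conn[OF assms] has_derivative_eser_kummer_coeff[OF assms, of x]
    has_derivative_eser_kummer_log_coeff[OF assms, of x] has_derivative_eser_diffs_kummer_coeff[OF assms, of x]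
    has_derivative_eser_diffs_kummer_log_coeff[OF assms, of x]
  show "((\<lambda>\<beta>. kummer_sol \<beta> l x) has_real_derivative kummer_sol_da \<beta> l x) (at \<beta>)"
    unfolding kummer_sol_def kummer_sol_da_def of_real_eq_id id_def
    by (rule DERIV_cong[OF DERIV_diff[OF DERIV_diff[OF DERIV_mult[OF d(1,2)] DERIV_cmult_right[OF d(2)]] d(3)]])
      (simp add: algebra_simps)
  show "((\<lambda>\<beta>. kummer_sol_dz \<beta> l x) has_real_derivative kummer_sol_dadz \<beta> l x) (at \<beta>)"
    unfolding kummer_sol_dz_def kummer_sol_dadz_def of_real_eq_id id_def
    by (rule DERIV_cong[OF DERIV_diff[OF DERIV_diff[OF DERIV_diff[OF DERIV_mult[OF d(1,4)] DERIV_cmult_right[OF d(4)]]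
      DERIV_cdivide[OF d(2)]] d(5)]])
      (simp add: algebra_simps)
qed

section \<open>Boundary values on the cut\<close>

text \<open>The logarithm with its cut turned to the negative imaginary axis. It agrees with
  \<open>Ln\<close> on the right and the upper half-plane and is holomorphic across the negative
  axis, so a boundary value from above becomes an ordinary value and its existence a matter of
  continuity.\<close>

definition upper_Ln :: "complex \<Rightarrow> complex" where
  "upper_Ln z = Ln (- \<i> * z) + \<i> * of_real (pi / 2)"

lemma has_field_derivative_upper_Ln:
  assumes "Re z \<noteq> 0 \<or> 0 < Im z"
  shows "(upper_Ln has_field_derivative 1 / z) (at z)"
proof -
  have z: "z \<noteq> 0" using assms by auto
  have "- \<i> * z \<notin> \<real>\<^sub>\<le>\<^sub>0"
    using assms by (auto simp: complex_nonpos_Reals_iff)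
  then show ?thesis
    unfolding upper_Ln_def[abs_def]
    by (rule DERIV_cong[OF DERIV_add[OF DERIV_chain2[OF has_field_derivative_Ln
        DERIV_cmult[OF DERIV_ident]] DERIV_const]]) (use z in \<open>auto simp: field_simps\<close>)
qed

lemma upper_Ln_eq_Ln:
  assumes "0 < Re z \<or> 0 < Im z"
  shows "upper_Ln z = Ln z"
proof -
  have z: "z \<noteq> 0" using assms by auto
  have "exp (upper_Ln z) = z"
  proof -
    have "exp (upper_Ln z) = - \<i> * z * exp (\<i> * of_real (pi / 2))"
      unfolding upper_Ln_def exp_add using z by simp
    also have "exp (\<i> * of_real (pi / 2)) = \<i>" by (metis cis_conv_exp cis_pi_half)
    finally show ?thesis by (simp add: complex_eq_iff)
  qed
  moreover have "Im (Ln (- \<i> * z)) \<le> pi / 2"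
  proof (cases "0 < Im z")
    case True
    then have "\<bar>Im (Ln (- \<i> * z))\<bar> < pi / 2"
      using z by (subst Re_Ln_pos_lt) auto
    then show ?thesis by linarith
  next
    case False
    then have "Im (- \<i> * z) < 0" using assms by auto
    then have "Im (Ln (- \<i> * z)) < 0"
      using Im_Ln_pos_le[of "- \<i> * z"] z mpi_less_Im_Ln[of "- \<i> * z"] Im_Ln_le_pi[of "- \<i> * z"] by auto
    then show ?thesis using pi_gt_zero by linarith
  qed
  moreover have "- pi < Im (Ln (- \<i> * z))" using mpi_less_Im_Ln[of "- \<i> * z"] z by auto
  ultimately show ?thesis
    by (intro Ln_unique[symmetric]) (auto simp: upper_Ln_def)
qed

lemma upper_Ln_neg:
  assumes "y > 0"
  shows "upper_Ln (- of_real y) = of_real (ln y) + \<i> * of_real pi"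
proof -
  have "Ln (\<i> * of_real y) = of_real (ln y) + \<i> * of_real (pi / 2)"
  proof (rule Ln_unique)
    have "exp (\<i> * of_real (pi / 2)) = \<i>" by (metis cis_conv_exp cis_pi_half)
    then show "exp (of_real (ln y) + \<i> * of_real (pi / 2)) = \<i> * of_real y"
      using assms unfolding exp_add exp_of_real by simp
  qed auto
  then show ?thesis by (simp add: upper_Ln_def)
qed

text \<open>Above the cut the logarithm gains i\<pi>, and l is multiplied only by a series with real
  coefficients; hence the imaginary part is - \<pi> times that series, and the real part is the same
  expression at the real logarithm u.\<close>

lemma
  assumes "\<beta> > 0"
  shows kummer_sol_boundary:
      "kummer_sol \<beta> (of_real u + \<i> * of_real pi) (of_real x) =
        of_real (kummer_sol \<beta> u x) - \<i> * of_real (pi * eser (kummer_coeff \<beta>) x)"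
    and kummer_sol_dz_boundary:
      "kummer_sol_dz \<beta> (of_real u + \<i> * of_real pi) (of_real x) =
        of_real (kummer_sol_dz \<beta> u x) - \<i> * of_real (pi * eser (diffs (kummer_coeff \<beta>)) x)"
    and kummer_sol_da_boundary:
      "kummer_sol_da \<beta> (of_real u + \<i> * of_real pi) (of_real x) =
        of_real (kummer_sol_da \<beta> u x) - \<i> * of_real (pi * eser (kummer_coeff_deriv \<beta>) x)"
    and kummer_sol_dadz_boundary:
      "kummer_sol_dadz \<beta> (of_real u + \<i> * of_real pi) (of_real x) =
        of_real (kummer_sol_dadz \<beta> u x) - \<i> * of_real (pi * eser (diffs (kummer_coeff_deriv \<beta>)) x)"
  unfolding kummer_sol_def kummer_sol_dz_def kummer_sol_da_def kummer_sol_dadz_def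
  by (simp_all add: eser_of_real exp_bounded_kummer exp_bounded_diffs assms algebra_simps)

lemma kummer_sol_of_real:
  assumes "\<beta> > 0"
  shows "kummer_sol \<beta> (of_real u) (of_real x :: complex) = of_real (kummer_sol \<beta> u x)"
    "kummer_sol_dz \<beta> (of_real u) (of_real x :: complex) = of_real (kummer_sol_dz \<beta> u x)"
    "kummer_sol_da \<beta> (of_real u) (of_real x :: complex) = of_real (kummer_sol_da \<beta> u x)"
    "kummer_sol_dadz \<beta> (of_real u) (of_real x :: complex) = of_real (kummer_sol_dadz \<beta> u x)"
  unfolding kummer_sol_def kummer_sol_dz_def kummer_sol_da_def kummer_sol_dadz_def
  by (simp_all add: eser_of_real exp_bounded_kummer exp_bounded_diffs assms)

lemma kummer_sol_cnj:
  assumes "\<beta> > 0"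
  shows "kummer_sol \<beta> (cnj l) (cnj z) = cnj (kummer_sol \<beta> l z)"
  unfolding kummer_sol_def by (simp add: eser_cnj exp_bounded_kummer assms)

definition kummer_modulus_sq :: "real \<Rightarrow> real \<Rightarrow> real" where
  "kummer_modulus_sq \<beta> y = (kummer_sol \<beta> (ln y) (- y))\<^sup>2 + (pi * eser (kummer_coeff \<beta>) (- y))\<^sup>2"

text \<open>The connection constant multiplies M and drops out of a Wronskian with M, as does the
  logarithm; what remains is \<open>kummer_wronskian\<close> at -y.\<close>

lemma kummer_sol_wronskian_neg:
  fixes y :: real
  assumes "\<beta> > 0" "y > 0"
  shows "kummer_sol_dz \<beta> (ln y) (- y) * eser (kummer_coeff \<beta>) (- y)
    - eser (diffs (kummer_coeff \<beta>)) (- y) * kummer_sol \<beta> (ln y) (- y) = exp (- y) / y"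
proof -
  have y: "y \<noteq> 0" using assms(2) by simp
  have "y * (kummer_sol_dz \<beta> (ln y) (- y) * eser (kummer_coeff \<beta>) (- y)
    - eser (diffs (kummer_coeff \<beta>)) (- y) * kummer_sol \<beta> (ln y) (- y)) = exp (- y)"
    using kummer_wronskian[OF assms(1), of "- y"] y
    unfolding kummer_sol_def kummer_sol_dz_def by (simp add: field_simps power2_eq_square)
  then show ?thesis using y by (simp add: eq_divide_eq mult.commute)
qed

text \<open>The two squares cannot vanish together, because the functions in them have the nonzero
  Wronskian exp(-y) / y.\<close>

lemma kummer_modulus_sq_pos:
  assumes "\<beta> > 0" "y > 0"
  shows "kummer_modulus_sq \<beta> y > 0"
proof -
  have "kummer_sol \<beta> (ln y) (- y) \<noteq> 0 \<or> eser (kummer_coeff \<beta>) (- y) \<noteq> 0"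
    using kummer_sol_wronskian_neg[OF assms] assms(2) by auto
  then show ?thesis
    unfolding kummer_modulus_sq_def by (auto simp: sum_power2_gt_zero_iff)
qed

lemma kummer_modulus_sq_eq:
  assumes "\<beta> > 0" "y > 0"
  shows "kummer_modulus_sq \<beta> y = (cmod (kummer_sol \<beta> (upper_Ln (- of_real y)) (- of_real y)))\<^sup>2"
  using kummer_sol_boundary[OF assms(1), of "ln y" "- y"]
  by (simp add: upper_Ln_neg assms cmod_power2 kummer_modulus_sq_def)

lemma kummer_sol_boundary_nonzero:
  assumes "\<beta> > 0" "y > 0"
  shows "kummer_sol \<beta> (upper_Ln (- of_real y)) (- of_real y) \<noteq> 0"
  using kummer_modulus_sq_pos[OF assms] kummer_modulus_sq_eq[OF assms] by auto

lemma Im_kummer_log_deriv: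
  assumes "\<beta> > 0" "y > 0"
  shows "Im (kummer_sol_dz \<beta> (upper_Ln (- of_real y)) (- of_real y) /
      kummer_sol \<beta> (upper_Ln (- of_real y)) (- of_real y)) = pi * (exp (- y) / (y * kummer_modulus_sq \<beta> y))"
proof -
  have "Im (kummer_sol_dz \<beta> (upper_Ln (- of_real y)) (- of_real y) /
      kummer_sol \<beta> (upper_Ln (- of_real y)) (- of_real y)) =
    pi * (kummer_sol_dz \<beta> (ln y) (- y) * eser (kummer_coeff \<beta>) (- y)
      - eser (diffs (kummer_coeff \<beta>)) (- y) * kummer_sol \<beta> (ln y) (- y)) / kummer_modulus_sq \<beta> y"
    unfolding upper_Ln_neg[OF assms(2)]
    unfolding of_real_minus[symmetric] kummer_sol_boundary[OF assms(1)]
      kummer_sol_dz_boundary[OF assms(1)]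
    by (simp add: Im_divide kummer_modulus_sq_def algebra_simps)
  then show ?thesis
    unfolding kummer_sol_wronskian_neg[OF assms] by simp
qed

text \<open>As derivatives in z and \<beta> commute, the quotient on the right is at once the
  \<beta>-derivative of w_z / w and the z-derivative of w_\<beta> / w. The first belongs to \<beta>
  times the spectral density, the second to the transform of the density of states; this coincidence
  is the origin of the \<alpha>-derivative in the theorem.\<close>

lemma has_derivative_kummer_density:
  assumes "\<beta> > 0" "y > 0"
  defines "z \<equiv> - complex_of_real y" and "l \<equiv> upper_Ln (- complex_of_real y)"
  shows "((\<lambda>\<beta>. exp (- y) / (y * kummer_modulus_sq \<beta> y)) has_real_derivative
    (1 / pi) * Im ((kummer_sol_dadz \<beta> l z * kummer_sol \<beta> l z - kummer_sol_da \<beta> l z * kummer_sol_dz \<beta> l z)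
      / (kummer_sol \<beta> l z)\<^sup>2)) (at \<beta>)"
proof -
  have l: "l = of_real (ln y) + \<i> * of_real pi" using upper_Ln_neg[OF assms(2)] by (simp add: l_def)
  have z: "z = of_real (- y)" by (simp add: z_def)
  \<comment> \<open>The parameter is real and the values are complex, so the derivative in \<beta>
    is a vector derivative, assembled from the real and imaginary parts that the boundary formulas
    separate.\<close>
  have vd: "((\<lambda>\<beta>. of_real (p \<beta>) - \<i> * of_real (pi * m \<beta>)) has_vector_derivative
      (of_real p' - \<i> * of_real (pi * m'))) (at \<beta>)"
    if "(p has_real_derivative p') (at \<beta>)" "(m has_real_derivative m') (at \<beta>)" for p m p' m'
    by (intro has_vector_derivative_diff has_vector_derivative_mult_right
      has_vector_derivative_of_real DERIV_cmult that)
  have d1: "((\<lambda>\<beta>. kummer_sol \<beta> l z) has_vector_derivative kummer_sol_da \<beta> l z) (at \<beta>)"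
  proof -
    have "((\<lambda>\<beta>. of_real (kummer_sol \<beta> (ln y) (- y)) - \<i> * of_real (pi * eser (kummer_coeff \<beta>) (- y)))
      has_vector_derivative kummer_sol_da \<beta> l z) (at \<beta>)"
      unfolding l z kummer_sol_da_boundary[OF assms(1)]
      by (intro vd has_derivative_kummer_sol_param has_derivative_eser_kummer_coeff assms(1))
    then show ?thesis
      by (rule has_vector_derivative_transform_within_open[where S="{0<..}"])
        (use assms(1) in \<open>simp_all add: l z kummer_sol_boundary del: of_real_minus of_real_mult\<close>)
  qed
  have d2: "((\<lambda>\<beta>. kummer_sol_dz \<beta> l z) has_vector_derivative kummer_sol_dadz \<beta> l z) (at \<beta>)"
  proof -
    have "((\<lambda>\<beta>. of_real (kummer_sol_dz \<beta> (ln y) (- y)) - \<i> * of_real (pi * eser (diffs (kummer_coeff \<beta>)) (- y)))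
      has_vector_derivative kummer_sol_dadz \<beta> l z) (at \<beta>)"
      unfolding l z kummer_sol_dadz_boundary[OF assms(1)]
      by (intro vd has_derivative_kummer_sol_dz_param has_derivative_eser_diffs_kummer_coeff assms(1))
    then show ?thesis
      by (rule has_vector_derivative_transform_within_open[where S="{0<..}"])
        (use assms(1) in \<open>simp_all add: l z kummer_sol_dz_boundary del: of_real_minus of_real_mult\<close>)
  qed
  have nz: "kummer_sol \<beta> l z \<noteq> 0"
    using kummer_sol_boundary_nonzero[OF assms(1,2)] by (simp add: l_def z_def)
  let ?D = "(kummer_sol_dadz \<beta> l z * kummer_sol \<beta> l z - kummer_sol_da \<beta> l z * kummer_sol_dz \<beta> l z)
      / (kummer_sol \<beta> l z)\<^sup>2"
  have "((\<lambda>\<beta>. kummer_sol_dz \<beta> l z / kummer_sol \<beta> l z) has_derivative (\<lambda>h. h *\<^sub>R ?D)) (at \<beta>)"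
    by (rule has_derivative_eq_rhs[OF has_derivative_divide[OF d2[unfolded has_vector_derivative_def]
        d1[unfolded has_vector_derivative_def] nz]])
      (use nz in \<open>auto simp: fun_eq_iff field_simps power2_eq_square scaleR_conv_of_real\<close>)
  then have "((\<lambda>\<beta>. Im (kummer_sol_dz \<beta> l z / kummer_sol \<beta> l z)) has_derivative (\<lambda>h. Im (h *\<^sub>R ?D))) (at \<beta>)"
    by (rule bounded_linear.has_derivative[OF bounded_linear_Im])
  then have "((\<lambda>\<beta>. Im (kummer_sol_dz \<beta> l z / kummer_sol \<beta> l z)) has_real_derivative Im ?D) (at \<beta>)"
    unfolding has_field_derivative_def by (rule has_derivative_eq_rhs) (auto simp: fun_eq_iff)
  then have "((\<lambda>\<beta>. pi * (exp (- y) / (y * kummer_modulus_sq \<beta> y))) has_real_derivative Im ?D) (at \<beta>)"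
    by (rule has_field_derivative_transform_within_open[where S="{0<..}"])
      (use assms(1,2) Im_kummer_log_deriv in \<open>auto simp: l_def z_def\<close>)
  from DERIV_cmult[OF this, of "1 / pi"] show ?thesis by simp
qed

section \<open>The Whittaker function as a multiple of the Kummer solution\<close>

text \<open>The classical formula W(z) = exp(-z/2) z^(1/2) U(1/2 - \<kappa>, 1, z) for \<mu> = 0:
  the choice \<kappa> = 1/2 - \<beta> makes the first argument \<beta>, and U = I /
  \<Gamma>(\<beta>).\<close>

definition whittaker_sol :: "real \<Rightarrow> complex \<Rightarrow> complex" where
  "whittaker_sol \<beta> z = exp (- z / 2) * exp (Ln z / 2) * kummer_sol \<beta> (Ln z) z / of_real (Gamma \<beta>)"

definition whittaker_sol_dz :: "real \<Rightarrow> complex \<Rightarrow> complex" where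
  "whittaker_sol_dz \<beta> z = exp (- z / 2) * exp (Ln z / 2) *
     (kummer_sol_dz \<beta> (Ln z) z + (- 1 / 2 + 1 / (2 * z)) * kummer_sol \<beta> (Ln z) z) / of_real (Gamma \<beta>)"

lemma DERIV_Ln_slit: "z \<in> - \<real>\<^sub>\<le>\<^sub>0 \<Longrightarrow> (Ln has_field_derivative 1 / z) (at z)"
  using has_field_derivative_Ln[of z] by (simp add: inverse_eq_divide)

lemma has_field_derivative_whittaker_factor:
  assumes "z \<in> - \<real>\<^sub>\<le>\<^sub>0"
  shows "((\<lambda>z. exp (- z / 2) * exp (Ln z / 2)) has_field_derivative
      exp (- z / 2) * exp (Ln z / 2) * (- 1 / 2 + 1 / (2 * z))) (at z)"
proof -
  have "z \<noteq> 0" using assms by auto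
  moreover have "((\<lambda>z. exp (- z / 2)) has_field_derivative exp (- z / 2) * (- 1 / 2)) (at z)"
    by (auto intro!: derivative_eq_intros)
  ultimately show ?thesis
    by (intro DERIV_cong[OF DERIV_mult[OF _ DERIV_chain2[OF DERIV_exp DERIV_cdivide[OF DERIV_Ln_slit[OF assms]]]]])
      (auto simp: field_simps)
qed

lemma has_field_derivative_whittaker_sol:
  assumes "\<beta> > 0" "z \<in> - \<real>\<^sub>\<le>\<^sub>0"
  shows "(whittaker_sol \<beta> has_field_derivative whittaker_sol_dz \<beta> z) (at z)"
proof -
  have z: "z \<noteq> 0" using assms(2) by auto
  note dL = DERIV_Ln_slit[OF assms(2)]
  show ?thesis
    unfolding whittaker_sol_def[abs_def]
    by (rule DERIV_cong[OF DERIV_cdivide[OF DERIV_mult[OF has_field_derivative_whittaker_factor[OF assms(2)]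
      has_field_derivative_kummer_sol[OF assms(1) dL]]]]) (simp add: whittaker_sol_dz_def algebra_simps)
qed

lemma has_field_derivative_whittaker_sol_dz:
  assumes "\<beta> > 0" "z \<in> - \<real>\<^sub>\<le>\<^sub>0"
  shows "(whittaker_sol_dz \<beta> has_field_derivative
    (1 / 4 - of_real (- \<beta> + 1 / 2) / z - (1 / 4) / z\<^sup>2) * whittaker_sol \<beta> z) (at z)"
proof -
  have z: "z \<noteq> 0" using assms(2) by auto
  note dL = DERIV_Ln_slit[OF assms(2)]
  note dk = has_field_derivative_kummer_sol[OF assms(1) dL]
  have dk1: "((\<lambda>z. kummer_sol_dz \<beta> (Ln z) z) has_field_derivative
      (1 - 1 / z) * kummer_sol_dz \<beta> (Ln z) z + of_real \<beta> * kummer_sol \<beta> (Ln z) z / z) (at z)"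
  proof -
    have "((\<lambda>z. (z * kummer_sol_dz \<beta> (Ln z) z) / z) has_field_derivative
      (1 - 1 / z) * kummer_sol_dz \<beta> (Ln z) z + of_real \<beta> * kummer_sol \<beta> (Ln z) z / z) (at z)"
      by (rule DERIV_cong[OF DERIV_divide[OF kummer_sol_ode[OF assms(1) dL z] DERIV_ident z]])
        (use z in \<open>simp add: field_simps\<close>)
    then show ?thesis
      by (rule has_field_derivative_transform_within_open[where S="- {0}"]) (use z in auto)
  qed
  note de = has_field_derivative_whittaker_factor[OF assms(2)]
  have dp: "((\<lambda>z. - 1 / 2 + 1 / (2 * z)) has_field_derivative - 1 / (2 * z\<^sup>2)) (at z)"
    using z by (auto intro!: derivative_eq_intros simp: power2_eq_square)
  \<comment> \<open>With w for 1/z the identity becomes polynomial; \<open>eqs\<close> performs the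
    renaming.\<close>
  have alg: "(E * ((1 - 1 / z) * k1 + b * k / z + (- 1 / 2 + 1 / (2 * z)) * k1 + - 1 / (2 * z\<^sup>2) * k)
      + E * (- 1 / 2 + 1 / (2 * z)) * (k1 + (- 1 / 2 + 1 / (2 * z)) * k)) / G =
      (1 / 4 - (- b + 1 / 2) / z - (1 / 4) / z\<^sup>2) * (E * k / G)" for E k1 k b G :: complex
  proof -
    have *: "E * ((1 - w) * k1 + b * k * w + (- 1 / 2 + w / 2) * k1 + - w\<^sup>2 / 2 * k)
        + E * (- 1 / 2 + w / 2) * (k1 + (- 1 / 2 + w / 2) * k) =
        (1 / 4 - (- b + 1 / 2) * w - (1 / 4) * w\<^sup>2) * (E * k)" for w
      by (simp add: field_simps power2_eq_square)
    have eqs: "1 / (2 * z) = (1 / z) / 2" "b * k / z = b * k * (1 / z)" "- 1 / (2 * z\<^sup>2) = - (1 / z)\<^sup>2 / 2"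
      "(- b + 1 / 2) / z = (- b + 1 / 2) * (1 / z)" "1 / 4 / z\<^sup>2 = 1 / 4 * (1 / z)\<^sup>2"
      by (simp_all add: power_divide)
    show ?thesis unfolding eqs *[of "1 / z"] by simp
  qed
  show ?thesis
    unfolding whittaker_sol_dz_def[abs_def] whittaker_sol_def
    by (rule DERIV_cong[OF DERIV_cdivide[OF DERIV_mult[OF de DERIV_add[OF dk1 DERIV_mult[OF dp dk]]]]])
      (use alg[of "exp (- z / 2) * exp (Ln z / 2)" "kummer_sol_dz \<beta> (Ln z) z" "of_real \<beta>"
        "kummer_sol \<beta> (Ln z) z" "of_real (Gamma \<beta>)"] in \<open>simp add: algebra_simps\<close>)
qed

lemma whittaker_sol_of_real:
  assumes "\<beta> > 0" "t > 0"
  shows "whittaker_sol \<beta> (of_real t) = of_real (exp (- t / 2) * sqrt t * kummer_int \<beta> t / Gamma \<beta>)"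
proof -
  have "exp (Ln (complex_of_real t) / 2) = of_real (sqrt t)"
  proof -
    have "exp (ln t / 2) = sqrt t"
      using assms(2) by (simp add: powr_half_sqrt[symmetric] powr_def)
    moreover have "exp (Ln (complex_of_real t) / 2) = of_real (exp (ln t / 2))"
      using assms(2) by (simp add: Ln_of_real exp_of_real[symmetric])
    ultimately show ?thesis by simp
  qed
  moreover have "exp (- complex_of_real t / 2) = of_real (exp (- t / 2))"
    by (simp add: exp_of_real[symmetric])
  moreover have "kummer_sol \<beta> (Ln (of_real t)) (complex_of_real t) = of_real (kummer_int \<beta> t)"
    using assms by (simp add: Ln_of_real kummer_sol_of_real kummer_int_eq_sol)
  ultimately show ?thesis by (simp add: whittaker_sol_def)
qed

lemma whittaker_sol_asymp:
  assumes "\<beta> > 0"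
  shows "((\<lambda>t::real. whittaker_sol \<beta> (of_real t) /
    (exp (- of_real t / 2) * of_real t powr of_real (- \<beta> + 1 / 2))) \<longlongrightarrow> 1) at_top"
proof -
  note G = Gamma_real_pos[OF assms]
  have "((\<lambda>t. complex_of_real (t powr \<beta> * kummer_int \<beta> t / Gamma \<beta>)) \<longlongrightarrow> of_real (Gamma \<beta> / Gamma \<beta>)) at_top"
    by (intro tendsto_intros kummer_int_asymp assms) (use G in auto)
  moreover have "\<forall>\<^sub>F t in at_top. complex_of_real (t powr \<beta> * kummer_int \<beta> t / Gamma \<beta>) =
    whittaker_sol \<beta> (of_real t) / (exp (- of_real t / 2) * of_real t powr of_real (- \<beta> + 1 / 2))"
    using eventually_gt_at_top[of 0]
  proof eventually_elim
    case (elim t)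
    have p: "complex_of_real t powr of_real (- \<beta> + 1 / 2) = of_real (t powr (- \<beta> + 1 / 2))"
      using elim by (intro powr_of_real) auto
    have e: "exp (- complex_of_real t / 2) = of_real (exp (- t / 2))"
      by (simp add: exp_of_real[symmetric])
    have s: "sqrt t = t powr \<beta> * t powr (- \<beta> + 1 / 2)"
      using elim by (simp add: powr_add[symmetric] powr_half_sqrt)
    have "t powr (- \<beta> + 1 / 2) \<noteq> 0" using elim by simp
    then show ?case
      unfolding whittaker_sol_of_real[OF assms elim] p e s by simp
  qed
  ultimately show ?thesis
    using G by (auto intro: Lim_transform_eventually)
qed

lemma is_whittaker_W_whittaker_sol:
  assumes "\<beta> > 0"
  shows "is_whittaker_W (of_real (- \<beta> + 1 / 2)) 0 (whittaker_sol \<beta>)"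
  unfolding is_whittaker_W_def
proof (intro conjI ballI)
  show "whittaker_sol \<beta> holomorphic_on - \<real>\<^sub>\<le>\<^sub>0"
    using has_field_derivative_whittaker_sol[OF assms]
    by (subst holomorphic_on_open) (auto simp: open_Compl)
  fix z :: complex assume z: "z \<in> - \<real>\<^sub>\<le>\<^sub>0"
  have "(deriv (whittaker_sol \<beta>) has_field_derivative
    (1 / 4 - of_real (- \<beta> + 1 / 2) / z - (1 / 4) / z\<^sup>2) * whittaker_sol \<beta> z) (at z)"
    by (rule has_field_derivative_transform_within_open[OF has_field_derivative_whittaker_sol_dz[OF assms z], where S="- \<real>\<^sub>\<le>\<^sub>0"])
      (use z DERIV_imp_deriv[OF has_field_derivative_whittaker_sol[OF assms]] in \<open>auto simp: open_Compl\<close>)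
  then have "deriv (deriv (whittaker_sol \<beta>)) z =
    (1 / 4 - of_real (- \<beta> + 1 / 2) / z - (1 / 4) / z\<^sup>2) * whittaker_sol \<beta> z"
    by (rule DERIV_imp_deriv)
  then show "deriv (deriv (whittaker_sol \<beta>)) z +
    (- 1 / 4 + of_real (- \<beta> + 1 / 2) / z + (1 / 4 - 0\<^sup>2) / z\<^sup>2) * whittaker_sol \<beta> z = 0"
    by (simp add: algebra_simps)
qed (rule whittaker_sol_asymp[OF assms])

section \<open>Uniqueness of the Whittaker function\<close>

lemma connected_slit_plane: "connected (- \<real>\<^sub>\<le>\<^sub>0 :: complex set)"
proof -
  have "starlike (- \<real>\<^sub>\<le>\<^sub>0 :: complex set)"
    unfolding starlike_def
  proof (intro bexI[of _ 1] ballI)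
    fix z :: complex assume z: "z \<in> - \<real>\<^sub>\<le>\<^sub>0"
    show "closed_segment 1 z \<subseteq> - \<real>\<^sub>\<le>\<^sub>0"
    proof
      fix w assume "w \<in> closed_segment 1 z"
      then obtain u where u: "0 \<le> u" "u \<le> 1" "w = (1 - u) *\<^sub>R 1 + u *\<^sub>R z"
        by (auto simp: closed_segment_def)
      show "w \<in> - \<real>\<^sub>\<le>\<^sub>0"
      proof
        assume "w \<in> \<real>\<^sub>\<le>\<^sub>0"
        then have w: "(1 - u) + u * Re z \<le> 0" "u * Im z = 0"
          using u by (auto simp: complex_nonpos_Reals_iff)
        then have "u \<noteq> 0" by auto
        then have "Im z = 0" "Re z > 0" using w(2) z by (auto simp: complex_nonpos_Reals_iff)
        then have "(1 - u) + u * Re z > 0" using u(1,2) \<open>u \<noteq> 0\<close> by (simp add: add_nonneg_pos)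
        then show False using w(1) by linarith
      qed
    qed
  qed auto
  then show ?thesis by (rule starlike_imp_connected)
qed

text \<open>Transforms are computed at positive real arguments only. The identity theorem, with 1 as
  a limit point of the positive axis, carries the equations to the whole connected domain.\<close>

lemma holomorphic_eq_of_eq_on_pos_reals:
  assumes "f holomorphic_on S" "g holomorphic_on S" "open S" "connected S"
    and "\<And>t. t > 0 \<Longrightarrow> of_real t \<in> S" "\<And>t. t > 0 \<Longrightarrow> f (of_real t) = g (of_real t)" "z \<in> S"
  shows "f z = g z"
proof -
  have "f z - g z = 0"
  proof (rule analytic_continuation[where S=S and U="of_real ` {0<..}" and \<xi>=1 and f="\<lambda>z. f z - g z"])
    show "(1::complex) islimpt of_real ` {0<..}"
      unfolding islimpt_sequential
    proof (intro exI[of _ "\<lambda>n. complex_of_real (1 + 1 / (real n + 1))"] conjI allI)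
      show "complex_of_real (1 + 1 / (real n + 1)) \<in> of_real ` {0<..} - {1}" for n
        by (auto simp: complex_eq_iff intro!: imageI add_pos_pos simp del: of_real_add)
      have "(\<lambda>n. 1 + 1 / (real n + 1)) \<longlonglongrightarrow> 1" by real_asymp
      then have "(\<lambda>n. complex_of_real (1 + 1 / (real n + 1))) \<longlonglongrightarrow> of_real 1"
        by (rule tendsto_of_real)
      then show "(\<lambda>n. complex_of_real (1 + 1 / (real n + 1))) \<longlonglongrightarrow> 1" by simp
    qed
    show "(1::complex) \<in> S" using assms(5)[of 1] by simp
  qed (use assms in \<open>auto intro!: holomorphic_intros\<close>)
  then show ?thesis by simp
qed

text \<open>Two solutions have a constant Wronskian \<open>C\<close>, so the quotient \<open>w / W\<close> has derivative
  \<open>- C / W\<^sup>2\<close> on the half-line; since \<open>W\<close> is recessive and the quotient converges, \<open>C = 0\<close>.\<close>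

lemma is_whittaker_W_unique:
  assumes \<beta>: "\<beta> > 0" and w: "is_whittaker_W (of_real (- \<beta> + 1 / 2)) 0 w" and z: "z \<in> - \<real>\<^sub>\<le>\<^sub>0"
  shows "w z = whittaker_sol \<beta> z"
proof -
  let ?S = "- \<real>\<^sub>\<le>\<^sub>0 :: complex set"
  let ?W = "whittaker_sol \<beta>" and ?\<kappa> = "complex_of_real (- \<beta> + 1 / 2)"
  have S: "open ?S" by (simp add: open_Compl)
  have hol: "w holomorphic_on ?S" using w by (simp add: is_whittaker_W_def)
  have holW: "?W holomorphic_on ?S"
    using is_whittaker_W_whittaker_sol[OF \<beta>] by (simp add: is_whittaker_W_def)
  note dW = has_field_derivative_whittaker_sol[OF \<beta>] has_field_derivative_whittaker_sol_dz[OF \<beta>]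
  have dw: "(w has_field_derivative deriv w u) (at u)" if "u \<in> ?S" for u
    using hol S that by (rule holomorphic_derivI)
  have dw1: "(deriv w has_field_derivative (1 / 4 - ?\<kappa> / u - (1 / 4) / u\<^sup>2) * w u) (at u)" if "u \<in> ?S" for u
  proof -
    have "deriv (deriv w) u = (1 / 4 - ?\<kappa> / u - (1 / 4) / u\<^sup>2) * w u"
      using w that unfolding is_whittaker_W_def by (auto simp: algebra_simps eq_neg_iff_add_eq_0)
    then show ?thesis
      using holomorphic_derivI[OF holomorphic_deriv[OF hol S] S that] by simp
  qed
  have "\<exists>C. \<forall>u\<in>{u. 0 < Re u}. w u * whittaker_sol_dz \<beta> u - deriv w u * ?W u = C"
  proof (rule has_field_derivative_zero_constant)
    fix u :: complex assume "u \<in> {u. 0 < Re u}"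
    then have u: "u \<in> ?S" by (auto simp: complex_nonpos_Reals_iff)
    have "((\<lambda>u. w u * whittaker_sol_dz \<beta> u - deriv w u * ?W u) has_field_derivative 0) (at u)"
      by (rule DERIV_cong[OF DERIV_diff[OF DERIV_mult[OF dw dW(2)] DERIV_mult[OF dw1 dW(1)]]])
        (use u in \<open>auto simp: algebra_simps\<close>)
    then show "((\<lambda>u. w u * whittaker_sol_dz \<beta> u - deriv w u * ?W u) has_field_derivative 0)
      (at u within {u. 0 < Re u})"
      by (rule has_field_derivative_at_within)
  qed (rule convex_halfspace_Re_gt)
  then obtain C where C: "\<And>u. 0 < Re u \<Longrightarrow> w u * whittaker_sol_dz \<beta> u - deriv w u * ?W u = C"
    by blast
  define R where "R t = exp (- t / 2) * sqrt t * kummer_int \<beta> t / Gamma \<beta>" for t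
  have R: "R t > 0" "?W (of_real t) = of_real (R t)" if "t > 0" for t
    using whittaker_sol_of_real[OF \<beta> that] kummer_int_pos[OF \<beta> that] Gamma_real_pos[OF \<beta>] that
    by (auto simp: R_def)
  have slit: "complex_of_real t \<in> ?S" if "t > 0" for t using that by (auto simp: complex_nonpos_Reals_iff)
  define q where "q u = w u / ?W u" for u
  have dq: "(q has_field_derivative - C / (of_real (R t))\<^sup>2) (at (of_real t))" if t: "t > 0" for t
  proof -
    have "(q has_field_derivative (deriv w (of_real t) * ?W (of_real t) - w (of_real t) * whittaker_sol_dz \<beta> (of_real t)) /
      (?W (of_real t) * ?W (of_real t))) (at (of_real t))"
      unfolding q_def by (rule DERIV_divide[OF dw dW(1)]) (use slit[OF t] R[OF t] in auto)
    also have "deriv w (of_real t) * ?W (of_real t) - w (of_real t) * whittaker_sol_dz \<beta> (of_real t) = - C"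
      using C[of "of_real t"] t by (simp add: algebra_simps)
    finally show ?thesis using R(2)[OF t] by (simp add: power2_eq_square)
  qed
  let ?a = "\<lambda>t::real. exp (- of_real t / 2) * of_real t powr ?\<kappa>"
  have "((\<lambda>t. (w (of_real t) / ?a t) / (?W (of_real t) / ?a t)) \<longlongrightarrow> 1 / 1) at_top"
    using w whittaker_sol_asymp[OF \<beta>] unfolding is_whittaker_W_def by (intro tendsto_divide) auto
  then have "((\<lambda>t. (w (of_real t) / ?a t) / (?W (of_real t) / ?a t)) \<longlongrightarrow> 1) at_top" by simp
  then have q1: "((\<lambda>t::real. q (of_real t)) \<longlongrightarrow> 1) at_top"
  proof (rule Lim_transform_eventually)
    show "\<forall>\<^sub>F t in at_top. (w (of_real t) / ?a t) / (?W (of_real t) / ?a t) = q (of_real t)"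
      using eventually_gt_at_top[of 0] by eventually_elim (simp add: q_def)
  qed
  have R0: "(R \<longlongrightarrow> 0) at_top"
  proof -
    have "((\<lambda>t. (exp (- t / 2) * t powr (1 / 2 - \<beta>)) * (t powr \<beta> * kummer_int \<beta> t) / Gamma \<beta>) \<longlongrightarrow>
      0 * Gamma \<beta> / Gamma \<beta>) at_top"
    proof (intro tendsto_intros kummer_int_asymp \<beta>)
      show "((\<lambda>t. exp (- t / 2) * t powr (1 / 2 - \<beta>)) \<longlongrightarrow> 0) at_top" by real_asymp
    qed (use Gamma_real_pos[OF \<beta>] in simp)
    then have "((\<lambda>t. (exp (- t / 2) * t powr (1 / 2 - \<beta>)) * (t powr \<beta> * kummer_int \<beta> t) / Gamma \<beta>) \<longlongrightarrow> 0) at_top"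
      by simp
    then show ?thesis
    proof (rule Lim_transform_eventually)
      show "\<forall>\<^sub>F t in at_top. (exp (- t / 2) * t powr (1 / 2 - \<beta>)) * (t powr \<beta> * kummer_int \<beta> t) / Gamma \<beta> = R t"
        using eventually_gt_at_top[of 0]
      proof eventually_elim
        case (elim t)
        have "sqrt t = t powr (1 / 2 - \<beta>) * t powr \<beta>"
          using elim by (simp add: powr_add[symmetric] powr_half_sqrt)
        then show ?case by (simp add: R_def)
      qed
    qed
  qed
  have "C = 0"
  proof (rule ccontr)
    assume "C \<noteq> 0"
    then have C2: "(cmod C)\<^sup>2 > 0" by simp
    \<comment> \<open>Taking the real part against \<open>cnj C\<close> makes the derivative the
      positive number \<bar>C\<bar>^2 / R^2, so that the real mean value theorem applies.\<close>
    define g where "g t = - Re (cnj C * q (of_real t))" for t :: real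
    have dg: "(g has_real_derivative (cmod C)\<^sup>2 / (R t)\<^sup>2) (at t)" if t: "t > 0" for t
    proof -
      have "((\<lambda>u. - (cnj C * q u)) has_field_derivative - (cnj C * (- C / (of_real (R t))\<^sup>2))) (at (of_real t))"
        by (intro DERIV_minus DERIV_cmult dq t)
      then have "((\<lambda>t. - (cnj C * q (of_real t))) has_vector_derivative - (cnj C * (- C / (of_real (R t))\<^sup>2))) (at t)"
        by (rule has_vector_derivative_real_field)
      then have "((\<lambda>t. Re (- (cnj C * q (of_real t)))) has_real_derivative
        Re (- (cnj C * (- C / (of_real (R t))\<^sup>2)))) (at t)"
        unfolding has_real_derivative_iff_has_vector_derivative
        by (rule bounded_linear.has_vector_derivative[OF bounded_linear_Re])
      also have "- (cnj C * (- C / (of_real (R t))\<^sup>2)) = of_real ((cmod C)\<^sup>2 / (R t)\<^sup>2)"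
        using complex_norm_square[of C] by (simp add: mult.commute)
      finally show ?thesis by (simp only: g_def[abs_def] uminus_complex.sel(1) Re_complex_of_real)
    qed
    have gl: "(g \<longlongrightarrow> - Re (cnj C * 1)) at_top"
      unfolding g_def by (intro tendsto_intros q1)
    have "filterlim (\<lambda>t::real. t + 1) at_top at_top" by real_asymp
    from tendsto_diff[OF filterlim_compose[OF gl this] gl]
    have "((\<lambda>t. g (t + 1) - g t) \<longlongrightarrow> 0) at_top" by simp
    then have ev1: "\<forall>\<^sub>F t in at_top. g (t + 1) - g t < (cmod C)\<^sup>2"
      using C2 by (rule order_tendstoD(2))
    \<comment> \<open>Beyond T the unit increments of g are at least \<bar>C\<bar>^2, as R < 1
      there; yet they tend to 0 because q converges.\<close>
    obtain T where T: "\<And>t. t \<ge> T \<Longrightarrow> R t < 1"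
      using order_tendstoD(2)[OF R0, of 1] by (auto simp: eventually_at_top_linorder)
    have "\<forall>\<^sub>F t in at_top. (cmod C)\<^sup>2 \<le> g (t + 1) - g t"
      using eventually_gt_at_top[of 0] eventually_ge_at_top[of T]
    proof eventually_elim
      case (elim t)
      have "\<exists>s>t. s < t + 1 \<and> g (t + 1) - g t = (t + 1 - t) * ((cmod C)\<^sup>2 / (R s)\<^sup>2)"
        by (rule MVT2) (use elim dg in auto)
      then obtain s where s: "s > t" "g (t + 1) - g t = (cmod C)\<^sup>2 / (R s)\<^sup>2" by auto
      have "0 < R s" "R s < 1" using R(1)[of s] T[of s] elim s by auto
      then have "(R s)\<^sup>2 \<le> 1" "0 < (R s)\<^sup>2" by (auto simp: power_le_one)
      then have "(cmod C)\<^sup>2 * (R s)\<^sup>2 \<le> (cmod C)\<^sup>2 * 1" by (intro mult_left_mono) auto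
      then show ?case using s \<open>0 < (R s)\<^sup>2\<close> by (simp add: le_divide_eq)
    qed
    then have "\<forall>\<^sub>F t::real in at_top. False" using ev1 by eventually_elim linarith
    then show False by simp
  qed
  have eq: "w (of_real t) = ?W (of_real t)" if t: "t > 0" for t
  proof -
    have vd: "((\<lambda>t. q (of_real t)) has_vector_derivative 0) (at t within {0<..})" if "t \<in> {0<..}" for t
    proof -
      from that
      have "(q has_field_derivative 0) (at (of_real t))" using dq[of t] \<open>C = 0\<close> by simp
      then have "((\<lambda>t. q (of_real t)) has_vector_derivative 0) (at t)"
        by (rule has_vector_derivative_real_field)
      then show ?thesis by (rule has_vector_derivative_at_within)
    qed
    obtain k where "\<And>t. t \<in> {0<..} \<Longrightarrow> q (of_real t) = k"
      by (rule has_vector_derivative_zero_constant[of "{0<..}" "\<lambda>t. q (of_real t)"]) (use vd in auto)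
    then have k: "\<And>t. t > 0 \<Longrightarrow> q (of_real t) = k" by simp
    have "((\<lambda>t::real. q (of_real t)) \<longlongrightarrow> k) at_top"
      by (rule tendsto_eventually) (auto intro!: eventually_mono[OF eventually_gt_at_top[of 0]] simp: k)
    then have "k = 1" using q1 tendsto_unique by force
    then show ?thesis using k[OF t] R[OF t] by (simp add: q_def)
  qed
  show ?thesis
    by (rule holomorphic_eq_of_eq_on_pos_reals[OF hol holW S connected_slit_plane])
      (use slit eq z in auto)
qed

lemma whittaker_W_eq:
  assumes "\<beta> > 0" "z \<in> - \<real>\<^sub>\<le>\<^sub>0"
  shows "whittaker_W (of_real (- \<beta> + 1 / 2)) 0 z = whittaker_sol \<beta> z"
  unfolding whittaker_W_def
  by (rule is_whittaker_W_unique[OF assms(1) _ assms(2)])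
    (rule someI[of "is_whittaker_W (of_real (- \<beta> + 1 / 2)) 0", OF is_whittaker_W_whittaker_sol[OF assms(1)]])

lemma whittaker_sol_cnj:
  assumes "\<beta> > 0" "z \<in> - \<real>\<^sub>\<le>\<^sub>0"
  shows "whittaker_sol \<beta> (cnj z) = cnj (whittaker_sol \<beta> z)"
proof -
  have "Ln (cnj z) = cnj (Ln z)" using assms(2) by (simp add: cnj_Ln)
  then show ?thesis
    by (simp add: whittaker_sol_def kummer_sol_cnj[OF assms(1)] exp_cnj)
qed

text \<open>From above, the function extends continuously through \<open>upper_Ln\<close>; from
  below, reflection gives the complex conjugate, all coefficients being real. Both boundary values
  therefore have the same modulus, to whose square the factor exp(-z/2) z^(1/2) contributes exp(y)
  y.\<close>

lemma cmod_whittaker_W_cut: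
  assumes "\<beta> > 0" "y > 0" "\<sigma> = 1 \<or> \<sigma> = - 1"
  shows "(cmod (whittaker_W_cut \<sigma> (of_real (- \<beta> + 1 / 2)) 0 y))\<^sup>2 =
    exp y * y * kummer_modulus_sq \<beta> y / (Gamma \<beta>)\<^sup>2"
proof -
  define g where "g z = exp (- z / 2) * exp (upper_Ln z / 2) * kummer_sol \<beta> (upper_Ln z) z / of_real (Gamma \<beta>)" for z
  let ?L = "g (- of_real y)"
  have dl: "(upper_Ln has_field_derivative 1 / (- of_real y)) (at (- of_real y))"
    by (rule has_field_derivative_upper_Ln) (use assms(2) in auto)
  have c: "isCont g (- of_real y)"
    unfolding g_def using DERIV_isCont[OF dl] DERIV_isCont[OF has_field_derivative_kummer_sol[OF assms(1) dl]]
      Gamma_real_pos[OF assms(1)]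
    by (intro continuous_intros) auto
  have "((\<lambda>\<epsilon>. Complex (- y) \<epsilon>) \<longlongrightarrow> Complex (- y) 0) (at_right 0)"
    by (intro tendsto_intros)
  moreover have "Complex (- y) 0 = - of_real y" by (simp add: complex_eq_iff)
  ultimately have "((\<lambda>\<epsilon>. Complex (- y) \<epsilon>) \<longlongrightarrow> - of_real y) (at_right 0)" by simp
  from isCont_tendsto_compose[OF c this]
  have lim: "((\<lambda>\<epsilon>. g (Complex (- y) \<epsilon>)) \<longlongrightarrow> ?L) (at_right 0)" .
  have up: "\<forall>\<^sub>F \<epsilon> in at_right 0. g (Complex (- y) \<epsilon>) = whittaker_W (of_real (- \<beta> + 1 / 2)) 0 (Complex (- y) \<epsilon>)"
    using eventually_at_right_less[of 0]
    by eventually_elim (simp add: whittaker_W_eq[OF assms(1), simplified] complex_nonpos_Reals_iff g_def whittaker_sol_def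
        upper_Ln_eq_Ln)
  have down: "\<forall>\<^sub>F \<epsilon> in at_right 0. cnj (g (Complex (- y) \<epsilon>)) =
      whittaker_W (of_real (- \<beta> + 1 / 2)) 0 (Complex (- y) (- \<epsilon>))"
    using eventually_at_right_less[of 0]
  proof eventually_elim
    case (elim \<epsilon>)
    have "Complex (- y) (- \<epsilon>) = cnj (Complex (- y) \<epsilon>)" by (simp add: complex_eq_iff)
    moreover have "cnj (Complex (- y) \<epsilon>) \<in> - \<real>\<^sub>\<le>\<^sub>0" "Complex (- y) \<epsilon> \<in> - \<real>\<^sub>\<le>\<^sub>0"
      using elim by (simp_all add: complex_nonpos_Reals_iff)
    ultimately have "whittaker_W (of_real (- \<beta> + 1 / 2)) 0 (Complex (- y) (- \<epsilon>)) =
      cnj (whittaker_sol \<beta> (Complex (- y) \<epsilon>))"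
      by (simp only: whittaker_W_eq[OF assms(1)] whittaker_sol_cnj[OF assms(1)])
    then show ?case using elim by (simp add: g_def whittaker_sol_def upper_Ln_eq_Ln)
  qed
  have "whittaker_W_cut \<sigma> (of_real (- \<beta> + 1 / 2)) 0 y = ?L \<or>
    whittaker_W_cut \<sigma> (of_real (- \<beta> + 1 / 2)) 0 y = cnj ?L"
    using assms(3)
  proof
    assume "\<sigma> = 1"
    then have "whittaker_W_cut \<sigma> (of_real (- \<beta> + 1 / 2)) 0 y = ?L"
      unfolding whittaker_W_cut_def
      by (intro tendsto_Lim) (use Lim_transform_eventually[OF lim up] in auto)
    then show ?thesis ..
  next
    assume "\<sigma> = - 1"
    then have "whittaker_W_cut \<sigma> (of_real (- \<beta> + 1 / 2)) 0 y = cnj ?L"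
      unfolding whittaker_W_cut_def
      by (intro tendsto_Lim) (use Lim_transform_eventually[OF tendsto_cnj[OF lim] down] in auto)
    then show ?thesis ..
  qed
  then have "cmod (whittaker_W_cut \<sigma> (of_real (- \<beta> + 1 / 2)) 0 y) = cmod ?L" by auto
  also have "\<dots> = exp (y / 2) * sqrt y * cmod (kummer_sol \<beta> (upper_Ln (- of_real y)) (- of_real y)) / Gamma \<beta>"
  proof -
    have "exp (ln y / 2) = sqrt y" using assms(2) by (simp add: powr_half_sqrt[symmetric] powr_def)
    then show ?thesis
      using Gamma_real_pos[OF assms(1)]
      by (simp add: g_def norm_mult norm_divide upper_Ln_neg[OF assms(2)])
  qed
  also have "\<dots>\<^sup>2 = exp y * y * kummer_modulus_sq \<beta> y / (Gamma \<beta>)\<^sup>2"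
    using assms(2) by (simp add: power_mult_distrib power_divide kummer_modulus_sq_eq[OF assms(1,2)]
      exp_double[symmetric])
  finally show ?thesis .
qed

lemma rho_as_sq_eq:
  assumes "\<beta> > 0" "y > 0" "\<sigma> = 1 \<or> \<sigma> = - 1"
  shows "\<beta> * rho_as_sq \<sigma> \<beta> y = exp (- y) / (y * kummer_modulus_sq \<beta> y)"
  using assms Gamma_real_pos[OF assms(1), THEN less_imp_neq] kummer_modulus_sq_pos[OF assms(1,2)] Gamma_plus1[of \<beta>]
  unfolding rho_as_sq_def cmod_whittaker_W_cut[OF assms]
  by (simp add: field_simps power2_eq_square exp_minus nonpos_Ints_def)

lemma Gamma_whittaker_W_cut_eq:
  assumes "\<beta> > 0" "y > 0" "\<sigma> = 1 \<or> \<sigma> = - 1"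
  shows "1 / (cmod (complex_of_real (Gamma \<beta>) * whittaker_W_cut \<sigma> (of_real (- \<beta> + 1 / 2)) 0 y))\<^sup>2 =
    exp (- y) / (y * kummer_modulus_sq \<beta> y)"
  using assms Gamma_real_pos[OF assms(1), THEN less_imp_neq]
  unfolding norm_mult power_mult_distrib cmod_whittaker_W_cut[OF assms]
  by (simp add: exp_minus field_simps)

section \<open>Behaviour at the origin\<close>

text \<open>Near 0, I behaves like - ln c, whereas its \<beta>-derivative stays bounded: the
  logarithm is multiplied by - M, and M(0) = 1 for every \<beta>, so differentiating in \<beta>
  leaves terms of order c ln c beside regular ones. These rates exclude atoms at the origin.\<close>

lemma
  assumes \<beta>: "\<beta> > 0"
  shows kummer_int_lim_0: "filterlim (kummer_int \<beta>) at_top (at_right 0)"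
    and kummer_sol_da_lim_0: "((\<lambda>c. kummer_sol_da \<beta> (ln c) c) \<longlongrightarrow> kummer_conn_deriv \<beta>) (at_right (0::real))"
    and kummer_sol_dadz_lim_0: "((\<lambda>c. c * kummer_sol_dadz \<beta> (ln c) c) \<longlongrightarrow> 0) (at_right (0::real))"
proof -
  have x0: "((\<lambda>x::real. x) \<longlongrightarrow> 0) (at_right 0)" by simp
  note te = tendsto_eser[OF _ x0]
  let ?m = "kummer_coeff \<beta>" and ?q = "kummer_log_coeff \<beta>"
  let ?md = "kummer_coeff_deriv \<beta>" and ?qd = "kummer_log_coeff_deriv \<beta>"
  note eb = exp_bounded_kummer[OF \<beta>] exp_bounded_kummer[OF \<beta>, THEN exp_bounded_diffs]
  have md0: "?md 0 = 0" "?qd 0 = 0" "?m 0 = 1" "?q 0 = 0"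
    by (simp_all add: kummer_coeff_deriv_def kummer_log_coeff_deriv_def kummer_psum_def kummer_coeff_def
      kummer_log_coeff_def harm_def)
  \<comment> \<open>The differentiated series has no constant term, and the factor x split off here
    tames the logarithm.\<close>
  have md: "eser ?md x = x * eser (\<lambda>n. ?md (Suc n)) x" for x :: real
  proof -
    have s: "summable (\<lambda>n. ?md n * x ^ n)" using exp_bounded_summable[OF eb(3), of x] by simp
    have s': "summable (\<lambda>n. ?md (Suc n) * x ^ n)"
      using summable_powser_split_head[of ?md x] s by simp
    show ?thesis
      using powser_split_head(1)[OF s] md0 unfolding eser_def by (simp add: mult.commute)
  qed
  have "exp_bounded (\<lambda>n. ?md (Suc n))"
  proof -
    obtain K C where KC: "0 \<le> K" "0 \<le> C" "\<And>n. \<bar>?md n\<bar> \<le> K * C ^ n / fact n"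
      using eb(3) unfolding exp_bounded_def by blast
    have "K * C ^ Suc n / fact (Suc n) \<le> K * C ^ Suc n / fact n" for n
      using KC(1,2) by (intro divide_left_mono fact_mono) auto
    then show ?thesis
      using KC by (intro exp_boundedI[of "K * C" C]) (force intro: order_trans[OF KC(3)] simp: mult_ac)+
  qed
  note te1 = te[OF this]
  have xlx: "((\<lambda>x::real. x * ln x) \<longlongrightarrow> 0) (at_right 0)" by real_asymp
  have mdln: "((\<lambda>x::real. eser ?md x * ln x) \<longlongrightarrow> 0) (at_right 0)"
    using tendsto_mult[OF te1 xlx] unfolding md by (simp add: mult_ac)
  have "((\<lambda>c. of_real (kummer_conn_deriv \<beta>) * eser ?m c + of_real (kummer_conn \<beta>) * eser ?md c - eser ?md c * ln c
    - eser ?qd c) \<longlongrightarrow> of_real (kummer_conn_deriv \<beta>) * eser ?m 0 + of_real (kummer_conn \<beta>) * eser ?md 0 - 0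
    - eser ?qd 0) (at_right (0::real))"
    by (intro tendsto_intros te mdln eb)
  then show "((\<lambda>c. kummer_sol_da \<beta> (ln c) c) \<longlongrightarrow> kummer_conn_deriv \<beta>) (at_right (0::real))"
    unfolding kummer_sol_da_def by (simp add: eser_0 md0)
  have "((\<lambda>c. of_real (kummer_conn_deriv \<beta>) * (c * eser (diffs ?m) c) + of_real (kummer_conn \<beta>) * (c * eser (diffs ?md) c)
    - eser (diffs ?md) c * (c * ln c) - eser ?md c - c * eser (diffs ?qd) c) \<longlongrightarrow>
    of_real (kummer_conn_deriv \<beta>) * (0 * eser (diffs ?m) 0) + of_real (kummer_conn \<beta>) * (0 * eser (diffs ?md) 0)
    - eser (diffs ?md) 0 * 0 - eser ?md 0 - 0 * eser (diffs ?qd) 0) (at_right (0::real))"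
    by (intro tendsto_intros te xlx eb x0)
  then have "((\<lambda>c. of_real (kummer_conn_deriv \<beta>) * (c * eser (diffs ?m) c) + of_real (kummer_conn \<beta>) * (c * eser (diffs ?md) c)
    - eser (diffs ?md) c * (c * ln c) - eser ?md c - c * eser (diffs ?qd) c) \<longlongrightarrow> 0) (at_right (0::real))"
    by (simp add: eser_0 md0)
  then show "((\<lambda>c. c * kummer_sol_dadz \<beta> (ln c) c) \<longlongrightarrow> 0) (at_right (0::real))"
  proof (rule Lim_transform_eventually)
    show "\<forall>\<^sub>F c in at_right (0::real). of_real (kummer_conn_deriv \<beta>) * (c * eser (diffs ?m) c) + of_real (kummer_conn \<beta>) * (c * eser (diffs ?md) c)
      - eser (diffs ?md) c * (c * ln c) - eser ?md c - c * eser (diffs ?qd) c = c * kummer_sol_dadz \<beta> (ln c) c"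
      using eventually_at_right_less[of "0::real"]
      by eventually_elim (simp add: kummer_sol_dadz_def algebra_simps)
  qed
  have "filterlim (\<lambda>c. eser ?m c * (- ln c)) at_top (at_right (0::real))"
  proof (rule filterlim_tendsto_pos_mult_at_top)
    show "(eser ?m \<longlongrightarrow> 1) (at_right (0::real))" using te[OF eb(1)] by (simp add: eser_0 md0)
    show "filterlim (\<lambda>c::real. - ln c) at_top (at_right 0)" by real_asymp
  qed simp
  moreover have "((\<lambda>c. kummer_conn \<beta> * eser ?m c - eser ?q c) \<longlongrightarrow> kummer_conn \<beta> * eser ?m 0 - eser ?q 0) (at_right (0::real))"
    by (intro tendsto_intros te eb)
  ultimately have "filterlim (\<lambda>c. kummer_conn \<beta> * eser ?m c - eser ?q c + eser ?m c * (- ln c)) at_top (at_right (0::real))"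
    by (rule filterlim_tendsto_add_at_top[rotated])
  then show "filterlim (kummer_int \<beta>) at_top (at_right 0)"
  proof (rule filterlim_mono_eventually)
    show "\<forall>\<^sub>F c in at_right 0. kummer_conn \<beta> * eser ?m c - eser ?q c + eser ?m c * (- ln c) = kummer_int \<beta> c"
      using eventually_at_right_less[of "0::real"]
      by eventually_elim (simp add: kummer_int_eq_sol[OF \<beta>] kummer_sol_def)
  qed auto
qed

section \<open>The limiting transforms\<close>

text \<open>A connected domain that contains both the positive axis, where the transforms are known,
  and the upper half-plane, from which the cut is approached; \<open>upper_Ln\<close> and
  \<open>Ln\<close> agree on it.\<close>

abbreviation upper_right :: "complex set" where
  "upper_right \<equiv> {z. 0 < Re z \<or> 0 < Im z}"

lemma upper_right_subset_slit: "upper_right \<subseteq> - \<real>\<^sub>\<le>\<^sub>0"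
  by (auto simp: complex_nonpos_Reals_iff)

lemma open_upper_right: "open upper_right"
  by (intro open_Collect_disj open_halfspace_Re_gt open_halfspace_Im_gt)

lemma connected_upper_right: "connected upper_right"
proof -
  have "Complex 1 1 \<in> {z. 0 < Re z} \<inter> {z. 0 < Im z}" by simp
  then have "connected ({z. 0 < Re z} \<union> {z. 0 < Im z})"
    by (intro connected_Un convex_connected convex_halfspace_Re_gt convex_halfspace_Im_gt) blast
  then show ?thesis by (simp add: Un_def)
qed

lemma holomorphic_stieltjes:
  assumes "real_distribution \<nu>"
  shows "(\<lambda>z. \<integral>x. 1 / (z + of_real (x\<^sup>2)) \<partial>\<nu>) holomorphic_on - \<real>\<^sub>\<le>\<^sub>0"
proof -
  interpret real_distribution \<nu> by fact
  have "\<exists>D. ((\<lambda>z. \<integral>x. 1 / (z + of_real (x\<^sup>2)) \<partial>\<nu>) has_field_derivative D) (at z0)"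
    if z0: "z0 \<in> - \<real>\<^sub>\<le>\<^sub>0" for z0 :: complex
  proof -
    have "open (- \<real>\<^sub>\<le>\<^sub>0 :: complex set)" by (simp add: open_Compl)
    from openE[OF this z0] obtain e where e: "e > 0" "ball z0 e \<subseteq> - \<real>\<^sub>\<le>\<^sub>0" by metis
    \<comment> \<open>The poles - x^2 lie outside the ball of radius e, so points within e/2 of the
      centre keep distance at least e/2 from all of them; this bounds integrand and derivative
      uniformly in x.\<close>
    define r where "r = e / 2"
    have r: "r > 0" using e by (simp add: r_def)
    have far: "r \<le> cmod (z + of_real (x\<^sup>2))" if "z \<in> ball z0 r" for z x
    proof -
      have "- complex_of_real (x\<^sup>2) \<notin> ball z0 e"
        using e(2) by (auto simp: complex_nonpos_Reals_iff)
      then have "e \<le> cmod (z0 + of_real (x\<^sup>2))" by (simp add: dist_norm)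
      moreover have "cmod (z0 + of_real (x\<^sup>2)) \<le> cmod (z0 - z) + cmod (z + of_real (x\<^sup>2))"
        using norm_triangle_ineq[of "z0 - z" "z + of_real (x\<^sup>2)"] by simp
      moreover have "cmod (z0 - z) < r" using that by (simp add: dist_norm)
      ultimately show ?thesis by (simp add: r_def)
    qed
    have nz: "z + of_real (x\<^sup>2) \<noteq> 0" if "z \<in> ball z0 r" for z x
      using far[OF that, of x] r by auto
    have "((\<lambda>z. \<integral>x. 1 / (z + of_real (x\<^sup>2)) \<partial>\<nu>) has_field_derivative
      (\<integral>x. - 1 / (z0 + of_real (x\<^sup>2))\<^sup>2 \<partial>\<nu>)) (at z0)"
    proof (rule has_field_derivative_lebesgue_integral[where r=r and g="\<lambda>_. 1 / r\<^sup>2" and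
          f'="\<lambda>z x. - 1 / (z + of_real (x\<^sup>2))\<^sup>2"])
      show "integrable \<nu> (\<lambda>x. 1 / (z0 + complex_of_real (x\<^sup>2)))"
      proof (rule integrable_const_bound[where B="1 / r"])
        show "AE x in \<nu>. cmod (1 / (z0 + complex_of_real (x\<^sup>2))) \<le> 1 / r"
          using far[of z0] r by (intro AE_I2) (simp add: norm_divide frac_le)
      qed measurable
      show "((\<lambda>z. 1 / (z + complex_of_real (x\<^sup>2))) has_field_derivative - 1 / (z + of_real (x\<^sup>2))\<^sup>2) (at z)"
        if "z \<in> ball z0 r" for z x
        using nz[OF that, of x] by (auto intro!: derivative_eq_intros simp: power2_eq_square)
      show "cmod (- 1 / (z + complex_of_real (x\<^sup>2))\<^sup>2) \<le> 1 / r\<^sup>2" if "z \<in> ball z0 r" for z x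
      proof -
        have "r\<^sup>2 \<le> (cmod (z + of_real (x\<^sup>2)))\<^sup>2" using far[OF that] r by (intro power_mono) auto
        then show ?thesis using r by (simp add: norm_divide norm_power frac_le)
      qed
    qed (use r in auto)
    then show ?thesis by blast
  qed
  then show ?thesis by (subst holomorphic_on_open) (auto simp: open_Compl)
qed

lemma stieltjes_of_real:
  assumes "real_distribution \<nu>" "c > 0"
  shows "(\<integral>x. 1 / (complex_of_real c + of_real (x\<^sup>2)) \<partial>\<nu>) = of_real ((\<integral>x. c / (c + x\<^sup>2) \<partial>\<nu>) / c)"
proof -
  have "(\<integral>x. 1 / (complex_of_real c + of_real (x\<^sup>2)) \<partial>\<nu>) = (\<integral>x. complex_of_real (1 / (c + x\<^sup>2)) \<partial>\<nu>)"
    by (intro Bochner_Integration.integral_cong) auto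
  also have "\<dots> = of_real (\<integral>x. 1 / (c + x\<^sup>2) \<partial>\<nu>)" by (rule integral_complex_of_real)
  also have "(\<lambda>x. 1 / (c + x\<^sup>2)) = (\<lambda>x. c / (c + x\<^sup>2) / c)"
    using assms(2) by (auto simp: fun_eq_iff)
  also have "(\<integral>x. c / (c + x\<^sup>2) / c \<partial>\<nu>) = (\<integral>x. c / (c + x\<^sup>2) \<partial>\<nu>) / c"
    by (rule integral_divide_zero)
  finally show ?thesis .
qed

lemma holomorphic_eser: "exp_bounded c \<Longrightarrow> eser c holomorphic_on S"
  using has_field_derivative_eser
  by (meson field_differentiable_at_within field_differentiable_def holomorphic_onI)

lemma holomorphic_kummer_upper:
  assumes "\<beta> > 0"
  defines "E \<equiv> {z. Re z \<noteq> 0 \<or> 0 < Im z}"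
  shows "(\<lambda>z. kummer_sol \<beta> (upper_Ln z) z) holomorphic_on E"
    "(\<lambda>z. kummer_sol_dz \<beta> (upper_Ln z) z) holomorphic_on E"
    "(\<lambda>z. kummer_sol_da \<beta> (upper_Ln z) z) holomorphic_on E"
    "(\<lambda>z. kummer_sol_dadz \<beta> (upper_Ln z) z) holomorphic_on E"
proof -
  have u: "upper_Ln holomorphic_on E"
    using has_field_derivative_upper_Ln unfolding E_def
    by (intro holomorphic_onI) (auto simp: field_differentiable_def intro: has_field_derivative_at_within)
  have nz: "z \<noteq> 0" if "z \<in> E" for z using that by (auto simp: E_def)
  show "(\<lambda>z. kummer_sol \<beta> (upper_Ln z) z) holomorphic_on E"
    "(\<lambda>z. kummer_sol_dz \<beta> (upper_Ln z) z) holomorphic_on E"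
    "(\<lambda>z. kummer_sol_da \<beta> (upper_Ln z) z) holomorphic_on E"
    "(\<lambda>z. kummer_sol_dadz \<beta> (upper_Ln z) z) holomorphic_on E"
    unfolding kummer_sol_def kummer_sol_dz_def kummer_sol_da_def kummer_sol_dadz_def
    by (intro holomorphic_intros holomorphic_eser exp_bounded_kummer exp_bounded_diffs assms u nz; assumption)+
qed

lemma kummer_upper_of_real:
  assumes "\<beta> > 0" "c > 0"
  shows "kummer_sol \<beta> (upper_Ln (of_real c)) (of_real c) = of_real (kummer_int \<beta> c)"
    "kummer_sol_dz \<beta> (upper_Ln (of_real c)) (of_real c) = of_real (kummer_int_deriv \<beta> c)"
    "kummer_sol_da \<beta> (upper_Ln (of_real c)) (of_real c) = of_real (kummer_sol_da \<beta> (ln c) c)"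
    "kummer_sol_dadz \<beta> (upper_Ln (of_real c)) (of_real c) = of_real (kummer_sol_dadz \<beta> (ln c) c)"
  using assms by (simp_all add: upper_Ln_eq_Ln Ln_of_real kummer_sol_of_real kummer_int_eq_sol
    kummer_int_deriv_eq_sol)

text \<open>Stated as a product, since division by w is legitimate only after its zeros have been
  excluded, and this very equation is what excludes them.\<close>

lemma stieltjes_kummer_eq:
  assumes \<beta>: "\<beta> > 0" and \<nu>: "real_distribution \<nu>"
    and S: "\<And>c. c > 0 \<Longrightarrow> (\<integral>x. c / (c + x\<^sup>2) \<partial>\<nu>) = kummer_int_shift \<beta> c / kummer_int \<beta> c"
    and z: "z \<in> upper_right"
  shows "of_real \<beta> * (\<integral>x. 1 / (z + of_real (x\<^sup>2)) \<partial>\<nu>) * kummer_sol \<beta> (upper_Ln z) z =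
    - kummer_sol_dz \<beta> (upper_Ln z) z"
proof (rule holomorphic_eq_of_eq_on_pos_reals[where S=upper_right and
      f="\<lambda>z. of_real \<beta> * (\<integral>x. 1 / (z + of_real (x\<^sup>2)) \<partial>\<nu>) * kummer_sol \<beta> (upper_Ln z) z" and
      g="\<lambda>z. - kummer_sol_dz \<beta> (upper_Ln z) z"])
  have sub: "upper_right \<subseteq> {z. Re z \<noteq> 0 \<or> 0 < Im z}" by auto
  note hol = holomorphic_kummer_upper[OF \<beta>, THEN holomorphic_on_subset, OF sub]
  show "(\<lambda>z. of_real \<beta> * (\<integral>x. 1 / (z + of_real (x\<^sup>2)) \<partial>\<nu>) * kummer_sol \<beta> (upper_Ln z) z) holomorphic_on upper_right"
    by (intro holomorphic_intros hol holomorphic_on_subset[OF holomorphic_stieltjes[OF \<nu>] upper_right_subset_slit])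
  show "(\<lambda>z. - kummer_sol_dz \<beta> (upper_Ln z) z) holomorphic_on upper_right"
    by (intro holomorphic_intros hol)
  fix c :: real assume c: "c > 0"
  have "\<beta> * (kummer_int_shift \<beta> c / kummer_int \<beta> c / c) * kummer_int \<beta> c = - kummer_int_deriv \<beta> c"
    using kummer_int_shift_eq[OF \<beta> c] kummer_int_pos[OF \<beta> c] c by (simp add: field_simps)
  then show "of_real \<beta> * (\<integral>x. 1 / (complex_of_real c + of_real (x\<^sup>2)) \<partial>\<nu>) *
      kummer_sol \<beta> (upper_Ln (of_real c)) (of_real c) = - kummer_sol_dz \<beta> (upper_Ln (of_real c)) (of_real c)"
    unfolding stieltjes_of_real[OF \<nu> c] S[OF c] kummer_upper_of_real[OF \<beta> c]
    by (simp only: of_real_mult[symmetric] of_real_minus[symmetric])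
qed (use z open_upper_right connected_upper_right in auto)

text \<open>\<open>\<open>w\<close>' = - \<beta> S w\<close> is a first-order linear equation with holomorphic coefficient, so a zero of
  \<open>w\<close> would make \<open>w\<close> vanish identically.\<close>

lemma kummer_sol_upper_nonzero:
  assumes \<beta>: "\<beta> > 0" and \<nu>: "real_distribution \<nu>"
    and S: "\<And>c. c > 0 \<Longrightarrow> (\<integral>x. c / (c + x\<^sup>2) \<partial>\<nu>) = kummer_int_shift \<beta> c / kummer_int \<beta> c"
    and z: "z \<in> upper_right"
  shows "kummer_sol \<beta> (upper_Ln z) z \<noteq> 0"
proof
  assume zero: "kummer_sol \<beta> (upper_Ln z) z = 0"
  define s where "s z = (\<integral>x. 1 / (z + of_real (x\<^sup>2)) \<partial>\<nu>)" for z :: complex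
  define w where "w z = kummer_sol \<beta> (upper_Ln z) z" for z
  have sub: "upper_right \<subseteq> {z. Re z \<noteq> 0 \<or> 0 < Im z}" by auto
  have hs: "s holomorphic_on upper_right"
    unfolding s_def by (rule holomorphic_on_subset[OF holomorphic_stieltjes[OF \<nu>] upper_right_subset_slit])
  have hw: "w holomorphic_on upper_right"
    unfolding w_def by (rule holomorphic_on_subset[OF holomorphic_kummer_upper(1)[OF \<beta>] sub])
  from openE[OF open_upper_right z] obtain e where e: "e > 0" "ball z e \<subseteq> upper_right"
    by metis
  obtain P where P: "\<And>u. u \<in> ball z e \<Longrightarrow> (P has_field_derivative s u) (at u within ball z e)"
    using holomorphic_convex_primitive'[OF convex_ball open_ball holomorphic_on_subset[OF hs e(2)]] by blast
  \<comment> \<open>With P a primitive of s on the disc, exp(\<beta> P) is an integrating factor, so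
    its product with w is constant there.\<close>
  have "\<exists>k. \<forall>u\<in>ball z e. w u * exp (of_real \<beta> * P u) = k"
  proof (rule has_field_derivative_zero_constant)
    fix u assume u: "u \<in> ball z e"
    then have ur: "u \<in> upper_right" using e by auto
    have dw: "(w has_field_derivative - of_real \<beta> * s u * w u) (at u)"
    proof -
      have "(upper_Ln has_field_derivative 1 / u) (at u)"
        by (rule has_field_derivative_upper_Ln) (use ur in auto)
      from has_field_derivative_kummer_sol[OF \<beta> this]
      have "(w has_field_derivative kummer_sol_dz \<beta> (upper_Ln u) u) (at u)" unfolding w_def .
      moreover have "kummer_sol_dz \<beta> (upper_Ln u) u = - of_real \<beta> * s u * w u"
        using stieltjes_kummer_eq[OF \<beta> \<nu> S ur] unfolding s_def w_def by simp
      ultimately show ?thesis by simp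
    qed
    have dP: "(P has_field_derivative s u) (at u)"
      using P[OF u] unfolding at_within_open[OF u open_ball] .
    have "((\<lambda>u. w u * exp (of_real \<beta> * P u)) has_field_derivative 0) (at u)"
      by (rule DERIV_cong[OF DERIV_mult[OF dw DERIV_chain2[OF DERIV_exp DERIV_cmult[OF dP]]]]) simp
    then show "((\<lambda>u. w u * exp (of_real \<beta> * P u)) has_field_derivative 0) (at u within ball z e)"
      by (rule has_field_derivative_at_within)
  qed simp
  then have w0: "w u = 0" if "u \<in> ball z e" for u
    using that zero e(1) unfolding w_def by (metis centre_in_ball exp_not_eq_zero mult_eq_0_iff)
  have "z islimpt ball z e" using e(1) by (simp add: islimpt_ball)
  then have "w 1 = 0"
    by (rule analytic_continuation[OF hw open_upper_right connected_upper_right e(2) z]) (simp_all add: w0)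
  moreover have "w 1 = of_real (kummer_int \<beta> 1)"
    using kummer_upper_of_real(1)[OF \<beta>, of 1] by (simp add: w_def)
  ultimately show False using kummer_int_pos[OF \<beta>, of 1] by simp
qed

text \<open>In the quarter-plane including the cut, w has no zeros: inside by its first-order
  equation, on the cut by the Wronskian. Hence - w' / (\<beta> w) extends the transform
  continuously. At the origin the mean of c / (c + x^2) is - c I' / (\<beta> I), where - c I' tends
  to 1 and I to infinity, so there is no atom.\<close>

lemma spectral_limit_density:
  assumes \<beta>: "\<beta> > 0" and \<nu>: "real_distribution \<nu>" and neg: "measure \<nu> {..<0} = 0"
    and \<sigma>: "\<sigma> = 1 \<or> \<sigma> = - 1"
    and S: "\<And>c. c > 0 \<Longrightarrow> (\<integral>x. c / (c + x\<^sup>2) \<partial>\<nu>) = kummer_int_shift \<beta> c / kummer_int \<beta> c"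
  shows "has_density_on_pos \<nu> (rho_as \<sigma> \<beta>)"
proof -
  define R where "R z = - kummer_sol_dz \<beta> (upper_Ln z) z / (of_real \<beta> * kummer_sol \<beta> (upper_Ln z) z)" for z
  have "has_density_on_pos \<nu> (\<lambda>t. 2 * t * rho_as_sq \<sigma> \<beta> (t\<^sup>2))"
  proof (rule stieltjes_density(1)[OF \<nu> neg, where R=R])
    fix z :: complex assume "Im z > 0"
    then have z: "z \<in> upper_right" by simp
    show "(\<integral>x. 1 / (z + of_real (x\<^sup>2)) \<partial>\<nu>) = R z"
      using stieltjes_kummer_eq[OF \<beta> \<nu> S z] kummer_sol_upper_nonzero[OF \<beta> \<nu> S z] \<beta>
      unfolding R_def by (subst eq_divide_eq) (simp add: mult_ac)
  next
    let ?B = "{z. 0 \<le> Im z \<and> Re z < 0}"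
    have sub: "?B \<subseteq> {z. Re z \<noteq> 0 \<or> 0 < Im z}" by auto
    note hol = holomorphic_kummer_upper[OF \<beta>, THEN holomorphic_on_subset, OF sub]
    have "kummer_sol \<beta> (upper_Ln z) z \<noteq> 0" if "z \<in> ?B" for z
    proof (cases "Im z > 0")
      case True
      then show ?thesis by (intro kummer_sol_upper_nonzero[OF \<beta> \<nu> S]) auto
    next
      case False
      then have "z = - of_real (- Re z)" "- Re z > 0" using that by (auto simp: complex_eq_iff)
      then show ?thesis using kummer_sol_boundary_nonzero[OF \<beta>, of "- Re z"] by metis
    qed
    then show "continuous_on ?B R"
      unfolding R_def using \<beta> by (intro continuous_intros holomorphic_on_imp_continuous_on hol) auto
  next
    have "((\<lambda>c. (- (c * kummer_int_deriv \<beta> c) / \<beta>) * inverse (kummer_int \<beta> c)) \<longlongrightarrow> (- (- 1) / \<beta>) * 0) (at_right 0)"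
      by (intro tendsto_intros kummer_int_deriv_lim_0 \<beta>
        filterlim_compose[OF tendsto_inverse_0_at_top[OF filterlim_ident] kummer_int_lim_0[OF \<beta>]]) (use \<beta> in auto)
    then have "((\<lambda>c. (- (c * kummer_int_deriv \<beta> c) / \<beta>) * inverse (kummer_int \<beta> c)) \<longlongrightarrow> 0) (at_right 0)"
      by simp
    then show "((\<lambda>c. \<integral>x. c / (c + x\<^sup>2) \<partial>\<nu>) \<longlongrightarrow> 0) (at_right 0)"
    proof (rule Lim_transform_eventually)
      show "\<forall>\<^sub>F c in at_right 0. (- (c * kummer_int_deriv \<beta> c) / \<beta>) * inverse (kummer_int \<beta> c) =
        (\<integral>x. c / (c + x\<^sup>2) \<partial>\<nu>)"
        using eventually_at_right_less[of 0]
      proof eventually_elim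
        case (elim c)
        have "kummer_int_shift \<beta> c = - (c * kummer_int_deriv \<beta> c) / \<beta>"
          using kummer_int_shift_eq[OF \<beta> elim] \<beta> by (simp add: field_simps)
        then show ?case unfolding S[OF elim] by (simp add: divide_inverse)
      qed
    qed
  next
    fix y :: real assume y: "y > 0"
    have "Im (R (- of_real y)) = - (1 / \<beta>) * Im (kummer_sol_dz \<beta> (upper_Ln (- of_real y)) (- of_real y) /
      kummer_sol \<beta> (upper_Ln (- of_real y)) (- of_real y))"
    proof -
      have "R (- of_real y) = of_real (- 1 / \<beta>) * (kummer_sol_dz \<beta> (upper_Ln (- of_real y)) (- of_real y) /
        kummer_sol \<beta> (upper_Ln (- of_real y)) (- of_real y))"
        unfolding R_def by simp
      then show ?thesis by (simp only: Im_complex_of_real Re_complex_of_real times_complex.simps)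
    qed
    then show "rho_as_sq \<sigma> \<beta> y = - (1 / pi) * Im (R (- of_real y))"
      unfolding Im_kummer_log_deriv[OF \<beta> y] rho_as_sq_eq[OF \<beta> y \<sigma>, symmetric] using \<beta> by simp
  qed
  then show ?thesis unfolding rho_as_def[abs_def] .
qed

text \<open>The logarithmic potential ln (c + x^2) is unbounded in x; normalised by its value at c =
  1 it is a bounded test function, to which weak convergence applies.\<close>

lemma abs_ln_ratio_le:
  fixes c x :: real
  assumes c: "c > 0"
  shows "\<bar>ln ((c + x\<^sup>2) / (1 + x\<^sup>2))\<bar> \<le> \<bar>ln c\<bar>"
proof -
  have pos: "0 < d + x\<^sup>2" if "d > 0" for d x :: real using that by (simp add: add_pos_nonneg)
  show ?thesis
  proof (cases "c \<ge> 1")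
    case True
    have "1 \<le> (c + x\<^sup>2) / (1 + x\<^sup>2)" "(c + x\<^sup>2) / (1 + x\<^sup>2) \<le> c"
      using True pos[of 1 x] mult_right_mono[of 1 c "x\<^sup>2"] by (auto simp: field_simps)
    then have "0 \<le> ln ((c + x\<^sup>2) / (1 + x\<^sup>2))" "ln ((c + x\<^sup>2) / (1 + x\<^sup>2)) \<le> ln c"
      using pos[of 1 x] pos[OF c, of x] c by (simp_all add: ln_le_cancel_iff)
    then show ?thesis by simp
  next
    case False
    have "(c + x\<^sup>2) / (1 + x\<^sup>2) \<le> 1" "c \<le> (c + x\<^sup>2) / (1 + x\<^sup>2)"
      using False pos[of 1 x] mult_right_mono[of c 1 "x\<^sup>2"] by (auto simp: field_simps)
    moreover have "0 < (c + x\<^sup>2) / (1 + x\<^sup>2)" using pos[of 1 x] pos[OF c, of x] by simp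
    ultimately have "ln ((c + x\<^sup>2) / (1 + x\<^sup>2)) \<le> 0" "ln c \<le> ln ((c + x\<^sup>2) / (1 + x\<^sup>2))"
      using c by (simp_all add: ln_le_cancel_iff)
    then show ?thesis by simp
  qed
qed

text \<open>Differentiating the potential in c gives the Stieltjes transform, here - d/dc of
  w_\<beta> / w, and removes the constant K. Zero-freeness is a hypothesis because it comes from the
  spectral limit, which is a different measure from \<nu>.\<close>

lemma dos_limit_density:
  fixes \<beta> K :: real and \<nu> :: "real measure"
  assumes \<beta>: "\<beta> > 0" and \<nu>: "real_distribution \<nu>" and neg: "measure \<nu> {..<0} = 0"
    and nz: "\<And>z. z \<in> upper_right \<Longrightarrow> kummer_sol \<beta> (upper_Ln z) z \<noteq> 0"
    and L: "\<And>c. c > 0 \<Longrightarrow> (\<integral>x. ln ((c + x\<^sup>2) / (1 + x\<^sup>2)) \<partial>\<nu>) =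
      K - kummer_sol_da \<beta> (ln c) c / kummer_int \<beta> c"
  defines "\<rho> \<equiv> \<lambda>y. (1 / pi) * Im ((kummer_sol_dadz \<beta> (upper_Ln (- complex_of_real y)) (- complex_of_real y) *
        kummer_sol \<beta> (upper_Ln (- complex_of_real y)) (- complex_of_real y) -
      kummer_sol_da \<beta> (upper_Ln (- complex_of_real y)) (- complex_of_real y) *
        kummer_sol_dz \<beta> (upper_Ln (- complex_of_real y)) (- complex_of_real y))
      / (kummer_sol \<beta> (upper_Ln (- complex_of_real y)) (- complex_of_real y))\<^sup>2)"
  shows "has_density_on_pos \<nu> (\<lambda>t. 2 * t * \<rho> (t\<^sup>2))"
    and "has_density_on_pos (distr \<nu> borel (\<lambda>t. t\<^sup>2)) \<rho>"
proof -
  interpret real_distribution \<nu> by fact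
  define R where "R z = - ((kummer_sol_dadz \<beta> (upper_Ln z) z * kummer_sol \<beta> (upper_Ln z) z
      - kummer_sol_da \<beta> (upper_Ln z) z * kummer_sol_dz \<beta> (upper_Ln z) z) / (kummer_sol \<beta> (upper_Ln z) z)\<^sup>2)" for z
  define T where "T c = - ((kummer_sol_dadz \<beta> (ln c) c * kummer_int \<beta> c
      - kummer_sol_da \<beta> (ln c) c * kummer_int_deriv \<beta> c) / (kummer_int \<beta> c)\<^sup>2)" for c
  have Sreal: "(\<integral>x. c / (c + x\<^sup>2) \<partial>\<nu>) = c * T c" if c: "c > 0" for c
  proof -
    have pos: "0 < d + x\<^sup>2" if "d > 0" for d x :: real using that by (simp add: add_pos_nonneg)
    have "((\<lambda>c. \<integral>x. ln ((c + x\<^sup>2) / (1 + x\<^sup>2)) \<partial>\<nu>) has_real_derivative (\<integral>x. 1 / (c + x\<^sup>2) \<partial>\<nu>)) (at c)"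
    proof (rule has_field_derivative_lebesgue_integral[where r="c / 2" and g="\<lambda>_. 2 / c" and f'="\<lambda>c x. 1 / (c + x\<^sup>2)"])
      show "integrable \<nu> (\<lambda>x. ln ((c + x\<^sup>2) / (1 + x\<^sup>2)))"
        by (rule integrable_const_bound[where B="\<bar>ln c\<bar>"]) (use abs_ln_ratio_le[OF c] in auto)
      have d: "d > c / 2" if "d \<in> ball c (c / 2)" for d
      proof -
        have "\<bar>c - d\<bar> < c / 2" using that by (simp add: dist_real_def)
        then show ?thesis by linarith
      qed
      show "((\<lambda>c. ln ((c + x\<^sup>2) / (1 + x\<^sup>2))) has_real_derivative 1 / (d + x\<^sup>2)) (at d)"
        if "d \<in> ball c (c / 2)" for d x
        using d[OF that] c pos[of d x] pos[of 1 x] by (auto intro!: derivative_eq_intros)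
      show "norm (1 / (d + x\<^sup>2)) \<le> 2 / c" if "d \<in> ball c (c / 2)" for d x
      proof -
        have "c / 2 \<le> d + x\<^sup>2" using d[OF that] zero_le_power2[of x] by linarith
        then have "1 / (d + x\<^sup>2) \<le> 1 / (c / 2)" using c by (intro frac_le) auto
        then show ?thesis using d[OF that] c pos[of d x] by simp
      qed
    qed (use c in auto)
    then have "((\<lambda>c. K - kummer_sol_da \<beta> (ln c) c / kummer_int \<beta> c) has_real_derivative (\<integral>x. 1 / (c + x\<^sup>2) \<partial>\<nu>)) (at c)"
      by (rule has_field_derivative_transform_within_open[where S="{0<..}"]) (use c L in auto)
    moreover have "((\<lambda>c. K - kummer_sol_da \<beta> (ln c) c / kummer_int \<beta> c) has_real_derivative T c) (at c)"
    proof -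
      have "(ln has_real_derivative 1 / c) (at c)" using c by (rule DERIV_ln_divide)
      from has_field_derivative_kummer_sol_da[OF \<beta> this]
      show ?thesis
        by (rule DERIV_cong[OF DERIV_diff[OF DERIV_const DERIV_divide[OF _ has_derivative_kummer_int[OF \<beta> c]]]])
          (use kummer_int_pos[OF \<beta> c] in \<open>auto simp: T_def power2_eq_square mult_ac\<close>)
    qed
    ultimately have "(\<integral>x. 1 / (c + x\<^sup>2) \<partial>\<nu>) = T c" by (rule DERIV_unique)
    moreover have "(\<integral>x. c / (c + x\<^sup>2) \<partial>\<nu>) = c * (\<integral>x. 1 / (c + x\<^sup>2) \<partial>\<nu>)"
      unfolding integral_mult_right_zero[symmetric] by simp
    ultimately show ?thesis by simp
  qed
  have sub1: "upper_right \<subseteq> {z. Re z \<noteq> 0 \<or> 0 < Im z}" by auto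
  note hol1 = holomorphic_kummer_upper[OF \<beta>, THEN holomorphic_on_subset, OF sub1]
  have S: "(\<integral>x. 1 / (z + of_real (x\<^sup>2)) \<partial>\<nu>) = R z" if "Im z > 0" for z
  proof (rule holomorphic_eq_of_eq_on_pos_reals[where S=upper_right and
        f="\<lambda>z. \<integral>x. 1 / (z + of_real (x\<^sup>2)) \<partial>\<nu>" and g=R])
    show "(\<lambda>z. \<integral>x. 1 / (z + of_real (x\<^sup>2)) \<partial>\<nu>) holomorphic_on upper_right"
      by (rule holomorphic_on_subset[OF holomorphic_stieltjes[OF \<nu>] upper_right_subset_slit])
    show "R holomorphic_on upper_right"
      unfolding R_def using nz by (intro holomorphic_intros hol1) auto
    fix c :: real assume c: "c > 0"
    have "R (of_real c) = of_real (T c)"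
      unfolding R_def T_def kummer_upper_of_real[OF \<beta> c] by simp
    then show "(\<integral>x. 1 / (complex_of_real c + of_real (x\<^sup>2)) \<partial>\<nu>) = R (of_real c)"
      unfolding stieltjes_of_real[OF \<nu> c] Sreal[OF c] using c by simp
  qed (use that open_upper_right connected_upper_right in auto)
  let ?B = "{z. 0 \<le> Im z \<and> Re z < 0}"
  have sub: "?B \<subseteq> {z. Re z \<noteq> 0 \<or> 0 < Im z}" by auto
  note hol = holomorphic_kummer_upper[OF \<beta>, THEN holomorphic_on_subset, OF sub]
  have nzB: "kummer_sol \<beta> (upper_Ln z) z \<noteq> 0" if "z \<in> ?B" for z
  proof (cases "Im z > 0")
    case True
    then show ?thesis by (intro nz) auto
  next
    case False
    then have "z = - of_real (- Re z)" "- Re z > 0" using that by (auto simp: complex_eq_iff)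
    then show ?thesis using kummer_sol_boundary_nonzero[OF \<beta>, of "- Re z"] by metis
  qed
  have cont: "continuous_on ?B R"
    unfolding R_def using nzB by (intro continuous_intros holomorphic_on_imp_continuous_on hol) auto
  \<comment> \<open>Every factor converges: 1 / I to 0, c I' to - 1, the \<beta>-derivative of I to
    a finite number and c times its mixed derivative to 0.\<close>
  have zero: "((\<lambda>c. \<integral>x. c / (c + x\<^sup>2) \<partial>\<nu>) \<longlongrightarrow> 0) (at_right 0)"
  proof -
    have inv: "((\<lambda>c. inverse (kummer_int \<beta> c)) \<longlongrightarrow> 0) (at_right 0)"
      by (rule filterlim_compose[OF tendsto_inverse_0_at_top[OF filterlim_ident] kummer_int_lim_0[OF \<beta>]])
    have "((\<lambda>c. - (c * kummer_sol_dadz \<beta> (ln c) c * inverse (kummer_int \<beta> c)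
        - kummer_sol_da \<beta> (ln c) c * (c * kummer_int_deriv \<beta> c) * (inverse (kummer_int \<beta> c))\<^sup>2)) \<longlongrightarrow>
        - (0 * 0 - kummer_conn_deriv \<beta> * (- 1) * 0\<^sup>2)) (at_right 0)"
      by (intro tendsto_intros inv kummer_sol_da_lim_0 kummer_sol_dadz_lim_0 kummer_int_deriv_lim_0 \<beta>)
    then have "((\<lambda>c. - (c * kummer_sol_dadz \<beta> (ln c) c * inverse (kummer_int \<beta> c)
        - kummer_sol_da \<beta> (ln c) c * (c * kummer_int_deriv \<beta> c) * (inverse (kummer_int \<beta> c))\<^sup>2)) \<longlongrightarrow> 0) (at_right 0)"
      by simp
    then show ?thesis
    proof (rule Lim_transform_eventually)
      show "\<forall>\<^sub>F c in at_right 0. - (c * kummer_sol_dadz \<beta> (ln c) c * inverse (kummer_int \<beta> c)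
        - kummer_sol_da \<beta> (ln c) c * (c * kummer_int_deriv \<beta> c) * (inverse (kummer_int \<beta> c))\<^sup>2) =
        (\<integral>x. c / (c + x\<^sup>2) \<partial>\<nu>)"
        using eventually_at_right_less[of 0]
      proof eventually_elim
        case (elim c)
        show ?case
          unfolding Sreal[OF elim] T_def using kummer_int_pos[OF \<beta> elim]
          by (simp add: field_simps power2_eq_square)
      qed
    qed
  qed
  have \<rho>: "\<rho> y = - (1 / pi) * Im (R (- of_real y))" for y
    unfolding \<rho>_def R_def by simp
  show "has_density_on_pos \<nu> (\<lambda>t. 2 * t * \<rho> (t\<^sup>2))"
    by (rule stieltjes_density(1)[OF \<nu> neg S cont zero \<rho>])
  show "has_density_on_pos (distr \<nu> borel (\<lambda>t. t\<^sup>2)) \<rho>"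
    by (rule stieltjes_density(2)[OF \<nu> neg S cont zero \<rho>])
qed

section \<open>The stationary law of the continued fraction\<close>

definition gamma_measure :: "real \<Rightarrow> real measure" where
  "gamma_measure \<alpha> = density lborel (\<lambda>t. ennreal (gamma_density \<alpha> t))"

definition kummer_measure :: "real \<Rightarrow> real \<Rightarrow> real measure" where
  "kummer_measure \<alpha> c = density lborel (\<lambda>t. ennreal (indicator {0<..} t * kummer_w \<alpha> c t / kummer_int \<alpha> c))"

lemma gamma_density_measurable[measurable]: "gamma_density \<alpha> \<in> borel_measurable borel"
  unfolding gamma_density_def[abs_def] by measurable

lemma sets_gamma_measure[simp, measurable_cong]: "sets (gamma_measure \<alpha>) = sets borel"
  and space_gamma_measure[simp]: "space (gamma_measure \<alpha>) = UNIV"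
  by (simp_all add: gamma_measure_def)

lemma sets_kummer_measure[simp, measurable_cong]: "sets (kummer_measure \<alpha> c) = sets borel"
  and space_kummer_measure[simp]: "space (kummer_measure \<alpha> c) = UNIV"
  by (simp_all add: kummer_measure_def)

lemma nn_integral_gamma_density:
  assumes "\<alpha> > 0"
  shows "(\<integral>\<^sup>+t. ennreal (gamma_density \<alpha> t) \<partial>lborel) = 1"
proof -
  have G: "Gamma \<alpha> > 0" by (rule Gamma_real_pos[OF assms])
  have "(\<integral>\<^sup>+t. ennreal (gamma_density \<alpha> t) \<partial>lborel) =
    (\<integral>\<^sup>+t. ennreal (1 / Gamma \<alpha>) * ennreal (indicator {0..} t * t powr (\<alpha> - 1) / exp t) \<partial>lborel)"
  proof (rule nn_integral_cong_AE)
    show "AE t in lborel. ennreal (gamma_density \<alpha> t) =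
      ennreal (1 / Gamma \<alpha>) * ennreal (indicator {0..} t * t powr (\<alpha> - 1) / exp t)"
      using AE_lborel_singleton[of 0]
      by eventually_elim
        (use G in \<open>auto simp: gamma_density_def indicator_def exp_minus field_simps ennreal_mult'[symmetric]\<close>)
  qed
  also have "\<dots> = ennreal (1 / Gamma \<alpha>) * ennreal (Gamma \<alpha>)"
    by (subst nn_integral_cmult) (simp_all add: Gamma_conv_nn_integral_real[OF assms])
  also have "\<dots> = 1" using G by (simp add: ennreal_mult'[symmetric])
  finally show ?thesis .
qed

lemma prob_space_gamma_measure: "\<alpha> > 0 \<Longrightarrow> prob_space (gamma_measure \<alpha>)"
  by (rule prob_spaceI) (simp add: gamma_measure_def emeasure_density nn_integral_gamma_density)

lemma nn_integral_kummer_measure: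
  assumes "\<alpha> > 0" "c > 0" and [measurable]: "f \<in> borel_measurable borel" and "\<And>t. t > 0 \<Longrightarrow> 0 \<le> f t"
    and "integrable halfline (\<lambda>t. f t * kummer_w \<alpha> c t)"
  shows "(\<integral>\<^sup>+t. ennreal (f t) \<partial>kummer_measure \<alpha> c) = ennreal ((\<integral>t. f t * kummer_w \<alpha> c t \<partial>halfline) / kummer_int \<alpha> c)"
proof -
  note I = kummer_int_pos[OF assms(1,2)]
  have "(\<integral>\<^sup>+t. ennreal (f t) \<partial>kummer_measure \<alpha> c) =
    (\<integral>\<^sup>+t. ennreal (indicator {0<..} t * kummer_w \<alpha> c t / kummer_int \<alpha> c) * ennreal (f t) \<partial>lborel)"
    unfolding kummer_measure_def by (rule nn_integral_density) measurable
  also have "\<dots> = (\<integral>\<^sup>+t. ennreal (f t * kummer_w \<alpha> c t / kummer_int \<alpha> c) * indicator {0<..} t \<partial>lborel)"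
  proof (rule nn_integral_cong)
    fix t :: real
    show "ennreal (indicator {0<..} t * kummer_w \<alpha> c t / kummer_int \<alpha> c) * ennreal (f t) =
      ennreal (f t * kummer_w \<alpha> c t / kummer_int \<alpha> c) * indicator {0<..} t"
    proof (cases "t > 0")
      case True
      then show ?thesis using assms(4)[OF True] by (simp add: ennreal_mult'[symmetric] mult.commute)
    qed simp
  qed
  also have "\<dots> = (\<integral>\<^sup>+t. ennreal (f t * kummer_w \<alpha> c t / kummer_int \<alpha> c) \<partial>halfline)"
    by (subst nn_integral_restrict_space) auto
  also have "\<dots> = ennreal (\<integral>t. f t * kummer_w \<alpha> c t / kummer_int \<alpha> c \<partial>halfline)"
  proof (intro nn_integral_eq_integral integrable_divide_zero AE_I2 assms(5))
    fix t assume "t \<in> space halfline"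
    then show "0 \<le> f t * kummer_w \<alpha> c t / kummer_int \<alpha> c"
      using assms(4)[of t] kummer_w_pos[of t \<alpha> c] I by simp
  qed
  finally show ?thesis by (simp add: integral_divide_zero)
qed

lemma prob_space_kummer_measure:
  assumes "\<alpha> > 0" "c > 0"
  shows "prob_space (kummer_measure \<alpha> c)"
proof (rule prob_spaceI)
  have "(\<integral>\<^sup>+t. ennreal 1 \<partial>kummer_measure \<alpha> c) = ennreal ((\<integral>t. 1 * kummer_w \<alpha> c t \<partial>halfline) / kummer_int \<alpha> c)"
    by (rule nn_integral_kummer_measure) (use assms integrable_kummer_w[OF assms] in auto)
  then show "emeasure (kummer_measure \<alpha> c) (space (kummer_measure \<alpha> c)) = 1"
    using kummer_int_pos[OF assms] by (simp add: kummer_int_def)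
qed

lemma AE_gamma_measure_pos: "AE u in gamma_measure \<alpha>. 0 < u"
  unfolding gamma_measure_def by (subst AE_density) (auto simp: gamma_density_def)

lemma AE_kummer_measure_pos: "AE t in kummer_measure \<alpha> c. 0 < t"
  unfolding kummer_measure_def by (subst AE_density) (auto simp: indicator_def)

lemma integral_kummer_measure:
  fixes f :: "real \<Rightarrow> real"
  assumes "\<alpha> > 0" "c > 0" and [measurable]: "f \<in> borel_measurable borel"
  shows "(\<integral>t. f t \<partial>kummer_measure \<alpha> c) = (\<integral>t. f t * kummer_w \<alpha> c t \<partial>halfline) / kummer_int \<alpha> c"
    and "integrable (kummer_measure \<alpha> c) f \<longleftrightarrow> integrable halfline (\<lambda>t. f t * kummer_w \<alpha> c t)"
proof -
  note I = kummer_int_pos[OF assms(1,2)]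
  have nn: "AE t in lborel. 0 \<le> indicator {0<..} t * kummer_w \<alpha> c t / kummer_int \<alpha> c"
  proof (rule AE_I2)
    fix t
    show "0 \<le> indicator {0<..} t * kummer_w \<alpha> c t / kummer_int \<alpha> c"
      using kummer_w_pos[of t \<alpha> c] I by (cases "t > 0") simp_all
  qed
  have "(\<integral>t. f t \<partial>kummer_measure \<alpha> c) =
    (\<integral>t. (indicator {0<..} t * kummer_w \<alpha> c t / kummer_int \<alpha> c) *\<^sub>R f t \<partial>lborel)"
    unfolding kummer_measure_def by (rule integral_density) (use nn in auto)
  also have "\<dots> = (\<integral>t. indicator {0<..} t *\<^sub>R (f t * kummer_w \<alpha> c t) / kummer_int \<alpha> c \<partial>lborel)"
    by (intro Bochner_Integration.integral_cong) (auto simp: indicator_def)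
  also have "\<dots> = (\<integral>t. indicator {0<..} t *\<^sub>R (f t * kummer_w \<alpha> c t) \<partial>lborel) / kummer_int \<alpha> c"
    by (rule integral_divide_zero)
  also have "(\<integral>t. indicator {0<..} t *\<^sub>R (f t * kummer_w \<alpha> c t) \<partial>lborel) = (\<integral>t. f t * kummer_w \<alpha> c t \<partial>halfline)"
    by (subst integral_restrict_space) auto
  finally show "(\<integral>t. f t \<partial>kummer_measure \<alpha> c) = (\<integral>t. f t * kummer_w \<alpha> c t \<partial>halfline) / kummer_int \<alpha> c" .
  have "integrable (kummer_measure \<alpha> c) f \<longleftrightarrow>
    integrable lborel (\<lambda>t. (indicator {0<..} t * kummer_w \<alpha> c t / kummer_int \<alpha> c) *\<^sub>R f t)"
    unfolding kummer_measure_def by (rule integrable_density) (use nn in auto)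
  also have "\<dots> \<longleftrightarrow> integrable lborel (\<lambda>t. inverse (kummer_int \<alpha> c) * (indicator {0<..} t *\<^sub>R (f t * kummer_w \<alpha> c t)))"
    by (intro Bochner_Integration.integrable_cong) (auto simp: indicator_def divide_inverse)
  also have "\<dots> \<longleftrightarrow> integrable lborel (\<lambda>t. indicator {0<..} t *\<^sub>R (f t * kummer_w \<alpha> c t))"
    by (subst integrable_mult_left_iff) (use I in auto)
  also have "\<dots> \<longleftrightarrow> integrable halfline (\<lambda>t. f t * kummer_w \<alpha> c t)"
    by (subst integrable_restrict_space) auto
  finally show "integrable (kummer_measure \<alpha> c) f \<longleftrightarrow> integrable halfline (\<lambda>t. f t * kummer_w \<alpha> c t)" .
qed

text \<open>By \<open>key\<close> each side is symmetric in s and t: the factor (1 + t)^(-\<alpha>)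
  of the weight cancels the power of 1 + t from the rescaled gamma density, and the exponents
  combine to - c (t + s + t s). The chain is reversible, which is how its stationary law is
  recognised.\<close>

lemma kummer_detailed_balance:
  assumes "\<alpha> > 0" "c > 0" "s > 0" "t > 0"
  shows "kummer_w \<alpha> c t * (c * (1 + t) * gamma_density \<alpha> (c * (1 + t) * s)) =
    kummer_w \<alpha> c s * (c * (1 + s) * gamma_density \<alpha> (c * (1 + s) * t))"
proof -
  have alg: "x / p / t * (c * b * (k * p * y / (c * b * s) / g)) * e = k / g * (x * y) / (t * s) * e"
    if "p \<noteq> 0" "b \<noteq> 0" "c \<noteq> 0" "s \<noteq> 0" "t \<noteq> 0" for x p t b k y s g e :: real
    using that by (simp add: mult_ac)
  have key: "kummer_w \<alpha> c t * (c * (1 + t) * gamma_density \<alpha> (c * (1 + t) * s)) =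
    c powr \<alpha> / Gamma \<alpha> * (t powr \<alpha> * s powr \<alpha>) / (t * s) * exp (- c * (t + s + t * s))"
    if "s > 0" "t > 0" for s t
  proof -
    have p: "c * (1 + t) * s > 0" using assms that by simp
    have "(c * (1 + t) * s) powr (\<alpha> - 1) = c powr \<alpha> * (1 + t) powr \<alpha> * s powr \<alpha> / (c * (1 + t) * s)"
      using assms that by (simp add: powr_diff powr_mult)
    moreover have "(t / (1 + t)) powr \<alpha> = t powr \<alpha> / (1 + t) powr \<alpha>"
      using that by (simp add: powr_divide)
    moreover have "exp (- c * t) * exp (- (c * (1 + t) * s)) = exp (- c * (t + s + t * s))"
      by (simp add: exp_add[symmetric] algebra_simps)
    ultimately have "kummer_w \<alpha> c t * (c * (1 + t) * gamma_density \<alpha> (c * (1 + t) * s)) =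
      t powr \<alpha> / (1 + t) powr \<alpha> / t * (c * (1 + t) * (c powr \<alpha> * (1 + t) powr \<alpha> * s powr \<alpha> / (c * (1 + t) * s)
        / Gamma \<alpha>)) * exp (- c * (t + s + t * s))"
      using p unfolding kummer_w_def gamma_density_def by (simp add: mult_ac)
    also have "\<dots> = c powr \<alpha> / Gamma \<alpha> * (t powr \<alpha> * s powr \<alpha>) / (t * s) * exp (- c * (t + s + t * s))"
    proof (rule alg)
      show "(1 + t) powr \<alpha> \<noteq> 0" "1 + t \<noteq> 0" using that by auto
    qed (use assms that in auto)
    finally show ?thesis .
  qed
  show ?thesis unfolding key[OF assms(3,4)] key[OF assms(4,3)] by (simp add: mult_ac add_ac)
qed

text \<open>Given t, the next state s = u / (c (1 + t)) has density c (1 + t) g(c (1 + t) s), with g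
  the gamma density. Detailed balance exchanges s and t under the double integral, after which the
  inner kernel integrates to 1.\<close>

lemma kummer_measure_stationary:
  assumes "\<alpha> > 0" "c > 0" and [measurable]: "F \<in> borel_measurable borel"
  shows "(\<integral>\<^sup>+t. (\<integral>\<^sup>+u. F (u / (c * (1 + t))) \<partial>gamma_measure \<alpha>) \<partial>kummer_measure \<alpha> c) =
    (\<integral>\<^sup>+t. F t \<partial>kummer_measure \<alpha> c)"
proof -
  let ?I = "kummer_int \<alpha> c"
  let ?p = "\<lambda>t. ennreal (indicator {0<..} t * kummer_w \<alpha> c t / ?I)"
  let ?g = "\<lambda>u. ennreal (gamma_density \<alpha> u)"
  note I = kummer_int_pos[OF assms(1,2)]
  have mass: "(\<integral>\<^sup>+t. ennreal b * ?g (b * t) \<partial>lborel) = 1" if b: "b > 0" for b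
    using nn_integral_real_affine[of ?g b 0] b
    by (simp add: nn_integral_gamma_density[OF assms(1)] nn_integral_cmult)
  have "(\<integral>\<^sup>+t. (\<integral>\<^sup>+u. F (u / (c * (1 + t))) \<partial>gamma_measure \<alpha>) \<partial>kummer_measure \<alpha> c) =
    (\<integral>\<^sup>+t. ?p t * (\<integral>\<^sup>+u. ?g u * F (u / (c * (1 + t))) \<partial>lborel) \<partial>lborel)"
    unfolding kummer_measure_def gamma_measure_def by (simp add: nn_integral_density)
  also have "\<dots> = (\<integral>\<^sup>+t. (\<integral>\<^sup>+s. ?p t * (ennreal (c * (1 + t)) * ?g (c * (1 + t) * s)) * F s \<partial>lborel) \<partial>lborel)"
  proof (rule nn_integral_cong)
    fix t :: real
    show "?p t * (\<integral>\<^sup>+u. ?g u * F (u / (c * (1 + t))) \<partial>lborel) =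
      (\<integral>\<^sup>+s. ?p t * (ennreal (c * (1 + t)) * ?g (c * (1 + t) * s)) * F s \<partial>lborel)"
    proof (cases "t > 0")
      case True
      then have b: "c * (1 + t) > 0" using assms(2) by simp
      have "(\<integral>\<^sup>+u. ?g u * F (u / (c * (1 + t))) \<partial>lborel) =
        \<bar>c * (1 + t)\<bar> * (\<integral>\<^sup>+s. ?g (0 + c * (1 + t) * s) * F ((0 + c * (1 + t) * s) / (c * (1 + t))) \<partial>lborel)"
        by (rule nn_integral_real_affine) (use b in auto)
      also have "\<dots> = (\<integral>\<^sup>+s. ennreal (c * (1 + t)) * (?g (c * (1 + t) * s) * F s) \<partial>lborel)"
      proof -
        have "c * (1 + t) \<noteq> 0" using b by (metis less_irrefl)
        then have "c * (1 + t) * s / (c * (1 + t)) = s" for s by (rule nonzero_mult_div_cancel_left)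
        then show ?thesis using b by (simp only: add_0 abs_of_pos) (simp add: nn_integral_cmult)
      qed
      finally show ?thesis
        by (simp add: nn_integral_cmult[symmetric] mult.assoc)
    qed simp
  qed
  also have "\<dots> = (\<integral>\<^sup>+s. (\<integral>\<^sup>+t. ?p t * (ennreal (c * (1 + t)) * ?g (c * (1 + t) * s)) * F s \<partial>lborel) \<partial>lborel)"
    by (rule lborel_pair.Fubini') measurable
  also have "\<dots> = (\<integral>\<^sup>+s. (\<integral>\<^sup>+t. ?p s * F s * (ennreal (c * (1 + s)) * ?g (c * (1 + s) * t)) \<partial>lborel) \<partial>lborel)"
  proof (rule nn_integral_cong_AE, use AE_lborel_singleton[of 0] in eventually_elim, rule nn_integral_cong_AE,
      use AE_lborel_singleton[of 0] in eventually_elim)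
    fix s t :: real assume st: "s \<noteq> 0" "t \<noteq> 0"
    consider "s > 0" "t > 0" | "s < 0" "t > 0" | "t < 0" using st by linarith
    then show "?p t * (ennreal (c * (1 + t)) * ?g (c * (1 + t) * s)) * F s =
      ?p s * F s * (ennreal (c * (1 + s)) * ?g (c * (1 + s) * t))"
    proof cases
      case 1
      have "?p t * (ennreal (c * (1 + t)) * ?g (c * (1 + t) * s)) =
        ennreal (kummer_w \<alpha> c t * (c * (1 + t) * gamma_density \<alpha> (c * (1 + t) * s)) / ?I)"
        using 1 assms I kummer_w_pos[of t \<alpha> c] Gamma_real_pos[OF assms(1)]
        by (simp add: ennreal_mult'[symmetric] gamma_density_def)
      moreover have "?p s * (ennreal (c * (1 + s)) * ?g (c * (1 + s) * t)) =
        ennreal (kummer_w \<alpha> c s * (c * (1 + s) * gamma_density \<alpha> (c * (1 + s) * t)) / ?I)"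
        using 1 assms I kummer_w_pos[of s \<alpha> c] Gamma_real_pos[OF assms(1)]
        by (simp add: ennreal_mult'[symmetric] gamma_density_def)
      ultimately show ?thesis
        using kummer_detailed_balance[OF assms(1,2) 1] by (metis mult.assoc mult.commute)
    next
      case 2
      then have "c * (1 + t) * s \<le> 0" using assms(2) by (simp add: mult_nonneg_nonpos)
      then show ?thesis using 2 by (simp add: gamma_density_def)
    next
      case 3
      then show ?thesis
      proof (cases "s > 0")
        case True
        then have "c * (1 + s) * t \<le> 0" using assms(2) 3 by (simp add: mult_nonneg_nonpos)
        then show ?thesis using 3 by (simp add: gamma_density_def)
      qed (use 3 in simp)
    qed
  qed
  also have "\<dots> = (\<integral>\<^sup>+s. ?p s * F s \<partial>lborel)"
  proof (rule nn_integral_cong)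
    fix s :: real
    show "(\<integral>\<^sup>+t. ?p s * F s * (ennreal (c * (1 + s)) * ?g (c * (1 + s) * t)) \<partial>lborel) = ?p s * F s"
    proof (cases "s > 0")
      case True
      then show ?thesis using mass[of "c * (1 + s)"] assms(2) by (subst nn_integral_cmult) auto
    qed simp
  qed
  also have "\<dots> = (\<integral>\<^sup>+t. F t \<partial>kummer_measure \<alpha> c)"
    unfolding kummer_measure_def by (simp add: nn_integral_density)
  finally show ?thesis .
qed

section \<open>Logarithmic contraction and convergence to the stationary law\<close>

text \<open>The chain in the variable d = 1 + t, a pivot divided by sqrt c. Values in
  \<open>ennreal\<close> allow iteration without integrability conditions.\<close>

definition markov_step :: "real \<Rightarrow> real \<Rightarrow> (real \<Rightarrow> ennreal) \<Rightarrow> real \<Rightarrow> ennreal" where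
  "markov_step \<alpha> c f d = (\<integral>\<^sup>+u. f (1 + u / (c * d)) \<partial>gamma_measure \<alpha>)"

lemma markov_step_measurable[measurable (raw)]:
  assumes "\<alpha> > 0" and [measurable]: "f \<in> borel_measurable borel"
  shows "markov_step \<alpha> c f \<in> borel_measurable borel"
proof -
  interpret prob_space "gamma_measure \<alpha>" by (rule prob_space_gamma_measure[OF assms(1)])
  show ?thesis unfolding markov_step_def[abs_def] by measurable
qed

text \<open>In the coordinate x = ln d the step is x \<mapsto> ln (1 + (u/c) exp(-x)), whose slope
  is at most u / (c + u) in modulus for x \<ge> 0. This factor is below 1 but not uniformly in u;
  its mean over u serves as contraction rate.\<close>

lemma ln_step_contraction:
  assumes "c > 0" "u > 0" "d \<ge> 1" "d' \<ge> (1::real)"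
  shows "\<bar>ln (1 + u / (c * d)) - ln (1 + u / (c * d'))\<bar> \<le> u / (c + u) * \<bar>ln d - ln d'\<bar>"
proof -
  let ?h = "\<lambda>x. ln (1 + u / c * exp (- x))"
  have pos: "0 < 1 + u / c * exp (- x)" for x using assms by (auto intro!: add_pos_pos)
  have "norm (?h (ln d) - ?h (ln d')) \<le> u / (c + u) * norm (ln d - ln d')"
  proof (rule field_differentiable_bound[where S="{0..}"])
    fix x :: real assume x: "x \<in> {0..}"
    show "(?h has_real_derivative - (u / c * exp (- x)) / (1 + u / c * exp (- x))) (at x within {0..})"
      using pos[of x] assms(1) by (auto intro!: derivative_eq_intros simp: mult_ac)
    have "exp (- x) \<le> 1" using x by simp
    then have e: "u / c * exp (- x) \<le> u / c" using assms mult_left_mono[of "exp (- x)" 1 "u / c"] by simp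
    have "u / c * exp (- x) / (1 + u / c * exp (- x)) = 1 - 1 / (1 + u / c * exp (- x))"
      using pos[of x] by (simp add: field_simps)
    also have "\<dots> \<le> 1 - 1 / (1 + u / c)"
      using e pos[of x] by (intro diff_left_mono frac_le) auto
    also have "\<dots> = u / (c + u)" using assms by (simp add: field_simps)
    finally show "norm (- (u / c * exp (- x)) / (1 + u / c * exp (- x))) \<le> u / (c + u)"
      using pos[of x] assms by simp
  qed (use assms in auto)
  moreover have "exp (- ln d) = 1 / d" "exp (- ln d') = 1 / d'" using assms by (simp_all add: exp_minus inverse_eq_divide)
  ultimately show ?thesis by simp
qed

definition contraction_factor :: "real \<Rightarrow> real \<Rightarrow> real" where
  "contraction_factor \<alpha> c = (\<integral>u. u / (c + u) \<partial>gamma_measure \<alpha>)"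

lemma contraction_factor:
  assumes "\<alpha> > 0" "c > 0"
  shows "(\<integral>\<^sup>+u. ennreal (u / (c + u)) \<partial>gamma_measure \<alpha>) = ennreal (contraction_factor \<alpha> c)"
    and "0 \<le> contraction_factor \<alpha> c" "contraction_factor \<alpha> c < 1"
proof -
  interpret prob_space "gamma_measure \<alpha>" by (rule prob_space_gamma_measure[OF assms(1)])
  have b: "AE u in gamma_measure \<alpha>. 0 < u / (c + u) \<and> u / (c + u) < 1"
    using AE_gamma_measure_pos by eventually_elim (use assms in \<open>auto simp: field_simps\<close>)
  have int: "integrable (gamma_measure \<alpha>) (\<lambda>u. u / (c + u))"
  proof (rule integrable_const_bound[where B=1])
    show "AE u in gamma_measure \<alpha>. norm (u / (c + u)) \<le> 1"
      using b by eventually_elim (simp only: real_norm_def, linarith)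
  qed measurable
  show "(\<integral>\<^sup>+u. ennreal (u / (c + u)) \<partial>gamma_measure \<alpha>) = ennreal (contraction_factor \<alpha> c)"
    unfolding contraction_factor_def
    by (rule nn_integral_eq_integral[OF int]) (use b in \<open>eventually_elim; simp\<close>)
  show "0 \<le> contraction_factor \<alpha> c"
    unfolding contraction_factor_def by (rule integral_nonneg_AE) (use b in \<open>eventually_elim; simp\<close>)
  show "contraction_factor \<alpha> c < 1"
    unfolding contraction_factor_def by (rule expectation_less[OF int]) (use b in \<open>eventually_elim; simp\<close>)
qed

text \<open>One-sided, because subtraction in \<open>ennreal\<close> is truncated; quantifying over
  both orders of d and d' restores symmetry. The range d \<ge> 1 is where the pivots lie and where a
  step contracts.\<close>

definition log_lipschitz :: "real \<Rightarrow> (real \<Rightarrow> ennreal) \<Rightarrow> bool" where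
  "log_lipschitz K f \<longleftrightarrow> (\<forall>d\<ge>1. \<forall>d'\<ge>1. f d \<le> f d' + ennreal (K * \<bar>ln d - ln d'\<bar>))"

lemma log_lipschitz_markov_step:
  assumes "\<alpha> > 0" "c > 0" "K \<ge> 0" and [measurable]: "f \<in> borel_measurable borel" and f: "log_lipschitz K f"
  shows "log_lipschitz (K * contraction_factor \<alpha> c) (markov_step \<alpha> c f)"
  unfolding log_lipschitz_def
proof (intro allI impI)
  fix d d' :: real assume d: "d \<ge> 1" "d' \<ge> 1"
  let ?l = "\<bar>ln d - ln d'\<bar>"
  have "markov_step \<alpha> c f d \<le> (\<integral>\<^sup>+u. f (1 + u / (c * d')) + ennreal (K * ?l) * ennreal (u / (c + u)) \<partial>gamma_measure \<alpha>)"
    unfolding markov_step_def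
  proof (rule nn_integral_mono_AE, use AE_gamma_measure_pos in eventually_elim)
    fix u :: real assume u: "u > 0"
    have "1 + u / (c * d) \<ge> 1" "1 + u / (c * d') \<ge> 1" using u d assms by auto
    then have "f (1 + u / (c * d)) \<le> f (1 + u / (c * d')) +
        ennreal (K * \<bar>ln (1 + u / (c * d)) - ln (1 + u / (c * d'))\<bar>)"
      using f unfolding log_lipschitz_def by blast
    also have "\<dots> \<le> f (1 + u / (c * d')) + ennreal (K * (u / (c + u) * ?l))"
      using ln_step_contraction[OF assms(2) u d] assms(3)
      by (intro add_left_mono ennreal_leI mult_left_mono) auto
    also have "ennreal (K * (u / (c + u) * ?l)) = ennreal (K * ?l) * ennreal (u / (c + u))"
      using u assms by (simp add: ennreal_mult'[symmetric] mult_ac)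
    finally show "f (1 + u / (c * d)) \<le> f (1 + u / (c * d')) + ennreal (K * ?l) * ennreal (u / (c + u))" .
  qed
  also have "\<dots> = markov_step \<alpha> c f d' + ennreal (K * ?l) * ennreal (contraction_factor \<alpha> c)"
    unfolding markov_step_def
    by (subst nn_integral_add) (auto simp: nn_integral_cmult contraction_factor(1)[OF assms(1,2)])
  also have "ennreal (K * ?l) * ennreal (contraction_factor \<alpha> c) = ennreal (K * contraction_factor \<alpha> c * ?l)"
    using assms(3) contraction_factor(2)[OF assms(1,2)] by (simp add: ennreal_mult'[symmetric] mult_ac)
  finally show "markov_step \<alpha> c f d \<le> markov_step \<alpha> c f d' + ennreal (K * contraction_factor \<alpha> c * ?l)" .
qed

lemma markov_step_power:
  assumes "\<alpha> > 0" "c > 0" and [measurable]: "f \<in> borel_measurable borel" and f: "log_lipschitz 1 f"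
  shows "(markov_step \<alpha> c ^^ m) f \<in> borel_measurable borel"
    and "log_lipschitz (contraction_factor \<alpha> c ^ m) ((markov_step \<alpha> c ^^ m) f)"
    and "(\<integral>\<^sup>+t. (markov_step \<alpha> c ^^ m) f (1 + t) \<partial>kummer_measure \<alpha> c) = (\<integral>\<^sup>+t. f (1 + t) \<partial>kummer_measure \<alpha> c)"
proof (induction m)
  case (Suc m)
  note [measurable] = Suc(1)
  show "(markov_step \<alpha> c ^^ Suc m) f \<in> borel_measurable borel"
    using markov_step_measurable[OF assms(1) Suc(1)] by simp
  show "log_lipschitz (contraction_factor \<alpha> c ^ Suc m) ((markov_step \<alpha> c ^^ Suc m) f)"
    using log_lipschitz_markov_step[OF assms(1,2) _ Suc(1,2)] contraction_factor(2)[OF assms(1,2)]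
    by (simp add: mult.commute)
  show "(\<integral>\<^sup>+t. (markov_step \<alpha> c ^^ Suc m) f (1 + t) \<partial>kummer_measure \<alpha> c) = (\<integral>\<^sup>+t. f (1 + t) \<partial>kummer_measure \<alpha> c)"
    using kummer_measure_stationary[OF assms(1,2), of "\<lambda>t. (markov_step \<alpha> c ^^ m) f (1 + t)"] Suc(3)
    by (simp add: markov_step_def)
qed (use f in auto)

lemma integrable_ln_1_plus_kummer_w:
  assumes "\<alpha> > 0" "c > 0"
  shows "integrable halfline (\<lambda>t. ln (1 + t) * kummer_w \<alpha> c t)"
proof (rule integrable_halfline_mono[OF integrable_kummer_w_power[OF assms, of 1]])
  fix t :: real assume t: "t > 0"
  have "ln (1 + t) \<le> t" "0 \<le> ln (1 + t)" using ln_add_one_self_le_self[of t] t by auto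
  then show "\<bar>ln (1 + t) * kummer_w \<alpha> c t\<bar> \<le> t ^ 1 * kummer_w \<alpha> c t"
    using kummer_w_pos[OF t, of \<alpha> c] by (simp add: abs_mult mult_right_mono)
qed measurable

text \<open>The chain started at 1, the innermost value of the continued fraction, is compared with
  the one started from the stationary law: after m steps they differ by at most q^m ln (1 + t), and
  ln (1 + t) has a finite stationary mean, which is B.\<close>

lemma markov_convergence:
  assumes "\<alpha> > 0" "c > 0" and [measurable]: "f \<in> borel_measurable borel" and f: "log_lipschitz 1 f"
  obtains B where "B \<ge> 0"
    and "\<And>m. (markov_step \<alpha> c ^^ m) f 1 \<le>
      (\<integral>\<^sup>+t. f (1 + t) \<partial>kummer_measure \<alpha> c) + ennreal (B * contraction_factor \<alpha> c ^ m)"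
    and "\<And>m. (\<integral>\<^sup>+t. f (1 + t) \<partial>kummer_measure \<alpha> c) \<le>
      (markov_step \<alpha> c ^^ m) f 1 + ennreal (B * contraction_factor \<alpha> c ^ m)"
proof
  interpret K: prob_space "kummer_measure \<alpha> c" by (rule prob_space_kummer_measure[OF assms(1,2)])
  let ?B = "(\<integral>t. ln (1 + t) * kummer_w \<alpha> c t \<partial>halfline) / kummer_int \<alpha> c"
  let ?q = "contraction_factor \<alpha> c"
  have B: "(\<integral>\<^sup>+t. ennreal (ln (1 + t)) \<partial>kummer_measure \<alpha> c) = ennreal ?B"
    by (rule nn_integral_kummer_measure) (use assms integrable_ln_1_plus_kummer_w in auto)
  show B0: "0 \<le> ?B"
  proof (intro divide_nonneg_pos integral_nonneg_AE AE_I2 kummer_int_pos assms(1,2))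
    fix t assume "t \<in> space halfline"
    then show "0 \<le> ln (1 + t) * kummer_w \<alpha> c t" using kummer_w_pos[of t \<alpha> c] by simp
  qed
  have q0: "0 \<le> ?q" by (rule contraction_factor(2)[OF assms(1,2)])
  fix m
  let ?f = "(markov_step \<alpha> c ^^ m) f"
  note [measurable] = markov_step_power(1)[OF assms(1-4), of m]
  note lip = markov_step_power(2)[OF assms(1-4), of m]
  note stat = markov_step_power(3)[OF assms(1-4), of m]
  have e: "(\<integral>\<^sup>+t. ennreal (?q ^ m) * ennreal (ln (1 + t)) \<partial>kummer_measure \<alpha> c) = ennreal (?B * ?q ^ m)"
    using q0 B0 by (subst nn_integral_cmult) (auto simp: B ennreal_mult'[symmetric] mult.commute)
  have l: "ennreal (?q ^ m * \<bar>ln 1 - ln (1 + t)\<bar>) = ennreal (?q ^ m) * ennreal (ln (1 + t))"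
    "ennreal (?q ^ m * \<bar>ln (1 + t) - ln 1\<bar>) = ennreal (?q ^ m) * ennreal (ln (1 + t))" if "t > 0" for t
    using that q0 by (simp_all add: ennreal_mult')
  have "?f 1 = (\<integral>\<^sup>+t. ?f 1 \<partial>kummer_measure \<alpha> c)" using K.emeasure_space_1 by simp
  also have "\<dots> \<le> (\<integral>\<^sup>+t. ?f (1 + t) + ennreal (?q ^ m) * ennreal (ln (1 + t)) \<partial>kummer_measure \<alpha> c)"
  proof (rule nn_integral_mono_AE, use AE_kummer_measure_pos in eventually_elim)
    fix t :: real assume t: "t > 0"
    show "?f 1 \<le> ?f (1 + t) + ennreal (?q ^ m) * ennreal (ln (1 + t))"
      unfolding l(1)[OF t, symmetric] using lip[unfolded log_lipschitz_def, rule_format, of 1 "1 + t"] t by simp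
  qed
  also have "\<dots> = (\<integral>\<^sup>+t. f (1 + t) \<partial>kummer_measure \<alpha> c) + ennreal (?B * ?q ^ m)"
    by (subst nn_integral_add) (auto simp: stat e)
  finally show "?f 1 \<le> (\<integral>\<^sup>+t. f (1 + t) \<partial>kummer_measure \<alpha> c) + ennreal (?B * ?q ^ m)" .
  have "(\<integral>\<^sup>+t. f (1 + t) \<partial>kummer_measure \<alpha> c) = (\<integral>\<^sup>+t. ?f (1 + t) \<partial>kummer_measure \<alpha> c)" by (simp add: stat)
  also have "\<dots> \<le> (\<integral>\<^sup>+t. ?f 1 + ennreal (?q ^ m) * ennreal (ln (1 + t)) \<partial>kummer_measure \<alpha> c)"
  proof (rule nn_integral_mono_AE, use AE_kummer_measure_pos in eventually_elim)
    fix t :: real assume t: "t > 0"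
    show "?f (1 + t) \<le> ?f 1 + ennreal (?q ^ m) * ennreal (ln (1 + t))"
      unfolding l(2)[OF t, symmetric] using lip[unfolded log_lipschitz_def, rule_format, of "1 + t" 1] t by simp
  qed
  also have "\<dots> = ?f 1 + ennreal (?B * ?q ^ m)"
    using K.emeasure_space_1 by (subst nn_integral_add) (auto simp: e)
  finally show "(\<integral>\<^sup>+t. f (1 + t) \<partial>kummer_measure \<alpha> c) \<le> ?f 1 + ennreal (?B * ?q ^ m)" .
qed

lemma log_lipschitz_inverse: "log_lipschitz 1 (\<lambda>d. ennreal (1 / d))"
  unfolding log_lipschitz_def
proof (intro allI impI)
  fix d d' :: real assume d: "d \<ge> 1" "d' \<ge> 1"
  have "1 / d - 1 / d' \<le> \<bar>ln d - ln d'\<bar>"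
  proof (cases "d \<ge> d'")
    case True
    then have "1 / d \<le> 1 / d'" using d by (intro frac_le) auto
    then show ?thesis by linarith
  next
    case False
    have "1 / d - 1 / d' = (1 - d / d') / d" using d by (simp add: field_simps)
    also have "\<dots> \<le> 1 - d / d'" using d False by (intro divide_left_mono[of 1 d, simplified]) (auto simp: field_simps)
    also have "\<dots> \<le> - ln (d / d')" using ln_le_minus_one[of "d / d'"] d by simp
    also have "\<dots> = ln d' - ln d" using d by (simp add: ln_div)
    finally show ?thesis by linarith
  qed
  then have "1 / d \<le> 1 / d' + \<bar>ln d - ln d'\<bar>" by linarith
  then have "ennreal (1 / d) \<le> ennreal (1 / d' + \<bar>ln d - ln d'\<bar>)" by (rule ennreal_leI)
  then show "ennreal (1 / d) \<le> ennreal (1 / d') + ennreal (1 * \<bar>ln d - ln d'\<bar>)"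
    using d by (simp add: ennreal_plus)
qed

lemma log_lipschitz_ln: "log_lipschitz 1 (\<lambda>d. ennreal (ln d))"
  unfolding log_lipschitz_def
proof (intro allI impI)
  fix d d' :: real assume d: "d \<ge> 1" "d' \<ge> 1"
  have "ennreal (ln d) \<le> ennreal (ln d' + \<bar>ln d - ln d'\<bar>)" by (rule ennreal_leI) linarith
  then show "ennreal (ln d) \<le> ennreal (ln d') + ennreal (1 * \<bar>ln d - ln d'\<bar>)"
    using d by (simp add: ennreal_plus)
qed

lemma nn_integral_kummer_inverse:
  assumes "\<alpha> > 0" "c > 0"
  shows "(\<integral>\<^sup>+t. ennreal (1 / (1 + t)) \<partial>kummer_measure \<alpha> c) = ennreal (kummer_int_shift \<alpha> c / kummer_int \<alpha> c)"
  using nn_integral_kummer_measure[OF assms, of "\<lambda>t. 1 / (1 + t)"] integrable_kummer_w_shift[OF assms]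
  by (simp add: kummer_int_shift_def)

definition kummer_mean_ln :: "real \<Rightarrow> real \<Rightarrow> real" where
  "kummer_mean_ln \<alpha> c = (\<integral>t. ln (1 + t) \<partial>kummer_measure \<alpha> c)"

lemma nn_integral_kummer_ln:
  assumes "\<alpha> > 0" "c > 0"
  shows "(\<integral>\<^sup>+t. ennreal (ln (1 + t)) \<partial>kummer_measure \<alpha> c) = ennreal (kummer_mean_ln \<alpha> c)"
    and "0 \<le> kummer_mean_ln \<alpha> c"
proof -
  have m: "kummer_mean_ln \<alpha> c = (\<integral>t. ln (1 + t) * kummer_w \<alpha> c t \<partial>halfline) / kummer_int \<alpha> c"
    unfolding kummer_mean_ln_def by (rule integral_kummer_measure(1)[OF assms]) measurable
  show "(\<integral>\<^sup>+t. ennreal (ln (1 + t)) \<partial>kummer_measure \<alpha> c) = ennreal (kummer_mean_ln \<alpha> c)"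
    unfolding m by (rule nn_integral_kummer_measure) (use assms integrable_ln_1_plus_kummer_w in auto)
  show "0 \<le> kummer_mean_ln \<alpha> c"
    unfolding kummer_mean_ln_def by (rule integral_nonneg_AE, use AE_kummer_measure_pos in eventually_elim) simp
qed

text \<open>Taking logarithms in the stationarity equation \<open>t = u / (c (1 + t'))\<close> in law expresses
  the mean of \<open>ln (1 + t)\<close> through the derivative of the normalisation in the parameter.\<close>

lemma kummer_mean_ln_eq:
  assumes "\<alpha> > 0" "c > 0"
  shows "2 * kummer_mean_ln \<alpha> c = (\<integral>u. ln u \<partial>gamma_measure \<alpha>) - ln c - kummer_sol_da \<alpha> (ln c) c / kummer_int \<alpha> c"
proof -
  interpret K: prob_space "kummer_measure \<alpha> c" by (rule prob_space_kummer_measure[OF assms])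
  interpret G: prob_space "gamma_measure \<alpha>" by (rule prob_space_gamma_measure[OF assms(1)])
  interpret KG: pair_prob_space "kummer_measure \<alpha> c" "gamma_measure \<alpha>" ..
  let ?P = "kummer_measure \<alpha> c \<Otimes>\<^sub>M gamma_measure \<alpha>"
  let ?X = "\<lambda>p::real \<times> real. snd p / (c * (1 + fst p))"
  note I = kummer_int_pos[OF assms]
  have X[measurable]: "?X \<in> borel_measurable ?P" by measurable
  \<comment> \<open>Stationarity as an identity of laws: (t, u) from the product measure gives u /
    (c (1 + t)) the law of t. In this form it applies to logarithms, which change sign, and not only
    to nonnegative integrands.\<close>
  have distr: "distr ?P borel ?X = kummer_measure \<alpha> c"
  proof (rule measure_eqI)
    fix A assume "A \<in> sets (distr ?P borel ?X)"
    then have [measurable]: "A \<in> sets borel" by simp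
    have "emeasure (distr ?P borel ?X) A = (\<integral>\<^sup>+p. indicator A (?X p) \<partial>?P)"
    proof -
      have "(\<integral>\<^sup>+p. indicator A (?X p) \<partial>?P) = (\<integral>\<^sup>+t. indicator A t \<partial>distr ?P borel ?X)"
        by (rule nn_integral_distr[symmetric]) measurable
      then show ?thesis by simp
    qed
    also have "\<dots> = (\<integral>\<^sup>+t. (\<integral>\<^sup>+u. indicator A (?X (t, u)) \<partial>gamma_measure \<alpha>) \<partial>kummer_measure \<alpha> c)"
      by (rule G.nn_integral_fst[symmetric]) measurable
    also have "\<dots> = (\<integral>\<^sup>+t. indicator A t \<partial>kummer_measure \<alpha> c)"
      using kummer_measure_stationary[OF assms, of "indicator A"] by simp
    finally show "emeasure (distr ?P borel ?X) A = emeasure (kummer_measure \<alpha> c) A" by simp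
  qed simp
  have dfst: "distr ?P borel fst = kummer_measure \<alpha> c"
  proof (rule measure_eqI)
    fix A assume "A \<in> sets (distr ?P borel fst)"
    then have [measurable]: "A \<in> sets borel" by simp
    have "emeasure (distr ?P borel fst) A = (\<integral>\<^sup>+p. indicator A (fst p) \<partial>?P)"
    proof -
      have "(\<integral>\<^sup>+p. indicator A (fst p) \<partial>?P) = (\<integral>\<^sup>+t. indicator A t \<partial>distr ?P borel fst)"
        by (rule nn_integral_distr[symmetric]) measurable
      then show ?thesis by simp
    qed
    also have "\<dots> = (\<integral>\<^sup>+t. (\<integral>\<^sup>+u. indicator A (fst (t, u)) \<partial>gamma_measure \<alpha>) \<partial>kummer_measure \<alpha> c)"
      by (rule G.nn_integral_fst[symmetric]) measurable
    also have "\<dots> = emeasure (kummer_measure \<alpha> c) A" using G.emeasure_space_1 by simp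
    finally show "emeasure (distr ?P borel fst) A = emeasure (kummer_measure \<alpha> c) A" .
  qed simp
  have dsnd: "distr ?P borel snd = gamma_measure \<alpha>"
  proof (rule measure_eqI)
    fix A assume "A \<in> sets (distr ?P borel snd)"
    then have [measurable]: "A \<in> sets borel" by simp
    have "emeasure (distr ?P borel snd) A = (\<integral>\<^sup>+p. indicator A (snd p) \<partial>?P)"
    proof -
      have "(\<integral>\<^sup>+p. indicator A (snd p) \<partial>?P) = (\<integral>\<^sup>+t. indicator A t \<partial>distr ?P borel snd)"
        by (rule nn_integral_distr[symmetric]) measurable
      then show ?thesis by simp
    qed
    also have "\<dots> = (\<integral>\<^sup>+t. (\<integral>\<^sup>+u. indicator A (snd (t, u)) \<partial>gamma_measure \<alpha>) \<partial>kummer_measure \<alpha> c)"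
      by (rule G.nn_integral_fst[symmetric]) measurable
    also have "\<dots> = emeasure (gamma_measure \<alpha>) A" using K.emeasure_space_1 by simp
    finally show "emeasure (distr ?P borel snd) A = emeasure (gamma_measure \<alpha>) A" .
  qed simp
  have i1: "integrable (kummer_measure \<alpha> c) (\<lambda>t. ln (1 + t))"
    using integrable_ln_1_plus_kummer_w[OF assms] by (subst integral_kummer_measure(2)[OF assms]) auto
  have i2: "integrable (kummer_measure \<alpha> c) (\<lambda>t. ln (t / (1 + t)))"
    using integrable_ln_kummer_w[OF assms] by (subst integral_kummer_measure(2)[OF assms]) auto
  have lneq: "AE t in kummer_measure \<alpha> c. ln (t / (1 + t)) + ln (1 + t) = ln t"
    using AE_kummer_measure_pos by eventually_elim (simp add: ln_div)
  \<comment> \<open>ln t is unbounded at both ends; the splitting into ln (t / (1 + t)) and ln (1 +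
    t) treats 0 and infinity separately.\<close>
  have i3: "integrable (kummer_measure \<alpha> c) ln"
    by (rule integrable_cong_AE[THEN iffD1, OF _ _ lneq]) (use i1 i2 in auto)
  have l3: "(\<integral>t. ln t \<partial>kummer_measure \<alpha> c) = (\<integral>t. ln (t / (1 + t)) \<partial>kummer_measure \<alpha> c) + kummer_mean_ln \<alpha> c"
    unfolding kummer_mean_ln_def Bochner_Integration.integral_add[OF i2 i1, symmetric]
    by (rule integral_cong_AE[symmetric, OF _ _ lneq]) auto
  \<comment> \<open>For fixed c the solution formula equals the integral for all \<beta> > 0, so the
    two expressions for the \<beta>-derivative agree by uniqueness of derivatives.\<close>
  have da: "(\<integral>t. ln (t / (1 + t)) \<partial>kummer_measure \<alpha> c) = kummer_sol_da \<alpha> (ln c) c / kummer_int \<alpha> c"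
  proof -
    have "((\<lambda>\<beta>. kummer_int \<beta> c) has_real_derivative kummer_sol_da \<alpha> (ln c) c) (at \<alpha>)"
      by (rule has_field_derivative_transform_within_open[OF has_derivative_kummer_sol_param[OF assms(1)], where S="{0<..}"])
        (use assms in \<open>auto simp: kummer_int_eq_sol\<close>)
    from DERIV_unique[OF this has_derivative_kummer_int_param[OF assms]]
    show ?thesis by (subst integral_kummer_measure(1)[OF assms]) auto
  qed
  have pp: "AE p in ?P. 0 < fst p \<and> 0 < snd p"
  proof -
    have a: "AE p in distr ?P borel fst. 0 < p" and b: "AE p in distr ?P borel snd. 0 < p"
      unfolding dfst dsnd by (rule AE_kummer_measure_pos AE_gamma_measure_pos)+
    have "AE p in ?P. 0 < fst p" by (rule AE_distrD[OF _ a]) measurable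
    moreover have "AE p in ?P. 0 < snd p" by (rule AE_distrD[OF _ b]) measurable
    ultimately show ?thesis by eventually_elim simp
  qed
  have j1: "integrable ?P (\<lambda>p. ln (1 + fst p))"
    using integrable_distr[of fst ?P borel "\<lambda>t. ln (1 + t)"] i1 unfolding dfst by simp
  have j2: "integrable ?P (\<lambda>p. ln (?X p))"
    using integrable_distr[OF X, of ln] i3 unfolding distr by simp
  have ae: "AE p in ?P. ln (?X p) + (ln c + ln (1 + fst p)) = ln (snd p)"
    using pp by eventually_elim (use assms in \<open>simp add: ln_div ln_mult\<close>)
  have "(\<integral>u. ln u \<partial>gamma_measure \<alpha>) = (\<integral>p. ln (snd p) \<partial>?P)"
    using integral_distr[of snd ?P borel "ln :: real \<Rightarrow> real"] unfolding dsnd by simp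
  also have "\<dots> = (\<integral>p. ln (?X p) + (ln c + ln (1 + fst p)) \<partial>?P)"
    by (rule integral_cong_AE[symmetric, OF _ _ ae]) auto
  also have "\<dots> = (\<integral>p. ln (?X p) \<partial>?P) + (ln c + (\<integral>p. ln (1 + fst p) \<partial>?P))"
    using j1 j2 KG.prob_space by simp
  also have "(\<integral>p. ln (?X p) \<partial>?P) = (\<integral>t. ln t \<partial>kummer_measure \<alpha> c)"
    using integral_distr[OF X, of ln] unfolding distr by simp
  also have "(\<integral>p. ln (1 + fst p) \<partial>?P) = kummer_mean_ln \<alpha> c"
    using integral_distr[of fst ?P borel "\<lambda>t. ln (1 + t)"] unfolding dfst kummer_mean_ln_def by simp
  finally show ?thesis unfolding l3 da by simp
qed

section \<open>Resolvents of anti-symmetric tridiagonal matrices\<close>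

definition tridiag_entry :: "(nat \<Rightarrow> real) \<Rightarrow> nat \<Rightarrow> nat \<Rightarrow> real" where
  "tridiag_entry a i k = (if k = Suc i then a k else if i = Suc k then - a i else 0)"

lemma tridiag_entry_swap: "tridiag_entry a k i = - tridiag_entry a i k"
  by (auto simp: tridiag_entry_def)

lemma sum_tridiag_entry:
  fixes f :: "nat \<Rightarrow> 'a::{real_algebra_1,comm_ring_1}"
  assumes "i < N"
  shows "(\<Sum>k<N. of_real (tridiag_entry a i k) * f k) =
    (if Suc i < N then of_real (a (Suc i)) * f (Suc i) else 0) - (if 0 < i then of_real (a i) * f (i - 1) else 0)"
proof -
  have "(\<Sum>k<N. of_real (tridiag_entry a i k) * f k) =
    (\<Sum>k<N. (if k = Suc i then of_real (a k) * f k else 0) - (if k = i - 1 \<and> 0 < i then of_real (a i) * f k else 0))"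
    by (rule sum.cong) (auto simp: tridiag_entry_def)
  also have "\<dots> = (\<Sum>k<N. (if k = Suc i then of_real (a k) * f k else 0)) -
    (\<Sum>k<N. (if k = i - 1 \<and> 0 < i then of_real (a i) * f k else 0))"
    by (rule sum_subtractf)
  also have "(\<Sum>k<N. (if k = Suc i then of_real (a k) * f k else 0)) =
      (if Suc i < N then of_real (a (Suc i)) * f (Suc i) else 0)"
    by (simp add: sum.delta)
  also have "(\<Sum>k<N. (if k = i - 1 \<and> 0 < i then of_real (a i) * f k else 0)) =
      (if 0 < i then of_real (a i) * f (i - 1) else 0)"
    using assms by (cases "0 < i") (simp_all add: sum.delta)
  finally show ?thesis .
qed

text \<open>The pivots of sqrt c + A under elimination from the last row, divided by sqrt c. Depth m
  involves the entries with indices k + 1 to k + m, and the value 1 at depth 0 belongs to the last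
  pivot.\<close>

fun cfrac :: "real \<Rightarrow> (nat \<Rightarrow> real) \<Rightarrow> nat \<Rightarrow> nat \<Rightarrow> real" where
  "cfrac c a k 0 = 1"
| "cfrac c a k (Suc m) = 1 + (a (Suc k))\<^sup>2 / (c * cfrac c a (Suc k) m)"

lemma cfrac_ge_1: "c > 0 \<Longrightarrow> 1 \<le> cfrac c a k m"
  by (induction m arbitrary: k) (force intro!: divide_nonneg_nonneg mult_nonneg_nonneg intro: order_trans[of 0 1])+

locale antisym_eigensystem =
  fixes N :: nat and a :: "nat \<Rightarrow> real" and x :: "nat \<Rightarrow> real" and v :: "nat \<Rightarrow> complex Matrix.vec"
  assumes N: "N \<ge> 1"
    and sys: "orthonormal_eigensystem N (\<i> \<cdot>\<^sub>m map_mat complex_of_real (antisym_tridiag N a)) x v"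
begin

abbreviation e :: "nat \<Rightarrow> nat \<Rightarrow> real" where "e \<equiv> tridiag_entry a"

definition w :: "nat \<Rightarrow> nat \<Rightarrow> complex" where "w j i = vec_index (v j) i"

lemma dim_v: "j < N \<Longrightarrow> v j \<in> carrier_vec N"
  using sys by (simp add: orthonormal_eigensystem_def)

lemma eigen: "j < N \<Longrightarrow> i < N \<Longrightarrow> (\<Sum>k<N. of_real (e i k) * w j k) = - \<i> * of_real (x j) * w j i"
proof -
  assume j: "j < N" and i: "i < N"
  let ?H = "\<i> \<cdot>\<^sub>m map_mat complex_of_real (antisym_tridiag N a)"
  have "vec_index (?H *\<^sub>v v j) i = vec_index (complex_of_real (x j) \<cdot>\<^sub>v v j) i"
    using sys j by (simp add: orthonormal_eigensystem_def)
  moreover have "vec_index (?H *\<^sub>v v j) i = (\<Sum>k<N. \<i> * of_real (e i k) * w j k)"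
    using i dim_v[OF j]
    by (auto simp: antisym_tridiag_def scalar_prod_def tridiag_entry_def w_def lessThan_atLeast0 intro!: sum.cong)
  moreover have "vec_index (complex_of_real (x j) \<cdot>\<^sub>v v j) i = of_real (x j) * w j i"
    using i dim_v[OF j] by (simp add: w_def)
  ultimately have "\<i> * (\<Sum>k<N. of_real (e i k) * w j k) = of_real (x j) * w j i"
    by (simp add: sum_distrib_left mult.assoc)
  then have "\<i> * (\<i> * (\<Sum>k<N. of_real (e i k) * w j k)) = \<i> * (of_real (x j) * w j i)" by simp
  then show ?thesis by (simp add: minus_equation_iff mult.assoc)
qed

lemma orthonormal:
  assumes "j < N" "k < N"
  shows "(\<Sum>i<N. w j i * cnj (w k i)) = (if j = k then 1 else 0)"
proof -
  have "v j \<bullet>c v k = (\<Sum>i<N. w j i * cnj (w k i))"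
    using dim_v[OF assms(1)] dim_v[OF assms(2)]
    by (auto simp: scalar_prod_def w_def lessThan_atLeast0 conjugate_complex_def intro!: sum.cong)
  then show ?thesis using sys assms by (simp add: orthonormal_eigensystem_def)
qed

definition U :: "complex Matrix.mat" where "U = Matrix.mat N N (\<lambda>(i, j). w j i)"
definition Uh :: "complex Matrix.mat" where "Uh = Matrix.mat N N (\<lambda>(j, i). cnj (w j i))"

lemma U_carrier[simp]: "U \<in> carrier_mat N N" "Uh \<in> carrier_mat N N"
  by (simp_all add: U_def Uh_def)

lemma Uh_U: "Uh * U = 1\<^sub>m N"
proof (rule eq_matI)
  fix j k assume jk: "j < dim_row (1\<^sub>m N)" "k < dim_col (1\<^sub>m N)"
  then have "(Uh * U) $$ (j, k) = (\<Sum>i<N. cnj (w j i) * w k i)"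
    by (simp add: U_def Uh_def scalar_prod_def lessThan_atLeast0)
  also have "\<dots> = (if k = j then 1 else 0)"
    using orthonormal[of k j] jk by (simp add: mult.commute)
  finally show "(Uh * U) $$ (j, k) = 1\<^sub>m N $$ (j, k)" using jk by simp
qed (simp_all add: U_def Uh_def)

text \<open>Orthonormality makes \<open>Uh\<close> a left inverse of the square matrix
  \<open>U\<close>, hence also a right inverse: orthonormal columns give orthonormal rows.\<close>

lemma complete:
  assumes "i < N" "k < N"
  shows "(\<Sum>j<N. w j i * cnj (w j k)) = (if i = k then 1 else 0)"
proof -
  have "U * Uh = 1\<^sub>m N" by (rule mat_mult_left_right_inverse[OF _ _ Uh_U]) simp_all
  then have "(U * Uh) $$ (i, k) = (if i = k then 1 else 0)" using assms by simp
  moreover have "(U * Uh) $$ (i, k) = (\<Sum>j<N. w j i * cnj (w j k))"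
    using assms by (simp add: U_def Uh_def scalar_prod_def lessThan_atLeast0)
  ultimately show ?thesis by simp
qed

text \<open>Entry (i, k) of the n-th power of iA. By \<open>moment_Suc\<close> it is a polynomial in
  the matrix entries, whatever the eigensystem; the measurability of the mean measures rests on
  this.\<close>

definition moment :: "nat \<Rightarrow> nat \<Rightarrow> nat \<Rightarrow> complex" where
  "moment n i k = (\<Sum>j<N. w j i * of_real (x j ^ n) * cnj (w j k))"

lemma moment_0: "i < N \<Longrightarrow> k < N \<Longrightarrow> moment 0 i k = (if i = k then 1 else 0)"
  using complete by (simp add: moment_def)

lemma moment_Suc:
  assumes "i < N"
  shows "moment (Suc n) i k = (\<Sum>l<N. \<i> * of_real (e i l) * moment n l k)"
proof -
  have "(\<Sum>l<N. \<i> * of_real (e i l) * moment n l k) =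
    (\<Sum>j<N. (\<i> * (\<Sum>l<N. of_real (e i l) * w j l)) * of_real (x j ^ n) * cnj (w j k))"
    unfolding moment_def sum_distrib_left sum_distrib_right
    by (subst sum.swap) (simp add: mult_ac)
  also have "\<dots> = (\<Sum>j<N. w j i * of_real (x j ^ Suc n) * cnj (w j k))"
  proof (rule sum.cong[OF refl])
    fix j assume "j \<in> {..<N}"
    then have "(\<Sum>l<N. of_real (e i l) * w j l) = - \<i> * of_real (x j) * w j i"
      using eigen[OF _ assms] by simp
    then have "\<i> * (\<Sum>l<N. of_real (e i l) * w j l) = of_real (x j) * w j i"
      by (simp only:) (simp add: complex_eq_iff)
    then show "(\<i> * (\<Sum>l<N. of_real (e i l) * w j l)) * of_real (x j ^ n) * cnj (w j k) =
      w j i * of_real (x j ^ Suc n) * cnj (w j k)"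
      by (simp only:) simp
  qed
  finally show ?thesis unfolding moment_def by simp
qed

lemma moment_diag: "moment n i i = of_real (\<Sum>j<N. (cmod (w j i))\<^sup>2 * x j ^ n)"
  unfolding moment_def of_real_sum
  by (rule sum.cong) (simp_all add: complex_norm_square mult_ac del: of_real_power)

lemma sum_weight_0: "i < N \<Longrightarrow> (\<Sum>j<N. (cmod (w j i))\<^sup>2) = 1"
  using moment_0[of i i] moment_diag[of 0 i] by (simp add: of_real_eq_1_iff del: of_real_sum of_real_power)

lemma sum_norm: "j < N \<Longrightarrow> (\<Sum>i<N. (cmod (w j i))\<^sup>2) = 1"
proof -
  assume j: "j < N"
  have "complex_of_real (\<Sum>i<N. (cmod (w j i))\<^sup>2) = (\<Sum>i<N. w j i * cnj (w j i))"
    unfolding of_real_sum by (simp add: complex_norm_square del: of_real_power)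
  also have "\<dots> = of_real 1" using orthonormal[OF j j] by simp
  finally show ?thesis unfolding of_real_eq_iff .
qed

text \<open>The diagonal entry of (iA)^2 is the squared norm of a row of A, which has at most two
  nonzero entries.\<close>

lemma second_moment:
  assumes "i < N"
  shows "(\<Sum>j<N. (cmod (w j i))\<^sup>2 * (x j)\<^sup>2) = (if Suc i < N then (a (Suc i))\<^sup>2 else 0) + (if 0 < i then (a i)\<^sup>2 else 0)"
proof -
  have 1: "moment (Suc 0) l i = \<i> * of_real (e l i)" if "l < N" for l
    unfolding moment_Suc[OF that] using assms by (simp add: moment_0 if_distrib sum.delta cong: if_cong)
  have "complex_of_real (\<Sum>j<N. (cmod (w j i))\<^sup>2 * (x j)\<^sup>2) = moment (Suc (Suc 0)) i i"
    by (simp add: moment_diag numeral_2_eq_2)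
  also have "\<dots> = (\<Sum>l<N. of_real (e i l) * of_real (e i l))"
    unfolding moment_Suc[OF assms]
  proof (rule sum.cong[OF refl])
    fix l assume "l \<in> {..<N}"
    then have l: "l < N" by simp
    show "\<i> * of_real (e i l) * moment (Suc 0) l i = of_real (e i l) * of_real (e i l)"
      unfolding 1[OF l] tridiag_entry_swap[of a l i] by (simp add: complex_eq_iff)
  qed
  also have "\<dots> = of_real ((if Suc i < N then (a (Suc i))\<^sup>2 else 0) + (if 0 < i then (a i)\<^sup>2 else 0))"
    unfolding sum_tridiag_entry[OF assms]
    by (auto simp: tridiag_entry_def power2_eq_square)
  finally show ?thesis unfolding of_real_eq_iff .
qed

section \<open>Pivots, corner resolvent and determinant\<close>

context
  fixes c :: real
  assumes c: "c > 0"
begin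

definition d :: "nat \<Rightarrow> real" where "d k = sqrt c * cfrac c a k (N - 1 - k)"

lemma d_pos: "d k > 0"
  using c cfrac_ge_1[OF c, of a k "N - 1 - k"] by (simp add: d_def)

lemma d_rec: "Suc k < N \<Longrightarrow> d k = sqrt c + (a (Suc k))\<^sup>2 / d (Suc k)"
proof -
  assume k: "Suc k < N"
  then have "N - 1 - k = Suc (N - 1 - Suc k)" by simp
  then have "d k = sqrt c * (1 + (a (Suc k))\<^sup>2 / (c * cfrac c a (Suc k) (N - 1 - Suc k)))"
    by (simp add: d_def)
  also have "\<dots> = sqrt c * (1 + (a (Suc k))\<^sup>2 / ((sqrt c * sqrt c) * cfrac c a (Suc k) (N - 1 - Suc k)))"
    using c by simp
  also have "\<dots> = sqrt c + (a (Suc k))\<^sup>2 / (sqrt c * cfrac c a (Suc k) (N - 1 - Suc k))"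
  proof -
    have "r * (1 + A / ((r * r) * D)) = r + A / (r * D)" if "r > 0" "D > 0" for r A D :: real
      using that by (simp add: field_simps)
    moreover have "sqrt c > 0" "cfrac c a (Suc k) (N - 1 - Suc k) > 0"
      using c cfrac_ge_1[OF c, of a "Suc k" "N - 1 - Suc k"] by simp_all
    ultimately show ?thesis by blast
  qed
  finally show ?thesis unfolding d_def .
qed

lemma d_last: "d (N - 1) = sqrt c"
  by (simp add: d_def)

text \<open>The first column of the inverse of sqrt c + A, by forward substitution once the pivots
  are known.\<close>

fun u :: "nat \<Rightarrow> real" where
  "u 0 = 1 / d 0"
| "u (Suc k) = a (Suc k) * u k / d (Suc k)"

lemma u_row:
  assumes "k < N"
  shows "sqrt c * u k + (\<Sum>l<N. e k l * u l) = (if k = 0 then 1 else 0)"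
proof -
  have "sqrt c * u k + (\<Sum>l<N. e k l * u l) = sqrt c * u k + (if Suc k < N then a (Suc k) * u (Suc k) else 0)
     - (if 0 < k then a k * u (k - 1) else 0)"
    using sum_tridiag_entry[OF assms, of a u] by (simp del: u.simps)
  also have "sqrt c * u k + (if Suc k < N then a (Suc k) * u (Suc k) else 0) = d k * u k"
  proof (cases "Suc k < N")
    case True
    then show ?thesis using d_rec[OF True] by (simp add: algebra_simps power2_eq_square)
  next
    case False
    then have "k = N - 1" using assms by simp
    then show ?thesis using d_last False by simp
  qed
  also have "d k * u k - (if 0 < k then a k * u (k - 1) else 0) = (if k = 0 then 1 else 0)"
    using d_pos[of k] by (cases k) auto
  finally show ?thesis .
qed

text \<open>A has eigenvalue - i x_j on v_j, so the corner entry of the inverse of sqrt c + A is the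
  sum of \<bar>w_j0\<bar>^2 / (sqrt c - i x_j). By elimination it is the real number 1 / d 0;
  comparing real parts and multiplying by sqrt c gives the claim.\<close>

lemma resolvent: "(\<Sum>j<N. (cmod (w j 0))\<^sup>2 * (c / (c + (x j)\<^sup>2))) = 1 / cfrac c a 0 (N - 1)"
proof -
  have N0: "0 < N" using N by simp
  \<comment> \<open>Coefficients of the solution u in the eigenbasis; \<open>conj\<close> uses
    anti-symmetry to let A act on the conjugated eigenvectors instead of u.\<close>
  define b where "b j = (\<Sum>k<N. of_real (u k) * cnj (w j k))" for j
  have conj: "(\<Sum>k<N. of_real (e k l) * cnj (w j k)) = - \<i> * of_real (x j) * cnj (w j l)" if "j < N" "l < N" for j l
  proof -
    have "cnj (\<Sum>k<N. of_real (e l k) * w j k) = cnj (- \<i> * of_real (x j) * w j l)"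
      using eigen[OF that] by simp
    then show ?thesis by (simp add: tridiag_entry_swap[of a _ l] sum_negf)
  qed
  have bj: "(of_real (sqrt c) - \<i> * of_real (x j)) * b j = cnj (w j 0)" if j: "j < N" for j
  proof -
    have "(\<Sum>k<N. of_real (sqrt c * u k + (\<Sum>l<N. e k l * u l)) * cnj (w j k)) =
      (\<Sum>k<N. of_real (if k = 0 then 1 else 0) * cnj (w j k))"
      by (rule sum.cong) (simp_all only: u_row lessThan_iff)
    also have "\<dots> = (\<Sum>k<N. if k = 0 then cnj (w j k) else 0)" by (rule sum.cong) auto
    also have "\<dots> = cnj (w j 0)" using N0 by (simp add: sum.delta)
    also have "(\<Sum>k<N. of_real (sqrt c * u k + (\<Sum>l<N. e k l * u l)) * cnj (w j k)) =
      of_real (sqrt c) * b j + (\<Sum>k<N. \<Sum>l<N. of_real (u l) * (of_real (e k l) * cnj (w j k)))"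
    proof -
      have "(\<Sum>k<N. of_real (sqrt c * u k + (\<Sum>l<N. e k l * u l)) * cnj (w j k)) =
        (\<Sum>k<N. of_real (sqrt c) * (of_real (u k) * cnj (w j k)) +
          (\<Sum>l<N. of_real (u l) * (of_real (e k l) * cnj (w j k))))"
        unfolding of_real_add of_real_mult of_real_sum distrib_right sum_distrib_right
        by (intro sum.cong arg_cong2[where f="(+)"]) (simp_all add: mult_ac del: u.simps)
      then show ?thesis by (simp only: sum.distrib sum_distrib_left b_def)
    qed
    also have "(\<Sum>k<N. \<Sum>l<N. of_real (u l) * (of_real (e k l) * cnj (w j k))) =
      (\<Sum>l<N. of_real (u l) * (\<Sum>k<N. of_real (e k l) * cnj (w j k)))"
      by (subst sum.swap) (simp add: sum_distrib_left)
    also have "\<dots> = (\<Sum>l<N. of_real (u l) * (- \<i> * of_real (x j) * cnj (w j l)))"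
      by (rule sum.cong) (simp_all add: conj[OF j] del: u.simps)
    also have "\<dots> = - \<i> * of_real (x j) * b j"
      by (simp add: b_def sum_distrib_left mult_ac sum_negf del: u.simps)
    finally show ?thesis by (simp add: algebra_simps)
  qed
  have "complex_of_real (u 0) = (\<Sum>k<N. if k = 0 then of_real (u k) else 0)" using N0 by (simp add: sum.delta del: u.simps)
  also have "\<dots> = (\<Sum>k<N. of_real (u k) * (\<Sum>j<N. w j 0 * cnj (w j k)))"
    by (rule sum.cong) (use N0 in \<open>auto simp: complete simp del: u.simps\<close>)
  also have "\<dots> = (\<Sum>j<N. w j 0 * b j)"
    unfolding b_def sum_distrib_left by (subst sum.swap) (simp add: mult_ac del: u.simps)
  also have "\<dots> = (\<Sum>j<N. of_real ((cmod (w j 0))\<^sup>2) / (of_real (sqrt c) - \<i> * of_real (x j)))"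
  proof (rule sum.cong[OF refl])
    fix j assume "j \<in> {..<N}"
    then have j: "j < N" by simp
    have "of_real (sqrt c) - \<i> * of_real (x j) \<noteq> 0" using c by (auto simp: complex_eq_iff)
    then have "b j = cnj (w j 0) / (of_real (sqrt c) - \<i> * of_real (x j))"
      using bj[OF j] by (simp add: eq_divide_eq mult.commute)
    then show "w j 0 * b j = of_real ((cmod (w j 0))\<^sup>2) / (of_real (sqrt c) - \<i> * of_real (x j))"
      by (simp add: complex_norm_square del: of_real_power)
  qed
  finally have "u 0 = Re (\<Sum>j<N. of_real ((cmod (w j 0))\<^sup>2) / (of_real (sqrt c) - \<i> * of_real (x j)))"
    by (metis Re_complex_of_real)
  also have "\<dots> = (\<Sum>j<N. (cmod (w j 0))\<^sup>2 * sqrt c / (c + (x j)\<^sup>2))"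
    unfolding Re_sum using c by (intro sum.cong) (simp_all add: Re_divide)
  finally have "sqrt c * u 0 = (\<Sum>j<N. sqrt c * ((cmod (w j 0))\<^sup>2 * sqrt c / (c + (x j)\<^sup>2)))"
    by (simp only: sum_distrib_left)
  also have "\<dots> = (\<Sum>j<N. (cmod (w j 0))\<^sup>2 * (c / (c + (x j)\<^sup>2)))"
    using c by (intro sum.cong) (simp_all add: mult_ac flip: power2_eq_square)
  finally show ?thesis using c by (simp add: d_def)
qed

text \<open>The determinant of sqrt c + A computed twice: by diagonalisation with U, and from a unit
  upper bidiagonal times a lower bidiagonal matrix carrying the pivots. This order of the triangular
  factors corresponds to elimination from the last row, which the continued fraction
  encodes.\<close>

lemma prod_eigenvalues: "(\<Prod>j<N. of_real (sqrt c) - \<i> * of_real (x j)) = complex_of_real (\<Prod>k<N. d k)"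
proof -
  define T where "T = Matrix.mat N N (\<lambda>(i, k). (if i = k then of_real (sqrt c) else 0) + complex_of_real (e i k))"
  define X where "X = Matrix.mat N N (\<lambda>(i, k). if i = k then of_real (sqrt c) - \<i> * of_real (x i) else 0)"
  define P where "P = Matrix.mat N N (\<lambda>(i, k). if i = k then 1 else if k = Suc i then complex_of_real (a k / d k) else 0)"
  define L where "L = Matrix.mat N N (\<lambda>(i, k). if i = k then complex_of_real (d i) else if i = Suc k then - complex_of_real (a i) else 0)"
  have carr[simp]: "T \<in> carrier_mat N N" "X \<in> carrier_mat N N" "P \<in> carrier_mat N N" "L \<in> carrier_mat N N"
    by (simp_all add: T_def X_def P_def L_def)
  have TU: "T * U = U * X"
  proof (rule eq_matI)
    fix i j assume "i < dim_row (U * X)" "j < dim_col (U * X)"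
    then have ij: "i < N" "j < N" by (simp_all add: U_def X_def)
    have "(T * U) $$ (i, j) = (\<Sum>k<N. ((if i = k then of_real (sqrt c) else 0) + complex_of_real (e i k)) * w j k)"
      using ij by (simp add: T_def U_def scalar_prod_def lessThan_atLeast0)
    also have "\<dots> = (\<Sum>k<N. if k = i then of_real (sqrt c) * w j k else 0) + (\<Sum>k<N. complex_of_real (e i k) * w j k)"
      unfolding sum.distrib[symmetric] by (rule sum.cong) (auto simp: distrib_right)
    also have "\<dots> = (of_real (sqrt c) - \<i> * of_real (x j)) * w j i"
      unfolding eigen[OF ij(2) ij(1)] using ij by (simp add: algebra_simps)
    also have "\<dots> = (\<Sum>k<N. if k = j then w k i * (of_real (sqrt c) - \<i> * of_real (x k)) else 0)"
      using ij by (simp add: sum.delta mult.commute)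
    also have "\<dots> = (U * X) $$ (i, j)"
    proof -
      have "(U * X) $$ (i, j) = (\<Sum>k<N. w k i * (if k = j then of_real (sqrt c) - \<i> * of_real (x k) else 0))"
        using ij by (simp add: X_def U_def scalar_prod_def lessThan_atLeast0 cong: if_cong)
      also have "\<dots> = (\<Sum>k<N. if k = j then w k i * (of_real (sqrt c) - \<i> * of_real (x k)) else 0)"
        by (rule sum.cong) auto
      finally show ?thesis by simp
    qed
    finally show "(T * U) $$ (i, j) = (U * X) $$ (i, j)" .
  qed (simp_all add: T_def U_def X_def)
  have PL: "P * L = T"
  proof (rule eq_matI)
    fix i j assume "i < dim_row T" "j < dim_col T"
    then have ij: "i < N" "j < N" by (simp_all add: T_def)
    let ?L = "\<lambda>i k. if i = k then complex_of_real (d i) else if i = Suc k then - complex_of_real (a i) else 0"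
    have "(P * L) $$ (i, j) = (\<Sum>k<N. (if i = k then 1 else if k = Suc i then complex_of_real (a k / d k) else 0) * ?L k j)"
      using ij by (simp add: P_def L_def scalar_prod_def lessThan_atLeast0)
    also have "\<dots> = (\<Sum>k<N. (if k = i then ?L k j else 0) + (if k = Suc i then complex_of_real (a k / d k) * ?L k j else 0))"
      by (rule sum.cong) auto
    also have "\<dots> = ?L i j + (if Suc i < N then complex_of_real (a (Suc i) / d (Suc i)) * ?L (Suc i) j else 0)"
      unfolding sum.distrib using ij by (simp add: sum.delta)
    also have "\<dots> = (if i = j then of_real (sqrt c) else 0) + complex_of_real (e i j)"
    proof (cases "i = j")
      case True
      show ?thesis
      proof (cases "Suc i < N")
        case True
        have "d i - a (Suc i) / d (Suc i) * a (Suc i) = sqrt c"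
          using d_rec[OF True] by (simp add: power2_eq_square)
        then have "complex_of_real (d i) - complex_of_real (a (Suc i) / d (Suc i)) * of_real (a (Suc i)) = of_real (sqrt c)"
          by (metis of_real_diff of_real_mult)
        then show ?thesis using True \<open>i = j\<close> by (simp add: tridiag_entry_def)
      next
        case False
        then have "i = N - 1" using ij by simp
        then show ?thesis using d_last \<open>i = j\<close> False by (simp add: tridiag_entry_def)
      qed
    next
      case False
      then show ?thesis using d_pos[of j] ij by (auto simp: tridiag_entry_def)
    qed
    also have "\<dots> = T $$ (i, j)" using ij by (simp add: T_def)
    finally show "(P * L) $$ (i, j) = T $$ (i, j)" .
  qed (simp_all add: P_def L_def T_def)
  have "Determinant.det Uh * Determinant.det U = 1"
    using det_mult[of Uh N U] Uh_U by simp
  then have dU: "Determinant.det U \<noteq> 0" by auto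
  have "Determinant.det T * Determinant.det U = Determinant.det U * Determinant.det X"
    using det_mult[OF carr(1) U_carrier(1)] det_mult[OF U_carrier(1) carr(2)] unfolding TU by (simp only:)
  then have "Determinant.det X = Determinant.det T" using dU by auto
  also have "\<dots> = Determinant.det P * Determinant.det L"
    using det_mult[of P N L] PL by simp
  also have "Determinant.det P = 1"
  proof -
    have "Determinant.det P = prod_list (diag_mat P)"
      by (rule det_upper_triangular[of _ N]) (auto simp: P_def upper_triangular_def)
    then show ?thesis unfolding prod_list_diag_prod by (simp add: P_def)
  qed
  also have "Determinant.det L = (\<Prod>k<N. complex_of_real (d k))"
  proof -
    have "Determinant.det L = prod_list (diag_mat L)"
      by (rule det_lower_triangular[of N]) (auto simp: L_def)
    then show ?thesis unfolding prod_list_diag_prod by (simp add: L_def lessThan_atLeast0)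
  qed
  also have "Determinant.det X = (\<Prod>j<N. of_real (sqrt c) - \<i> * of_real (x j))"
  proof -
    have "Determinant.det X = prod_list (diag_mat X)"
      by (rule det_upper_triangular[of _ N]) (auto simp: X_def upper_triangular_def)
    then show ?thesis unfolding prod_list_diag_prod by (simp add: X_def lessThan_atLeast0)
  qed
  finally show ?thesis by simp
qed

text \<open>Squared moduli turn sqrt c - i x into c + x^2. Dividing each of the N factors on both
  sides by c makes all logarithms nonnegative, as the later integrals in \<open>ennreal\<close>
  require.\<close>

lemma sum_ln_eigenvalues: "(\<Sum>j<N. ln (1 + (x j)\<^sup>2 / c)) = 2 * (\<Sum>k<N. ln (cfrac c a k (N - 1 - k)))"
proof -
  have "(\<Prod>j<N. c + (x j)\<^sup>2) = (cmod (\<Prod>j<N. of_real (sqrt c) - \<i> * of_real (x j)))\<^sup>2"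
    unfolding prod_norm[symmetric] prod_power_distrib using c by (intro prod.cong) (simp_all add: cmod_power2)
  also have "\<dots> = (\<Prod>k<N. d k)\<^sup>2"
    unfolding prod_eigenvalues norm_of_real by simp
  finally have eq: "(\<Prod>j<N. c + (x j)\<^sup>2) = (\<Prod>k<N. (d k)\<^sup>2)" by (simp add: prod_power_distrib)
  have pos: "0 < c + (x j)\<^sup>2" for j using c by (simp add: add_pos_nonneg)
  have nz: "c + (x j)\<^sup>2 \<noteq> 0" for j using pos[of j] by (metis less_irrefl)
  have nzd: "d k \<noteq> 0" for k using d_pos[of k] by (metis less_irrefl)
  have "(\<Sum>j<N. ln (c + (x j)\<^sup>2)) = ln (\<Prod>j<N. c + (x j)\<^sup>2)"
    by (rule ln_prod[symmetric]) (simp_all add: nz)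
  also have "\<dots> = (\<Sum>k<N. ln ((d k)\<^sup>2))"
    unfolding eq by (rule ln_prod) (simp_all add: nzd)
  finally have "(\<Sum>j<N. ln (c + (x j)\<^sup>2) - ln c) = (\<Sum>k<N. ln ((d k)\<^sup>2) - ln c)"
    by (simp add: sum_subtractf)
  moreover have "ln (c + (x j)\<^sup>2) - ln c = ln (1 + (x j)\<^sup>2 / c)" for j
  proof -
    have "1 + (x j)\<^sup>2 / c = (c + (x j)\<^sup>2) / c" using c by (simp add: field_simps)
    then show ?thesis using c nz[of j] by (simp only: ln_div) simp
  qed
  moreover have "ln ((d k)\<^sup>2) - ln c = 2 * ln (cfrac c a k (N - 1 - k))" for k
    using c cfrac_ge_1[OF c, of a k "N - 1 - k"]
    by (simp add: d_def power_mult_distrib ln_mult ln_realpow)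
  ultimately show ?thesis by (simp add: sum_distrib_left)
qed

end

end

section \<open>Mean measures\<close>

text \<open>Weighted power sums of the atoms are measurable, while single atoms may fail to be.
  Polynomials within 1 / (n + 1) of f on [-n, n] converge to f pointwise on the line, and the sums
  inherit measurability.\<close>

lemma borel_measurable_atoms_continuous:
  fixes W X :: "'w \<Rightarrow> nat \<Rightarrow> real" and f :: "real \<Rightarrow> real"
  assumes mom: "\<And>n. (\<lambda>\<omega>. \<Sum>j<N. W \<omega> j * X \<omega> j ^ n) \<in> borel_measurable M"
    and f: "continuous_on UNIV f"
  shows "(\<lambda>\<omega>. \<Sum>j<N. W \<omega> j * f (X \<omega> j)) \<in> borel_measurable M"
proof -
  have "\<exists>p. real_polynomial_function p \<and> (\<forall>x\<in>{- real n..real n}. \<bar>f x - p x\<bar> < 1 / (real n + 1))" for n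
  proof -
    have "continuous_on {- real n..real n} f" using f by (rule continuous_on_subset) simp
    then obtain p where "real_polynomial_function p" "\<And>x. x \<in> {- real n..real n} \<Longrightarrow> \<bar>f x - p x\<bar> < 1 / (real n + 1)"
      by (rule Stone_Weierstrass_real_polynomial_function[OF compact_Icc, of _ _ f "1 / (real n + 1)"]) auto
    then show ?thesis by blast
  qed
  then obtain p where p: "\<And>n. real_polynomial_function (p n)"
    "\<And>n x. x \<in> {- real n..real n} \<Longrightarrow> \<bar>f x - p n x\<bar> < 1 / (real n + 1)"
    by metis
  have lim: "(\<lambda>n. p n x) \<longlonglongrightarrow> f x" for x
  proof (rule Lim_transform_bound[where g="\<lambda>n. 1 / (real n + 1)", THEN LIM_zero_cancel])
    obtain n0 where n0: "\<bar>x\<bar> \<le> real n0" using real_arch_simple by blast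
    show "\<forall>\<^sub>F n in sequentially. norm (p n x - f x) \<le> norm (1 / (real n + 1))"
      using eventually_ge_at_top[of n0]
    proof eventually_elim
      case (elim n)
      then have "x \<in> {- real n..real n}" using n0 by auto
      from p(2)[OF this] show ?case by (simp add: abs_minus_commute)
    qed
    show "(\<lambda>n. 1 / (real n + 1)) \<longlonglongrightarrow> 0" by real_asymp
  qed
  have pm: "(\<lambda>\<omega>. \<Sum>j<N. W \<omega> j * p n (X \<omega> j)) \<in> borel_measurable M" for n
  proof -
    obtain b m where b: "p n = (\<lambda>x. \<Sum>i\<le>m. b i * x ^ i)"
      using p(1)[of n] unfolding real_polynomial_function_iff_sum by blast
    have "(\<lambda>\<omega>. \<Sum>j<N. W \<omega> j * p n (X \<omega> j)) = (\<lambda>\<omega>. \<Sum>i\<le>m. b i * (\<Sum>j<N. W \<omega> j * X \<omega> j ^ i))"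
      unfolding b sum_distrib_left by (subst sum.swap) (simp add: mult_ac)
    then show ?thesis using mom by simp
  qed
  show ?thesis
    by (rule borel_measurable_LIMSEQ_real[where u="\<lambda>n \<omega>. \<Sum>j<N. W \<omega> j * p n (X \<omega> j)", OF _ pm])
      (intro tendsto_sum tendsto_mult tendsto_const lim)
qed

lemma borel_measurable_atoms_abs_atMost:
  fixes W X :: "'w \<Rightarrow> nat \<Rightarrow> real"
  assumes mom: "\<And>n. (\<lambda>\<omega>. \<Sum>j<N. W \<omega> j * X \<omega> j ^ n) \<in> borel_measurable M"
  shows "(\<lambda>\<omega>. \<Sum>j<N. W \<omega> j * indicator {..b} \<bar>X \<omega> j\<bar>) \<in> borel_measurable M"
proof -
  \<comment> \<open>Continuous ramps falling, for n > 0, from 1 at b to 0 at b + 1/n; they decrease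
    to the indicator of the closed half-line.\<close>
  define f where "f n x = max 0 (min 1 (1 - real n * (\<bar>x\<bar> - b)))" for n x
  have limf: "(\<lambda>n. f n x) \<longlonglongrightarrow> indicator {..b} \<bar>x\<bar>" for x
  proof (cases "\<bar>x\<bar> \<le> b")
    case True
    have "f n x = 1" for n
      using True mult_nonneg_nonpos[of "real n" "\<bar>x\<bar> - b"] by (simp add: f_def)
    then show ?thesis using True by (simp add: indicator_def)
  next
    case False
    obtain n0 where n0: "1 / (\<bar>x\<bar> - b) \<le> real n0" using real_arch_simple by blast
    have "\<forall>\<^sub>F n in sequentially. f n x = 0"
      using eventually_ge_at_top[of n0]
    proof eventually_elim
      case (elim n)
      then have "1 / (\<bar>x\<bar> - b) \<le> real n" using n0 by linarith
      then have "1 \<le> real n * (\<bar>x\<bar> - b)" using False by (simp add: pos_divide_le_eq)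
      then show ?case by (simp add: f_def)
    qed
    then show ?thesis using False by (simp add: tendsto_eventually indicator_def)
  qed
  have fm: "(\<lambda>\<omega>. \<Sum>j<N. W \<omega> j * f n (X \<omega> j)) \<in> borel_measurable M" for n
    by (rule borel_measurable_atoms_continuous[OF mom]) (auto simp: f_def intro!: continuous_intros)
  show ?thesis
    by (rule borel_measurable_LIMSEQ_real[where u="\<lambda>n \<omega>. \<Sum>j<N. W \<omega> j * f n (X \<omega> j)", OF _ fm])
      (intro tendsto_sum tendsto_mult tendsto_const limf)
qed

text \<open>Integration against \<mu> needs countable additivity of the formula inside
  \<open>measure_of\<close>. It comes from viewing the atoms as a random probability measure K and
  \<mu> as the mixture \<open>M \<bind> K\<close>. Measurability of K need only be tested on the
  half-lines {..b}, which generate the Borel sets and are closed under intersection.\<close>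

lemma
  fixes W X :: "'w \<Rightarrow> nat \<Rightarrow> real"
  assumes M: "prob_space M"
    and W: "\<And>\<omega> j. \<omega> \<in> space M \<Longrightarrow> 0 \<le> W \<omega> j" "\<And>\<omega>. \<omega> \<in> space M \<Longrightarrow> (\<Sum>j<N. W \<omega> j) = 1"
    and mom: "\<And>n. (\<lambda>\<omega>. \<Sum>j<N. W \<omega> j * X \<omega> j ^ n) \<in> borel_measurable M"
  defines "\<mu> \<equiv> measure_of UNIV (sets borel) (\<lambda>B. \<integral>\<^sup>+\<omega>. (\<Sum>j<N. ennreal (W \<omega> j) * indicator B \<bar>X \<omega> j\<bar>) \<partial>M)"
  shows real_distribution_mean_atoms: "real_distribution \<mu>"
    and nn_integral_mean_atoms: "f \<in> borel_measurable borel \<Longrightarrow>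
      (\<integral>\<^sup>+y. f y \<partial>\<mu>) = (\<integral>\<^sup>+\<omega>. (\<Sum>j<N. ennreal (W \<omega> j) * f \<bar>X \<omega> j\<bar>) \<partial>M)"
proof -
  interpret prob_space M by fact
  define K where "K \<omega> = distr (point_measure {..<N} (\<lambda>j. ennreal (W \<omega> j))) borel (\<lambda>j. \<bar>X \<omega> j\<bar>)" for \<omega>
  have Kf: "(\<integral>\<^sup>+y. f y \<partial>K \<omega>) = (\<Sum>j<N. ennreal (W \<omega> j) * f \<bar>X \<omega> j\<bar>)" if "f \<in> borel_measurable borel" for f \<omega>
    unfolding K_def using that by (subst nn_integral_distr) (auto simp: nn_integral_point_measure_finite)
  have KA: "emeasure (K \<omega>) A = (\<Sum>j<N. ennreal (W \<omega> j) * indicator A \<bar>X \<omega> j\<bar>)" if "A \<in> sets borel" for A \<omega>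
    using Kf[of "indicator A" \<omega>] that by (simp add: K_def)
  have Kp: "prob_space (K \<omega>)" if "\<omega> \<in> space M" for \<omega>
  proof (rule prob_spaceI)
    have "emeasure (K \<omega>) (space (K \<omega>)) = (\<Sum>j<N. ennreal (W \<omega> j))"
      using KA[of UNIV \<omega>] by (simp add: K_def)
    also have "\<dots> = ennreal (\<Sum>j<N. W \<omega> j)" using W(1)[OF that] by (rule sum_ennreal)
    finally show "emeasure (K \<omega>) (space (K \<omega>)) = 1" using W(2)[OF that] by simp
  qed
  have K: "K \<in> measurable M (subprob_algebra borel)"
  proof (rule measurable_subprob_algebra_generated[where \<Omega>=UNIV and G="range (\<lambda>b::real. {..b})"])
    show "sets borel = sigma_sets UNIV (range (\<lambda>b::real. {..b}))"
      by (subst borel_eq_atMost) (rule sets_measure_of, simp)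
    show "Int_stable (range (\<lambda>b::real. {..b}))"
      by (auto simp: Int_stable_def)
    show "subprob_space (K \<omega>)" if "\<omega> \<in> space M" for \<omega>
      using Kp[OF that] by (rule prob_space_imp_subprob_space)
    show "(\<lambda>\<omega>. emeasure (K \<omega>) UNIV) \<in> borel_measurable M"
    proof (rule measurable_cong[THEN iffD2])
      show "emeasure (K \<omega>) UNIV = 1" if "\<omega> \<in> space M" for \<omega>
        using prob_space.emeasure_space_1[OF Kp[OF that]] by (simp add: K_def)
    qed simp
    fix A assume "A \<in> range (\<lambda>b::real. {..b})"
    then obtain b where A: "A = {..b}" by auto
    show "(\<lambda>\<omega>. emeasure (K \<omega>) A) \<in> borel_measurable M"
    proof (rule measurable_cong[THEN iffD2])
      fix \<omega> assume w: "\<omega> \<in> space M"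
      have "emeasure (K \<omega>) A = (\<Sum>j<N. ennreal (W \<omega> j) * indicator {..b} \<bar>X \<omega> j\<bar>)"
        unfolding A by (rule KA) simp
      also have "\<dots> = (\<Sum>j<N. ennreal (W \<omega> j * indicator {..b} \<bar>X \<omega> j\<bar>))"
        by (rule sum.cong) (simp_all split: split_indicator)
      also have "\<dots> = ennreal (\<Sum>j<N. W \<omega> j * indicator {..b} \<bar>X \<omega> j\<bar>)"
        using W(1)[OF w] by (intro sum_ennreal) simp
      finally show "emeasure (K \<omega>) A = ennreal (\<Sum>j<N. W \<omega> j * indicator {..b} \<bar>X \<omega> j\<bar>)" .
    qed (use borel_measurable_atoms_abs_atMost[OF mom] in measurable)
  qed (auto simp: K_def)
  have ne: "space M \<noteq> {}" by (rule not_empty)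
  have setsB: "sets (M \<bind> K) = sets borel" by (rule sets_bind) (simp_all add: K_def ne)
  have "\<mu> = measure_of (space (M \<bind> K)) (sets (M \<bind> K)) (emeasure (M \<bind> K))"
  proof -
    have sp: "space (M \<bind> K) = UNIV" using sets_eq_imp_space_eq[OF setsB] by simp
    show ?thesis unfolding \<mu>_def sp setsB
    proof (rule measure_of_eq)
      fix A :: "real set" assume "A \<in> sigma_sets UNIV (sets borel)"
      then have A: "A \<in> sets borel" using sets.sigma_sets_eq[of "borel :: real measure"] by simp
      show "(\<integral>\<^sup>+\<omega>. (\<Sum>j<N. ennreal (W \<omega> j) * indicator A \<bar>X \<omega> j\<bar>) \<partial>M) = emeasure (M \<bind> K) A"
        unfolding emeasure_bind[OF ne K A] KA[OF A] ..
    qed simp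
  qed
  also have "\<dots> = M \<bind> K" by (rule measure_of_of_measure)
  finally have \<mu>: "\<mu> = M \<bind> K" .
  have "prob_space (M \<bind> K)"
    by (rule prob_space_bind[OF _ K]) (auto intro!: AE_I2 Kp)
  then show "real_distribution \<mu>"
    unfolding \<mu> by (simp add: real_distribution_def real_distribution_axioms_def setsB)
  show "(\<integral>\<^sup>+y. f y \<partial>\<mu>) = (\<integral>\<^sup>+\<omega>. (\<Sum>j<N. ennreal (W \<omega> j) * f \<bar>X \<omega> j\<bar>) \<partial>M)"
    if "f \<in> borel_measurable borel"
    unfolding \<mu> nn_integral_bind[OF that K] Kf[OF that] ..
qed

lemma cfrac_cong: "(\<And>j. k < j \<Longrightarrow> j \<le> k + m \<Longrightarrow> a j = b j) \<Longrightarrow> cfrac c a k m = cfrac c b k m"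
proof (induction m arbitrary: k)
  case (Suc m)
  have "cfrac c a (Suc k) m = cfrac c b (Suc k) m" by (rule Suc.IH) (use Suc.prems in auto)
  then show ?case using Suc.prems[of "Suc k"] by simp
qed simp

lemma measurable_cfrac_PiM:
  "{k<..k + m} \<subseteq> B \<Longrightarrow> (\<lambda>g. cfrac c g k m) \<in> borel_measurable (PiM B (\<lambda>_. borel))"
proof (induction m arbitrary: k)
  case (Suc m)
  have [measurable]: "(\<lambda>g. cfrac c g (Suc k) m) \<in> borel_measurable (PiM B (\<lambda>_. borel))"
    by (rule Suc.IH) (use Suc.prems in auto)
  have "Suc k \<in> B" using Suc.prems by auto
  then have [measurable]: "(\<lambda>g. g (Suc k)) \<in> borel_measurable (PiM B (\<lambda>_. borel))"
    by (rule measurable_component_singleton)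
  show ?case by simp measurable
qed simp

section \<open>Ensemble averages for matrices of fixed size\<close>

locale antisym_ensemble =
  fixes \<alpha> :: real and N :: nat and M :: "'w measure" and a :: "nat \<Rightarrow> 'w \<Rightarrow> real"
    and x :: "'w \<Rightarrow> nat \<Rightarrow> real" and v :: "'w \<Rightarrow> nat \<Rightarrow> complex Matrix.vec"
  assumes \<alpha>: "\<alpha> > 0" and N: "N \<ge> 1"
    and ens: "antisym_gaussian_ensemble \<alpha> N M a"
    and sys: "\<And>\<omega>. \<omega> \<in> space M \<Longrightarrow>
      orthonormal_eigensystem N (\<i> \<cdot>\<^sub>m map_mat complex_of_real (antisym_tridiag N (\<lambda>j. a j \<omega>))) (x \<omega>) (v \<omega>)"
begin

sublocale prob_space M
  using ens by (simp add: antisym_gaussian_ensemble_def)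

lemma eig: "\<omega> \<in> space M \<Longrightarrow> antisym_eigensystem N (\<lambda>j. a j \<omega>) (x \<omega>) (v \<omega>)"
  using N sys by (simp add: antisym_eigensystem_def)

lemma indep: "indep_vars (\<lambda>_. borel) a {1..<N}"
  using ens by (simp add: antisym_gaussian_ensemble_def)

lemma a_measurable: "j \<in> {1..<N} \<Longrightarrow> a j \<in> borel_measurable M"
  using indep by (simp add: indep_vars_def)

lemma distr_square: "j \<in> {1..<N} \<Longrightarrow> distr M borel (\<lambda>\<omega>. (a j \<omega>)\<^sup>2) = gamma_measure \<alpha>"
proof -
  assume "j \<in> {1..<N}"
  then have "distributed M lborel (\<lambda>\<omega>. (a j \<omega>)\<^sup>2) (\<lambda>t. ennreal (gamma_density \<alpha> t))"
    using ens by (simp add: antisym_gaussian_ensemble_def)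
  then have "distr M lborel (\<lambda>\<omega>. (a j \<omega>)\<^sup>2) = gamma_measure \<alpha>"
    by (simp add: distributed_def gamma_measure_def)
  moreover have "distr M borel (\<lambda>\<omega>. (a j \<omega>)\<^sup>2) = distr M lborel (\<lambda>\<omega>. (a j \<omega>)\<^sup>2)"
    by (rule distr_cong) auto
  ultimately show ?thesis by simp
qed

text \<open>The outermost entry \<open>a (Suc k)\<close> is independent of the tail of the fraction,
  so integrating it out is one application of \<open>markov_step\<close> to f; hence f and k vary in
  the induction. As the entries are identically distributed, the result depends on the depth m and
  not on k.\<close>

lemma nn_integral_cfrac:
  assumes c: "c > 0" and km: "k + m < N" and f: "f \<in> borel_measurable borel"
  shows "(\<integral>\<^sup>+\<omega>. f (cfrac c (\<lambda>j. a j \<omega>) k m) \<partial>M) = (markov_step \<alpha> c ^^ m) f 1"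
  using km f
proof (induction m arbitrary: k f)
  case 0
  then show ?case using emeasure_space_1 by simp
next
  case (Suc m)
  note [measurable] = Suc.prems(2)
  let ?A = "{Suc k}" and ?B = "{Suc k<..Suc k + m}"
  let ?X = "\<lambda>\<omega>. (a (Suc k) \<omega>)\<^sup>2" and ?Y = "\<lambda>\<omega>. cfrac c (\<lambda>j. a j \<omega>) (Suc k) m"
  have "indep_var borel ((\<lambda>g. (g (Suc k))\<^sup>2) \<circ> (\<lambda>\<omega>. restrict (\<lambda>i. a i \<omega>) ?A))
    borel ((\<lambda>g. cfrac c g (Suc k) m) \<circ> (\<lambda>\<omega>. restrict (\<lambda>i. a i \<omega>) ?B))"
  proof (rule indep_var_compose[OF indep_var_restrict[OF indep]])
    show "(\<lambda>g. cfrac c g (Suc k) m) \<in> borel_measurable (PiM ?B (\<lambda>_. borel))"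
      by (rule measurable_cfrac_PiM) simp
  qed (use Suc.prems in auto)
  moreover have "(\<lambda>g. (g (Suc k))\<^sup>2) \<circ> (\<lambda>\<omega>. restrict (\<lambda>i. a i \<omega>) ?A) = ?X" by auto
  moreover have "(\<lambda>g. cfrac c g (Suc k) m) \<circ> (\<lambda>\<omega>. restrict (\<lambda>i. a i \<omega>) ?B) = ?Y"
    by (intro ext, simp only: comp_def, rule cfrac_cong) auto
  ultimately have ind: "indep_var borel ?X borel ?Y" by simp
  note rv[measurable] = indep_var_rv1[OF ind] indep_var_rv2[OF ind]
  have dX: "distr M borel ?X = gamma_measure \<alpha>" by (rule distr_square) (use Suc.prems in auto)
  interpret G: prob_space "gamma_measure \<alpha>" by (rule prob_space_gamma_measure[OF \<alpha>])
  interpret Y: prob_space "distr M borel ?Y" by (rule prob_space_distr) measurable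
  interpret GY: pair_sigma_finite "gamma_measure \<alpha>" "distr M borel ?Y" ..
  have pair: "gamma_measure \<alpha> \<Otimes>\<^sub>M distr M borel ?Y = distr M (borel \<Otimes>\<^sub>M borel) (\<lambda>\<omega>. (?X \<omega>, ?Y \<omega>))"
    using ind unfolding indep_var_distribution_eq dX by simp
  have "(\<integral>\<^sup>+\<omega>. f (cfrac c (\<lambda>j. a j \<omega>) k (Suc m)) \<partial>M) =
    (\<integral>\<^sup>+p. f (1 + fst p / (c * snd p)) \<partial>distr M (borel \<Otimes>\<^sub>M borel) (\<lambda>\<omega>. (?X \<omega>, ?Y \<omega>)))"
    by (subst nn_integral_distr) auto
  also have "\<dots> = (\<integral>\<^sup>+p. f (1 + fst p / (c * snd p)) \<partial>(gamma_measure \<alpha> \<Otimes>\<^sub>M distr M borel ?Y))"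
    by (simp only: pair)
  also have "\<dots> = (\<integral>\<^sup>+y. (\<integral>\<^sup>+u. f (1 + fst (u, y) / (c * snd (u, y))) \<partial>gamma_measure \<alpha>) \<partial>distr M borel ?Y)"
    by (rule GY.nn_integral_snd[symmetric]) measurable
  also have "\<dots> = (\<integral>\<^sup>+y. markov_step \<alpha> c f y \<partial>distr M borel ?Y)" by (simp add: markov_step_def)
  also have "\<dots> = (\<integral>\<^sup>+\<omega>. markov_step \<alpha> c f (?Y \<omega>) \<partial>M)"
    using markov_step_measurable[OF \<alpha> Suc.prems(2)] by (subst nn_integral_distr) auto
  also have "\<dots> = (markov_step \<alpha> c ^^ m) (markov_step \<alpha> c f) 1"
    by (rule Suc.IH) (use Suc.prems markov_step_measurable[OF \<alpha> Suc.prems(2)] in auto)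
  also have "\<dots> = (markov_step \<alpha> c ^^ Suc m) f 1" by (simp add: funpow_swap1)
  finally show ?case .
qed

lemma nn_integral_square:
  assumes "j \<in> {1..<N}"
  shows "(\<integral>\<^sup>+\<omega>. ennreal ((a j \<omega>)\<^sup>2) \<partial>M) = ennreal \<alpha>"
proof -
  note [measurable] = a_measurable[OF assms]
  have "(\<integral>\<^sup>+\<omega>. ennreal ((a j \<omega>)\<^sup>2) \<partial>M) = (\<integral>\<^sup>+u. ennreal u \<partial>distr M borel (\<lambda>\<omega>. (a j \<omega>)\<^sup>2))"
    by (subst nn_integral_distr) auto
  also have "\<dots> = (\<integral>\<^sup>+u. ennreal (gamma_density \<alpha> u) * ennreal u \<partial>lborel)"
    unfolding distr_square[OF assms] gamma_measure_def by (rule nn_integral_density) auto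
  also have "\<dots> = (\<integral>\<^sup>+u. ennreal \<alpha> * ennreal (gamma_density (\<alpha> + 1) u) \<partial>lborel)"
  proof (rule nn_integral_cong)
    fix u :: real
    have G: "Gamma (\<alpha> + 1) = \<alpha> * Gamma \<alpha>" using \<alpha> by (intro Gamma_plus1) (auto simp: nonpos_Ints_def)
    show "ennreal (gamma_density \<alpha> u) * ennreal u = ennreal \<alpha> * ennreal (gamma_density (\<alpha> + 1) u)"
      using \<alpha> Gamma_real_pos[OF \<alpha>]
      by (simp add: gamma_density_def G ennreal_mult'[symmetric] ennreal_mult''[symmetric] powr_diff)
  qed
  also have "\<dots> = ennreal \<alpha>"
    using nn_integral_gamma_density[of "\<alpha> + 1"] \<alpha> by (subst nn_integral_cmult) auto
  finally show ?thesis .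
qed

text \<open>The eigenvectors enter through the matrix moments alone, and these are polynomials in
  the measurable entries by induction along \<open>moment_Suc\<close>.\<close>

lemma weight_moment_measurable:
  assumes "i < N"
  shows "(\<lambda>\<omega>. \<Sum>j<N. (cmod (vec_index (v \<omega> j) i))\<^sup>2 * x \<omega> j ^ n) \<in> borel_measurable M"
proof -
  let ?e = "\<lambda>i k \<omega>. tridiag_entry (\<lambda>j. a j \<omega>) i k"
  define mom where "mom n i k \<omega> = antisym_eigensystem.moment N (x \<omega>) (v \<omega>) n i k" for n i k \<omega>
  have e[measurable]: "?e i k \<in> borel_measurable M" if "i < N" "k < N" for i k
  proof -
    consider "k = Suc i" | "i = Suc k" | "k \<noteq> Suc i" "i \<noteq> Suc k" by blast
    then show ?thesis
      using that a_measurable[of k] a_measurable[of i] by cases (auto simp: tridiag_entry_def)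
  qed
  have "mom n i k \<in> borel_measurable M" if "i < N" "k < N" for i k
    using that
  proof (induction n arbitrary: i)
    case 0
    then show ?case
      by (subst measurable_cong[where g="\<lambda>_. if i = k then 1 else 0"])
        (auto simp: mom_def antisym_eigensystem.moment_0[OF eig])
  next
    case (Suc n)
    have "(\<lambda>\<omega>. \<Sum>l<N. \<i> * of_real (?e i l \<omega>) * mom n l k \<omega>) \<in> borel_measurable M"
      using Suc by (intro borel_measurable_sum borel_measurable_times) auto
    then show ?case
      by (subst measurable_cong[where g="\<lambda>\<omega>. \<Sum>l<N. \<i> * of_real (?e i l \<omega>) * mom n l k \<omega>"])
        (auto simp: mom_def antisym_eigensystem.moment_Suc[OF eig Suc.prems(1)])
  qed
  from this[OF assms assms] have "(\<lambda>\<omega>. Re (mom n i i \<omega>)) \<in> borel_measurable M" by measurable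
  then show ?thesis
    by (subst (asm) measurable_cong[where g="\<lambda>\<omega>. \<Sum>j<N. (cmod (vec_index (v \<omega> j) i))\<^sup>2 * x \<omega> j ^ n"])
      (simp_all add: mom_def antisym_eigensystem.moment_diag[OF eig] antisym_eigensystem.w_def[OF eig]
        del: of_real_sum of_real_mult of_real_power)
qed

lemma
  shows real_distribution_spectral: "real_distribution (mean_spectral_measure N M x v)"
    and nn_integral_spectral: "f \<in> borel_measurable borel \<Longrightarrow> (\<integral>\<^sup>+y. f y \<partial>mean_spectral_measure N M x v) =
      (\<integral>\<^sup>+\<omega>. (\<Sum>j<N. ennreal ((cmod (vec_index (v \<omega> j) 0))\<^sup>2) * f \<bar>x \<omega> j\<bar>) \<partial>M)"
proof -
  have N0: "0 < N" using N by simp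
  have 1: "(\<Sum>j<N. (cmod (vec_index (v \<omega> j) 0))\<^sup>2) = 1" if "\<omega> \<in> space M" for \<omega>
    using antisym_eigensystem.sum_weight_0[OF eig[OF that] N0] by (simp add: antisym_eigensystem.w_def[OF eig[OF that]])
  show "real_distribution (mean_spectral_measure N M x v)"
    unfolding mean_spectral_measure_def
    by (rule real_distribution_mean_atoms[OF prob_space_axioms _ 1 weight_moment_measurable[OF N0]]) auto
  show "(\<integral>\<^sup>+y. f y \<partial>mean_spectral_measure N M x v) =
      (\<integral>\<^sup>+\<omega>. (\<Sum>j<N. ennreal ((cmod (vec_index (v \<omega> j) 0))\<^sup>2) * f \<bar>x \<omega> j\<bar>) \<partial>M)" if "f \<in> borel_measurable borel"
    unfolding mean_spectral_measure_def
    by (rule nn_integral_mean_atoms[OF prob_space_axioms _ 1 weight_moment_measurable[OF N0] that]) auto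
qed

text \<open>Eigenvectors have norm 1, so the uniform weight 1/N is the average over all sites i of
  the spectral weights at i. Power sums of the eigenvalues are thereby averages of site moments,
  hence measurable.\<close>

lemma
  shows real_distribution_dos: "real_distribution (mean_density_of_states N M x)"
    and nn_integral_dos: "f \<in> borel_measurable borel \<Longrightarrow> (\<integral>\<^sup>+y. f y \<partial>mean_density_of_states N M x) =
      (\<integral>\<^sup>+\<omega>. (\<Sum>j<N. ennreal (1 / real N) * f \<bar>x \<omega> j\<bar>) \<partial>M)"
proof -
  have 1: "(\<Sum>j<N. 1 / real N) = 1" using N by simp
  have mom: "(\<lambda>\<omega>. \<Sum>j<N. 1 / real N * x \<omega> j ^ n) \<in> borel_measurable M" for n
  proof -
    have "(\<lambda>\<omega>. \<Sum>i<N. 1 / real N * (\<Sum>j<N. (cmod (vec_index (v \<omega> j) i))\<^sup>2 * x \<omega> j ^ n)) \<in> borel_measurable M"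
      by (intro borel_measurable_sum borel_measurable_times[OF borel_measurable_const weight_moment_measurable])
        simp
    moreover have "(\<Sum>i<N. 1 / real N * (\<Sum>j<N. (cmod (vec_index (v \<omega> j) i))\<^sup>2 * x \<omega> j ^ n)) =
      (\<Sum>j<N. 1 / real N * x \<omega> j ^ n)" if "\<omega> \<in> space M" for \<omega>
    proof -
      have "(\<Sum>i<N. 1 / real N * (\<Sum>j<N. (cmod (vec_index (v \<omega> j) i))\<^sup>2 * x \<omega> j ^ n)) =
        (\<Sum>j<N. (\<Sum>i<N. (cmod (vec_index (v \<omega> j) i))\<^sup>2) * (1 / real N * x \<omega> j ^ n))"
        unfolding sum_distrib_left sum_distrib_right by (subst sum.swap) (simp add: mult_ac)
      also have "\<dots> = (\<Sum>j<N. 1 / real N * x \<omega> j ^ n)"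
        using antisym_eigensystem.sum_norm[OF eig[OF that]] antisym_eigensystem.w_def[OF eig[OF that]]
        by (intro sum.cong) auto
      finally show ?thesis .
    qed
    ultimately show ?thesis by (subst (asm) measurable_cong) auto
  qed
  have eq: "mean_density_of_states N M x = measure_of UNIV (sets borel)
    (\<lambda>B. \<integral>\<^sup>+\<omega>. (\<Sum>j<N. ennreal (1 / real N) * indicator B \<bar>x \<omega> j\<bar>) \<partial>M)"
    unfolding mean_density_of_states_def sum_distrib_left ..
  show "real_distribution (mean_density_of_states N M x)"
    unfolding eq by (rule real_distribution_mean_atoms[OF prob_space_axioms _ 1 mom]) auto
  show "(\<integral>\<^sup>+y. f y \<partial>mean_density_of_states N M x) =
      (\<integral>\<^sup>+\<omega>. (\<Sum>j<N. ennreal (1 / real N) * f \<bar>x \<omega> j\<bar>) \<partial>M)" if "f \<in> borel_measurable borel"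
    unfolding eq by (rule nn_integral_mean_atoms[OF prob_space_axioms _ 1 mom that]) auto
qed

text \<open>Each of the at most two neighbouring entries has mean square \<alpha>. The bound is
  uniform in N and is the source of tightness.\<close>

lemma nn_integral_second_moment:
  assumes "i < N"
  shows "(\<integral>\<^sup>+\<omega>. ennreal (\<Sum>j<N. (cmod (vec_index (v \<omega> j) i))\<^sup>2 * (x \<omega> j)\<^sup>2) \<partial>M) \<le> ennreal (2 * \<alpha>)"
proof -
  have "(\<integral>\<^sup>+\<omega>. ennreal (\<Sum>j<N. (cmod (vec_index (v \<omega> j) i))\<^sup>2 * (x \<omega> j)\<^sup>2) \<partial>M) =
    (\<integral>\<^sup>+\<omega>. ennreal (if Suc i < N then (a (Suc i) \<omega>)\<^sup>2 else 0) + ennreal (if 0 < i then (a i \<omega>)\<^sup>2 else 0) \<partial>M)"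
  proof (rule nn_integral_cong)
    fix \<omega> assume w: "\<omega> \<in> space M"
    show "ennreal (\<Sum>j<N. (cmod (vec_index (v \<omega> j) i))\<^sup>2 * (x \<omega> j)\<^sup>2) =
      ennreal (if Suc i < N then (a (Suc i) \<omega>)\<^sup>2 else 0) + ennreal (if 0 < i then (a i \<omega>)\<^sup>2 else 0)"
      using antisym_eigensystem.second_moment[OF eig[OF w] assms] antisym_eigensystem.w_def[OF eig[OF w]]
      by (simp add: ennreal_plus[symmetric] del: ennreal_plus)
  qed
  also have "\<dots> = (\<integral>\<^sup>+\<omega>. ennreal (if Suc i < N then (a (Suc i) \<omega>)\<^sup>2 else 0) \<partial>M) +
    (\<integral>\<^sup>+\<omega>. ennreal (if 0 < i then (a i \<omega>)\<^sup>2 else 0) \<partial>M)"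
  proof (rule nn_integral_add)
    show "(\<lambda>\<omega>. ennreal (if Suc i < N then (a (Suc i) \<omega>)\<^sup>2 else 0)) \<in> borel_measurable M"
      using a_measurable[of "Suc i"] by (cases "Suc i < N") auto
    show "(\<lambda>\<omega>. ennreal (if 0 < i then (a i \<omega>)\<^sup>2 else 0)) \<in> borel_measurable M"
      using a_measurable[of i] assms by (cases "0 < i") auto
  qed
  also have "\<dots> \<le> ennreal \<alpha> + ennreal \<alpha>"
    using nn_integral_square[of "Suc i"] nn_integral_square[of i] assms
    by (intro add_mono) (cases "Suc i < N"; cases "0 < i"; simp)+
  finally show ?thesis using \<alpha> by (simp add: ennreal_plus[symmetric] del: ennreal_plus)
qed

lemma spectral_second_moment: "(\<integral>\<^sup>+y. ennreal (y\<^sup>2) \<partial>mean_spectral_measure N M x v) \<le> ennreal (2 * \<alpha>)"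
proof -
  have "(\<integral>\<^sup>+y. ennreal (y\<^sup>2) \<partial>mean_spectral_measure N M x v) =
    (\<integral>\<^sup>+\<omega>. (\<Sum>j<N. ennreal ((cmod (vec_index (v \<omega> j) 0))\<^sup>2 * (x \<omega> j)\<^sup>2)) \<partial>M)"
    by (subst nn_integral_spectral) (simp_all add: ennreal_mult')
  also have "\<dots> = (\<integral>\<^sup>+\<omega>. ennreal (\<Sum>j<N. (cmod (vec_index (v \<omega> j) 0))\<^sup>2 * (x \<omega> j)\<^sup>2) \<partial>M)"
    by (intro nn_integral_cong sum_ennreal) simp
  also have "\<dots> \<le> ennreal (2 * \<alpha>)" by (rule nn_integral_second_moment) (use N in simp)
  finally show ?thesis .
qed

lemma dos_second_moment: "(\<integral>\<^sup>+y. ennreal (y\<^sup>2) \<partial>mean_density_of_states N M x) \<le> ennreal (2 * \<alpha>)"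
proof -
  let ?s = "\<lambda>i \<omega>. \<Sum>j<N. (cmod (vec_index (v \<omega> j) i))\<^sup>2 * (x \<omega> j)\<^sup>2"
  have "(\<integral>\<^sup>+y. ennreal (y\<^sup>2) \<partial>mean_density_of_states N M x) =
    (\<integral>\<^sup>+\<omega>. (\<Sum>j<N. ennreal (1 / real N * (x \<omega> j)\<^sup>2)) \<partial>M)"
    by (subst nn_integral_dos, measurable)
      (intro nn_integral_cong sum.cong refl, simp only: power2_abs, rule ennreal_mult'[symmetric], simp)
  also have "\<dots> = (\<integral>\<^sup>+\<omega>. (\<Sum>i<N. ennreal (1 / real N) * ennreal (?s i \<omega>)) \<partial>M)"
  proof (rule nn_integral_cong)
    fix \<omega> assume w: "\<omega> \<in> space M"
    have "(\<Sum>j<N. 1 / real N * (x \<omega> j)\<^sup>2) = (\<Sum>j<N. (\<Sum>i<N. (cmod (vec_index (v \<omega> j) i))\<^sup>2) * (1 / real N * (x \<omega> j)\<^sup>2))"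
      using antisym_eigensystem.sum_norm[OF eig[OF w]] antisym_eigensystem.w_def[OF eig[OF w]]
      by (intro sum.cong) auto
    also have "\<dots> = (\<Sum>i<N. 1 / real N * ?s i \<omega>)"
      unfolding sum_distrib_left sum_distrib_right by (subst sum.swap) (simp add: mult_ac)
    finally have eq: "(\<Sum>j<N. 1 / real N * (x \<omega> j)\<^sup>2) = (\<Sum>i<N. 1 / real N * ?s i \<omega>)" .
    have "(\<Sum>j<N. ennreal (1 / real N * (x \<omega> j)\<^sup>2)) = ennreal (\<Sum>j<N. 1 / real N * (x \<omega> j)\<^sup>2)"
      by (rule sum_ennreal) simp
    also have "\<dots> = (\<Sum>i<N. ennreal (1 / real N * ?s i \<omega>))"
      unfolding eq by (rule sum_ennreal[symmetric]) (auto intro!: divide_nonneg_nonneg sum_nonneg)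
    also have "\<dots> = (\<Sum>i<N. ennreal (1 / real N) * ennreal (?s i \<omega>))"
      by (intro sum.cong refl ennreal_mult') simp
    finally show "(\<Sum>j<N. ennreal (1 / real N * (x \<omega> j)\<^sup>2)) = (\<Sum>i<N. ennreal (1 / real N) * ennreal (?s i \<omega>))" .
  qed
  also have "\<dots> = (\<Sum>i<N. ennreal (1 / real N) * (\<integral>\<^sup>+\<omega>. ennreal (?s i \<omega>) \<partial>M))"
    using weight_moment_measurable[of _ 2]
    by (subst nn_integral_sum) (auto intro!: sum.cong nn_integral_cmult borel_measurable_times_ennreal measurable_compose[OF _ measurable_ennreal])
  also have "\<dots> \<le> (\<Sum>i<N. ennreal (1 / real N) * ennreal (2 * \<alpha>))"
    using nn_integral_second_moment by (intro sum_mono mult_left_mono) auto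
  also have "\<dots> = ennreal (2 * \<alpha>)"
    using N \<alpha> by (simp add: ennreal_mult'[symmetric] ennreal_of_nat_eq_real_of_nat)
  finally show ?thesis .
qed

lemma spectral_neg: "measure (mean_spectral_measure N M x v) {..<0} = 0"
proof -
  have "emeasure (mean_spectral_measure N M x v) {..<0} = (\<integral>\<^sup>+y. indicator {..<0} y \<partial>mean_spectral_measure N M x v)"
    using real_distribution.events_eq_borel[OF real_distribution_spectral] by simp
  also have "\<dots> = 0" by (subst nn_integral_spectral) auto
  finally show ?thesis by (simp add: measure_def)
qed

lemma dos_neg: "measure (mean_density_of_states N M x) {..<0} = 0"
proof -
  have "emeasure (mean_density_of_states N M x) {..<0} = (\<integral>\<^sup>+y. indicator {..<0} y \<partial>mean_density_of_states N M x)"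
    using real_distribution.events_eq_borel[OF real_distribution_dos] by simp
  also have "\<dots> = 0" by (subst nn_integral_dos) auto
  finally show ?thesis by (simp add: measure_def)
qed

lemma spectral_transform:
  assumes c: "c > 0"
  shows "(\<integral>\<^sup>+y. ennreal (c / (c + y\<^sup>2)) \<partial>mean_spectral_measure N M x v) =
    (markov_step \<alpha> c ^^ (N - 1)) (\<lambda>d. ennreal (1 / d)) 1"
proof -
  have "(\<integral>\<^sup>+y. ennreal (c / (c + y\<^sup>2)) \<partial>mean_spectral_measure N M x v) =
    (\<integral>\<^sup>+\<omega>. (\<Sum>j<N. ennreal ((cmod (vec_index (v \<omega> j) 0))\<^sup>2 * (c / (c + (x \<omega> j)\<^sup>2)))) \<partial>M)"
    by (subst nn_integral_spectral, measurable)
      (intro nn_integral_cong sum.cong refl, simp only: power2_abs, rule ennreal_mult'[symmetric], simp)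
  also have "\<dots> = (\<integral>\<^sup>+\<omega>. ennreal (1 / cfrac c (\<lambda>j. a j \<omega>) 0 (N - 1)) \<partial>M)"
  proof (rule nn_integral_cong)
    fix \<omega> assume w: "\<omega> \<in> space M"
    have "(\<Sum>j<N. ennreal ((cmod (vec_index (v \<omega> j) 0))\<^sup>2 * (c / (c + (x \<omega> j)\<^sup>2)))) =
      ennreal (\<Sum>j<N. (cmod (vec_index (v \<omega> j) 0))\<^sup>2 * (c / (c + (x \<omega> j)\<^sup>2)))"
      using c by (intro sum_ennreal) (auto intro!: mult_nonneg_nonneg divide_nonneg_nonneg)
    then show "(\<Sum>j<N. ennreal ((cmod (vec_index (v \<omega> j) 0))\<^sup>2 * (c / (c + (x \<omega> j)\<^sup>2)))) =
      ennreal (1 / cfrac c (\<lambda>j. a j \<omega>) 0 (N - 1))"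
      using antisym_eigensystem.resolvent[OF eig[OF w] c] antisym_eigensystem.w_def[OF eig[OF w]] by simp
  qed
  also have "\<dots> = (markov_step \<alpha> c ^^ (N - 1)) (\<lambda>d. ennreal (1 / d)) 1"
    using N by (intro nn_integral_cfrac[OF c]) auto
  finally show ?thesis .
qed

text \<open>The pivot at site k has depth N - 1 - k and a mean depending on the depth alone. Summing
  over the sites thus runs through the iterates 0, ..., N - 1, and the transform is twice their
  Cesaro mean.\<close>

lemma dos_transform:
  assumes c: "c > 0"
  shows "(\<integral>\<^sup>+y. ennreal (ln (1 + y\<^sup>2 / c)) \<partial>mean_density_of_states N M x) =
    ennreal (2 / real N) * (\<Sum>m<N. (markov_step \<alpha> c ^^ m) (\<lambda>d. ennreal (ln d)) 1)"
proof -
  have ln0: "0 \<le> ln (1 + y\<^sup>2 / c)" for y using c by simp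
  let ?t = "\<lambda>k \<omega>. cfrac c (\<lambda>j. a j \<omega>) k (N - 1 - k)"
  have tm: "(\<lambda>\<omega>. ?t k \<omega>) \<in> borel_measurable M" for k
  proof -
    have "(\<lambda>\<omega>. cfrac c (\<lambda>j. a j \<omega>) k m) \<in> borel_measurable M" if "k + m < N" for k m
      using that
    proof (induction m arbitrary: k)
      case (Suc m)
      then have [measurable]: "(\<lambda>\<omega>. cfrac c (\<lambda>j. a j \<omega>) (Suc k) m) \<in> borel_measurable M" by simp
      have [measurable]: "a (Suc k) \<in> borel_measurable M" by (rule a_measurable) (use Suc.prems in auto)
      show ?case by simp measurable
    qed simp
    then show ?thesis by (cases "k < N") auto
  qed
  have "(\<integral>\<^sup>+y. ennreal (ln (1 + y\<^sup>2 / c)) \<partial>mean_density_of_states N M x) =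
    (\<integral>\<^sup>+\<omega>. (\<Sum>j<N. ennreal (1 / real N * ln (1 + (x \<omega> j)\<^sup>2 / c))) \<partial>M)"
    by (subst nn_integral_dos, measurable)
      (intro nn_integral_cong sum.cong refl, simp only: power2_abs, rule ennreal_mult'[symmetric], simp)
  also have "\<dots> = (\<integral>\<^sup>+\<omega>. ennreal (2 / real N) * (\<Sum>k<N. ennreal (ln (?t k \<omega>))) \<partial>M)"
  proof (rule nn_integral_cong)
    fix \<omega> assume w: "\<omega> \<in> space M"
    have "(\<Sum>j<N. ennreal (1 / real N * ln (1 + (x \<omega> j)\<^sup>2 / c))) = ennreal (\<Sum>j<N. 1 / real N * ln (1 + (x \<omega> j)\<^sup>2 / c))"
      using ln0 by (intro sum_ennreal mult_nonneg_nonneg) auto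
    also have "(\<Sum>j<N. 1 / real N * ln (1 + (x \<omega> j)\<^sup>2 / c)) = 2 / real N * (\<Sum>k<N. ln (?t k \<omega>))"
      using antisym_eigensystem.sum_ln_eigenvalues[OF eig[OF w] c]
      unfolding sum_distrib_left[symmetric] by simp
    also have "ennreal \<dots> = ennreal (2 / real N) * ennreal (\<Sum>k<N. ln (?t k \<omega>))"
      by (rule ennreal_mult') simp
    also have "ennreal (\<Sum>k<N. ln (?t k \<omega>)) = (\<Sum>k<N. ennreal (ln (?t k \<omega>)))"
      using cfrac_ge_1[OF c] by (intro sum_ennreal[symmetric]) simp
    finally show "(\<Sum>j<N. ennreal (1 / real N * ln (1 + (x \<omega> j)\<^sup>2 / c))) =
      ennreal (2 / real N) * (\<Sum>k<N. ennreal (ln (?t k \<omega>)))" .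
  qed
  also have "\<dots> = ennreal (2 / real N) * (\<Sum>k<N. (\<integral>\<^sup>+\<omega>. ennreal (ln (?t k \<omega>)) \<partial>M))"
    using tm by (subst nn_integral_cmult) (auto simp: nn_integral_sum)
  also have "(\<Sum>k<N. (\<integral>\<^sup>+\<omega>. ennreal (ln (?t k \<omega>)) \<partial>M)) =
    (\<Sum>k<N. (markov_step \<alpha> c ^^ (N - 1 - k)) (\<lambda>d. ennreal (ln d)) 1)"
  proof (rule sum.cong[OF refl])
    fix k assume "k \<in> {..<N}"
    then show "(\<integral>\<^sup>+\<omega>. ennreal (ln (?t k \<omega>)) \<partial>M) = (markov_step \<alpha> c ^^ (N - 1 - k)) (\<lambda>d. ennreal (ln d)) 1"
      by (intro nn_integral_cfrac[OF c]) auto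
  qed
  also have "\<dots> = (\<Sum>m<N. (markov_step \<alpha> c ^^ m) (\<lambda>d. ennreal (ln d)) 1)"
    using sum.nat_diff_reindex[of "\<lambda>m. (markov_step \<alpha> c ^^ m) (\<lambda>d. ennreal (ln d)) 1" N] by simp
  finally show ?thesis .
qed

end

section \<open>The limit of large matrices\<close>

lemma markov_limit:
  assumes "\<alpha> > 0" "c > 0" "f \<in> borel_measurable borel" "log_lipschitz 1 f"
    and p: "(\<integral>\<^sup>+t. f (1 + t) \<partial>kummer_measure \<alpha> c) = ennreal p" "p \<ge> 0"
  obtains l B where "\<And>m. 0 \<le> l m" "\<And>m. (markov_step \<alpha> c ^^ m) f 1 = ennreal (l m)"
    "\<And>m. \<bar>l m - p\<bar> \<le> B * contraction_factor \<alpha> c ^ m"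
proof -
  let ?q = "contraction_factor \<alpha> c"
  have q: "0 \<le> ?q" by (rule contraction_factor(2)[OF assms(1,2)])
  obtain B where B: "B \<ge> 0"
    "\<And>m. (markov_step \<alpha> c ^^ m) f 1 \<le> (\<integral>\<^sup>+t. f (1 + t) \<partial>kummer_measure \<alpha> c) + ennreal (B * ?q ^ m)"
    "\<And>m. (\<integral>\<^sup>+t. f (1 + t) \<partial>kummer_measure \<alpha> c) \<le> (markov_step \<alpha> c ^^ m) f 1 + ennreal (B * ?q ^ m)"
    by (rule markov_convergence[OF assms(1-4)]) blast
  define l where "l m = enn2real ((markov_step \<alpha> c ^^ m) f 1)" for m
  have Bq: "0 \<le> B * ?q ^ m" for m using B(1) q by simp
  have up: "(markov_step \<alpha> c ^^ m) f 1 \<le> ennreal (p + B * ?q ^ m)" for m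
    using B(2)[of m] p Bq[of m] by (simp add: ennreal_plus)
  have l: "(markov_step \<alpha> c ^^ m) f 1 = ennreal (l m)" for m
  proof -
    have "(markov_step \<alpha> c ^^ m) f 1 < \<top>" using up[of m] by (rule le_less_trans) simp
    then show ?thesis by (simp add: l_def)
  qed
  have l0: "0 \<le> l m" for m by (simp add: l_def)
  have "\<bar>l m - p\<bar> \<le> B * ?q ^ m" for m
  proof -
    have "ennreal (l m) \<le> ennreal (p + B * ?q ^ m)" using up[of m] l[of m] by simp
    then have "l m \<le> p + B * ?q ^ m" using p(2) Bq[of m] by (subst (asm) ennreal_le_iff) auto
    moreover have "ennreal p \<le> ennreal (l m + B * ?q ^ m)"
      using B(3)[of m] p l[of m] l0[of m] Bq[of m] by (simp add: ennreal_plus)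
    then have "p \<le> l m + B * ?q ^ m" using l0[of m] Bq[of m] by (subst (asm) ennreal_le_iff) auto
    ultimately show ?thesis by linarith
  qed
  then show ?thesis using that l l0 by blast
qed

text \<open>The errors are dominated by a geometric series, so their total stays below B / (1 - q)
  and is divided by n + 1.\<close>

lemma tendsto_cesaro_geometric:
  fixes l :: "nat \<Rightarrow> real"
  assumes "0 \<le> q" "q < 1" and l: "\<And>m. \<bar>l m - p\<bar> \<le> B * q ^ m"
  shows "(\<lambda>n. (\<Sum>m<Suc n. l m) / real (Suc n)) \<longlonglongrightarrow> p"
proof (rule Lim_transform_bound[where g="\<lambda>n. (B / (1 - q)) / (real n + 1)", THEN LIM_zero_cancel])
  have B: "0 \<le> B" using order_trans[OF abs_ge_zero l[of 0]] by simp
  show "\<forall>\<^sub>F n in sequentially. norm ((\<Sum>m<Suc n. l m) / real (Suc n) - p) \<le> norm ((B / (1 - q)) / (real n + 1))"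
  proof (rule always_eventually, rule allI)
    fix n
    have "\<bar>\<Sum>m<Suc n. l m - p\<bar> \<le> (\<Sum>m<Suc n. \<bar>l m - p\<bar>)" by (rule sum_abs)
    also have "\<dots> \<le> (\<Sum>m<Suc n. B * q ^ m)" by (rule sum_mono) (rule l)
    also have "\<dots> = B * ((1 - q ^ Suc n) / (1 - q))"
    proof -
      have "(q ^ Suc n - 1) / (q - 1) = (1 - q ^ Suc n) / (1 - q)"
        by (metis minus_divide_divide minus_diff_eq)
      then show ?thesis
        unfolding sum_distrib_left[symmetric] using assms(2) geometric_sum[of q "Suc n"] by simp
    qed
    also have "\<dots> \<le> B * (1 / (1 - q))"
      using assms B by (intro mult_left_mono divide_right_mono) auto
    finally have *: "\<bar>\<Sum>m<Suc n. l m - p\<bar> \<le> B / (1 - q)" by simp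
    have "(\<Sum>m<Suc n. l m) / real (Suc n) - p = (\<Sum>m<Suc n. l m - p) / (real n + 1)"
      unfolding sum_subtractf by (simp add: field_simps)
    then have "\<bar>(\<Sum>m<Suc n. l m) / real (Suc n) - p\<bar> = \<bar>\<Sum>m<Suc n. l m - p\<bar> / (real n + 1)"
      by (simp only: abs_divide)
    also have "\<dots> \<le> (B / (1 - q)) / (real n + 1)" using * by (rule divide_right_mono) simp
    finally show "norm ((\<Sum>m<Suc n. l m) / real (Suc n) - p) \<le> norm ((B / (1 - q)) / (real n + 1))"
      by (simp only: real_norm_def)
  qed
  show "(\<lambda>n. (B / (1 - q)) / (real n + 1)) \<longlonglongrightarrow> 0" by real_asymp
qed

context antisym_ensemble
begin

lemma spectral_transform_real:
  assumes c: "c > 0" and l: "(markov_step \<alpha> c ^^ (N - 1)) (\<lambda>d. ennreal (1 / d)) 1 = ennreal l" "0 \<le> l"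
  shows "(\<integral>y. c / (c + y\<^sup>2) \<partial>mean_spectral_measure N M x v) = l"
proof -
  interpret S: real_distribution "mean_spectral_measure N M x v" by (rule real_distribution_spectral)
  have "(\<integral>y. c / (c + y\<^sup>2) \<partial>mean_spectral_measure N M x v) =
    enn2real (\<integral>\<^sup>+y. ennreal (c / (c + y\<^sup>2)) \<partial>mean_spectral_measure N M x v)"
    by (rule integral_eq_nn_integral) (use c in \<open>auto intro!: divide_nonneg_nonneg\<close>)
  then show ?thesis unfolding spectral_transform[OF c] l(1) using l(2) by simp
qed

lemma dos_transform_real:
  assumes c: "c > 0" and l: "\<And>m. (markov_step \<alpha> c ^^ m) (\<lambda>d. ennreal (ln d)) 1 = ennreal (l m)" "\<And>m. 0 \<le> l m"
  shows "integrable (mean_density_of_states N M x) (\<lambda>y. ln (1 + y\<^sup>2 / c))"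
    and "(\<integral>y. ln (1 + y\<^sup>2 / c) \<partial>mean_density_of_states N M x) = 2 * ((\<Sum>m<N. l m) / real N)"
proof -
  interpret S: real_distribution "mean_density_of_states N M x" by (rule real_distribution_dos)
  have ln0: "0 \<le> ln (1 + y\<^sup>2 / c)" for y using c by simp
  have eq: "(\<integral>\<^sup>+y. ennreal (ln (1 + y\<^sup>2 / c)) \<partial>mean_density_of_states N M x) = ennreal (2 * ((\<Sum>m<N. l m) / real N))"
    unfolding dos_transform[OF c] l(1) using l(2)
    by (simp add: sum_ennreal ennreal_mult'[symmetric] sum_nonneg)
  show "integrable (mean_density_of_states N M x) (\<lambda>y. ln (1 + y\<^sup>2 / c))"
    by (rule integrableI_nonneg) (use ln0 eq in auto)
  have "(\<integral>y. ln (1 + y\<^sup>2 / c) \<partial>mean_density_of_states N M x) =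
    enn2real (\<integral>\<^sup>+y. ennreal (ln (1 + y\<^sup>2 / c)) \<partial>mean_density_of_states N M x)"
    by (rule integral_eq_nn_integral) (use ln0 in auto)
  then show "(\<integral>y. ln (1 + y\<^sup>2 / c) \<partial>mean_density_of_states N M x) = 2 * ((\<Sum>m<N. l m) / real N)"
    unfolding eq using l(2) by (simp add: sum_nonneg)
qed

end

text \<open>Ensembles are given for N \<ge> 1 only, so limits are taken along N = Suc n and shifted
  back here.\<close>

lemma weak_conv_m_Suc:
  assumes "weak_conv_m (\<lambda>n. \<mu> (Suc n)) \<nu>"
  shows "weak_conv_m \<mu> \<nu>"
  using assms unfolding weak_conv_m_def weak_conv_def by (auto intro: LIMSEQ_imp_Suc)

section \<open>Limits of the transforms and of the mean measures\<close>

locale antisym_ensembles =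
  fixes \<alpha> :: real and M :: "nat \<Rightarrow> 'w measure" and a :: "nat \<Rightarrow> nat \<Rightarrow> 'w \<Rightarrow> real"
    and x :: "nat \<Rightarrow> 'w \<Rightarrow> nat \<Rightarrow> real" and v :: "nat \<Rightarrow> 'w \<Rightarrow> nat \<Rightarrow> complex Matrix.vec"
  assumes ens: "\<And>N. N \<ge> 1 \<Longrightarrow> antisym_ensemble \<alpha> N (M N) (a N) (x N) (v N)"
begin

lemma \<alpha>: "\<alpha> > 0"
  using antisym_ensemble.\<alpha>[OF ens[of 1]] by simp

lemma ens_Suc: "antisym_ensemble \<alpha> (Suc n) (M (Suc n)) (a (Suc n)) (x (Suc n)) (v (Suc n))"
  by (rule ens) simp

definition \<mu>_spec :: "nat \<Rightarrow> real measure" where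
  "\<mu>_spec n = mean_spectral_measure (Suc n) (M (Suc n)) (x (Suc n)) (v (Suc n))"

definition \<mu>_dos :: "nat \<Rightarrow> real measure" where
  "\<mu>_dos n = mean_density_of_states (Suc n) (M (Suc n)) (x (Suc n))"

lemma spectral_transform_limit:
  assumes c: "c > 0"
  shows "(\<lambda>n. \<integral>y. c / (c + y\<^sup>2) \<partial>\<mu>_spec n) \<longlonglongrightarrow> kummer_int_shift \<alpha> c / kummer_int \<alpha> c"
proof -
  let ?p = "kummer_int_shift \<alpha> c / kummer_int \<alpha> c"
  have p0: "0 \<le> ?p"
    using kummer_int_shift_eq[OF \<alpha> c] kummer_int_pos[OF \<alpha> c] kummer_w_pos[of _ \<alpha> c]
    unfolding kummer_int_shift_def
    by (intro divide_nonneg_pos integral_nonneg_AE AE_I2) (simp_all add: less_imp_le)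
  obtain l B where l: "\<And>m. 0 \<le> l m"
    "\<And>m. (markov_step \<alpha> c ^^ m) (\<lambda>d. ennreal (1 / d)) 1 = ennreal (l m)"
    "\<And>m. \<bar>l m - ?p\<bar> \<le> B * contraction_factor \<alpha> c ^ m"
    by (rule markov_limit[OF \<alpha> c _ log_lipschitz_inverse nn_integral_kummer_inverse[OF \<alpha> c] p0]) (simp, blast)
  have Bq: "(\<lambda>m. B * contraction_factor \<alpha> c ^ m) \<longlonglongrightarrow> B * 0"
    using contraction_factor(2,3)[OF \<alpha> c] by (intro tendsto_intros LIMSEQ_power_zero) simp
  have "(\<lambda>m. l m - ?p) \<longlonglongrightarrow> 0"
  proof (rule Lim_null_comparison)
    show "\<forall>\<^sub>F m in sequentially. norm (l m - ?p) \<le> B * contraction_factor \<alpha> c ^ m"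
      unfolding real_norm_def by (intro always_eventually allI l(3))
    show "(\<lambda>m. B * contraction_factor \<alpha> c ^ m) \<longlonglongrightarrow> 0" using Bq by (simp only: mult_zero_right)
  qed
  then have "l \<longlonglongrightarrow> ?p" by (rule LIM_zero_cancel)
  moreover have "(\<integral>y. c / (c + y\<^sup>2) \<partial>\<mu>_spec n) = l n" for n
    unfolding \<mu>_spec_def
    by (rule antisym_ensemble.spectral_transform_real[OF ens_Suc c]) (use l in simp_all)
  ultimately show ?thesis by simp
qed

text \<open>The potentials at c and at 1 converge separately. In their difference the term ln c
  cancels, and so does the mean of ln u under the gamma law, which \<open>kummer_mean_ln_eq\<close>
  leaves unevaluated.\<close>

lemma dos_transform_limit:
  assumes c: "c > 0"
  shows "(\<lambda>n. \<integral>y. ln ((c + y\<^sup>2) / (1 + y\<^sup>2)) \<partial>\<mu>_dos n) \<longlonglongrightarrow>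
    kummer_sol_da \<alpha> (ln 1) 1 / kummer_int \<alpha> 1 - kummer_sol_da \<alpha> (ln c) c / kummer_int \<alpha> c"
proof -
  have lim: "\<exists>r. (\<forall>n. integrable (\<mu>_dos n) (\<lambda>y. ln (1 + y\<^sup>2 / c)) \<and> (\<integral>y. ln (1 + y\<^sup>2 / c) \<partial>\<mu>_dos n) = r n) \<and>
    r \<longlonglongrightarrow> 2 * kummer_mean_ln \<alpha> c" if c: "c > 0" for c
  proof -
    obtain l B where l: "\<And>m. 0 \<le> l m"
      "\<And>m. (markov_step \<alpha> c ^^ m) (\<lambda>d. ennreal (ln d)) 1 = ennreal (l m)"
      "\<And>m. \<bar>l m - kummer_mean_ln \<alpha> c\<bar> \<le> B * contraction_factor \<alpha> c ^ m"
      by (rule markov_limit[OF \<alpha> c _ log_lipschitz_ln nn_integral_kummer_ln[OF \<alpha> c]]) (simp, blast)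
    have "(\<lambda>n. 2 * ((\<Sum>m<Suc n. l m) / real (Suc n))) \<longlonglongrightarrow> 2 * kummer_mean_ln \<alpha> c"
      by (intro tendsto_intros tendsto_cesaro_geometric[OF contraction_factor(2,3)[OF \<alpha> c] l(3)])
    moreover have "integrable (\<mu>_dos n) (\<lambda>y. ln (1 + y\<^sup>2 / c))"
      "(\<integral>y. ln (1 + y\<^sup>2 / c) \<partial>\<mu>_dos n) = 2 * ((\<Sum>m<Suc n. l m) / real (Suc n))" for n
      unfolding \<mu>_dos_def by (rule antisym_ensemble.dos_transform_real[OF ens_Suc c l(2,1)])+
    ultimately show ?thesis by (intro exI[of _ "\<lambda>n. 2 * ((\<Sum>m<Suc n. l m) / real (Suc n))"]) auto
  qed
  obtain r where r: "\<And>n. integrable (\<mu>_dos n) (\<lambda>y. ln (1 + y\<^sup>2 / c))"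
    "\<And>n. (\<integral>y. ln (1 + y\<^sup>2 / c) \<partial>\<mu>_dos n) = r n" "r \<longlonglongrightarrow> 2 * kummer_mean_ln \<alpha> c"
    using lim[OF c] by blast
  obtain r1 where r1: "\<And>n. integrable (\<mu>_dos n) (\<lambda>y. ln (1 + y\<^sup>2 / 1))"
    "\<And>n. (\<integral>y. ln (1 + y\<^sup>2 / 1) \<partial>\<mu>_dos n) = r1 n" "r1 \<longlonglongrightarrow> 2 * kummer_mean_ln \<alpha> 1"
    using lim[of 1] by auto
  have "(\<integral>y. ln ((c + y\<^sup>2) / (1 + y\<^sup>2)) \<partial>\<mu>_dos n) = ln c + r n - r1 n" for n
  proof -
    interpret real_distribution "\<mu>_dos n"
      unfolding \<mu>_dos_def by (rule antisym_ensemble.real_distribution_dos[OF ens_Suc])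
    have "ln ((c + y\<^sup>2) / (1 + y\<^sup>2)) = ln c + ln (1 + y\<^sup>2 / c) - ln (1 + y\<^sup>2 / 1)" for y
    proof -
      have p: "0 < 1 + y\<^sup>2 / c" "0 < 1 + y\<^sup>2" using c by (simp_all add: add_pos_nonneg)
      have "c + y\<^sup>2 = c * (1 + y\<^sup>2 / c)" using c by (simp add: distrib_left)
      then have "ln ((c + y\<^sup>2) / (1 + y\<^sup>2)) = ln (c * (1 + y\<^sup>2 / c) / (1 + y\<^sup>2))" by (simp only:)
      also have "\<dots> = ln c + ln (1 + y\<^sup>2 / c) - ln (1 + y\<^sup>2 / 1)"
        using p c by (simp add: ln_div ln_mult)
      finally show ?thesis .
    qed
    then have "(\<integral>y. ln ((c + y\<^sup>2) / (1 + y\<^sup>2)) \<partial>\<mu>_dos n) =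
      (\<integral>y. ln c + ln (1 + y\<^sup>2 / c) - ln (1 + y\<^sup>2 / 1) \<partial>\<mu>_dos n)" by simp
    also have "\<dots> = ln c + r n - r1 n"
      unfolding r(2)[symmetric] r1(2)[symmetric] using r(1)[of n] r1(1)[of n] prob_space by simp
    finally show ?thesis .
  qed
  moreover have "(\<lambda>n. ln c + r n - r1 n) \<longlonglongrightarrow> ln c + 2 * kummer_mean_ln \<alpha> c - 2 * kummer_mean_ln \<alpha> 1"
    by (intro tendsto_intros r(3) r1(3))
  moreover have "ln c + 2 * kummer_mean_ln \<alpha> c - 2 * kummer_mean_ln \<alpha> 1 =
    kummer_sol_da \<alpha> (ln 1) 1 / kummer_int \<alpha> 1 - kummer_sol_da \<alpha> (ln c) c / kummer_int \<alpha> c"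
    using kummer_mean_ln_eq[OF \<alpha> c] kummer_mean_ln_eq[OF \<alpha>, of 1] by simp
  ultimately show ?thesis by simp
qed

lemma spectral_limit_transform:
  assumes s: "strict_mono s" and \<nu>: "real_distribution \<nu>" and w: "weak_conv_m (\<mu>_spec \<circ> s) \<nu>" and c: "c > 0"
  shows "(\<integral>y. c / (c + y\<^sup>2) \<partial>\<nu>) = kummer_int_shift \<alpha> c / kummer_int \<alpha> c"
proof (rule LIMSEQ_unique)
  have pos: "c + y\<^sup>2 > 0" for y :: real using c by (simp add: add_pos_nonneg)
  show "(\<lambda>n. \<integral>y. c / (c + y\<^sup>2) \<partial>(\<mu>_spec \<circ> s) n) \<longlonglongrightarrow> (\<integral>y. c / (c + y\<^sup>2) \<partial>\<nu>)"
  proof (rule weak_conv_imp_integral_bdd_continuous_conv[OF _ \<nu> w, where B=1])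
    show "real_distribution ((\<mu>_spec \<circ> s) n)" for n
      by (simp add: \<mu>_spec_def antisym_ensemble.real_distribution_spectral[OF ens_Suc])
    show "isCont (\<lambda>y. c / (c + y\<^sup>2)) y" for y
      using pos[of y] by (intro continuous_intros) auto
    show "norm (c / (c + y\<^sup>2)) \<le> 1" for y
      using pos[of y] c by simp
  qed
  show "(\<lambda>n. \<integral>y. c / (c + y\<^sup>2) \<partial>(\<mu>_spec \<circ> s) n) \<longlonglongrightarrow> kummer_int_shift \<alpha> c / kummer_int \<alpha> c"
    using LIMSEQ_subseq_LIMSEQ[OF spectral_transform_limit[OF c] s] by (simp add: comp_def)
qed

lemma dos_limit_transform:
  assumes s: "strict_mono s" and \<nu>: "real_distribution \<nu>" and w: "weak_conv_m (\<mu>_dos \<circ> s) \<nu>" and c: "c > 0"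
  shows "(\<integral>y. ln ((c + y\<^sup>2) / (1 + y\<^sup>2)) \<partial>\<nu>) =
    kummer_sol_da \<alpha> (ln 1) 1 / kummer_int \<alpha> 1 - kummer_sol_da \<alpha> (ln c) c / kummer_int \<alpha> c"
proof (rule LIMSEQ_unique)
  have pos: "d + y\<^sup>2 > 0" if "d > 0" for d y :: real using that by (simp add: add_pos_nonneg)
  show "(\<lambda>n. \<integral>y. ln ((c + y\<^sup>2) / (1 + y\<^sup>2)) \<partial>(\<mu>_dos \<circ> s) n) \<longlonglongrightarrow> (\<integral>y. ln ((c + y\<^sup>2) / (1 + y\<^sup>2)) \<partial>\<nu>)"
  proof (rule weak_conv_imp_integral_bdd_continuous_conv[OF _ \<nu> w, where B="\<bar>ln c\<bar>"])
    show "real_distribution ((\<mu>_dos \<circ> s) n)" for n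
      by (simp add: \<mu>_dos_def antisym_ensemble.real_distribution_dos[OF ens_Suc])
    show "isCont (\<lambda>y. ln ((c + y\<^sup>2) / (1 + y\<^sup>2))) y" for y
      using pos[OF c, of y] pos[of 1 y] by (intro continuous_intros) auto
    show "norm (ln ((c + y\<^sup>2) / (1 + y\<^sup>2))) \<le> \<bar>ln c\<bar>" for y
      using abs_ln_ratio_le[OF c] by simp
  qed
  show "(\<lambda>n. \<integral>y. ln ((c + y\<^sup>2) / (1 + y\<^sup>2)) \<partial>(\<mu>_dos \<circ> s) n) \<longlonglongrightarrow>
    kummer_sol_da \<alpha> (ln 1) 1 / kummer_int \<alpha> 1 - kummer_sol_da \<alpha> (ln c) c / kummer_int \<alpha> c"
    using LIMSEQ_subseq_LIMSEQ[OF dos_transform_limit[OF c] s] by (simp add: comp_def)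
qed

text \<open>The transform is exported along with the limit, because the treatment of the density of
  states takes the zero-freeness of w from it.\<close>

lemma spectral_limit:
  assumes \<sigma>: "\<sigma> = 1 \<or> \<sigma> = - 1"
  obtains \<nu> where "real_distribution \<nu>" "weak_conv_m \<mu>_spec \<nu>" "has_density_on_pos \<nu> (rho_as \<sigma> \<alpha>)"
    "\<And>c. c > 0 \<Longrightarrow> (\<integral>y. c / (c + y\<^sup>2) \<partial>\<nu>) = kummer_int_shift \<alpha> c / kummer_int \<alpha> c"
proof -
  have "\<exists>\<nu> s. strict_mono s \<and> weak_conv_m (\<mu>_spec \<circ> s) \<nu> \<and> measure \<nu> {..<0} = 0 \<and>
    real_distribution \<nu> \<and> weak_conv_m \<mu>_spec \<nu> \<and> has_density_on_pos \<nu> (rho_as \<sigma> \<alpha>)"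
  proof (rule weak_conv_has_density)
    show "real_distribution (\<mu>_spec n)" "measure (\<mu>_spec n) {..<0} = 0"
      "(\<integral>\<^sup>+y. ennreal (y\<^sup>2) \<partial>\<mu>_spec n) \<le> ennreal (2 * \<alpha>)" for n
      unfolding \<mu>_spec_def
      by (rule antisym_ensemble.real_distribution_spectral[OF ens_Suc] antisym_ensemble.spectral_neg[OF ens_Suc]
        antisym_ensemble.spectral_second_moment[OF ens_Suc])+
    show "has_density_on_pos \<nu> (rho_as \<sigma> \<alpha>)"
      if "strict_mono s" "real_distribution \<nu>" "weak_conv_m (\<mu>_spec \<circ> s) \<nu>" "measure \<nu> {..<0} = 0" for s \<nu>
      by (rule spectral_limit_density[OF \<alpha> that(2,4) \<sigma> spectral_limit_transform[OF that(1,2,3)]])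
  qed
  then show ?thesis using that spectral_limit_transform by blast
qed

text \<open>(1/\<pi>) Im of d/dz (w_\<alpha> / w) on the upper side of the cut, w_\<alpha> being the
  derivative in the parameter.\<close>

definition dos_density_sq :: "real \<Rightarrow> real" where
  "dos_density_sq y = (1 / pi) * Im ((kummer_sol_dadz \<alpha> (upper_Ln (- complex_of_real y)) (- complex_of_real y) *
        kummer_sol \<alpha> (upper_Ln (- complex_of_real y)) (- complex_of_real y) -
      kummer_sol_da \<alpha> (upper_Ln (- complex_of_real y)) (- complex_of_real y) *
        kummer_sol_dz \<alpha> (upper_Ln (- complex_of_real y)) (- complex_of_real y))
      / (kummer_sol \<alpha> (upper_Ln (- complex_of_real y)) (- complex_of_real y))\<^sup>2)"

text \<open>\<open>\<nu>0\<close> is the spectral limit; it acts as a witness that w has no zeros,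
  the hypothesis \<open>nz\<close> of \<open>dos_limit_density\<close>.\<close>

lemma dos_limit:
  obtains \<nu> where "real_distribution \<nu>" "weak_conv_m \<mu>_dos \<nu>"
    "has_density_on_pos \<nu> (\<lambda>t. 2 * t * dos_density_sq (t\<^sup>2))"
    "has_density_on_pos (distr \<nu> borel (\<lambda>t. t\<^sup>2)) dos_density_sq"
proof -
  obtain \<nu>0 where \<nu>0: "real_distribution \<nu>0"
    "\<And>c. c > 0 \<Longrightarrow> (\<integral>y. c / (c + y\<^sup>2) \<partial>\<nu>0) = kummer_int_shift \<alpha> c / kummer_int \<alpha> c"
    by (rule spectral_limit[of 1]) auto
  have nz: "kummer_sol \<alpha> (upper_Ln z) z \<noteq> 0" if "z \<in> upper_right" for z
    by (rule kummer_sol_upper_nonzero[OF \<alpha> \<nu>0 that])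
  note dens = dos_limit_density[OF \<alpha> _ _ nz, folded dos_density_sq_def]
  have "\<exists>\<nu> s. strict_mono s \<and> weak_conv_m (\<mu>_dos \<circ> s) \<nu> \<and> measure \<nu> {..<0} = 0 \<and>
    real_distribution \<nu> \<and> weak_conv_m \<mu>_dos \<nu> \<and> has_density_on_pos \<nu> (\<lambda>t. 2 * t * dos_density_sq (t\<^sup>2))"
  proof (rule weak_conv_has_density)
    show "real_distribution (\<mu>_dos n)" "measure (\<mu>_dos n) {..<0} = 0"
      "(\<integral>\<^sup>+y. ennreal (y\<^sup>2) \<partial>\<mu>_dos n) \<le> ennreal (2 * \<alpha>)" for n
      unfolding \<mu>_dos_def
      by (rule antisym_ensemble.real_distribution_dos[OF ens_Suc] antisym_ensemble.dos_neg[OF ens_Suc]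
        antisym_ensemble.dos_second_moment[OF ens_Suc])+
    show "has_density_on_pos \<nu> (\<lambda>t. 2 * t * dos_density_sq (t\<^sup>2))"
      if "strict_mono s" "real_distribution \<nu>" "weak_conv_m (\<mu>_dos \<circ> s) \<nu>" "measure \<nu> {..<0} = 0" for s \<nu>
      by (rule dens(1)[OF that(2,4) _ dos_limit_transform[OF that(1,2,3)]])
  qed
  then obtain \<nu> s where \<nu>: "strict_mono s" "weak_conv_m (\<mu>_dos \<circ> s) \<nu>" "measure \<nu> {..<0} = 0"
    "real_distribution \<nu>" "weak_conv_m \<mu>_dos \<nu>" "has_density_on_pos \<nu> (\<lambda>t. 2 * t * dos_density_sq (t\<^sup>2))"
    by blast
  have "has_density_on_pos (distr \<nu> borel (\<lambda>t. t\<^sup>2)) dos_density_sq"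
    by (rule dens(2)[OF \<nu>(4,3) _ dos_limit_transform[OF \<nu>(1,4,2)]])
  then show ?thesis using that \<nu> by blast
qed

lemma has_derivative_density_sq:
  assumes "y > 0"
  shows "((\<lambda>\<beta>. exp (- y) / (y * kummer_modulus_sq \<beta> y)) has_real_derivative dos_density_sq y) (at \<alpha>)"
  unfolding dos_density_sq_def by (rule has_derivative_kummer_density[OF \<alpha> assms])

end

theorem theorem6p1:
  fixes \<alpha> \<sigma> :: real
    and M :: "nat \<Rightarrow> 'w measure"
    and a :: "nat \<Rightarrow> nat \<Rightarrow> 'w \<Rightarrow> real"
    and x :: "nat \<Rightarrow> 'w \<Rightarrow> nat \<Rightarrow> real"
    and v :: "nat \<Rightarrow> 'w \<Rightarrow> nat \<Rightarrow> complex Matrix.vec"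
  assumes "\<alpha> > 0"
    and "\<sigma> = 1 \<or> \<sigma> = -1"
    and "\<And>N. N \<ge> 1 \<Longrightarrow> antisym_gaussian_ensemble \<alpha> N (M N) (a N)"
    and "\<And>N \<omega>. N \<ge> 1 \<Longrightarrow> \<omega> \<in> space (M N) \<Longrightarrow>
      orthonormal_eigensystem N
        (\<i> \<cdot>\<^sub>m map_mat complex_of_real (antisym_tridiag N (\<lambda>j. a N j \<omega>))) (x N \<omega>) (v N \<omega>)"
  shows "(\<exists>\<nu>. real_distribution \<nu> \<and>
            weak_conv_m (\<lambda>N. mean_spectral_measure N (M N) (x N) (v N)) \<nu> \<and>
            has_density_on_pos \<nu> (rho_as \<sigma> \<alpha>)) \<and>
         (\<exists>\<nu> \<mu> \<mu>_sq. real_distribution \<nu> \<and>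
            weak_conv_m (\<lambda>N. mean_density_of_states N (M N) (x N)) \<nu> \<and>
            has_density_on_pos \<nu> \<mu> \<and>
            (\<forall>t>0. ((\<lambda>\<beta>. \<beta> * rho_as \<sigma> \<beta> t) has_real_derivative \<mu> t) (at \<alpha>)) \<and>
            has_density_on_pos (distr \<nu> borel (\<lambda>t. t\<^sup>2)) \<mu>_sq \<and>
            (\<forall>y>0. ((\<lambda>\<beta>. 1 / (cmod (complex_of_real (Gamma \<beta>) *
                whittaker_W_cut \<sigma> (complex_of_real (- \<beta> + 1/2)) 0 y))\<^sup>2)
              has_real_derivative \<mu>_sq y) (at \<alpha>)))"
proof -
  interpret antisym_ensembles \<alpha> M a x v
    by unfold_locales (use assms in auto)
  obtain \<nu> where \<nu>: "real_distribution \<nu>" "weak_conv_m \<mu>_spec \<nu>" "has_density_on_pos \<nu> (rho_as \<sigma> \<alpha>)"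
    by (rule spectral_limit[OF assms(2)])
  obtain \<nu>' where \<nu>': "real_distribution \<nu>'" "weak_conv_m \<mu>_dos \<nu>'"
    "has_density_on_pos \<nu>' (\<lambda>t. 2 * t * dos_density_sq (t\<^sup>2))"
    "has_density_on_pos (distr \<nu>' borel (\<lambda>t. t\<^sup>2)) dos_density_sq"
    by (rule dos_limit)
  have "weak_conv_m (\<lambda>N. mean_spectral_measure N (M N) (x N) (v N)) \<nu>"
    using \<nu>(2) unfolding \<mu>_spec_def[abs_def] by (rule weak_conv_m_Suc)
  moreover have "weak_conv_m (\<lambda>N. mean_density_of_states N (M N) (x N)) \<nu>'"
    using \<nu>'(2) unfolding \<mu>_dos_def[abs_def] by (rule weak_conv_m_Suc)
  \<comment> \<open>The factor \<beta> turns 1 / (\<Gamma>(\<beta> + 1) \<Gamma>(\<beta>)) into 1 /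
    \<Gamma>(\<beta>)^2, so up to the factor 2t this claim and the next one differentiate the same
    function of \<beta>. The closed form is used for all \<beta> > 0, since a derivative at \<alpha>
    depends on neighbouring values.\<close>
  moreover have "((\<lambda>\<beta>. \<beta> * rho_as \<sigma> \<beta> t) has_real_derivative 2 * t * dos_density_sq (t\<^sup>2)) (at \<alpha>)"
    if t: "t > 0" for t
  proof -
    have "((\<lambda>\<beta>. 2 * t * (exp (- t\<^sup>2) / (t\<^sup>2 * kummer_modulus_sq \<beta> (t\<^sup>2)))) has_real_derivative
      2 * t * dos_density_sq (t\<^sup>2)) (at \<alpha>)"
      by (rule DERIV_cmult[OF has_derivative_density_sq]) (use t in simp)
    then show ?thesis
    proof (rule has_field_derivative_transform_within_open[where S="{0<..}"])
      fix \<beta> :: real assume "\<beta> \<in> {0<..}"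
      then have eq: "exp (- t\<^sup>2) / (t\<^sup>2 * kummer_modulus_sq \<beta> (t\<^sup>2)) = \<beta> * rho_as_sq \<sigma> \<beta> (t\<^sup>2)"
        using rho_as_sq_eq[of \<beta> "t\<^sup>2" \<sigma>] t assms(2) by simp
      show "2 * t * (exp (- t\<^sup>2) / (t\<^sup>2 * kummer_modulus_sq \<beta> (t\<^sup>2))) = \<beta> * rho_as \<sigma> \<beta> t"
        unfolding eq rho_as_def by (simp only: mult_ac)
    qed (use assms(1) in auto)
  qed
  moreover have "((\<lambda>\<beta>. 1 / (cmod (complex_of_real (Gamma \<beta>) *
      whittaker_W_cut \<sigma> (complex_of_real (- \<beta> + 1/2)) 0 y))\<^sup>2) has_real_derivative dos_density_sq y) (at \<alpha>)"
    if y: "y > 0" for y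
    using has_derivative_density_sq[OF y]
  proof (rule has_field_derivative_transform_within_open[where S="{0<..}"])
    fix \<beta> :: real assume "\<beta> \<in> {0<..}"
    then show "exp (- y) / (y * kummer_modulus_sq \<beta> y) = 1 / (cmod (complex_of_real (Gamma \<beta>) *
      whittaker_W_cut \<sigma> (complex_of_real (- \<beta> + 1/2)) 0 y))\<^sup>2"
      using Gamma_whittaker_W_cut_eq[of \<beta> y \<sigma>] y assms(2) by simp
  qed (use assms(1) in auto)
  ultimately show ?thesis using \<nu> \<nu>' by blast
qed



end
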